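(* Let $\mathcal T_n$ be a polygonal mesh satisfying the assumptions (G1), (G2) of the context, let the diffusion coefficient $\kappa$ be piecewise constant over $\mathcal T_n$ with $0<k_*\le\kappa\le k^*<\infty$, and let $p\in\mathbb N$. For every convex $K\in\mathcal T_n$, consider the bilinear form $S^K$ defined, for $\boldsymbol\sigma_n,\boldsymbol\tau_n\in\ker(\boldsymbol\Pi^0_p)\subset\boldsymbol\Sigma_n(K)$, by $$S^K(\boldsymbol\sigma_n,\boldsymbol\tau_n)=h_K(\kappa^{-1}\,\mathbf n\cdot\boldsymbol\sigma_n,\mathbf n\cdot\boldsymbol\tau_n)_{0,\partial K}+h_K^2(\kappa^{-1}\operatorname{div}\boldsymbol\sigma_n,\operatorname{div}\boldsymbol\tau_n)_{0,K}+h_K^2(\kappa^{-1}\operatorname{rot}\boldsymbol\sigma_n,\operatorname{rot}\boldsymbol\tau_n)_{0,K}.$$ Then the constants $\alpha_*,\alpha^*$ in the stability bounds $$\alpha_*\,a^K(\boldsymbol\tau_n,\boldsymbol\tau_n)\le S^K(\boldsymbol\tau_n,\boldsymbol\tau_n)\le\alpha^*\,a^K(\boldsymbol\tau_n,\boldsymbol\tau_n)\qquad\forall\boldsymbol\tau_n\in\ker(\boldsymbol\Pi^0_p)$$ satisfy $$\alpha_*\gtrsim (k^* )^{-1},\qquad \alpha^*\lesssim (k_* )^{-1}\,p^7.$$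
   Context: $a\lesssim b$ (equivalently $b\gtrsim a$) means that there is a positive constant $C$ with $a\le C\,b$; in the bounds above the dependence on $p$, $k_*$, $k^*$ is the one displayed, and the hidden constants do not depend on $h_K$. $h_K$ is the diameter of the polygon $K$, $h_e$ the length of the edge $e$, $\mathcal E^K$ the set of edges of $K$, $\mathbf n$ the outward unit normal on $\partial K$. (G1): every $K$ is star-shaped with respect to a ball of radius at least $\gamma h_K$, $\gamma>0$. (G2): $h_K\le\widetilde\gamma h_e$ for every $e\in\mathcal E^K$, $\widetilde\gamma>0$. $(\cdot,\cdot)_{0,D}$ is the $L^2(D)$ inner product; $\operatorname{div}\boldsymbol\tau=\partial_x\tau_1+\partial_y\tau_2$, $\operatorname{rot}\boldsymbol\tau=\partial_y\tau_1-\partial_x\tau_2$; $H(\operatorname{div},K)$, $H(\operatorname{rot},K)$ are the spaces of $[L^2(K)]^2$ fields with div, resp. rot, in $L^2(K)$; $\mathbb P_\ell$ denotes polynomials of degree at most $\ell$. Local mixed virtual element space: $$\boldsymbol\Sigma_n(K)=\{\boldsymbol\tau\in H(\operatorname{div},K)\cap H(\operatorname{rot},K):\ \mathbf n\cdot\boldsymbol\tau|_e\in\mathbb P_p(e)\ \forall e\in\mathcal E^K,\ \operatorname{div}\boldsymbol\tau\in\mathbb P_{p-1}(K),\ \operatorname{rot}\boldsymbol\tau\in\mathbb P_{p-1}(K)\}.$$ Bilinear form: $a^K(\boldsymbol\sigma,\boldsymbol\tau)=\int_K\kappa^{-1}\boldsymbol\sigma\cdot\boldsymbol\tau$. Projector: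 $\boldsymbol\Pi^0_p:\boldsymbol\Sigma_n(K)\to\nabla\mathbb P_{p+1}(K)$ is defined by $a^K(\boldsymbol\tau_n-\boldsymbol\Pi^0_p\boldsymbol\tau_n,\mathbf q)=0$ for all $\mathbf q\in\nabla\mathbb P_{p+1}(K)$.
   Formalization: The hidden constants may depend on γ, γ̃ and a fixed reference value k0>0 with k_* ≤ k0 ≤ k^*; with constants fully independent of k_*, k^* the bounds fail, since S^K/a^K does not depend on κ. Also p ≥ 1. *)

theory Defs
  imports "HOL-Analysis.Analysis"
begin

section \<open>Polygons and meshes\<close>

text \<open>A polygon is given by the cyclic list of its vertices. Consecutive edges may be collinear,
  so hanging nodes are allowed, also for convex polygons.\<close>

type_synonym polygon = "(real^2) list"

definition edges :: "polygon \<Rightarrow> ((real^2) \<times> (real^2)) set" where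
  "edges vs = set (zip vs (rotate1 vs))"

definition edge_length :: "(real^2) \<times> (real^2) \<Rightarrow> real" where
  "edge_length e = dist (fst e) (snd e)"

definition polygon_boundary :: "polygon \<Rightarrow> (real^2) set" where
  "polygon_boundary vs = (\<Union>(a, b)\<in>edges vs. closed_segment a b)"

text \<open>Two different edges meet at most in their common endpoints, so the boundary is a simple
  closed curve.\<close>

definition simple_polygon :: "polygon \<Rightarrow> bool" where
  "simple_polygon vs \<longleftrightarrow> 3 \<le> length vs \<and> distinct vs \<and>
     (\<forall>(a, b)\<in>edges vs. \<forall>(c, d)\<in>edges vs. (a, b) \<noteq> (c, d) \<longrightarrow>
        closed_segment a b \<inter> closed_segment c d = {a, b} \<inter> {c, d})"

text \<open>The open region enclosed by the polygon.\<close>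

definition region :: "polygon \<Rightarrow> (real^2) set" where
  "region vs = inside (polygon_boundary vs)"

definition polygonal_mesh :: "polygon set \<Rightarrow> bool" where
  "polygonal_mesh T \<longleftrightarrow> finite T \<and> T \<noteq> {} \<and> (\<forall>K\<in>T. simple_polygon K) \<and>
     (\<forall>K\<in>T. \<forall>L\<in>T. K \<noteq> L \<longrightarrow> region K \<inter> region L = {})"

definition star_shaped_wrt :: "(real^2) set \<Rightarrow> (real^2) set \<Rightarrow> bool" where
  "star_shaped_wrt S B \<longleftrightarrow> B \<subseteq> S \<and> (\<forall>y\<in>B. \<forall>x\<in>S. closed_segment y x \<subseteq> S)"

definition mesh_G1 :: "real \<Rightarrow> polygon set \<Rightarrow> bool" where
  "mesh_G1 \<gamma> T \<longleftrightarrow>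
     (\<forall>K\<in>T. \<exists>z r. \<gamma> * diameter (region K) \<le> r \<and> star_shaped_wrt (region K) (ball z r))"

definition mesh_G2 :: "real \<Rightarrow> polygon set \<Rightarrow> bool" where
  "mesh_G2 \<gamma>' T \<longleftrightarrow> (\<forall>K\<in>T. \<forall>e\<in>edges K. diameter (region K) \<le> \<gamma>' * edge_length e)"


section \<open>Derivatives, test functions, square-integrable functions\<close>

definition partial :: "2 \<Rightarrow> (real^2 \<Rightarrow> real) \<Rightarrow> real^2 \<Rightarrow> real" where
  "partial i f x = frechet_derivative f (at x) (axis i 1)"

definition grad :: "(real^2 \<Rightarrow> real) \<Rightarrow> real^2 \<Rightarrow> real^2" where
  "grad f x = (\<chi> i. partial i f x)"

primrec Ck :: "nat \<Rightarrow> (real^2 \<Rightarrow> real) \<Rightarrow> bool" where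
  "Ck 0 = (\<lambda>f. continuous_on UNIV f)"
| "Ck (Suc k) = (\<lambda>f. (\<forall>x. f differentiable (at x)) \<and> (\<forall>i. Ck k (partial i f)))"

definition smooth :: "(real^2 \<Rightarrow> real) \<Rightarrow> bool" where
  "smooth f \<longleftrightarrow> (\<forall>k. Ck k f)"

definition test_function :: "(real^2) set \<Rightarrow> (real^2 \<Rightarrow> real) \<Rightarrow> bool" where
  "test_function D \<phi> \<longleftrightarrow>
     smooth \<phi> \<and> compact (closure {x. \<phi> x \<noteq> 0}) \<and> closure {x. \<phi> x \<noteq> 0} \<subseteq> D"

definition L2_on :: "'a::euclidean_space set \<Rightarrow> ('a \<Rightarrow> 'b::euclidean_space) \<Rightarrow> bool" where
  "L2_on D f \<longleftrightarrow> f \<in> borel_measurable (lebesgue_on D) \<and>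
     integrable (lebesgue_on D) (\<lambda>x. (norm (f x))\<^sup>2)"

text \<open>Integration with respect to arc length over the boundary, edge by edge.\<close>

definition boundary_integral :: "polygon \<Rightarrow> (real^2 \<Rightarrow> real) \<Rightarrow> real" where
  "boundary_integral vs f =
     (\<Sum>(a, b)\<in>edges vs. edge_length (a, b) *
        integral\<^sup>L (lebesgue_on {0..1}) (\<lambda>t. f (linepath a b t)))"

definition L2_boundary :: "polygon \<Rightarrow> (real^2 \<Rightarrow> real) \<Rightarrow> bool" where
  "L2_boundary vs g \<longleftrightarrow> (\<forall>(a, b)\<in>edges vs. L2_on {0..1} (\<lambda>t. g (linepath a b t)))"


section \<open>Weak divergence, weak rotation, normal trace\<close>

definition has_weak_div :: "(real^2) set \<Rightarrow> (real^2 \<Rightarrow> real^2) \<Rightarrow> (real^2 \<Rightarrow> real) \<Rightarrow> bool" where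
  "has_weak_div D \<tau> d \<longleftrightarrow> L2_on D d \<and>
     (\<forall>\<phi>. test_function D \<phi> \<longrightarrow>
        integral\<^sup>L (lebesgue_on D) (\<lambda>x. d x * \<phi> x)
          = - integral\<^sup>L (lebesgue_on D) (\<lambda>x. \<tau> x \<bullet> grad \<phi> x))"

definition has_weak_rot :: "(real^2) set \<Rightarrow> (real^2 \<Rightarrow> real^2) \<Rightarrow> (real^2 \<Rightarrow> real) \<Rightarrow> bool" where
  "has_weak_rot D \<tau> r \<longleftrightarrow> L2_on D r \<and>
     (\<forall>\<phi>. test_function D \<phi> \<longrightarrow>
        integral\<^sup>L (lebesgue_on D) (\<lambda>x. r x * \<phi> x)
          = - integral\<^sup>L (lebesgue_on D) (\<lambda>x. \<tau> x $ 1 * partial 2 \<phi> x - \<tau> x $ 2 * partial 1 \<phi> x))"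

text \<open>Both are determined up to null sets only; the representative is chosen arbitrarily.\<close>

definition weak_div :: "(real^2) set \<Rightarrow> (real^2 \<Rightarrow> real^2) \<Rightarrow> real^2 \<Rightarrow> real" where
  "weak_div D \<tau> = (SOME d. has_weak_div D \<tau> d)"

definition weak_rot :: "(real^2) set \<Rightarrow> (real^2 \<Rightarrow> real^2) \<Rightarrow> real^2 \<Rightarrow> real" where
  "weak_rot D \<tau> = (SOME r. has_weak_rot D \<tau> r)"

definition H_div :: "(real^2) set \<Rightarrow> (real^2 \<Rightarrow> real^2) set" where
  "H_div D = {\<tau>. L2_on D \<tau> \<and> (\<exists>d. has_weak_div D \<tau> d)}"

definition H_rot :: "(real^2) set \<Rightarrow> (real^2 \<Rightarrow> real^2) set" where
  "H_rot D = {\<tau>. L2_on D \<tau> \<and> (\<exists>r. has_weak_rot D \<tau> r)}"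

text \<open>The trace \<open>n \<cdot> \<tau>\<close> of a field in \<open>H(div, K)\<close>, \<open>n\<close> being the outward unit normal, is the
  functional on traces defined by the divergence theorem
  \<open>\<langle>n \<cdot> \<tau>, v\<rangle> = \<integral>\<^sub>K \<tau> \<cdot> \<nabla>v + \<integral>\<^sub>K (div \<tau>) v\<close>, which also fixes its sign. The predicate says that it
  is represented by the square-integrable boundary function \<open>g\<close>. Restrictions of smooth functions
  on the plane are dense in \<open>H\<^sup>1(K)\<close>, so it is enough to test with these.\<close>

definition has_normal_trace :: "polygon \<Rightarrow> (real^2 \<Rightarrow> real^2) \<Rightarrow> (real^2 \<Rightarrow> real) \<Rightarrow> bool" where
  "has_normal_trace K \<tau> g \<longleftrightarrow> L2_boundary K g \<and>
     (\<forall>v. smooth v \<longrightarrow>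
        boundary_integral K (\<lambda>x. g x * v x)
          = integral\<^sup>L (lebesgue_on (region K)) (\<lambda>x. \<tau> x \<bullet> grad v x)
            + integral\<^sup>L (lebesgue_on (region K)) (\<lambda>x. weak_div (region K) \<tau> x * v x))"

definition normal_trace :: "polygon \<Rightarrow> (real^2 \<Rightarrow> real^2) \<Rightarrow> real^2 \<Rightarrow> real" where
  "normal_trace K \<tau> = (SOME g. has_normal_trace K \<tau> g)"


section \<open>Polynomials and the local virtual element space\<close>

text \<open>Bivariate polynomials of total degree at most \<open>l\<close>.\<close>

definition polys :: "nat \<Rightarrow> (real^2 \<Rightarrow> real) set" where
  "polys l = {q. \<exists>c :: nat \<Rightarrow> nat \<Rightarrow> real.
     q = (\<lambda>x. \<Sum>i\<le>l. \<Sum>j\<le>l - i. c i j * (x $ 1) ^ i * (x $ 2) ^ j)}"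

definition grad_polys :: "nat \<Rightarrow> (real^2 \<Rightarrow> real^2) set" where
  "grad_polys l = grad ` polys l"

text \<open>Endpoints are left out because the function may jump at the vertices of a polygon.\<close>

definition poly_on_edge :: "nat \<Rightarrow> (real^2) \<times> (real^2) \<Rightarrow> (real^2 \<Rightarrow> real) \<Rightarrow> bool" where
  "poly_on_edge p e g \<longleftrightarrow>
     (\<exists>c :: nat \<Rightarrow> real. \<forall>t\<in>{0<..<1}. g (linepath (fst e) (snd e) t) = (\<Sum>i\<le>p. c i * t ^ i))"

definition Sigma_n :: "nat \<Rightarrow> polygon \<Rightarrow> (real^2 \<Rightarrow> real^2) set" where
  "Sigma_n p K = {\<tau> \<in> H_div (region K) \<inter> H_rot (region K).
     (\<exists>g. has_normal_trace K \<tau> g \<and> (\<forall>e\<in>edges K. poly_on_edge p e g)) \<and>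
     (\<exists>d\<in>polys (p - 1). has_weak_div (region K) \<tau> d) \<and>
     (\<exists>r\<in>polys (p - 1). has_weak_rot (region K) \<tau> r)}"


section \<open>Bilinear forms and projector\<close>

text \<open>In this section \<open>k\<close> is the constant value of the diffusion coefficient on the element.\<close>

definition a_form :: "polygon \<Rightarrow> real \<Rightarrow> (real^2 \<Rightarrow> real^2) \<Rightarrow> (real^2 \<Rightarrow> real^2) \<Rightarrow> real" where
  "a_form K k \<sigma> \<tau> = integral\<^sup>L (lebesgue_on (region K)) (\<lambda>x. inverse k * (\<sigma> x \<bullet> \<tau> x))"

definition Pi0 :: "nat \<Rightarrow> polygon \<Rightarrow> real \<Rightarrow> (real^2 \<Rightarrow> real^2) \<Rightarrow> real^2 \<Rightarrow> real^2" where
  "Pi0 p K k \<tau> = (THE s. s \<in> grad_polys (p + 1) \<and>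
     (\<forall>q\<in>grad_polys (p + 1). a_form K k (\<lambda>x. \<tau> x - s x) q = 0))"

definition ker_Pi0 :: "nat \<Rightarrow> polygon \<Rightarrow> real \<Rightarrow> (real^2 \<Rightarrow> real^2) set" where
  "ker_Pi0 p K k = {\<tau> \<in> Sigma_n p K. Pi0 p K k \<tau> = (\<lambda>x. 0)}"

definition S_form :: "polygon \<Rightarrow> real \<Rightarrow> (real^2 \<Rightarrow> real^2) \<Rightarrow> (real^2 \<Rightarrow> real^2) \<Rightarrow> real" where
  "S_form K k \<sigma> \<tau> =
     (let D = region K; h = diameter D in
        h * boundary_integral K (\<lambda>x. inverse k * normal_trace K \<sigma> x * normal_trace K \<tau> x)
        + h\<^sup>2 * integral\<^sup>L (lebesgue_on D) (\<lambda>x. inverse k * weak_div D \<sigma> x * weak_div D \<tau> x)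
        + h\<^sup>2 * integral\<^sup>L (lebesgue_on D) (\<lambda>x. inverse k * weak_rot D \<sigma> x * weak_rot D \<tau> x))"

end

theory Submission
 imports Defs "HOL-Computational_Algebra.Polynomial"
begin

text \<open>The coefficient is constant on an element and cancels, so both bounds are about the field only.

 Lower bound: gradients of smooth functions and curls of test functions together are dense in \<open>L\<^sup>2(K)\<close> and
 orthogonal to each other, so \<open>\<tau>\<close> may be paired with \<open>grad v + curl \<psi>\<close>. The definition of the
 normal trace and of the weak rotation turns the pairing into the three terms of \<open>S\<close>, with \<open>v\<close> (up to a
 constant) and \<open>\<psi>\<close> controlled by the Poincare, trace and Friedrichs inequalities.

 Upper bound: for a polynomial divergence \<open>d\<close> of degree below \<open>p\<close>, test with \<open>b d\<close>, where \<open>b\<close> is the distance to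
 the boundary. The inverse estimates \<open>\<parallel>b grad d\<parallel> \<lesssim> p \<parallel>d\<parallel>\<close> and \<open>\<parallel>d\<parallel>\<^sup>2 \<lesssim> p\<^sup>2 \<parallel>b\<^bsup>1/2\<^esup> d\<parallel>\<^sup>2 / h\<close> lead to
 \<open>h \<parallel>d\<parallel> \<lesssim> p\<^sup>3 \<parallel>\<tau>\<parallel>\<close>, and likewise for the rotation. The normal trace on an edge, a polynomial, is tested
 with itself times a roof over the edge of relative width \<open>p\<^bsup>-3\<^esup>\<close>: the width balances the gradient of the roof
 against the divergence, and the inverse estimate with a boundary weight contributes \<open>p\<^sup>4\<close>, in total \<open>p\<^sup>7\<close>.\<close>

section \<open>Inverse estimates for univariate polynomials\<close>

text \<open>The normal trace, divergence and rotation in \<open>S_form\<close> are values of a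
  choice operator, fixed only up to null sets, while membership in \<open>Sigma_n\<close> supplies
  polynomial representatives. So uniqueness of these weak quantities must be known before an inverse
  estimate can be applied. For the trace, which is tested only over the whole boundary, the roof
  functions isolate a single edge. The natural test functions, distance and roof, are merely
  Lipschitz; each is smoothed from below, with an error that tends to zero or is absorbed. The
  Helmholtz decomposition is likewise approximate, and a remainder of a quarter of the squared norm
  is absorbed. The factor p^4 is the square of the p^2 in the boundary weight estimate: it enters
  once when the tested trace is bounded from below, and once more because the remaining terms have
  to be absorbed into that smaller quantity. The edges are never counted: (G2) bounds h by each edge
  length, and the trace inequality for the constant 1 bounds the perimeter.\<close>

lemma continuous_on_poly_eta: "continuous_on S (poly (q :: real poly))"
 by (simp add: continuous_at_imp_continuous_on)

section \<open>Legendre polynomials as eigenvectors of a symmetric operator\<close>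

definition pint :: "real poly => real" where
 "pint q = integral {-1..1} (poly q)"

lemma pint_add: "pint (p + q) = pint p + pint q"
 unfolding pint_def poly_add
 by (intro Henstock_Kurzweil_Integration.integral_add integrable_continuous_interval continuous_intros)

lemma pint_smult: "pint (smult c q) = c * pint q"
 unfolding pint_def poly_smult by simp

lemma pint_0: "pint 0 = 0"
 using pint_smult[of 0 0] by simp

lemma pint_minus: "pint (- q) = - pint q"
 using pint_smult[of "-1" q] by simp

lemma pint_diff: "pint (p - q) = pint p - pint q"
 using pint_add[of p "-q"] pint_minus[of q] by simp

lemma pint_pderiv: "pint (pderiv q) = poly q 1 - poly q (-1)"
proof -
 have "((%x. poly (pderiv q) x) has_integral (poly q 1 - poly q (-1))) {-1..1}"
  by (rule fundamental_theorem_of_calculus)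
   (auto intro!: derivative_eq_intros simp flip: has_real_derivative_iff_has_vector_derivative)
 then show ?thesis unfolding pint_def by (simp add: integral_unique)
qed

lemma pint_square_nonneg: "0 <= pint (q * q)"
 unfolding pint_def by (rule Henstock_Kurzweil_Integration.integral_nonneg)
  (intro integrable_continuous_interval continuous_on_poly_eta, simp)

lemma pint_square_eq_0: assumes "pint (q * q) = 0" shows "q = 0"
proof (rule ccontr)
 assume "q ~= 0"
 have "\<forall>x\<in>{-1..1}. poly (q * q) x = 0"
 proof (rule iffD1[OF integral_eq_0_iff])
  show "integral {-1..1} (poly (q * q)) = 0" using assms by (simp only: pint_def)
  show "0 <= poly (q * q) x" for x by simp
 qed (rule continuous_on_poly_eta, simp)
 then have "{-1..1} \<subseteq> {x. poly q x = 0}" by (simp add: subset_eq)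
 moreover have "finite {x. poly q x = 0}" using \<open>q ~= 0\<close> by (rule poly_roots_finite)
 ultimately have "finite {-1..1::real}" by (rule finite_subset)
 then show False using infinite_Icc[of "-1::real" 1] by simp
qed

text \<open>The Legendre operator that sends q to -((1 - x^2) q')'; \<open>[:1, 0, -1:]\<close> is 1
  - x^2. For the inner product \<open>pint (p * q)\<close> it is symmetric on polynomials, with
  eigenvalues n (n + 1).\<close>

definition legendre_op :: "real poly => real poly" where
 "legendre_op q = - pderiv ([:1, 0, -1:] * pderiv q)"

lemma legendre_op_add: "legendre_op (p + q) = legendre_op p + legendre_op q"
 by (simp add: legendre_op_def pderiv_add distrib_left del: mult_pCons_left)

lemma legendre_op_smult: "legendre_op (smult c q) = smult c (legendre_op q)"
 by (simp add: legendre_op_def pderiv_smult del: mult_pCons_left)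

text \<open>Integration by parts: the boundary terms vanish because 1 - x^2 is zero at both
  endpoints. The right side is symmetric in q and r, and for q = r it is a weighted norm of the
  derivative.\<close>

lemma pint_legendre_op: "pint (legendre_op q * r) = pint ([:1, 0, -1:] * pderiv q * pderiv r)"
proof -
 define w where "w = [:1, 0, -1::real:]"
 have "pint (pderiv (w * pderiv q * r)) = 0"
  unfolding pint_pderiv by (simp add: w_def)
 moreover have "pderiv (w * pderiv q * r) = w * pderiv q * pderiv r - legendre_op q * r"
  unfolding legendre_op_def w_def[symmetric] pderiv_mult[of "w * pderiv q" r] by (simp add: algebra_simps)
 ultimately show ?thesis by (simp add: pint_diff w_def)
qed

lemma pint_legendre_op_sym: "pint (legendre_op q * r) = pint (q * legendre_op r)"
proof -
 have "w * pderiv q * pderiv r = w * pderiv r * pderiv q" for w :: "real poly" by (simp only: ac_simps)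
 then show ?thesis
  unfolding mult.commute[of q "legendre_op r"] pint_legendre_op by (rule arg_cong)
qed

text \<open>The matrix in the monomial basis is triangular: the degree does not grow, and the
  leading coefficient in degree n is multiplied by n (n + 1).\<close>

lemma coeff_legendre_op:
 "coeff (legendre_op q) i = real i * (real i + 1) * coeff q i - (real i + 1) * (real i + 2) * coeff q (i + 2)"
proof -
 have w: "[:1, 0, -1:] * f = f - pCons 0 (pCons 0 f)" for f :: "real poly" by simp
 show ?thesis
  unfolding legendre_op_def w
  by (cases i) (simp_all add: coeff_pderiv algebra_simps)
qed

text \<open>Degree below n, stated through coefficients so that n = 0 leaves exactly the zero
  polynomial; with \<open>degree\<close> that case would need separate treatment.\<close>

definition deg_less :: "nat => real poly => bool" where
 "deg_less n q \<longleftrightarrow> (\<forall>i\<ge>n. coeff q i = 0)"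

lemma deg_less_legendre_op: "deg_less n q ==> deg_less n (legendre_op q)"
 by (simp add: deg_less_def coeff_legendre_op)

text \<open>Orthogonal projection onto the polynomials of degree below n. In the induction step the
  part of the monomial of degree n that is orthogonal to lower degrees becomes a new basis vector,
  and one Fourier coefficient is added.\<close>

lemma legendre_gram_schmidt:
 "\<exists>g. deg_less n g \<and> (\<forall>r. deg_less n r \<longrightarrow> pint ((f - g) * r) = 0)"
proof (induction n arbitrary: f)
 case 0
 have "r = 0" if "deg_less 0 r" for r using that by (auto simp: deg_less_def poly_eq_iff)
 then have "pint ((f - 0) * r) = 0" if "deg_less 0 r" for r
  using \<open>deg_less 0 r ==> r = 0\<close>[OF that] by (simp add: pint_0)
 then show ?case by (intro exI[of _ 0]) (auto simp: deg_less_def)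
next
 case (Suc n)
 obtain g where g: "deg_less n g" "!!r. deg_less n r ==> pint ((f - g) * r) = 0" using Suc by blast
 obtain g' where g': "deg_less n g'" "!!r. deg_less n r ==> pint ((monom 1 n - g') * r) = 0" using Suc by blast
 define P where "P = monom 1 n - g'"
 have P1: "coeff P n = 1" "!!i. i > n ==> coeff P i = 0"
  using g'(1) by (auto simp: P_def deg_less_def)
 have "P ~= 0" using P1 by auto
 then have nz: "pint (P * P) ~= 0" using pint_square_eq_0 by blast
 define c where "c = pint ((f - g) * P) / pint (P * P)"
 have "deg_less (Suc n) (g + smult c P)" using g(1) P1 by (auto simp: deg_less_def)
 moreover have "pint ((f - (g + smult c P)) * r) = 0" if r: "deg_less (Suc n) r" for r
 proof -
  \<comment> \<open>Removing the leading term with the help of \<open>P\<close> leaves a polynomial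
    of degree below n, to which both orthogonality relations apply.\<close>
  define r0 where "r0 = r - smult (coeff r n) P"
  have "deg_less n r0" unfolding deg_less_def r0_def
  proof (intro allI impI)
   fix i assume "n <= i"
   then show "coeff (r - smult (coeff r n) P) i = 0"
    using r P1 by (cases "i = n") (auto simp: deg_less_def)
  qed
  then have z: "pint ((f - g) * r0) = 0" "pint (P * r0) = 0" using g g' by (auto simp: P_def)
  have "pint ((f - (g + smult c P)) * P) = 0"
  proof -
   have "(f - (g + smult c P)) * P = (f - g) * P - smult c (P * P)" by (simp add: algebra_simps)
   then show ?thesis using nz by (simp add: pint_diff pint_smult c_def)
  qed
  moreover have "pint ((f - (g + smult c P)) * r0) = 0"
  proof -
   have "(f - (g + smult c P)) * r0 = (f - g) * r0 - smult c (P * r0)" by (simp add: algebra_simps)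
   then show ?thesis using z by (simp add: pint_diff pint_smult)
  qed
  moreover have "(f - (g + smult c P)) * r = (f - (g + smult c P)) * r0 + smult (coeff r n) ((f - (g + smult c P)) * P)"
   by (simp add: r0_def algebra_simps smult_diff_right smult_add_right)
  ultimately show ?thesis by (simp add: pint_add pint_smult)
 qed
 ultimately show ?case by blast
qed

text \<open>\<open>P\<close> is the monic polynomial orthogonal to all lower degrees. The defect of
  the eigenvalue equation has lower degree, so by symmetry of the operator it is orthogonal to
  itself and vanishes.\<close>

lemma legendre_poly_exists:
 "\<exists>P. coeff P n = 1 \<and> deg_less (Suc n) P \<and> (\<forall>r. deg_less n r \<longrightarrow> pint (P * r) = 0) \<and>
   legendre_op P = smult (real n * (real n + 1)) P"
proof -
 obtain g where g: "deg_less n g" "!!r. deg_less n r ==> pint ((monom 1 n - g) * r) = 0"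
  using legendre_gram_schmidt by blast
 define P where "P = monom 1 n - g"
 have P1: "coeff P n = 1" "deg_less (Suc n) P"
  using g(1) by (auto simp: P_def deg_less_def)
 have orth: "pint (P * r) = 0" if "deg_less n r" for r using g(2)[OF that] by (simp add: P_def)
 define s where "s = legendre_op P - smult (real n * (real n + 1)) P"
 have "deg_less n s" unfolding deg_less_def
 proof (intro allI impI)
  fix i assume "n <= i"
  then show "coeff s i = 0" using P1
   by (cases "i = n") (auto simp: s_def coeff_legendre_op deg_less_def)
 qed
 then have "pint (legendre_op P * s) = 0" "pint (P * s) = 0"
  using orth deg_less_legendre_op by (auto simp: pint_legendre_op_sym)
 moreover have "s * s = legendre_op P * s - smult (real n * (real n + 1)) (P * s)"
  by (subst (1) s_def) (simp add: algebra_simps)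
 ultimately have "pint (s * s) = 0" by (simp add: pint_diff pint_smult)
 then have "s = 0" by (rule pint_square_eq_0)
 then show ?thesis using P1 orth by (intro exI[of _ P]) (auto simp: s_def)
qed

text \<open>Splitting off the top Legendre component is orthogonal for all three quadratic forms, so
  the induction only compares eigenvalues, the largest being n (n + 1).\<close>

lemma legendre_op_bounds:
 "deg_less (Suc n) q ==>
  pint (legendre_op q * legendre_op q) <= (real n * (real n + 1))^2 * pint (q * q) \<and>
  pint (legendre_op q * q) <= real n * (real n + 1) * pint (q * q)"
proof (induction n arbitrary: q)
 case 0
 then have "real i * coeff q i = 0" for i by (cases i) (auto simp: deg_less_def)
 with 0 have "legendre_op q = 0" by (auto simp: poly_eq_iff coeff_legendre_op deg_less_def)
 then show ?case by (simp add: pint_0)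
next
 case (Suc n)
 obtain P where P: "coeff P (Suc n) = 1" "deg_less (Suc (Suc n)) P"
  "!!r. deg_less (Suc n) r ==> pint (P * r) = 0"
  "legendre_op P = smult (real (Suc n) * (real (Suc n) + 1)) P"
  using legendre_poly_exists by blast
 define l where "l = real (Suc n) * (real (Suc n) + 1)"
 define k where "k = real n * (real n + 1)"
 have kl: "0 <= k" "k <= l" by (auto simp: k_def l_def algebra_simps)
 define c where "c = coeff q (Suc n)"
 define q1 where "q1 = q - smult c P"
 have q1: "deg_less (Suc n) q1" unfolding deg_less_def
 proof (intro allI impI)
  fix i assume "Suc n <= i"
  then show "coeff q1 i = 0" using P(1,2) Suc.prems
   by (cases "i = Suc n") (auto simp: q1_def c_def deg_less_def)
 qed
 have q: "q = q1 + smult c P" by (simp add: q1_def)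
 have LP: "legendre_op P = smult l P" using P(4) by (simp add: l_def)
 have Lq: "legendre_op q = legendre_op q1 + smult (c * l) P"
  unfolding q legendre_op_add legendre_op_smult LP by simp
 have o: "pint (P * q1) = 0" "pint (P * legendre_op q1) = 0"
  using P(3) q1 deg_less_legendre_op by auto
 have "q * q = q1 * q1 + (smult c (P * q1) + smult c (P * q1)) + smult (c^2) (P * P)"
  unfolding q by (simp add: algebra_simps power2_eq_square)
 then have nq: "pint (q * q) = pint (q1 * q1) + c^2 * pint (P * P)"
  using o by (simp only: pint_add pint_smult mult_zero_right add_0_right)
 have "legendre_op q * legendre_op q = legendre_op q1 * legendre_op q1 + (smult (c * l) (P * legendre_op q1) + smult (c * l) (P * legendre_op q1)) + smult ((c * l)^2) (P * P)"
  unfolding Lq by (simp add: algebra_simps power2_eq_square)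
 then have nL: "pint (legendre_op q * legendre_op q) = pint (legendre_op q1 * legendre_op q1) + (c * l)^2 * pint (P * P)"
  using o by (simp only: pint_add pint_smult mult_zero_right add_0_right)
 have "legendre_op q * q = legendre_op q1 * q1 + smult (c * l) (P * q1) + smult c (P * legendre_op q1) + smult (c^2 * l) (P * P)"
  unfolding Lq unfolding q by (simp add: algebra_simps smult_add_right power2_eq_square)
 then have nLq: "pint (legendre_op q * q) = pint (legendre_op q1 * q1) + c^2 * l * pint (P * P)"
  using o by (simp add: pint_add pint_smult)
 have IH: "pint (legendre_op q1 * legendre_op q1) <= k^2 * pint (q1 * q1)" "pint (legendre_op q1 * q1) <= k * pint (q1 * q1)"
  using Suc.IH[OF q1] by (auto simp: k_def)
 have "k^2 * pint (q1 * q1) <= l^2 * pint (q1 * q1)" "k * pint (q1 * q1) <= l * pint (q1 * q1)"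
  using kl pint_square_nonneg[of q1] by (auto intro!: mult_right_mono power_mono)
 then show ?case using IH unfolding nq nL nLq l_def[symmetric]
  by (simp add: algebra_simps power_mult_distrib)
qed

lemma deg_less_degree: "degree q <= n ==> deg_less (Suc n) q"
 by (auto simp: deg_less_def intro: coeff_eq_0)

section \<open>Weighted derivative bound and endpoint bound\<close>

lemma integral_CS_interval:
 fixes f g :: "real => real"
 assumes "continuous_on {a..b} f" "continuous_on {a..b} g"
 shows "(integral {a..b} (%x. f x * g x))^2 <= integral {a..b} (%x. (f x)^2) * integral {a..b} (%x. (g x)^2)"
proof -
 let ?A = "integral {a..b} (%x. (f x)^2)" and ?B = "integral {a..b} (%x. f x * g x)" and ?C = "integral {a..b} (%x. (g x)^2)"
 have int: "(%x. (f x)^2) integrable_on {a..b}" "(%x. f x * g x) integrable_on {a..b}" "(%x. (g x)^2) integrable_on {a..b}"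
  using assms by (auto intro!: integrable_continuous_interval continuous_intros)
 have key: "0 <= s^2 * ?A - 2 * s * t * ?B + t^2 * ?C" for s t
 proof -
  have "0 <= integral {a..b} (%x. (s * f x - t * g x)^2)"
   by (rule Henstock_Kurzweil_Integration.integral_nonneg) (use assms in \<open>auto intro!: integrable_continuous_interval continuous_intros\<close>)
  also have "(%x. (s * f x - t * g x)^2) = (%x. s^2 * (f x)^2 - 2 * s * t * (f x * g x) + t^2 * (g x)^2)"
   by (auto simp: power2_eq_square algebra_simps)
  also have "integral {a..b} ... = s^2 * ?A - 2 * s * t * ?B + t^2 * ?C"
   using int by (subst Henstock_Kurzweil_Integration.integral_add Henstock_Kurzweil_Integration.integral_diff,
    (auto intro!: integrable_diff integrable_on_mult_right)[2])+ simp
  finally show ?thesis .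
 qed
 have C: "0 <= ?C" by (rule Henstock_Kurzweil_Integration.integral_nonneg) (use int in auto)
 show ?thesis
 proof (cases "?C = 0")
  case True
  show ?thesis
  proof (cases "?B = 0")
   case False
   from key[of 1 "(?A + 1) / (2 * ?B)"] True False show ?thesis by (simp add: field_simps)
  qed (use True in simp)
 next
  case False
  from key[of ?C ?B] have "0 <= ?C * (?C * ?A - ?B^2)" by (simp add: power2_eq_square algebra_simps)
  then have "0 <= ?C * ?A - ?B^2" using C False by (simp add: zero_le_mult_iff)
  then show ?thesis by (simp add: algebra_simps)
 qed
qed

lemma integral_affine_to_unit:
 fixes f :: "real => real"
 assumes "s < e" "continuous_on {s..e} f"
 shows "integral {s..e} f = (e - s) / 2 * integral {-1..1} (%u. f ((s + e) / 2 + (e - s) / 2 * u))"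
proof -
 define k m where "k = (e - s) / 2" and "m = (s + e) / 2"
 have k: "k > 0" using assms by (simp add: k_def)
 have "((%u. k *\<^sub>R f (m + k * u)) has_integral integral {m + k * (-1)..m + k * 1} f) {-1..1}"
 proof (rule has_integral_substitution[where c = s and d = e])
  show "(%u. m + k * u) ` {-1..1} \<subseteq> {s..e}"
  proof
   fix x assume "x \<in> (%u. m + k * u) ` {-1..1}"
   then obtain u where u: "x = m + k * u" "-1 <= u" "u <= 1" by (metis (no_types, lifting) atLeastAtMost_iff imageE)
   have "k * (-1) <= k * u" "k * u <= k * 1" using u k by (intro mult_left_mono; simp)+
   then show "x \<in> {s..e}" unfolding u(1) by (simp add: k_def m_def field_simps)
  qed
  show "((%u. m + k * u) has_real_derivative k) (at x within {-1..1})" for x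
   by (auto intro!: derivative_eq_intros)
 qed (use assms k in auto)
 moreover have "m + k * (-1) = s" "m + k * 1 = e" by (simp_all add: k_def m_def field_simps)
 ultimately have "integral {-1..1} (%u. k * f (m + k * u)) = integral {s..e} f"
  by (simp only: integral_unique real_scaleR_def)
 moreover have "integral {-1..1} (%u. k * f (m + k * u)) = k * integral {-1..1} (%u. f (m + k * u))"
  by (rule integral_mult_right)
 ultimately show ?thesis unfolding k_def[symmetric] m_def[symmetric] by (rule trans[OF sym])
qed

text \<open>The left side is the quadratic form of \<open>legendre_op\<close> after an affine map.
  The estimate is scale invariant: the weight contributes k^2 and the squared derivative
  k^(-2).\<close>

lemma poly_weighted_deriv_bound:
 assumes "s <= e" "degree q <= n"
 shows "integral {s..e} (%x. (x - s) * (e - x) * (poly (pderiv q) x)^2)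
     <= real n * (real n + 1) * integral {s..e} (%x. (poly q x)^2)"
proof (cases "s = e")
 case False
 then have se: "s < e" using assms by simp
 define k m where "k = (e - s) / 2" and "m = (s + e) / 2"
 have k: "k > 0" using se by (simp add: k_def)
 define Q where "Q = pcompose q [:m, k:]"
 have "degree Q <= n" using assms(2) by (simp add: Q_def degree_pcompose k less_imp_neq[THEN not_sym])
 then have d: "deg_less (Suc n) Q" by (rule deg_less_degree)
 have pQ: "poly Q u = poly q (m + k * u)" for u by (simp add: Q_def poly_pcompose mult.commute)
 have pQ': "poly (pderiv Q) u = k * poly (pderiv q) (m + k * u)" for u
  by (simp add: Q_def pderiv_pcompose poly_pcompose pderiv_pCons mult.commute)
 have "pint ([:1, 0, -1:] * pderiv Q * pderiv Q) <= real n * (real n + 1) * pint (Q * Q)"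
  using legendre_op_bounds[OF d] by (simp add: pint_legendre_op)
 moreover have "k * pint ([:1, 0, -1:] * pderiv Q * pderiv Q) = integral {s..e} (%x. (x - s) * (e - x) * (poly (pderiv q) x)^2)"
 proof -
  have "integral {s..e} (%x. (x - s) * (e - x) * (poly (pderiv q) x)^2) =
   k * integral {-1..1} (%u. ((m + k * u) - s) * (e - (m + k * u)) * (poly (pderiv q) (m + k * u))^2)"
   unfolding k_def m_def by (intro integral_affine_to_unit se continuous_intros)
  also have "(%u. ((m + k * u) - s) * (e - (m + k * u)) * (poly (pderiv q) (m + k * u))^2) = poly ([:1, 0, -1:] * pderiv Q * pderiv Q)"
  proof
   fix u
   have "((m + k * u) - s) * (e - (m + k * u)) = k^2 * (1 - u * u)"
    by (simp add: k_def m_def power2_eq_square field_simps)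
   then show "((m + k * u) - s) * (e - (m + k * u)) * (poly (pderiv q) (m + k * u))^2 = poly ([:1, 0, -1:] * pderiv Q * pderiv Q) u"
    by (simp add: pQ' power2_eq_square algebra_simps)
  qed
  finally show ?thesis by (simp only: pint_def)
 qed
 moreover have "k * pint (Q * Q) = integral {s..e} (%x. (poly q x)^2)"
 proof -
  have "integral {s..e} (%x. (poly q x)^2) = k * integral {-1..1} (%u. (poly q (m + k * u))^2)"
   unfolding k_def m_def by (intro integral_affine_to_unit se continuous_intros)
  also have "(%u. (poly q (m + k * u))^2) = poly (Q * Q)" by (auto simp: pQ power2_eq_square)
  finally show ?thesis by (simp only: pint_def)
 qed
 ultimately show ?thesis using mult_left_mono[of "pint ([:1, 0, -1:] * pderiv Q * pderiv Q)" "real n * (real n + 1) * pint (Q * Q)" k] k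
  by (metis (no_types, lifting) mult.left_commute less_imp_le)
qed auto

text \<open>Integrating \<open>legendre_op q\<close> from x to 1 recovers (1 - x^2) q'(x), so
  Cauchy-Schwarz and the spectral bound give |q'(x)| <= M / sqrt (1 - x). This singularity is
  integrable: on the last interval of length 1/N^2 the polynomial varies by at most 2 N sqrt A, and
  averaging over that interval produces N^2.\<close>

lemma poly_endpoint_bound_symmetric:
 assumes "degree q <= n"
 shows "(poly q 1)^2 <= 10 * (real n + 1)^2 * integral {-1..1} (%x. (poly q x)^2)"
proof -
 define N where "N = real n + 1"
 define A where "A = integral {-1..1} (%x. (poly q x)^2)"
 have N: "N \<ge> 1" by (simp add: N_def)
 have A: "A = pint (q * q)" by (simp add: A_def pint_def power2_eq_square[abs_def] poly_mult[abs_def])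
 have A0: "A \<ge> 0" unfolding A by (rule pint_square_nonneg)
 define M where "M = N^2 * sqrt A"
 have M0: "M \<ge> 0" using A0 by (simp add: M_def)
 have L: "pint (legendre_op q * legendre_op q) <= M^2"
 proof -
  have "pint (legendre_op q * legendre_op q) <= (real n * (real n + 1))^2 * A"
   using legendre_op_bounds[OF deg_less_degree[OF assms]] by (simp add: A)
  also have "... <= (N^2)^2 * A"
   using A0 by (intro mult_right_mono power_mono) (auto simp: N_def power2_eq_square algebra_simps)
  also have "... = M^2" using A0 by (simp add: M_def power_mult_distrib)
  finally show ?thesis .
 qed
 have deriv: "\<bar>poly (pderiv q) x\<bar> <= M / sqrt (1 - x)" if x: "0 <= x" "x < 1" for x
 proof -
  define v where "v = [:1, 0, -1::real:] * pderiv q"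
  have "(poly (legendre_op q) has_integral ((- poly v 1) - (- poly v x))) {x..1}"
   unfolding legendre_op_def v_def[symmetric]
   by (rule fundamental_theorem_of_calculus)
    (use x in \<open>auto intro!: derivative_eq_intros simp flip: has_real_derivative_iff_has_vector_derivative\<close>)
  then have I: "integral {x..1} (poly (legendre_op q)) = (1 - x * x) * poly (pderiv q) x"
   by (simp add: integral_unique v_def algebra_simps)
  have "(integral {x..1} (%t. 1 * poly (legendre_op q) t))^2 <= integral {x..1} (%t. 1^2) * integral {x..1} (%t. (poly (legendre_op q) t)^2)"
   by (rule integral_CS_interval) (auto intro!: continuous_intros)
  moreover have "integral {x..1} (%t. 1^2) = (sqrt (1 - x))^2" using x by simp
  ultimately have CS: "((1 - x * x) * poly (pderiv q) x)^2 <= (sqrt (1 - x))^2 * integral {x..1} (%t. (poly (legendre_op q) t)^2)"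
   by (simp only: I mult_1_left)
  have "integral {x..1} (%t. (poly (legendre_op q) t)^2) <= integral {-1..1} (%t. (poly (legendre_op q) t)^2)"
   by (rule integral_subset_le) (use x in \<open>auto intro!: integrable_continuous_interval continuous_intros\<close>)
  also have "... = pint (legendre_op q * legendre_op q)" by (simp add: pint_def power2_eq_square[abs_def] poly_mult[abs_def])
  also have "... <= M^2" by (rule L)
  finally have "((1 - x * x) * poly (pderiv q) x)^2 <= (sqrt (1 - x) * M)^2"
   using order_trans[OF CS mult_left_mono[OF _ zero_le_power2]] by (simp only: power_mult_distrib)
  then have "\<bar>(1 - x * x) * poly (pderiv q) x\<bar> <= sqrt (1 - x) * M"
  proof -
   have "0 <= sqrt (1 - x) * M" using M0 x by (intro mult_nonneg_nonneg) simp_all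
   then show ?thesis using abs_le_square_iff[of "(1 - x * x) * poly (pderiv q) x" "sqrt (1 - x) * M"] \<open>_ <= (sqrt (1 - x) * M)^2\<close>
    by (simp only: abs_of_nonneg)
  qed
  moreover have "(1 - x) * \<bar>poly (pderiv q) x\<bar> <= \<bar>(1 - x * x) * poly (pderiv q) x\<bar>"
  proof -
   have "(1 - x) <= 1 - x * x" using x by (simp add: mult_left_le)
   then have "(1 - x) * \<bar>poly (pderiv q) x\<bar> <= \<bar>1 - x * x\<bar> * \<bar>poly (pderiv q) x\<bar>"
    by (intro mult_right_mono) auto
   then show ?thesis by (simp only: abs_mult)
  qed
  ultimately have "(1 - x) * \<bar>poly (pderiv q) x\<bar> <= sqrt (1 - x) * M" by linarith
  moreover have "sqrt (1 - x) * (sqrt (1 - x) * \<bar>poly (pderiv q) x\<bar>) = (1 - x) * \<bar>poly (pderiv q) x\<bar>"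
   using x by (metis abs_of_pos diff_gt_0_iff_gt mult.assoc real_sqrt_mult_self)
  ultimately have "sqrt (1 - x) * (sqrt (1 - x) * \<bar>poly (pderiv q) x\<bar>) <= sqrt (1 - x) * M" by linarith
  then have "sqrt (1 - x) * \<bar>poly (pderiv q) x\<bar> <= M" by (rule mult_left_le_imp_le) (use x in simp)
  moreover have "0 < sqrt (1 - x)" using x by simp
  ultimately show ?thesis by (metis mult.commute pos_le_divide_eq)
 qed
 \<comment> \<open>The signs s = 1 and s = -1 give the two one-sided estimates. The term 2 M sqrt (1
   - x) has derivative -M / sqrt (1 - x), so the sum with s q is decreasing.\<close>
 have diff1: "s * poly q 1 <= s * poly q y + 2 * M * sqrt (1 - y)" if y: "0 <= y" "y <= 1" and s: "\<bar>s\<bar> = 1" for y s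
 proof -
  have "s * poly q 1 + 2 * M * sqrt (1 - 1) <= s * poly q y + 2 * M * sqrt (1 - y)"
  proof (rule DERIV_nonpos_imp_decreasing_open[where f = "%x. s * poly q x + 2 * M * sqrt (1 - x)"])
   fix x assume x: "y < x" "x < 1"
   have "((%x. s * poly q x + 2 * M * sqrt (1 - x)) has_real_derivative (s * poly (pderiv q) x - M / sqrt (1 - x))) (at x)"
   proof -
    have "((%x. sqrt (1 - x)) has_real_derivative - inverse (sqrt (1 - x)) / 2) (at x)"
    proof -
     have "((%x. 1 - x) has_real_derivative -1) (at x)" by (auto intro!: derivative_eq_intros)
     from DERIV_chain2[OF DERIV_real_sqrt this] show ?thesis using x by simp
    qed
    then have "((%x. s * poly q x + 2 * M * sqrt (1 - x)) has_real_derivative (s * poly (pderiv q) x + 2 * M * (- inverse (sqrt (1 - x)) / 2))) (at x)"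
     by (rule DERIV_add[OF DERIV_cmult[OF poly_DERIV] DERIV_cmult])
    moreover have "s * poly (pderiv q) x + 2 * M * (- inverse (sqrt (1 - x)) / 2) = s * poly (pderiv q) x - M / sqrt (1 - x)"
     unfolding divide_inverse[of M] by simp
    ultimately show ?thesis by (rule DERIV_cong)
   qed
   moreover have "s * poly (pderiv q) x <= \<bar>poly (pderiv q) x\<bar>"
    using abs_ge_self[of "s * poly (pderiv q) x"] s by (simp add: abs_mult)
   moreover have "\<bar>poly (pderiv q) x\<bar> <= M / sqrt (1 - x)" using x y(1) by (intro deriv) simp_all
   ultimately have "((%x. s * poly q x + 2 * M * sqrt (1 - x)) has_real_derivative (s * poly (pderiv q) x - M / sqrt (1 - x))) (at x) \<and> s * poly (pderiv q) x - M / sqrt (1 - x) <= 0"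
    by linarith
   then show "\<exists>z. ((%x. s * poly q x + 2 * M * sqrt (1 - x)) has_real_derivative z) (at x) \<and> z <= 0"
    by blast
  qed (use y in \<open>auto intro!: continuous_intros\<close>)
  then show ?thesis by simp
 qed
 \<comment> \<open>The length 1/N^2 balances two contributions: the mean of q^2 over the interval is
   at most N^2 A, and the squared variation is at most 4 N^2 A.\<close>
 define y0 where "y0 = 1 - 1 / N^2"
 have N2: "1 / N^2 <= 1" "0 < 1 / N^2" using N by (auto simp: one_le_power)
 then have y0: "0 <= y0" "y0 <= 1" by (auto simp: y0_def)
 have pt: "(poly q 1)^2 <= 2 * (poly q y)^2 + 8 * N^2 * A" if y: "y \<in> {y0..1}" for y
 proof -
  have "sqrt (1 - y) <= sqrt (1 / N^2)" using y by (intro real_sqrt_le_mono) (auto simp: y0_def)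
  also have "... = 1 / N" using N by (simp add: real_sqrt_divide)
  finally have "2 * M * sqrt (1 - y) <= 2 * M * (1 / N)" using M0 by (intro mult_left_mono) auto
  also have "... = 2 * N * sqrt A" using N by (simp add: M_def power2_eq_square)
  finally have b: "\<bar>poly q 1 - poly q y\<bar> <= 2 * N * sqrt A"
   using diff1[of y 1] diff1[of y "-1"] y y0 by auto
  have "(poly q 1 - poly q y)^2 <= (2 * N * sqrt A)^2"
   using power_mono[OF b, of 2] by simp
  then have "(poly q 1 - poly q y)^2 <= 4 * N^2 * A" using A0 by (simp add: power_mult_distrib)
  moreover have "(poly q 1)^2 <= 2 * (poly q y)^2 + 2 * (poly q 1 - poly q y)^2"
   using zero_le_power2[of "poly q 1 - 2 * poly q y"] by (simp add: power2_eq_square algebra_simps)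
  ultimately show ?thesis by linarith
 qed
 have "integral {y0..1} (%y. (poly q 1)^2) <= integral {y0..1} (%y. 2 * (poly q y)^2 + 8 * N^2 * A)"
  by (rule integral_le) (use pt in \<open>auto intro!: integrable_continuous_interval continuous_intros\<close>)
 also have "... = 2 * integral {y0..1} (%y. (poly q y)^2) + (1 - y0) * (8 * N^2 * A)"
  using y0 by (subst Henstock_Kurzweil_Integration.integral_add) (auto intro!: integrable_continuous_interval continuous_intros)
 also have "integral {y0..1} (%y. (poly q y)^2) <= A" unfolding A_def
  by (rule integral_subset_le) (use y0 in \<open>auto intro!: integrable_continuous_interval continuous_intros\<close>)
 also have "(1 - y0) * (8 * N^2 * A) = 8 * A" using N by (simp add: y0_def)
 finally have "(poly q 1)^2 * (1 / N^2) <= 10 * A" using y0 by (simp add: y0_def)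
 then have "(poly q 1)^2 <= 10 * A * N^2" using N2(2) N by (simp add: pos_divide_le_eq)
 also have "... = 10 * N^2 * A" by simp
 finally show ?thesis unfolding A_def N_def .
qed

lemma poly_endpoint_bound:
 assumes "degree q <= n"
 shows "(poly q 1)^2 <= 20 * (real n + 1)^2 * integral {0..1} (%x. (poly q x)^2)"
proof -
 define Q where "Q = pcompose q [:1/2, 1/2:]"
 have "degree Q <= n" using assms by (simp add: Q_def degree_pcompose)
 note b = poly_endpoint_bound_symmetric[OF this]
 have pQ: "poly Q x = poly q (1/2 + 1/2 * x)" for x by (simp add: Q_def poly_pcompose)
 have "(poly q 1)^2 <= 10 * (real n + 1)^2 * integral {-1..1} (%x. (poly q (1/2 + 1/2 * x))^2)"
  using b unfolding pQ by simp
 also have "integral {-1..1} (%x. (poly q (1/2 + 1/2 * x))^2) = 2 * integral {0..1} (%x. (poly q x)^2)"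
 proof -
  have "continuous_on {0..1} (%x. (poly q x)^2)" by (intro continuous_intros)
  from integral_affine_to_unit[OF zero_less_one this]
  have "integral {0..1} (%x. (poly q x)^2) = 1/2 * integral {-1..1} (%x. (poly q (1/2 + 1/2 * x))^2)"
   unfolding add_0_left diff_zero .
  then show ?thesis by linarith
 qed
 finally have "(poly q 1)^2 <= 10 * (real n + 1)^2 * (2 * integral {0..1} (%x. (poly q x)^2))" .
 then show ?thesis by linarith
qed

section \<open>Square-integrable functions\<close>

text \<open>Formulated for an arbitrary measure, so that the same lemmas serve
  \<open>lebesgue_on\<close>, where the problem lives, and \<open>lborel\<close>, where Fubini and
  convolution are available.\<close>

definition sqint :: "'a measure => ('a => 'b::euclidean_space) => bool" where
 "sqint M f \<longleftrightarrow> f \<in> borel_measurable M \<and> integrable M (%x. (norm (f x))^2)"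

lemma sqint_measurable[measurable_dest]: "sqint M f ==> f \<in> borel_measurable M"
 by (simp add: sqint_def)

lemma L2_on_sqint: "L2_on D f \<longleftrightarrow> sqint (lebesgue_on D) f"
 by (simp add: L2_on_def sqint_def)

lemma two_mult_le_sum_squares: "2 * (a::real) * b <= a^2 + b^2"
 using zero_le_power2[of "a - b"] by (simp add: power2_diff)

lemma norm_add_square_le: "(norm (a + b))^2 <= 2 * (norm a)^2 + 2 * (norm (b :: 'b::real_normed_vector))^2"
proof -
 have "(norm (a + b))^2 <= (norm a + norm b)^2" by (intro power_mono norm_triangle_ineq norm_ge_zero)
 also have "... = (norm a)^2 + (norm b)^2 + 2 * norm a * norm b" by (simp add: power2_sum)
 finally show ?thesis using two_mult_le_sum_squares[of "norm a" "norm b"] by linarith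
qed

lemma sqint_add: assumes "sqint M f" "sqint M g" shows "sqint M (%x. f x + g x)"
 unfolding sqint_def
proof
 have [measurable]: "f \<in> borel_measurable M" "g \<in> borel_measurable M" using assms by (auto simp: sqint_def)
 show "(%x. f x + g x) \<in> borel_measurable M" by measurable
 show "integrable M (%x. (norm (f x + g x))^2)"
 proof (rule Bochner_Integration.integrable_bound)
  show "integrable M (%x. 2 * (norm (f x))^2 + 2 * (norm (g x))^2)" using assms by (auto simp: sqint_def)
  show "AE x in M. norm ((norm (f x + g x))^2) <= norm (2 * (norm (f x))^2 + 2 * (norm (g x))^2)"
   using norm_add_square_le by (intro AE_I2) auto
 qed measurable
qed

lemma sqint_scaleR: "sqint M f ==> sqint M (%x. c *\<^sub>R f x)"
 by (auto simp: sqint_def power_mult_distrib)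

lemma sqint_diff: assumes "sqint M f" "sqint M g" shows "sqint M (%x. f x - g x)"
 using sqint_add[OF assms(1) sqint_scaleR[OF assms(2), of "-1"]] by simp

lemma sqint_inner_integrable:
 assumes "sqint M f" "sqint M g"
 shows "integrable M (%x. f x \<bullet> g x)"
proof (rule Bochner_Integration.integrable_bound)
 have [measurable]: "f \<in> borel_measurable M" "g \<in> borel_measurable M" using assms by (auto simp: sqint_def)
 show "integrable M (%x. (norm (f x))^2 + (norm (g x))^2)" using assms by (auto simp: sqint_def)
 show "(%x. f x \<bullet> g x) \<in> borel_measurable M" by measurable
 have "\<bar>f x \<bullet> g x\<bar> <= (norm (f x))^2 + (norm (g x))^2" for x
 proof -
  have "\<bar>f x \<bullet> g x\<bar> <= norm (f x) * norm (g x)" by (rule Cauchy_Schwarz_ineq2)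
  moreover have "0 <= norm (f x) * norm (g x)" by simp
  ultimately show ?thesis using two_mult_le_sum_squares[of "norm (f x)" "norm (g x)"] by linarith
 qed
 then show "AE x in M. norm (f x \<bullet> g x) <= norm ((norm (f x))^2 + (norm (g x))^2)"
  by (intro AE_I2) auto
qed

lemma sqint_mult_integrable:
 fixes f g :: "'a => real"
 assumes "sqint M f" "sqint M g" shows "integrable M (%x. f x * g x)"
 using sqint_inner_integrable[OF assms] by simp

lemma integral_norm_square_combination:
 assumes "sqint M f" "sqint M g"
 shows "(LINT x|M. (norm (f x + c *\<^sub>R g x))^2)
  = (LINT x|M. (norm (f x))^2) + 2 * c * (LINT x|M. f x \<bullet> g x) + c^2 * (LINT x|M. (norm (g x))^2)"
proof -
 have "(norm (f x + c *\<^sub>R g x))^2 = (norm (f x))^2 + 2 * c * (f x \<bullet> g x) + c^2 * (norm (g x))^2" for x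
  unfolding power2_norm_eq_inner by (simp add: inner_add inner_commute power2_eq_square algebra_simps)
 then show ?thesis
  using assms sqint_inner_integrable[OF assms] by (simp add: sqint_def)
qed

text \<open>Serves two purposes: the Cauchy-Schwarz inequality, and the near orthogonality of almost
  minimizing residuals.\<close>

lemma discriminant_bound:
 fixes a b c :: real
 assumes "!!t. 0 <= a + 2 * t * b + t^2 * c" "0 <= c"
 shows "b^2 <= a * c"
proof (cases "c = 0")
 case True
 have "b = 0"
 proof (rule ccontr)
  assume "b ~= 0"
  have "0 <= a + 2 * (- (a + 1) / (2 * b)) * b" using assms(1)[of "- (a + 1) / (2 * b)"] True by simp
  also have "... = -1" using \<open>b ~= 0\<close> by (simp add: field_simps)
  finally show False by simp
 qed
 with True show ?thesis by simp
next
 case False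
 then have c: "c > 0" using assms(2) by simp
 have "0 <= a + 2 * (- b / c) * b + (- b / c)^2 * c" by (rule assms(1))
 also have "... = a - b^2 / c" using c by (simp add: power2_eq_square field_simps)
 finally have "b^2 / c <= a" by simp
 then show ?thesis using c by (simp add: pos_divide_le_eq)
qed

lemma integral_Cauchy_Schwarz:
 assumes "sqint M f" "sqint M g"
 shows "(LINT x|M. f x \<bullet> g x)^2 <= (LINT x|M. (norm (f x))^2) * (LINT x|M. (norm (g x))^2)"
proof (rule discriminant_bound)
 fix t
 have "0 <= (LINT x|M. (norm (f x + t *\<^sub>R g x))^2)" by (rule Bochner_Integration.integral_nonneg) simp
 then show "0 <= (LINT x|M. (norm (f x))^2) + 2 * t * (LINT x|M. f x \<bullet> g x) + t^2 * (LINT x|M. (norm (g x))^2)"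
  by (simp only: integral_norm_square_combination[OF assms])
next
 show "0 <= (LINT x|M. (norm (g x))^2)" by (rule Bochner_Integration.integral_nonneg) simp
qed

definition l2n :: "'a measure => ('a => 'b::euclidean_space) => real" where
 "l2n M f = sqrt (LINT x|M. (norm (f x))^2)"

lemma l2n_nonneg: "0 <= l2n M f"
 by (simp add: l2n_def)

lemma l2n_square: "(l2n M f)^2 = (LINT x|M. (norm (f x))^2)"
 by (simp add: l2n_def)

lemma integral_inner_le_l2n:
 assumes "sqint M f" "sqint M g"
 shows "\<bar>\<integral>x. f x \<bullet> g x \<partial>M\<bar> <= l2n M f * l2n M g"
proof -
 have "\<bar>\<integral>x. f x \<bullet> g x \<partial>M\<bar> = sqrt ((LINT x|M. f x \<bullet> g x)^2)" by simp
 also have "... <= sqrt ((LINT x|M. (norm (f x))^2) * (LINT x|M. (norm (g x))^2))"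
  using integral_Cauchy_Schwarz[OF assms] by (rule real_sqrt_le_mono)
 finally show ?thesis by (simp add: l2n_def real_sqrt_mult)
qed

lemma l2n_add_le:
 assumes "sqint M f" "sqint M g"
 shows "(LINT x|M. (norm (f x + g x))^2) <= 2 * (LINT x|M. (norm (f x))^2) + 2 * (LINT x|M. (norm (g x))^2)"
proof -
 have "(LINT x|M. (norm (f x + g x))^2) <= (LINT x|M. 2 * (norm (f x))^2 + 2 * (norm (g x))^2)"
  using assms sqint_add[OF assms] norm_add_square_le
  by (intro integral_mono) (auto simp: sqint_def)
 also have "... = 2 * (LINT x|M. (norm (f x))^2) + 2 * (LINT x|M. (norm (g x))^2)"
  using assms by (simp add: sqint_def)
 finally show ?thesis .
qed

lemma sqint_finite_integrable:
 assumes "finite_measure M" "sqint M f"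
 shows "integrable M f"
proof -
 interpret finite_measure M by fact
 have [measurable]: "f \<in> borel_measurable M" using assms by (auto simp: sqint_def)
 show ?thesis
 proof (rule Bochner_Integration.integrable_bound)
  show "integrable M (%x. 1 + (norm (f x))^2)" using assms by (auto simp: sqint_def)
  have "norm (f x) <= 1 + (norm (f x))^2" for x
  proof -
   have "2 * norm (f x) <= (norm (f x))^2 + 1" using two_mult_le_sum_squares[of "norm (f x)" 1] by simp
   then show ?thesis using norm_ge_zero[of "f x"] by linarith
  qed
  then show "AE x in M. norm (f x) <= norm (1 + (norm (f x))^2)" by (intro AE_I2) auto
 qed measurable
qed

lemma integral_norm_le_l2n:
 assumes "finite_measure M" "sqint M f"
 shows "(LINT x|M. norm (f x))^2 <= measure M (space M) * (LINT x|M. (norm (f x))^2)"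
proof -
 interpret finite_measure M by fact
 have "sqint M (%x. 1::real)" by (simp add: sqint_def)
 moreover have "sqint M (%x. norm (f x))" using assms by (auto simp: sqint_def)
 ultimately show ?thesis using integral_Cauchy_Schwarz[of M "%x. 1::real" "%x. norm (f x)"] by simp
qed

text \<open>The residual of the best approximation, a limit of almost minimizers by completeness of
 $L^2$ as in the Riesz-Fischer theorem.\<close>

lemma L2_orthogonal_residual:
 fixes f :: "'a => 'b::euclidean_space" and X :: "('a => 'b) set"
 assumes M: "finite_measure M" and f: "sqint M f"
  and X: "!!x. x \<in> X ==> sqint M x" "X ~= {}"
   "!!x y c. x \<in> X ==> y \<in> X ==> (%t. x t + c *\<^sub>R y t) \<in> X"
  and \<delta>: "\<delta> > 0" "!!x. x \<in> X ==> \<delta> <= (LINT t|M. (norm (f t - x t))^2)"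
 obtains \<rho> where "sqint M \<rho>" "!!x. x \<in> X ==> (LINT t|M. \<rho> t \<bullet> x t) = 0" "0 < (LINT t|M. (norm (\<rho> t))^2)"
proof -
 interpret finite_measure M by fact
 define N where "N g = (LINT t|M. (norm (g t))^2)" for g :: "'a => 'b"
 define Q where "Q = (%x. N (%t. f t - x t)) ` X"
 define d where "d = Inf Q"
 have bdd: "bdd_below Q" using \<delta>(2) by (intro bdd_belowI[of _ \<delta>]) (auto simp: Q_def N_def)
 have d\<delta>: "\<delta> <= d" unfolding d_def using X(2) \<delta>(2) by (intro cInf_greatest) (auto simp: Q_def N_def)
 have dle: "d <= N (%t. f t - x t)" if "x \<in> X" for x
  unfolding d_def using that bdd by (intro cInf_lower) (auto simp: Q_def)
 have "\<exists>x\<in>X. N (%t. f t - x t) < d + 1 / real (Suc n)" for n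
 proof -
  have "Q ~= {}" using X(2) by (simp add: Q_def)
  moreover have "Inf Q < d + 1 / real (Suc n)" by (simp add: d_def)
  ultimately obtain q where "q \<in> Q" "q < d + 1 / real (Suc n)" using cInf_lessD by blast
  then show ?thesis by (auto simp: Q_def)
 qed
 then obtain \<xi> where \<xi>: "!!n. \<xi> n \<in> X" "!!n. N (%t. f t - \<xi> n t) < d + 1 / real (Suc n)" by metis
 define r where "r n t = f t - \<xi> n t" for n t
 have sr: "sqint M (r n)" for n
  using sqint_diff[OF f X(1)[OF \<xi>(1)]] by (simp add: r_def[abs_def])
 \<comment> \<open>Moving by a multiple of \<open>x\<close> cannot bring the squared distance below
   \<open>d\<close>, and that of \<open>r n\<close> exceeds \<open>d\<close> by at most 1 / (n + 1).
   So a quadratic polynomial in \<open>c\<close> is nonnegative, and its discriminant measures the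
   failure of orthogonality.\<close>
 have almost_orth: "(LINT t|M. r n t \<bullet> x t)^2 <= 1 / real (Suc n) * N x" if x: "x \<in> X" for n x
 proof (rule discriminant_bound)
  fix c
  have "(%t. \<xi> n t + (- c) *\<^sub>R x t) \<in> X" using X(3) \<xi>(1) x by blast
  from dle[OF this] have "d <= N (%t. r n t + c *\<^sub>R x t)" by (simp add: r_def algebra_simps)
  also have "... = N (r n) + 2 * c * (LINT t|M. r n t \<bullet> x t) + c^2 * N x"
   unfolding N_def by (rule integral_norm_square_combination[OF sr X(1)[OF x]])
  finally have "d <= N (r n) + 2 * c * (LINT t|M. r n t \<bullet> x t) + c^2 * N x" .
  moreover have "N (r n) < d + 1 / real (Suc n)" using \<xi>(2)[of n] unfolding r_def[abs_def] .
  ultimately show "0 <= 1 / real (Suc n) + 2 * c * (LINT t|M. r n t \<bullet> x t) + c^2 * N x"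
   by linarith
 qed (simp add: N_def)
 \<comment> \<open>Parallelogram identity: the mean of two residuals is the residual of the mean of
   two competitors, so its squared norm is at least \<open>d\<close>.\<close>
 have cauchy2: "N (%t. r m t - r n t) <= 2 / real (Suc m) + 2 / real (Suc n)" for m n
 proof -
  have par: "(norm (r m t - r n t))^2 = 2 * (norm (r m t))^2 + 2 * (norm (r n t))^2 - 4 * (norm ((1/2) *\<^sub>R (r m t + r n t)))^2" for t
   unfolding power2_norm_eq_inner by (simp add: inner_add inner_diff inner_commute algebra_simps)
  have s: "sqint M (%t. (1/2) *\<^sub>R (r m t + r n t))" by (intro sqint_scaleR sqint_add sr)
  have "N (%t. r m t - r n t) = 2 * N (r m) + 2 * N (r n) - 4 * N (%t. (1/2) *\<^sub>R (r m t + r n t))"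
   unfolding N_def par using sr[of m] sr[of n] s by (simp add: sqint_def)
  moreover have "d <= N (%t. (1/2) *\<^sub>R (r m t + r n t))"
  proof -
   \<comment> \<open>Closure of \<open>X\<close> is given in the form x + c y; the mean is built as
     the sum, then half the difference, then the second element added back.\<close>
   have "(%t. \<xi> m t + 1 *\<^sub>R \<xi> n t) \<in> X" using X(3) \<xi>(1) by blast
   then have "(%t. \<xi> m t + (-1/2) *\<^sub>R (\<xi> m t + 1 *\<^sub>R \<xi> n t)) \<in> X" using X(3) \<xi>(1) by blast
   then have "(%t. (\<xi> m t + (-1/2) *\<^sub>R (\<xi> m t + 1 *\<^sub>R \<xi> n t)) + 1 *\<^sub>R \<xi> n t) \<in> X" using X(3) \<xi>(1) by blast
   from dle[OF this] show ?thesis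
    by (rule order_trans) (auto simp: r_def algebra_simps N_def intro!: eq_refl Bochner_Integration.integral_cong arg_cong[where f = "%x. (norm x)^2"] simp flip: scaleR_add_left)
  qed
  moreover have "N (r n) < d + 1 / real (Suc n)" for n using \<xi>(2)[of n] unfolding r_def[abs_def] .
  from this[of m] this[of n] have "2 * N (r m) + 2 * N (r n) - 4 * d < 2 / real (Suc m) + 2 / real (Suc n)" by linarith
  ultimately show ?thesis by linarith
 qed
 have small: "\<exists>K. \<forall>n\<ge>K. C / real (Suc n) < e" if "e > 0" for C e :: real
 proof -
  have "(%n. C * inverse (real (Suc n))) \<longlonglongrightarrow> C * 0" by (intro tendsto_mult tendsto_const LIMSEQ_inverse_real_of_nat)
  then have "\<forall>\<^sub>F n in sequentially. C * inverse (real (Suc n)) < e"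
   using that by (intro order_tendstoD) auto
  then show ?thesis by (simp add: eventually_sequentially divide_inverse)
 qed
 \<comment> \<open>The measure is finite, so a Cauchy sequence in L^2 is Cauchy in L^1, and a
   subsequence converges almost everywhere.\<close>
 have "\<exists>s. strict_mono s \<and> (AE t in M. Cauchy (%i. r (s i) t))"
 proof -
  have "\<exists>K. \<forall>i\<ge>K. \<forall>j\<ge>K. (LINT t|M. norm (r i t - r j t)) < e" if e: "e > 0" for e
  proof -
   define m where "m = measure M (space M)"
   obtain K where K: "!!n. n \<ge> K ==> (4 * m) / real (Suc n) < e^2 " using small[of "e^2" "4 * m"] e by auto
   have "(LINT t|M. norm (r i t - r j t)) < e" if "i \<ge> K" "j \<ge> K" for i j
   proof -
    have "(LINT t|M. norm (r i t - r j t))^2 <= m * N (%t. r i t - r j t)"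
     unfolding m_def N_def by (rule integral_norm_le_l2n[OF M sqint_diff[OF sr sr]])
    also have "... <= m * (2 / real (Suc i) + 2 / real (Suc j))"
     by (intro mult_left_mono cauchy2) (simp add: m_def)
    also have "... = (4 * m / real (Suc i) + 4 * m / real (Suc j)) / 2" by (simp add: distrib_left)
    also have "... < e^2"
    proof -
     have "x < z ==> y < z ==> (x + y) / 2 < z" for x y z :: real by simp
     then show ?thesis using K[OF that(1)] K[OF that(2)] .
    qed
    finally show ?thesis using e by (simp add: power_less_imp_less_base)
   qed
   then show ?thesis by blast
  qed
  from cauchy_L1_AE_cauchy_subseq[OF sqint_finite_integrable[OF M sr] this] show ?thesis by blast
 qed
 then obtain s where s: "strict_mono s" "AE t in M. Cauchy (%i. r (s i) t)" by blast
 define \<rho> where "\<rho> t = lim (%i. r (s i) t)" for t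
 have [measurable]: "r n \<in> borel_measurable M" for n using sr by (auto simp: sqint_def)
 have [measurable]: "\<rho> \<in> borel_measurable M" unfolding \<rho>_def by measurable
 have conv: "AE t in M. (%i. r (s i) t) \<longlonglongrightarrow> \<rho> t"
  using s(2) by eventually_elim (simp add: \<rho>_def Cauchy_convergent convergent_LIMSEQ_iff[symmetric])
 \<comment> \<open>Fatou along the subsequence turns the pairwise bound into a bound for the
   limit.\<close>
 have close: "(nn_integral M (%t. ennreal ((norm (\<rho> t - r n t))^2))) <= ennreal (4 / real (Suc n))" for n
 proof -
  have "(nn_integral M (%t. ennreal ((norm (\<rho> t - r n t))^2))) = (nn_integral M (%t. liminf (%i. ennreal ((norm (r (s i) t - r n t))^2))))"
  proof (rule nn_integral_cong_AE)
   show "AE t in M. ennreal ((norm (\<rho> t - r n t))^2) = liminf (%i. ennreal ((norm (r (s i) t - r n t))^2))"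
    using conv
   proof eventually_elim
    case (elim t)
    then have "(%i. ennreal ((norm (r (s i) t - r n t))^2)) \<longlonglongrightarrow> ennreal ((norm (\<rho> t - r n t))^2)"
     by (intro tendsto_intros) auto
    then show ?case by (intro lim_imp_Liminf[symmetric]) auto
   qed
  qed
  also have "... <= liminf (%i. nn_integral M (%t. ennreal ((norm (r (s i) t - r n t))^2)))"
   by (rule nn_integral_liminf) measurable
  also have "... <= ennreal (4 / real (Suc n))"
  proof (rule Liminf_le)
   show "\<forall>\<^sub>F i in sequentially. (nn_integral M (%t. ennreal ((norm (r (s i) t - r n t))^2))) <= ennreal (4 / real (Suc n))"
    unfolding eventually_sequentially
   proof (intro exI[of _ n] allI impI)
    fix i assume i: "n <= i"
    then have "n <= s i" using seq_suble[OF s(1), of i] by linarith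
    then have "2 / real (Suc (s i)) <= 2 / real (Suc n)" by (intro divide_left_mono) auto
    then have "N (%t. r (s i) t - r n t) <= 4 / real (Suc n)" using cauchy2[of "s i" n] by linarith
    moreover have "(nn_integral M (%t. ennreal ((norm (r (s i) t - r n t))^2))) = ennreal (N (%t. r (s i) t - r n t))"
     unfolding N_def using sqint_diff[OF sr sr] by (intro nn_integral_eq_integral) (auto simp: sqint_def)
    ultimately show "(nn_integral M (%t. ennreal ((norm (r (s i) t - r n t))^2))) <= ennreal (4 / real (Suc n))"
     by (simp add: ennreal_leI)
   qed
  qed simp
  finally show ?thesis .
 qed
 have sd: "sqint M (%t. \<rho> t - r n t)" for n
  unfolding sqint_def
 proof
  show "integrable M (%t. (norm (\<rho> t - r n t))^2)"
   by (rule integrableI_nonneg) (use close[of n] in \<open>auto simp: order_le_less_trans\<close>)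
 qed measurable
 have Nd: "N (%t. \<rho> t - r n t) <= 4 / real (Suc n)" for n
 proof -
  have "(nn_integral M (%t. ennreal ((norm (\<rho> t - r n t))^2))) = ennreal (N (%t. \<rho> t - r n t))"
   unfolding N_def using sd by (intro nn_integral_eq_integral) (auto simp: sqint_def)
  with close[of n] have "ennreal (N (%t. \<rho> t - r n t)) <= ennreal (4 / real (Suc n))" by simp
  then show ?thesis by (metis ennreal_le_iff divide_nonneg_nonneg of_nat_0_le_iff zero_le_numeral)
 qed
 have s\<rho>: "sqint M \<rho>" using sqint_add[OF sd[of 0] sr[of 0]] by simp
 have orth: "(LINT t|M. \<rho> t \<bullet> x t) = 0" if x: "x \<in> X" for x
 proof -
  have sx: "sqint M x" using X(1) x .
  have bound: "(LINT t|M. \<rho> t \<bullet> x t)^2 <= (10 * N x) / real (Suc n)" for n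
  proof -
   have "(LINT t|M. \<rho> t \<bullet> x t) = (LINT t|M. (\<rho> t - r n t) \<bullet> x t) + (LINT t|M. r n t \<bullet> x t)"
    using sqint_inner_integrable[OF sd[of n] sx] sqint_inner_integrable[OF sr[of n] sx]
    by (simp add: inner_diff_left flip: Bochner_Integration.integral_add)
   then have "(LINT t|M. \<rho> t \<bullet> x t)^2 <= 2 * (LINT t|M. (\<rho> t - r n t) \<bullet> x t)^2 + 2 * (LINT t|M. r n t \<bullet> x t)^2"
    using norm_add_square_le[of "\<integral>t. (\<rho> t - r n t) \<bullet> x t \<partial>M" "\<integral>t. r n t \<bullet> x t \<partial>M"] by simp
   moreover have "(LINT t|M. (\<rho> t - r n t) \<bullet> x t)^2 <= 4 / real (Suc n) * N x"
   proof -
    have "(LINT t|M. (\<rho> t - r n t) \<bullet> x t)^2 <= N (%t. \<rho> t - r n t) * N x"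
     unfolding N_def by (rule integral_Cauchy_Schwarz[OF sd sx])
    also have "... <= 4 / real (Suc n) * N x" by (intro mult_right_mono Nd) (simp add: N_def)
    finally show ?thesis .
   qed
   moreover note almost_orth[OF x, of n]
   moreover have "2 * (4 / real (Suc n) * N x) + 2 * (1 / real (Suc n) * N x) = (10 * N x) / real (Suc n)"
   proof -
    have "2 * (4 / k * y) + 2 * (1 / k * y) = (10 * y) / k" for k y :: real
     by (cases "k = 0") (auto simp: field_simps)
    then show ?thesis .
   qed
   ultimately show ?thesis by linarith
  qed
  show ?thesis
  proof (rule ccontr)
   assume "(LINT t|M. \<rho> t \<bullet> x t) ~= 0"
   then have "0 < (LINT t|M. \<rho> t \<bullet> x t)^2" by simp
   from small[OF this, of "10 * N x"] bound show False by (meson le_refl not_le)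
  qed
 qed
 \<comment> \<open>Each \<open>r n\<close> has squared norm at least \<open>\<delta>\<close>, and
   its squared distance to the limit is at most 4 / (n + 1), so the limit cannot vanish.\<close>
 have pos: "0 < N \<rho>"
 proof -
  obtain n where n: "16 / real (Suc n) < \<delta>" using small[OF \<delta>(1), of 16] by blast
  have "d <= N (r n)" using dle[OF \<xi>(1)] by (simp add: r_def[abs_def])
  also have "N (r n) = N (%t. \<rho> t + (-1) *\<^sub>R (\<rho> t - r n t))" by simp
  also have "... <= 2 * N \<rho> + 2 * N (%t. (-1) *\<^sub>R (\<rho> t - r n t))"
   unfolding N_def by (rule l2n_add_le[OF s\<rho> sqint_scaleR[OF sd]])
  also have "N (%t. (-1) *\<^sub>R (\<rho> t - r n t)) = N (%t. \<rho> t - r n t)" by (simp add: N_def norm_minus_commute)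
  finally have "d <= 2 * N \<rho> + 8 / real (Suc n)" using Nd[of n] by simp
  then show ?thesis using n d\<delta> \<delta>(1) by simp
 qed
 show thesis by (rule that[OF s\<rho> orth]) (use pos in \<open>simp_all add: N_def\<close>)
qed

section \<open>Integration in the plane\<close>

text \<open>Lebesgue measure on \<open>real^2\<close> and the image of the product measure agree on
  boxes, which determine them. Nonnegative integrals allow the exchange of integrations without
  integrability conditions.\<close>

lemma nn_integral_real2:
 fixes f :: "real^2 => ennreal"
 assumes [measurable]: "f \<in> borel_measurable borel"
 shows "(nn_integral lborel (%x. f x)) = (nn_integral lborel (%s. nn_integral lborel (%t. f (vector [s, t]))))"
proof -
 define V :: "real \<times> real => real^2" where "V p = vector [fst p, snd p]" for p
 have V: "V p = fst p *\<^sub>R axis 1 1 + snd p *\<^sub>R axis 2 1" for p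
  by (simp add: V_def vec_eq_iff forall_2 axis_def)
 have [measurable]: "V \<in> borel_measurable borel"
  unfolding V by (intro borel_measurable_continuous_onI continuous_intros)
 have "lborel = distr (lborel \<Otimes>\<^sub>M lborel) borel V"
 proof (rule lborel_eqI)
  fix l u :: "real^2"
  assume lu: "!!b. b \<in> Basis ==> l \<bullet> b <= u \<bullet> b"
  have B: "(Basis :: (real^2) set) = {axis 1 1, axis 2 1}"
   by (auto simp: Basis_vec_def UNIV_2)
  have ne: "axis 1 1 ~= (axis 2 1 :: real^2)" by (simp add: axis_eq_axis)
  have le: "l $ 1 <= u $ 1" "l $ 2 <= u $ 2"
   using lu[of "axis 1 1"] lu[of "axis 2 1"] by (auto simp: B inner_axis)
  have pre: "V -` box l u = box (l $ 1) (u $ 1) \<times> box (l $ 2) (u $ 2)"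
   by (auto simp: V_def mem_box_cart forall_2)
  have "emeasure (distr (lborel \<Otimes>\<^sub>M lborel) borel V) (box l u) = emeasure (lborel \<Otimes>\<^sub>M lborel) (box (l $ 1) (u $ 1) \<times> box (l $ 2) (u $ 2))"
   by (subst emeasure_distr) (simp_all add: pre lborel_prod)
  also have "... = ennreal (u $ 1 - l $ 1) * ennreal (u $ 2 - l $ 2)"
   using le by (subst lborel.emeasure_pair_measure_Times) auto
  also have "... = ennreal (\<Prod>b\<in>Basis. (u - l) \<bullet> b)"
   using le ne by (simp add: B inner_axis ennreal_mult)
  finally show "emeasure (distr (lborel \<Otimes>\<^sub>M lborel) borel V) (box l u) = ennreal (\<Prod>b\<in>Basis. (u - l) \<bullet> b)" .
 qed simp
 then have "(nn_integral lborel (%x. f x)) = (nn_integral (distr (lborel \<Otimes>\<^sub>M lborel) borel V) (%x. f x))" by simp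
 also have "... = (nn_integral ((lborel \<Otimes>\<^sub>M lborel)) (%p. f (V p)))"
  by (subst nn_integral_distr) (auto simp: lborel_prod)
 also have "... = (nn_integral lborel (%s. nn_integral lborel (%t. f (V (s, t)))))"
  by (subst lborel.nn_integral_fst) (auto simp: lborel_prod)
 finally show ?thesis by (simp add: V_def)
qed

text \<open>Lebesgue measure is compared on boxes with its weighted image under the affine map; the
  determinant comes from the volume of a linear image.\<close>

lemma nn_integral_linear_change:
 fixes f :: "real^2 => ennreal" and z u v :: "real^2"
 assumes [measurable]: "f \<in> borel_measurable borel" and d: "u $ 1 * v $ 2 - v $ 1 * u $ 2 ~= 0"
 shows "(nn_integral lborel (%x. f x))
  = ennreal \<bar>u $ 1 * v $ 2 - v $ 1 * u $ 2\<bar> * (nn_integral lborel (%s. nn_integral lborel (%t. f (z + s *\<^sub>R u + t *\<^sub>R v))))"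
proof -
 define L :: "real^2 => real^2" where "L x = x $ 1 *\<^sub>R u + x $ 2 *\<^sub>R v" for x
 define T where "T x = z + L x" for x
 have linL: "linear L" by (rule linearI) (auto simp: L_def algebra_simps scaleR_add_left)
 have dL: "det (matrix L) = u $ 1 * v $ 2 - v $ 1 * u $ 2"
  by (simp add: det_2 matrix_def L_def axis_def)
 define D where "D = \<bar>u $ 1 * v $ 2 - v $ 1 * u $ 2\<bar>"
 have D: "D > 0" using d by (simp add: D_def)
 have injL: "inj L" using d linL by (simp add: dL flip: det_nz_iff_inj)
 have [measurable]: "T \<in> borel_measurable borel"
  unfolding T_def using linL by (intro borel_measurable_continuous_onI continuous_intros linear_continuous_on linear_conv_bounded_linear[THEN iffD1])
 have "lborel = density (distr lborel borel T) (%_. ennreal D)"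
 proof (rule lborel_eqI)
  fix l w :: "real^2" assume lw: "!!b. b \<in> Basis ==> l \<bullet> b <= w \<bullet> b"
  obtain L' where L': "linear L'" "!!x. L' (L x) = x" "!!x. L (L' x) = x"
   using linear_injective_isomorphism[OF linL injL] by auto
  define S where "S = T -` box l w"
  have TS: "L ` S = (%x. - z + x) ` box l w"
  proof safe
   fix x assume "x \<in> S" then show "L x \<in> (%x. - z + x) ` box l w"
    by (intro image_eqI[of _ _ "T x"]) (auto simp: S_def T_def)
  next
   fix x assume "x \<in> box l w" then show "- z + x \<in> L ` S"
    by (intro image_eqI[of _ _ "L' (- z + x)"]) (auto simp: S_def T_def L')
  qed
  have S: "S = (%x. L' (- z + x)) ` box l w"
  proof -
   have "S = L' ` (L ` S)" by (simp add: image_image L'(2))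
   then show ?thesis unfolding TS image_image .
  qed
  have "bounded S" unfolding S using L'(1)
   by (intro bounded_linear_image[of "(%x. - z + x) ` box l w" L', unfolded image_image] bounded_translation linear_conv_bounded_linear[THEN iffD1]) auto
  moreover have Sb: "S \<in> sets borel" using measurable_sets[of T borel borel "box l w"] by (simp add: S_def)
  ultimately have Sm: "S \<in> lmeasurable" by (intro bounded_set_imp_lmeasurable) auto
  have "emeasure (density (distr lborel borel T) (%_. ennreal D)) (box l w) = ennreal D * emeasure lborel S"
   by (subst emeasure_density) (auto simp: nn_integral_cmult nn_integral_distr S_def emeasure_distr)
  also have "emeasure lborel S = ennreal (measure lebesgue S)"
   using Sb emeasure_eq_measure2[OF Sm] by simp
  also have "ennreal D * ... = ennreal (measure lebesgue (L ` S))"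
   using measure_linear_image[OF linL Sm] D by (simp add: dL D_def ennreal_mult)
  also have "measure lebesgue (L ` S) = measure lebesgue (box l w)"
   unfolding TS by (rule measure_translation)
  also have "... = (\<Prod>b\<in>Basis. (w - l) \<bullet> b)" using lw by (simp add: measure_lborel_box_eq)
  finally show "emeasure (density (distr lborel borel T) (%_. ennreal D)) (box l w) = ennreal (\<Prod>b\<in>Basis. (w - l) \<bullet> b)" .
 qed simp
 then have "(nn_integral lborel (%x. f x)) = (nn_integral (density (distr lborel borel T) (%_. ennreal D)) (%x. f x))" by simp
 also have "... = ennreal D * (nn_integral lborel (%x. f (T x)))"
  by (simp add: nn_integral_density nn_integral_cmult nn_integral_distr)
 also have "(nn_integral lborel (%x. f (T x))) = (nn_integral lborel (%s. nn_integral lborel (%t. f (T (vector [s, t])))))"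
  by (rule nn_integral_real2) measurable
 finally show ?thesis by (simp add: T_def L_def D_def add.assoc)
qed

lemma nn_integral_lborel_affine:
 fixes f :: "'a::euclidean_space => ennreal"
 assumes [measurable]: "f \<in> borel_measurable borel" and c: "c ~= 0"
 shows "(nn_integral lborel (%x. f x)) = ennreal (\<bar>c\<bar> ^ DIM('a)) * (nn_integral lborel (%x. f (w + c *\<^sub>R x)))"
proof -
 have "(nn_integral lborel (%x. f x)) = (nn_integral (density (distr lborel borel (%x. w + c *\<^sub>R x)) (%_. \<bar>c\<bar> ^ DIM('a))) (%x. f x))"
  using lborel_affine[OF c, of w] by simp
 also have "... = ennreal (\<bar>c\<bar> ^ DIM('a)) * (nn_integral lborel (%x. f (w + c *\<^sub>R x)))"
  by (simp add: nn_integral_density nn_integral_cmult nn_integral_distr)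
 finally show ?thesis .
qed

section \<open>Borel representatives and continuous approximation\<close>

lemma nn_integral_lebesgue_on:
 fixes f :: "'a::euclidean_space => ennreal"
 assumes "D \<in> sets borel" "f \<in> borel_measurable borel"
 shows "(nn_integral (lebesgue_on D) (%x. f x)) = (nn_integral lborel (%x. f x * indicator D x))"
proof -
 have "(nn_integral (lebesgue_on D) (%x. f x)) = (nn_integral lebesgue (%x. f x * indicator D x))"
  using assms by (subst nn_integral_restrict_space) auto
 also have "... = (nn_integral lborel (%x. f x * indicator D x))"
  by (rule nn_integral_completion)
 finally show ?thesis .
qed

lemma integral_lebesgue_on_lborel:
 fixes f :: "'a::euclidean_space => 'b::euclidean_space"
 assumes "D \<in> sets borel" "f \<in> borel_measurable borel"
 shows "integrable (lebesgue_on D) f \<longleftrightarrow> integrable lborel (%x. indicator D x *\<^sub>R f x)"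
  and "integral\<^sup>L (lebesgue_on D) f = (LBINT x. indicator D x *\<^sub>R f x)"
proof -
 have m: "(%x. indicator D x *\<^sub>R f x) \<in> borel_measurable lborel" using assms by simp
 show "integrable (lebesgue_on D) f \<longleftrightarrow> integrable lborel (%x. indicator D x *\<^sub>R f x)"
  using assms m by (simp add: integrable_restrict_space integrable_completion)
 show "integral\<^sup>L (lebesgue_on D) f = (LBINT x. indicator D x *\<^sub>R f x)"
  using assms m by (simp add: integral_restrict_space integral_completion)
qed

text \<open>A function measurable for the completed measure agrees almost everywhere with a Borel
  function; this is applied coordinate by coordinate and the result extended by zero. Convolutions
  are later formed with the Borel function over the whole space.\<close>

lemma sqint_borel_representative:
 fixes f :: "'a::euclidean_space => 'b::euclidean_space"
 assumes D: "D \<in> sets borel" and f: "sqint (lebesgue_on D) f"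
 obtains g where "g \<in> borel_measurable borel" "!!x. x \<notin> D ==> g x = 0"
  "AE x in lebesgue_on D. f x = g x" "sqint lborel g"
proof -
 have "(%x. if x \<in> D then f x else 0) \<in> borel_measurable lebesgue"
  using f D by (subst borel_measurable_if) (auto simp: sqint_def)
 then have "\<exists>g\<in>borel_measurable lborel. AE x in lborel. (if x \<in> D then f x else 0) \<bullet> b = g x" for b
  by (intro completion_ex_borel_measurable_real) auto
 then obtain G where G: "!!b. G b \<in> borel_measurable lborel"
  "!!b. AE x in lborel. (if x \<in> D then f x else 0) \<bullet> b = G b x" by metis
 have "\<exists>g. g \<in> borel_measurable lborel \<and> (AE x in lebesgue. (if x \<in> D then f x else 0) = g x)"
 proof (intro exI conjI)
  show "(%x. \<Sum>b\<in>Basis. G b x *\<^sub>R b) \<in> borel_measurable lborel"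
   using G(1) by (intro borel_measurable_sum borel_measurable_scaleR) auto
  have "AE x in lborel. \<forall>b\<in>Basis. (if x \<in> D then f x else 0) \<bullet> b = G b x"
   by (intro AE_finite_allI G(2)) simp
  then have "AE x in lborel. (if x \<in> D then f x else 0) = (\<Sum>b\<in>Basis. G b x *\<^sub>R b)"
  proof eventually_elim
   case (elim x)
   have "(if x \<in> D then f x else 0) = (\<Sum>b\<in>Basis. ((if x \<in> D then f x else 0) \<bullet> b) *\<^sub>R b)"
    by (rule euclidean_representation[symmetric])
   also have "... = (\<Sum>b\<in>Basis. G b x *\<^sub>R b)" using elim by (intro sum.cong) auto
   finally show ?case .
  qed
  then show "AE x in lebesgue. (if x \<in> D then f x else 0) = (\<Sum>b\<in>Basis. G b x *\<^sub>R b)"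
   by (rule AE_completion)
 qed
 then obtain g where g: "g \<in> borel_measurable lborel" "AE x in lebesgue. (if x \<in> D then f x else 0) = g x" by blast
 define h where "h x = indicator D x *\<^sub>R g x" for x
 have [measurable]: "g \<in> borel_measurable borel" "D \<in> sets borel" using g D by auto
 have h: "h \<in> borel_measurable borel" unfolding h_def by measurable
 have ae: "AE x in lebesgue_on D. f x = h x"
  using g(2) D by (subst AE_restrict_space_iff) (auto simp: h_def)
 have "integrable (lebesgue_on D) (%x. (norm (f x))^2)" using f by (auto simp: sqint_def)
 then have "integrable (lebesgue_on D) (%x. (norm (h x))^2)"
 proof (rule integrable_cong_AE_imp)
  have "(%x. (norm (h x))^2) \<in> borel_measurable lborel" using h by simp
  then show "(%x. (norm (h x))^2) \<in> borel_measurable (lebesgue_on D)"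
   by (intro measurable_restrict_space1 measurable_completion)
  show "AE x in lebesgue_on D. (norm (f x))^2 = (norm (h x))^2" using ae by eventually_elim simp
 qed
 then have "integrable lborel (%x. indicator D x *\<^sub>R (norm (h x))^2)"
  using D h by (subst (asm) integral_lebesgue_on_lborel(1)) auto
 moreover have "(%x. indicator D x *\<^sub>R (norm (h x))^2) = (%x. (norm (h x))^2)"
  by (auto simp: h_def indicator_def)
 ultimately have "sqint lborel h" using h by (simp add: sqint_def)
 with that[of h] h ae show thesis by (auto simp: h_def)
qed

text \<open>First f is truncated at level N, then the truncation is approximated almost everywhere
  by continuous functions. Truncating these as well makes dominated convergence applicable and gives
  the uniform bound on h.\<close>

lemma L2_continuous_approximation:
 fixes f :: "'a::euclidean_space => real"
 assumes D: "D \<in> sets borel" "bounded D" and f: "sqint lborel f" "!!x. x \<notin> D ==> f x = 0" and e: "e > 0"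
 obtains h B where "continuous_on UNIV h" "!!x. \<bar>h x\<bar> <= B" "(LBINT x. (f x - indicator D x * h x)^2) < e"
proof -
 have [measurable]: "f \<in> borel_measurable borel" "D \<in> sets borel" using f D by (auto simp: sqint_def)
 have fin: "emeasure lborel D < \<infinity>" using D(2) by (rule emeasure_bounded_finite)
 define cl where "cl N y = max (- real N) (min (real N) y)" for N y
 have clb: "\<bar>cl N y\<bar> <= real N" for N y by (auto simp: cl_def)
 have cl0: "cl N 0 = 0" for N by (auto simp: cl_def)
 have [measurable]: "cl N \<in> borel_measurable borel" for N unfolding cl_def by measurable
 have clc: "continuous_on UNIV (cl N)" for N unfolding cl_def by (intro continuous_intros)
 have clle: "\<bar>y - cl N y\<bar> <= \<bar>y\<bar>" for N y by (auto simp: cl_def)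
 have cllim: "(%N. cl N y) \<longlonglongrightarrow> y" for y
 proof (rule tendsto_eventually)
  obtain N0 where "\<bar>y\<bar> <= real N0" using real_arch_simple by blast
  then show "\<forall>\<^sub>F N in sequentially. cl N y = y"
   unfolding eventually_sequentially cl_def by (intro exI[of _ N0]) auto
 qed
 have "(%N. \<integral>x. (f x - cl N (f x))^2 \<partial>lborel) \<longlonglongrightarrow> (LINT x|(lborel :: 'a measure). 0)"
 proof (rule integral_dominated_convergence[where w = "%x. (f x)^2"])
  show "AE x in lborel. (%N. (f x - cl N (f x))^2) \<longlonglongrightarrow> 0"
  proof (rule AE_I2)
   fix x
   have "(%N. (f x - cl N (f x))^2) \<longlonglongrightarrow> (f x - f x)^2" by (intro tendsto_intros cllim)
   then show "(%N. (f x - cl N (f x))^2) \<longlonglongrightarrow> 0" by simp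
  qed
  show "AE x in lborel. norm ((f x - cl N (f x))^2) <= (f x)^2" for N
   using clle by (intro AE_I2) (simp add: abs_le_square_iff)
 qed (use f in \<open>auto simp: sqint_def\<close>)
 then have "\<forall>\<^sub>F N in sequentially. (LBINT x. (f x - cl N (f x))^2) < e / 4"
  by (rule order_tendstoD) (use e in auto)
 then obtain N where N: "(LBINT x. (f x - cl N (f x))^2) < e / 4" by (auto simp: eventually_sequentially)
 define fN where "fN x = cl N (f x)" for x
 have "fN \<in> borel_measurable lebesgue" unfolding fN_def by (intro measurable_completion) auto
 then have "fN measurable_on UNIV" by (simp add: measurable_on_iff_borel_measurable)
 then obtain Z g where Z: "negligible Z" and g: "!!n::nat. continuous_on UNIV (g n)"
  and lim: "!!x. x \<notin> Z ==> (%n. g n x) \<longlonglongrightarrow> fN x"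
  unfolding measurable_on_def by auto
 have [measurable]: "g n \<in> borel_measurable borel" for n using g by (rule borel_measurable_continuous_onI)
 have AEZ: "AE x in lborel. x \<notin> Z"
  using Z by (metis AE_completion_iff AE_not_in negligible_iff_null_sets)
 define k where "k n x = cl N (g n x)" for n x
 have "(%n. \<integral>x. (fN x - indicator D x * k n x)^2 \<partial>lborel) \<longlonglongrightarrow> (LINT x|(lborel :: 'a measure). 0)"
 proof (rule integral_dominated_convergence[where w = "%x. (2 * real N)^2 * indicator D x"])
  show "AE x in lborel. (%n. (fN x - indicator D x * k n x)^2) \<longlonglongrightarrow> 0"
   using AEZ
  proof eventually_elim
   case (elim x)
   have "(%n. cl N (g n x)) \<longlonglongrightarrow> cl N (fN x)"
    using clc lim[OF elim] by (metis continuous_on_tendsto_compose UNIV_I eventually_sequentiallyI)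
   moreover have "cl N (fN x) = fN x" by (auto simp: fN_def cl_def)
   ultimately have "(%n. (fN x - indicator D x * k n x)^2) \<longlonglongrightarrow> (fN x - indicator D x * fN x)^2"
    unfolding k_def by (intro tendsto_intros) simp
   moreover have "fN x - indicator D x * fN x = 0" using f(2)[of x] by (auto simp: fN_def cl0 indicator_def)
   ultimately show ?case by simp
  qed
  show "AE x in lborel. norm ((fN x - indicator D x * k n x)^2) <= (2 * real N)^2 * indicator D x" for n
  proof (rule AE_I2)
   fix x
   have "\<bar>fN x - k n x\<bar> <= \<bar>2 * real N\<bar>" using clb[of N "f x"] clb[of N "g n x"] by (simp add: fN_def k_def)
   then have "(fN x - k n x)^2 <= (2 * real N)^2" by (simp only: abs_le_square_iff)
   then show "norm ((fN x - indicator D x * k n x)^2) <= (2 * real N)^2 * indicator D x"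
    using f(2)[of x] by (auto simp: indicator_def fN_def cl0)
  qed
  show "integrable lborel (%x. (2 * real N)^2 * indicator D x)"
   using fin D by (intro integrable_mult_right integrable_real_indicator) auto
 qed (auto simp: fN_def k_def)
 then have "\<forall>\<^sub>F n in sequentially. (LBINT x. (fN x - indicator D x * k n x)^2) < e / 4"
  by (rule order_tendstoD) (use e in auto)
 then obtain n where n: "(LBINT x. (fN x - indicator D x * k n x)^2) < e / 4" by (auto simp: eventually_sequentially)
 have "sqint lborel (%x. fN x - indicator D x * k n x)" unfolding sqint_def
 proof
  show "integrable lborel (%x. (norm (fN x - indicator D x * k n x))^2)"
  proof (rule Bochner_Integration.integrable_bound)
   show "integrable lborel (%x. (2 * real N)^2 * indicator D x)"
    using fin D by (intro integrable_mult_right integrable_real_indicator) auto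
   show "AE x in lborel. norm ((norm (fN x - indicator D x * k n x))^2) <= norm ((2 * real N)^2 * indicator D x)"
   proof (rule AE_I2)
    fix x
    have "\<bar>fN x - k n x\<bar> <= \<bar>2 * real N\<bar>" using clb[of N "f x"] clb[of N "g n x"] by (simp add: fN_def k_def)
    then have "(fN x - k n x)^2 <= (2 * real N)^2" by (simp only: abs_le_square_iff)
    then show "norm ((norm (fN x - indicator D x * k n x))^2) <= norm ((2 * real N)^2 * indicator D x)"
     using f(2)[of x] by (auto simp: indicator_def fN_def cl0)
   qed
  qed (auto simp: fN_def k_def)
 qed (auto simp: fN_def k_def)
 moreover have "sqint lborel (%x. f x - fN x)" unfolding sqint_def
 proof
  show "integrable lborel (%x. (norm (f x - fN x))^2)"
  proof (rule Bochner_Integration.integrable_bound)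
   show "integrable lborel (%x. (norm (f x))^2)" using f by (auto simp: sqint_def)
   show "AE x in lborel. norm ((norm (f x - fN x))^2) <= norm ((norm (f x))^2)"
    using clle by (intro AE_I2) (simp add: abs_le_square_iff fN_def)
  qed (auto simp: fN_def)
 qed (auto simp: fN_def)
 ultimately have "(LBINT x. (norm ((f x - fN x) + (fN x - indicator D x * k n x)))^2)
  <= 2 * (LBINT x. (norm (f x - fN x))^2) + 2 * (LBINT x. (norm (fN x - indicator D x * k n x))^2)"
  by (intro l2n_add_le)
 then have "(LBINT x. (f x - indicator D x * k n x)^2) < e" using N n by (simp add: fN_def)
 moreover have "continuous_on UNIV (k n)" unfolding k_def
  by (rule continuous_on_compose2[OF clc g]) auto
 moreover have "\<bar>k n x\<bar> <= real N" for x using clb by (simp add: k_def)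
 ultimately show thesis by (intro that[of "k n" "real N"])
qed

section \<open>Smooth functions and mollification\<close>

text \<open>The class C^k on the line, the counterpart of \<open>Ck\<close>: profiles built in one
  variable become smooth functions on the plane by composition with affine functionals.\<close>

primrec dk :: "nat => (real => real) => bool" where
 "dk 0 f = continuous_on UNIV f"
| "dk (Suc k) f = (\<exists>f'. (\<forall>x. (f has_real_derivative f' x) (at x)) \<and> dk k f')"

lemma dk_mono: "dk (Suc k) f ==> dk k f"
proof (induction k arbitrary: f)
 case 0
 then obtain f' where "!!x. (f has_real_derivative f' x) (at x)" by auto
 then show ?case by (auto intro!: continuous_at_imp_continuous_on DERIV_isCont)
next
 case (Suc k)
 then show ?case by (metis dk.simps(2))
qed

lemma dk_const: "dk k (%x. c)"
proof (induction k arbitrary: c)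
 case (Suc k)
 show ?case using Suc[of 0] by (auto intro!: exI[of _ "%x. 0"] derivative_eq_intros)
qed simp

lemma dk_add: "dk k f ==> dk k g ==> dk k (%x. f x + g x)"
proof (induction k arbitrary: f g)
 case 0
 then show ?case by (auto intro: continuous_intros)
next
 case (Suc k)
 then obtain f' g' where fg: "!!x. (f has_real_derivative f' x) (at x)" "dk k f'"
  "!!x. (g has_real_derivative g' x) (at x)" "dk k g'" by auto
 then show ?case using Suc.IH[OF fg(2,4)]
  by (auto intro!: exI[of _ "%x. f' x + g' x"] DERIV_add)
qed

lemma dk_mult: "dk k f ==> dk k g ==> dk k (%x. f x * g x)"
proof (induction k arbitrary: f g)
 case 0
 then show ?case by (auto intro: continuous_intros)
next
 case (Suc k)
 then obtain f' g' where fg: "!!x. (f has_real_derivative f' x) (at x)" "dk k f'"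
  "!!x. (g has_real_derivative g' x) (at x)" "dk k g'" by auto
 have "dk k f" "dk k g" using Suc.prems dk_mono by blast+
 then have "dk k (%x. f' x * g x + g' x * f x)" using Suc.IH fg(2,4) dk_add by blast
 moreover have "((%x. f x * g x) has_real_derivative f' x * g x + g' x * f x) (at x)" for x
  by (rule DERIV_mult[OF fg(1,3)])
 ultimately show ?case unfolding dk.simps by (intro exI[of _ "%x. f' x * g x + g' x * f x"]) blast
qed

lemma dk_affine: "dk k f ==> dk k (%x. f (c * x + d))"
proof (induction k arbitrary: f)
 case 0
 then show ?case by (auto intro!: continuous_on_compose2[of UNIV f] continuous_intros)
next
 case (Suc k)
 then obtain f' where f: "!!x. (f has_real_derivative f' x) (at x)" "dk k f'" by auto
 have "((%x. f (c * x + d)) has_real_derivative f' (c * x + d) * c) (at x)" for x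
 proof (rule DERIV_chain2[OF f(1)])
  show "((%x. c * x + d) has_real_derivative c) (at x)" by (auto intro!: derivative_eq_intros)
 qed
 moreover have "dk k (%x. f' (c * x + d) * c)" using dk_mult Suc.IH[OF f(2)] dk_const by blast
 ultimately show ?case unfolding dk.simps by (intro exI[of _ "%x. f' (c * x + d) * c"]) blast
qed

definition smooth1 :: "(real => real) => bool" where "smooth1 f \<longleftrightarrow> (\<forall>k. dk k f)"

lemma smooth1_antiderivative:
 assumes "smooth1 f'" "!!x. (f has_real_derivative f' x) (at x)" shows "smooth1 f"
 unfolding smooth1_def
proof
 fix k
 have "dk (Suc k) f" using assms by (auto simp: smooth1_def)
 then show "dk k f" by (rule dk_mono)
qed

text \<open>The functions $P(1/u)\,e^{-1/u}$ for $u > 0$, extended by zero, form a class that is closed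
 under differentiation.\<close>

definition flat_exp :: "real poly => real => real" where
 "flat_exp P u = (if u > 0 then poly P (1 / u) * exp (- (1 / u)) else 0)"

lemma poly_times_exp_neg_tendsto_0: "((%y. poly P y * exp (- y)) \<longlongrightarrow> (0::real)) at_top"
proof -
 have "((%y::real. \<Sum>i\<le>degree P. coeff P i * (y ^ i / exp y)) \<longlongrightarrow> (\<Sum>i\<le>degree P. coeff P i * 0)) at_top"
  by (intro tendsto_sum tendsto_mult tendsto_const tendsto_power_div_exp_0)
 moreover have "(\<Sum>i\<le>degree P. coeff P i * (y ^ i / exp y)) = poly P y * exp (- y)" for y
  by (simp add: poly_altdef sum_distrib_right exp_minus divide_inverse mult.assoc)
 ultimately show ?thesis by simp
qed

lemma flat_exp_tendsto_0: "(flat_exp P \<longlongrightarrow> 0) (at 0)"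
proof -
 have "((%u. poly P (inverse u) * exp (- inverse u)) \<longlongrightarrow> (0::real)) (at_right 0)"
  using filterlim_compose[OF poly_times_exp_neg_tendsto_0 filterlim_inverse_at_top_right] .
 then have "(flat_exp P \<longlongrightarrow> 0) (at_right 0)"
  by (rule Lim_transform_eventually)
   (auto simp: eventually_at_right_less flat_exp_def inverse_eq_divide intro!: eventually_mono[OF eventually_at_right_less[of 0]])
 moreover have "(flat_exp P \<longlongrightarrow> 0) (at_left 0)"
  by (rule tendsto_eventually) (auto simp: flat_exp_def eventually_at_filter)
 ultimately show ?thesis by (simp add: filterlim_split_at)
qed

text \<open>With y = 1/u the chain rule produces the factor y^2 and the polynomial P - P'.\<close>

lemma flat_exp_derivative:
 "(flat_exp P has_real_derivative flat_exp ([:0, 0, 1:] * (P - pderiv P)) u) (at u)"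
proof -
 consider "u > 0" | "u < 0" | "u = 0" by linarith
 then show ?thesis
 proof cases
  case 1
  have "((%u. poly P (1 / u) * exp (- (1 / u))) has_real_derivative
    (poly (pderiv P) (1 / u) * (- (1 / u^2))) * exp (- (1 / u)) + (exp (- (1 / u)) * (1 / u^2)) * poly P (1 / u)) (at u)"
  proof (rule DERIV_mult)
   have i: "((%u. 1 / u) has_real_derivative - (1 / u^2)) (at u)"
    using 1 by (auto intro!: derivative_eq_intros simp: power2_eq_square)
   show "((%u. poly P (1 / u)) has_real_derivative poly (pderiv P) (1 / u) * (- (1 / u^2))) (at u)"
    by (rule DERIV_chain2[OF poly_DERIV i])
   have "((%u. - (1 / u)) has_real_derivative 1 / u^2) (at u)" using DERIV_minus[OF i] by simp
   then show "((%u. exp (- (1 / u))) has_real_derivative exp (- (1 / u)) * (1 / u^2)) (at u)"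
    by (rule DERIV_chain2[OF DERIV_exp])
  qed
  moreover have "poly (pderiv P) (1 / u) * (- (1 / u^2)) * exp (- (1 / u)) + exp (- (1 / u)) * (1 / u^2) * poly P (1 / u)
    = flat_exp ([:0, 0, 1:] * (P - pderiv P)) u"
   using 1 by (simp add: flat_exp_def power2_eq_square algebra_simps)
  ultimately have "((%u. poly P (1 / u) * exp (- (1 / u))) has_real_derivative flat_exp ([:0, 0, 1:] * (P - pderiv P)) u) (at u)"
   by simp
  then show ?thesis
   by (rule has_field_derivative_transform_within_open[where S = "{0<..}"]) (use 1 in \<open>auto simp: flat_exp_def\<close>)
 next
  case 2
  have "((%u. 0) has_real_derivative 0) (at u)" by simp
  then have "(flat_exp P has_real_derivative 0) (at u)"
   by (rule has_field_derivative_transform_within_open[where S = "{..<0}"]) (use 2 in \<open>auto simp: flat_exp_def\<close>)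
  then show ?thesis using 2 by (simp add: flat_exp_def)
 next
  case 3
  have "((%h. (flat_exp P (0 + h) - flat_exp P 0) / h) \<longlongrightarrow> 0) (at 0)"
  \<comment> \<open>At zero the difference quotient stays in the class: dividing by h multiplies the
    polynomial by its variable, whose value is 1/h.\<close>
  proof (rule Lim_transform_eventually[OF flat_exp_tendsto_0[of "[:0, 1:] * P"]])
   show "\<forall>\<^sub>F h in at 0. flat_exp ([:0, 1:] * P) h = (flat_exp P (0 + h) - flat_exp P 0) / h"
    by (auto simp: flat_exp_def eventually_at_filter)
  qed
  then show ?thesis unfolding 3 DERIV_def by (simp add: flat_exp_def)
 qed
qed

lemma smooth1_flat_exp: "smooth1 (flat_exp P)"
 unfolding smooth1_def
proof
 fix k show "dk k (flat_exp P)"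
 proof (induction k arbitrary: P)
  case 0
  have "isCont (flat_exp P) x" for x using DERIV_isCont[OF flat_exp_derivative] .
  then show ?case by (simp add: continuous_at_imp_continuous_on)
 next
  case (Suc k)
  then show ?case using flat_exp_derivative by (auto intro!: exI[of _ "flat_exp ([:0, 0, 1:] * (P - pderiv P))"])
 qed
qed

text \<open>The product of exp (-1/u) and its mirror image about 1/2, normalized to mass one. The
  antiderivative is kept because it yields a kernel whose derivative in one coordinate is the
  mollifier.\<close>

lemma bump_exists:
 obtains a A :: "real => real"
 where "smooth1 a" "smooth1 A" "!!x. (A has_real_derivative a x) (at x)" "!!x. 0 <= a x"
  "!!x. x <= 0 ==> a x = 0" "!!x. x \<ge> 1 ==> a x = 0" "!!x. x <= 0 ==> A x = 0"
  "(nn_integral lborel (%x. ennreal (a x))) = 1"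
proof -
 define b where "b u = flat_exp 1 u * flat_exp 1 (1 - u)" for u
 have sb: "smooth1 b"
 proof -
  have "dk k (%u. flat_exp 1 ((-1) * u + 1))" for k
   using smooth1_flat_exp by (intro dk_affine) (auto simp: smooth1_def)
  then show ?thesis using smooth1_flat_exp[of 1] by (auto simp: smooth1_def b_def[abs_def] intro!: dk_mult)
 qed
 have b0: "0 <= b x" "x <= 0 ==> b x = 0" "x \<ge> 1 ==> b x = 0" "0 < x ==> x < 1 ==> 0 < b x" for x
  by (auto simp: b_def flat_exp_def)
 have "dk 0 b" using sb by (simp only: smooth1_def)
 then have cb: "continuous_on S b" for S by (auto intro: continuous_on_subset)
 \<comment> \<open>Starting the integral at -1 keeps every x >= 0 in the interior of the interval
   from -1 to x + 1; to the left of 0 both functions vanish.\<close>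
 define B where "B u = integral {-1..u} b" for u
 have Bneg: "B u = 0" if "u <= 0" for u
 proof -
  have "B u = integral {-1..u} (%x. 0)" unfolding B_def by (rule integral_cong) (use that b0 in auto)
  then show ?thesis by simp
 qed
 have dB: "(B has_real_derivative b x) (at x)" for x
 proof (cases "x < 0")
  case True
  have "((%u. 0) has_real_derivative 0) (at x)" by simp
  then have "(B has_real_derivative 0) (at x)"
   by (rule has_field_derivative_transform_within_open[where S = "{..<0}"]) (use True Bneg in auto)
  then show ?thesis using True b0 by simp
 next
  case False
  have "(B has_real_derivative b x) (at x within {-1..x + 1})"
   unfolding B_def by (rule integral_has_real_derivative[OF cb]) (use False in auto)
  moreover have "at x within {-1..x + 1} = at x" by (rule at_within_interior) (use False in simp)
  ultimately show ?thesis by simp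
 qed
 define c where "c = integral {-1..1} b"
 have hI: "(b has_integral c) {-1..1}" unfolding c_def by (intro integrable_integral integrable_continuous_interval cb)
 have c: "c > 0"
 proof -
  have "c ~= 0"
  proof
   assume "c = 0"
   then have "integral {-1..1} b = 0" by (simp add: c_def)
   then have "\<forall>x\<in>{-1..1}. b x = 0" using integral_eq_0_iff[of "-1" 1 b] cb b0(1) by simp
   then have "b (1/2) = 0" by simp
   then show False using b0(4)[of "1/2"] by simp
  qed
  moreover have "c \<ge> 0" unfolding c_def by (rule Henstock_Kurzweil_Integration.integral_nonneg) (use hI b0(1) in auto)
  ultimately show ?thesis by simp
 qed
 have [measurable]: "b \<in> borel_measurable borel" using cb by (intro borel_measurable_continuous_onI)
 have "(b has_integral c) UNIV"
 proof -
  have "((%x. if x \<in> {-1..1} then b x else 0) has_integral c) UNIV" using hI by (simp only: has_integral_restrict_UNIV)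
  moreover have "(%x. if x \<in> {-1..1} then b x else 0) = b" using b0 by (auto simp: fun_eq_iff)
  ultimately show ?thesis by simp
 qed
 then have nb: "(nn_integral lborel (%x. ennreal (b x))) = ennreal c"
  by (intro nn_integral_has_integral_lborel) (use b0 in auto)
 show thesis
 proof (rule that[of "%x. b x * inverse c" "%x. B x * inverse c"])
  show "smooth1 (%x. b x * inverse c)" using sb by (auto simp: smooth1_def intro!: dk_mult dk_const)
  moreover have "smooth1 B" by (rule smooth1_antiderivative[OF sb dB])
  then show "smooth1 (%x. B x * inverse c)" by (auto simp: smooth1_def intro!: dk_mult dk_const)
  show "((%x. B x * inverse c) has_real_derivative b x * inverse c) (at x)" for x
   by (rule DERIV_cmult_right[OF dB])
  show "(nn_integral lborel (%x. ennreal (b x * inverse c))) = 1"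
   using c b0(1) nb by (simp add: ennreal_mult nn_integral_multc) (simp flip: ennreal_mult)
 qed (use b0 Bneg c in auto)
qed

section \<open>Calculus of smooth functions of two variables\<close>

lemma partial_eq: "(f has_derivative f') (at x) ==> partial i f x = f' (axis i 1)"
 unfolding partial_def by (metis frechet_derivative_at)

lemma has_derivative_grad:
 assumes "f differentiable (at x)"
 shows "(f has_derivative (%h. grad f x \<bullet> h)) (at x)"
proof -
 define f' where "f' = frechet_derivative f (at x)"
 have f': "(f has_derivative f') (at x)" using assms unfolding f'_def by (simp add: frechet_derivative_works)
 have lin: "linear f'" using f' by (rule has_derivative_linear)
 have "f' h = grad f x \<bullet> h" for h
 proof -
  have h: "h = h $ 1 *\<^sub>R axis 1 1 + h $ 2 *\<^sub>R axis 2 1" by (simp add: vec_eq_iff forall_2 axis_def)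
  have "f' h = h $ 1 * f' (axis 1 1) + h $ 2 * f' (axis 2 1)"
   using lin by (subst h) (simp only: linear_add linear_scale real_scaleR_def)
  then show ?thesis by (simp add: grad_def partial_def f'_def inner_vec_def sum_2)
 qed
 then have "f' = (%h. grad f x \<bullet> h)" by auto
 then show ?thesis using f' by simp
qed

lemma Ck_mono: "Ck (Suc k) f ==> Ck k f"
proof (induction k arbitrary: f)
 case 0
 then show ?case by (auto intro!: continuous_at_imp_continuous_on differentiable_imp_continuous_within)
next
 case (Suc k)
 then show ?case by (metis Ck.simps(2))
qed

lemma Ck_const: "Ck k (%x. c)"
proof (induction k arbitrary: c)
 case (Suc k)
 have "partial i (%x. c) = (%x. 0)" for i by (auto simp: partial_def)
 then show ?case using Suc[of 0] by simp
qed simp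

lemma Ck_add: "Ck k f ==> Ck k g ==> Ck k (%x. f x + g x)"
proof (induction k arbitrary: f g)
 case 0
 then show ?case by (auto intro: continuous_intros)
next
 case (Suc k)
 have "partial i (%x. f x + g x) = (%x. partial i f x + partial i g x)" for i
 proof
  fix x
  have "((%x. f x + g x) has_derivative (%h. grad f x \<bullet> h + grad g x \<bullet> h)) (at x)"
   using Suc.prems by (intro has_derivative_add has_derivative_grad) auto
  from partial_eq[OF this] show "partial i (%x. f x + g x) x = partial i f x + partial i g x"
   by (simp add: inner_axis grad_def)
 qed
 then show ?case using Suc by auto
qed

lemma partial_mult:
 assumes "f differentiable (at x)" "g differentiable (at x)"
 shows "partial i (%x. f x * g x) x = f x * partial i g x + g x * partial i f x"
proof -
 have "((%x. f x * g x) has_derivative (%h. f x * (grad g x \<bullet> h) + (grad f x \<bullet> h) * g x)) (at x)"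
  by (rule has_derivative_mult[OF has_derivative_grad[OF assms(1)] has_derivative_grad[OF assms(2)]])
 from partial_eq[OF this] show ?thesis by (simp add: inner_axis grad_def)
qed

lemma Ck_mult: "Ck k f ==> Ck k g ==> Ck k (%x. f x * g x)"
proof (induction k arbitrary: f g)
 case 0
 then show ?case by (auto intro: continuous_intros)
next
 case (Suc k)
 have "partial i (%x. f x * g x) = (%x. f x * partial i g x + g x * partial i f x)" for i
  using Suc.prems partial_mult by auto
 moreover have "Ck k f" "Ck k g" using Suc.prems Ck_mono by blast+
 ultimately show ?case using Suc by (auto intro!: Ck_add)
qed

lemma Ck_comp1: "dk k h ==> Ck k (%x. h (u \<bullet> x + c))"
proof (induction k arbitrary: h)
 case 0
 then show ?case by (auto intro!: continuous_on_compose2[of UNIV h] continuous_intros)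
next
 case (Suc k)
 then obtain h' where h: "!!x. (h has_real_derivative h' x) (at x)" "dk k h'" by auto
 have d: "((%x. h (u \<bullet> x + c)) has_derivative (%y. h' (u \<bullet> x + c) * (u \<bullet> y))) (at x)" for x
 proof -
  have "((%x. u \<bullet> x + c) has_derivative (%y. u \<bullet> y)) (at x)" by (auto intro!: derivative_eq_intros)
  from has_derivative_compose[OF this h(1)[unfolded has_field_derivative_def]]
  show ?thesis by simp
 qed
 have "partial i (%x. h (u \<bullet> x + c)) = (%x. h' (u \<bullet> x + c) * (u \<bullet> axis i 1))" for i
  using partial_eq[OF d] by auto
 then show ?case using d Suc.IH[OF h(2)] Ck_mult Ck_const by (auto simp: differentiable_def)
qed

lemma partial_comp1:
 assumes "!!x. (h has_real_derivative h' x) (at x)"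
 shows "partial i (%x. h (u \<bullet> x + c)) x = h' (u \<bullet> x + c) * u $ i"
proof -
 have "((%x. u \<bullet> x + c) has_derivative (%y. u \<bullet> y)) (at x)" by (auto intro!: derivative_eq_intros)
 from has_derivative_compose[OF this assms[unfolded has_field_derivative_def]]
 have "((%x. h (u \<bullet> x + c)) has_derivative (%y. h' (u \<bullet> x + c) * (u \<bullet> y))) (at x)" by simp
 from partial_eq[OF this] show ?thesis by (simp add: inner_axis)
qed

lemma partial_affine:
 assumes "f differentiable (at (c *\<^sub>R x + w))"
 shows "partial i (%x. f (c *\<^sub>R x + w)) x = c * partial i f (c *\<^sub>R x + w)"
  and "(%x. f (c *\<^sub>R x + w)) differentiable (at x)"
proof -
 have "((%x. c *\<^sub>R x + w) has_derivative (%y. c *\<^sub>R y)) (at x)" by (auto intro!: derivative_eq_intros)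
 from has_derivative_compose[OF this has_derivative_grad[OF assms]]
 have d: "((%x. f (c *\<^sub>R x + w)) has_derivative (%y. grad f (c *\<^sub>R x + w) \<bullet> (c *\<^sub>R y))) (at x)" .
 show "partial i (%x. f (c *\<^sub>R x + w)) x = c * partial i f (c *\<^sub>R x + w)"
  using partial_eq[OF d] by (simp add: inner_axis grad_def)
 show "(%x. f (c *\<^sub>R x + w)) differentiable (at x)" using d by (auto simp: differentiable_def)
qed

lemma Ck_affine: "Ck k f ==> Ck k (%x. f (c *\<^sub>R x + w))"
proof (induction k arbitrary: f)
 case 0
 then show ?case by (auto intro!: continuous_on_compose2[of UNIV f] continuous_intros)
next
 case (Suc k)
 have "partial i (%x. f (c *\<^sub>R x + w)) = (%x. c * partial i f (c *\<^sub>R x + w))" for i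
  using Suc.prems partial_affine(1) by auto
 then show ?case using Suc partial_affine(2) Ck_mult Ck_const by auto
qed

lemma smooth_Ck: "smooth f ==> Ck k f" by (simp add: smooth_def)
lemma smooth_differentiable: "smooth f ==> f differentiable (at x)" using smooth_Ck[of f 1] by auto
lemma smooth_partial: "smooth f ==> smooth (partial i f)" unfolding smooth_def by (metis Ck.simps(2))
lemma smooth_continuous: "smooth f ==> continuous_on S f"
 using smooth_Ck[of f 0] by (auto intro: continuous_on_subset)
lemma smooth_const: "smooth (%x. c)" by (simp add: smooth_def Ck_const)
lemma smooth_add: "smooth f ==> smooth g ==> smooth (%x. f x + g x)" by (simp add: smooth_def Ck_add)
lemma smooth_mult: "smooth f ==> smooth g ==> smooth (%x. f x * g x)" by (simp add: smooth_def Ck_mult)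
lemma smooth_affine: "smooth f ==> smooth (%x. f (c *\<^sub>R x + w))" by (simp add: smooth_def Ck_affine)
lemma smooth_comp1: "smooth1 h ==> smooth (%x. h (u \<bullet> x + c))" by (simp add: smooth_def smooth1_def Ck_comp1)
lemma DERIV_along_line:
 assumes "smooth f"
 shows "((%t. f (x + t *\<^sub>R v)) has_real_derivative grad f (x + t *\<^sub>R v) \<bullet> v) (at t)"
proof -
 have "((%s. x + s *\<^sub>R v) has_derivative (%s. s *\<^sub>R v)) (at t)" by (auto intro!: derivative_eq_intros)
 from has_derivative_compose[OF this has_derivative_grad[OF smooth_differentiable[OF assms]]]
 show ?thesis unfolding has_field_derivative_def by (simp add: mult_commute_abs)
qed

lemma grad_continuous: "smooth f ==> continuous_on S (grad f)"
 unfolding grad_def[abs_def] by (intro continuous_on_vec_lambda) (auto intro: smooth_continuous smooth_partial)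

lemma partial_add: "smooth f ==> smooth g ==> partial i (%x. f x + g x) x = partial i f x + partial i g x"
proof -
 assume "smooth f" "smooth g"
 then have "((%x. f x + g x) has_derivative (%h. grad f x \<bullet> h + grad g x \<bullet> h)) (at x)"
  by (intro has_derivative_add has_derivative_grad smooth_differentiable)
 from partial_eq[OF this] show ?thesis by (simp add: inner_axis grad_def)
qed

lemma partial_cmult: "smooth f ==> partial i (%x. c * f x) x = c * partial i f x"
 using partial_mult[of "%x. c" x f i] smooth_differentiable by (simp add: partial_def)

definition is_bump :: "(real => real) => (real => real) => bool" where
 "is_bump a A \<longleftrightarrow> smooth1 a \<and> smooth1 A \<and> (\<forall>x. (A has_real_derivative a x) (at x)) \<and> (\<forall>x. 0 <= a x) \<and>
  (\<forall>x\<le>0. a x = 0) \<and> (\<forall>x\<ge>1. a x = 0) \<and> (\<forall>x\<le>0. A x = 0) \<and> (nn_integral lborel (%x. ennreal (a x))) = 1"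

text \<open>Chosen as a pair, so that \<open>bump_int\<close> is an antiderivative of this very
  \<open>bump\<close>.\<close>

definition bump_pair :: "(real => real) \<times> (real => real)" where
 "bump_pair = (SOME p. is_bump (fst p) (snd p))"

definition bump :: "real => real" where "bump = fst bump_pair"
definition bump_int :: "real => real" where "bump_int = snd bump_pair"

lemma is_bump: "is_bump bump bump_int"
proof -
 have "\<exists>a A. is_bump a A" using bump_exists unfolding is_bump_def by metis
 then have "\<exists>p. is_bump (fst p) (snd p)" by auto
 then show ?thesis unfolding bump_def bump_int_def bump_pair_def by (rule someI_ex)
qed

lemma bump_nonneg: "0 <= bump x" and bump_smooth: "smooth1 bump" and bump_int_smooth: "smooth1 bump_int"
 and bump_int_deriv: "(bump_int has_real_derivative bump x) (at x)"
 and bump_le_0: "x <= 0 ==> bump x = 0" and bump_ge_1: "x \<ge> 1 ==> bump x = 0"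
 and bump_int_le_0: "x <= 0 ==> bump_int x = 0"
 and bump_nn_integral: "(nn_integral lborel (%x. ennreal (bump x))) = 1"
 using is_bump by (auto simp: is_bump_def)

lemma bump_measurable[measurable]: "bump \<in> borel_measurable borel"
proof -
 have "dk 0 bump" using bump_smooth by (simp only: smooth1_def)
 then show ?thesis by (auto intro: borel_measurable_continuous_onI)
qed

text \<open>A mollifier of mass one supported in the square [0, \<mu>]^2. Its product form gives an
  explicit antiderivative in the first coordinate that vanishes to the left of the support.\<close>

definition eta :: "real => real^2 => real" where
 "eta \<mu> z = bump (z $ 1 / \<mu>) / \<mu> * (bump (z $ 2 / \<mu>) / \<mu>)"

text \<open>The antiderivative of the mollifier \<open>eta\<close> in the first coordinate.\<close>

definition etaH :: "real => real^2 => real" where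
 "etaH \<mu> z = bump_int (z $ 1 / \<mu>) * (bump (z $ 2 / \<mu>) / \<mu>)"

lemma axis_scaled_inner: "(inverse \<mu> *\<^sub>R axis i 1) \<bullet> (z :: real^2) + 0 = z $ i / \<mu>"
 by (simp add: inner_axis' divide_inverse)

lemma smooth_coord: "smooth1 h ==> smooth (%z. h (z $ i / \<mu>))"
 using smooth_comp1[of h "inverse \<mu> *\<^sub>R axis i 1" 0] unfolding axis_scaled_inner .

lemma smooth_eta: "smooth (eta \<mu>)"
proof -
 have "smooth (%z. (bump (z $ 1 / \<mu>) * inverse \<mu>) * (bump (z $ 2 / \<mu>) * inverse \<mu>))"
  by (intro smooth_mult smooth_const smooth_coord bump_smooth)
 then show ?thesis by (simp add: eta_def[abs_def] divide_inverse)
qed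

lemma smooth_etaH: "smooth (etaH \<mu>)"
proof -
 have "smooth (%z. bump_int (z $ 1 / \<mu>) * (bump (z $ 2 / \<mu>) * inverse \<mu>))"
  by (intro smooth_mult smooth_const smooth_coord bump_smooth bump_int_smooth)
 then show ?thesis by (simp add: etaH_def[abs_def] divide_inverse)
qed

lemma partial_etaH: "partial 1 (etaH \<mu>) = eta \<mu>"
proof
 fix z
 obtain b' where b': "!!x. (bump has_real_derivative b' x) (at x)"
  using bump_smooth unfolding smooth1_def by (metis dk.simps(2))
 have "partial 1 (%z. bump_int (z $ 1 / \<mu>)) z = bump (z $ 1 / \<mu>) * inverse \<mu>"
  using partial_comp1[OF bump_int_deriv, of 1 "inverse \<mu> *\<^sub>R axis 1 1" 0 z] unfolding axis_scaled_inner by simp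
 moreover have "partial 1 (%z. bump (z $ 2 / \<mu>) * inverse \<mu>) z = 0"
  using partial_comp1[where i = 1 and u = "inverse \<mu> *\<^sub>R axis 2 1" and c = 0 and x = z
   and h = "%x. bump x * inverse \<mu>" and h' = "%x. b' x * inverse \<mu>", OF DERIV_cmult_right[OF b']]
  unfolding axis_scaled_inner by (simp add: axis_def)
 moreover have d: "(%z. bump_int (z $ 1 / \<mu>)) differentiable (at z)" "(%z. bump (z $ 2 / \<mu>) * inverse \<mu>) differentiable (at z)"
  by (intro smooth_differentiable smooth_mult smooth_const smooth_coord bump_smooth bump_int_smooth)+
 ultimately have "partial 1 (%z. bump_int (z $ 1 / \<mu>) * (bump (z $ 2 / \<mu>) * inverse \<mu>)) z
   = (bump (z $ 2 / \<mu>) * inverse \<mu>) * (bump (z $ 1 / \<mu>) * inverse \<mu>)"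
  unfolding partial_mult[OF d] by simp
 then show "partial 1 (etaH \<mu>) z = eta \<mu> z" by (simp add: etaH_def[abs_def] eta_def divide_inverse mult.commute)
qed

lemma eta_measurable[measurable]: "eta \<mu> \<in> borel_measurable borel"
 by (intro borel_measurable_continuous_onI smooth_continuous smooth_eta)

lemma eta_nonneg: "\<mu> > 0 ==> 0 <= eta \<mu> z"
 by (simp add: eta_def bump_nonneg)

lemma eta_support:
 assumes "\<mu> > 0" "eta \<mu> z ~= 0" shows "norm z <= 2 * \<mu>"
proof -
 have "\<bar>z $ i\<bar> <= \<mu>" for i
 proof (rule ccontr)
  assume "\<not> \<bar>z $ i\<bar> <= \<mu>"
  then have "z $ i / \<mu> <= 0 \<or> z $ i / \<mu> \<ge> 1" using assms(1) by (auto simp: field_simps)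
  then have "bump (z $ i / \<mu>) = 0" using bump_le_0 bump_ge_1 by blast
  then have "eta \<mu> z = 0" using exhaust_2[of i] by (auto simp: eta_def)
  with assms show False by simp
 qed
 then have "(\<Sum>i\<in>UNIV. \<bar>z $ i\<bar>) <= (\<Sum>i\<in>(UNIV :: 2 set). \<mu>)" by (intro sum_mono)
 then show ?thesis using norm_le_l1_cart[of z] by simp
qed

lemma eta_nn_integral: assumes \<mu>: "\<mu> > 0" shows "(nn_integral lborel (%z. ennreal (eta \<mu> z))) = 1"
proof -
 have one: "(nn_integral lborel (%s. ennreal (bump (s / \<mu>) / \<mu>))) = 1"
 proof -
  have "1 = (nn_integral lborel (%x. ennreal (bump x)))" by (simp add: bump_nn_integral)
  also have "... = ennreal \<bar>inverse \<mu>\<bar> * (nn_integral lborel (%s. ennreal (bump (0 + inverse \<mu> * s))))"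
   using \<mu> by (intro nn_integral_real_affine) auto
  also have "... = (nn_integral lborel (%s. ennreal (inverse \<mu>) * ennreal (bump (s / \<mu>))))"
   using \<mu> by (subst nn_integral_cmult) (auto simp: divide_inverse mult.commute)
  also have "... = (nn_integral lborel (%s. ennreal (bump (s / \<mu>) / \<mu>)))"
   using \<mu> bump_nonneg by (auto simp: divide_inverse mult.commute simp flip: ennreal_mult intro!: nn_integral_cong)
  finally show ?thesis by simp
 qed
 have "(nn_integral lborel (%z. ennreal (eta \<mu> z))) = (nn_integral lborel (%s. nn_integral lborel (%t. ennreal (eta \<mu> (vector [s, t])))))"
  by (rule nn_integral_real2) measurable
 also have "... = (nn_integral lborel (%s. nn_integral lborel (%t. ennreal (bump (s / \<mu>) / \<mu>) * ennreal (bump (t / \<mu>) / \<mu>))))"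
 proof -
  have "ennreal (eta \<mu> (vector [s, t])) = ennreal (bump (s / \<mu>) / \<mu>) * ennreal (bump (t / \<mu>) / \<mu>)" for s t
   unfolding eta_def using \<mu> bump_nonneg by (subst ennreal_mult) auto
  then show ?thesis by (simp only:)
 qed
 also have "... = (nn_integral lborel (%s. ennreal (bump (s / \<mu>) / \<mu>) * 1))"
  by (simp add: nn_integral_cmult one)
 finally show ?thesis by (simp add: one)
qed

lemma eta_nn_integral_affine:
 assumes \<mu>: "\<mu> > 0" and c: "c ~= 0"
 shows "(nn_integral lborel (%y. ennreal (eta \<mu> (w + c *\<^sub>R y)))) = ennreal (1 / c^2)"
proof -
 let ?I = "nn_integral lborel (%y. ennreal (eta \<mu> (w + c *\<^sub>R y)))"
 have "1 = ennreal (\<bar>c\<bar> ^ DIM(real^2)) * ?I"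
  using nn_integral_lborel_affine[of "%z. ennreal (eta \<mu> z)" c w] eta_nn_integral[OF \<mu>] c by simp
 then have 1: "1 = ennreal (c^2) * ?I" by simp
 have "?I = ennreal (1 / c^2) * (ennreal (c^2) * ?I)"
  using c by (simp add: mult.assoc[symmetric] flip: ennreal_mult)
 then show ?thesis using 1 by simp
qed

lemma eta_integral_affine:
 assumes \<mu>: "\<mu> > 0" and c: "c ~= 0"
 shows "integrable lborel (%y. eta \<mu> (w + c *\<^sub>R y))" "(LBINT y. eta \<mu> (w + c *\<^sub>R y)) = 1 / c^2"
proof -
 show i: "integrable lborel (%y. eta \<mu> (w + c *\<^sub>R y))"
  by (rule integrableI_nonneg) (use eta_nn_integral_affine[OF assms] eta_nonneg[OF \<mu>] in auto)
 show "(LBINT y. eta \<mu> (w + c *\<^sub>R y)) = 1 / c^2"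
  using eta_nn_integral_affine[OF assms] eta_nonneg[OF \<mu>] by (subst integral_eq_nn_integral) auto
qed

lemma eta_integral_reflect:
 assumes "\<mu> > 0"
 shows "integrable lborel (%y. eta \<mu> (x - y))" "(LBINT y. eta \<mu> (x - y)) = 1"
 using eta_integral_affine[OF assms, of "-1" x] by simp_all

section \<open>Convolution with smooth kernels\<close>

definition conv :: "(real^2 => real) => (real^2 => real) => real^2 => real" where
 "conv f \<kappa> x = (LBINT y. f y * \<kappa> (x - y))"

lemma integral_weight_bound:
 fixes f g :: "real^2 => real"
 assumes f: "integrable lborel f" "!!y. y \<notin> cball 0 R ==> f y = 0" and g: "continuous_on UNIV g"
  and e: "!!y. y \<in> cball 0 R ==> \<bar>g y\<bar> <= e"
 shows "integrable lborel (%y. f y * g y)" "\<bar>\<integral>y. f y * g y \<partial>lborel\<bar> <= e * (LBINT y. \<bar>f y\<bar>)"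
proof -
 have [measurable]: "f \<in> borel_measurable borel" "g \<in> borel_measurable borel"
  using f(1) g by (auto intro: borel_measurable_continuous_onI)
 have le: "\<bar>f y * g y\<bar> <= e * \<bar>f y\<bar>" for y
 proof (cases "y \<in> cball 0 R")
  case True
  have "\<bar>g y\<bar> * \<bar>f y\<bar> <= e * \<bar>f y\<bar>" using e[OF True] by (intro mult_right_mono) auto
  then show ?thesis by (simp only: abs_mult mult.commute)
 qed (simp add: f(2))
 have i: "integrable lborel (%y. e * \<bar>f y\<bar>)" using f by simp
 show fg: "integrable lborel (%y. f y * g y)"
  by (rule Bochner_Integration.integrable_bound[OF i]) (use le in \<open>auto intro!: AE_I2 order_trans[OF le]\<close>)
 have "\<bar>\<integral>y. f y * g y \<partial>lborel\<bar> <= (LBINT y. \<bar>f y * g y\<bar>)" by (rule integral_abs_bound)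
 also have "... <= (LBINT y. e * \<bar>f y\<bar>)" using fg i le by (intro integral_mono) auto
 finally show "\<bar>\<integral>y. f y * g y \<partial>lborel\<bar> <= e * (LBINT y. \<bar>f y\<bar>)" by simp
qed

lemma conv_integrable:
 fixes f \<kappa> :: "real^2 => real"
 assumes f: "integrable lborel f" "!!y. y \<notin> cball 0 R ==> f y = 0" and g: "continuous_on UNIV \<kappa>"
 shows "integrable lborel (%y. f y * \<kappa> (x - y))"
proof -
 have c: "continuous_on UNIV (%y. \<kappa> (x - y))" by (intro continuous_on_compose2[OF g] continuous_intros) auto
 then have "compact ((%y. \<kappa> (x - y)) ` cball 0 R)"
  by (intro compact_continuous_image) (auto intro: continuous_on_subset)
 then obtain e where "!!y. y \<in> cball 0 R ==> \<bar>\<kappa> (x - y)\<bar> <= e"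
  using compact_imp_bounded bounded_iff by (metis (no_types, lifting) imageI real_norm_def)
 from integral_weight_bound(1)[OF f c this] show ?thesis .
qed

lemma conv_continuous:
 assumes f: "integrable lborel f" "!!y. y \<notin> cball 0 R ==> f y = 0" and g: "continuous_on UNIV \<kappa>"
 shows "continuous_on UNIV (conv f \<kappa>)"
 unfolding continuous_on_iff
proof (intro ballI allI impI)
 fix x :: "real^2" and e :: real assume e: "e > 0"
 define F where "F = (LBINT y. \<bar>f y\<bar>)"
 have F: "F \<ge> 0" unfolding F_def by (rule Bochner_Integration.integral_nonneg) simp
 define B where "B = cball (0 :: real^2) (norm x + \<bar>R\<bar> + 1)"
 have "uniformly_continuous_on B \<kappa>" unfolding B_def
  by (intro compact_uniformly_continuous continuous_on_subset[OF g]) auto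
 moreover have "e / (F + 1) > 0" using e F by simp
 ultimately obtain d where d: "d > 0" "!!a b. a \<in> B ==> b \<in> B ==> dist a b < d ==> dist (\<kappa> a) (\<kappa> b) < e / (F + 1)"
  unfolding uniformly_continuous_on_def by metis
 show "\<exists>d>0. \<forall>x'\<in>UNIV. dist x' x < d \<longrightarrow> dist (conv f \<kappa> x') (conv f \<kappa> x) < e"
 proof (intro exI[of _ "min d 1"] conjI ballI impI)
  fix x' assume x': "dist x' x < min d 1"
  have bound: "\<bar>\<kappa> (x' - y) - \<kappa> (x - y)\<bar> <= e / (F + 1)" if "y \<in> cball 0 R" for y
  proof -
   have y: "norm y <= \<bar>R\<bar>" using that by simp
   have "norm (x' - x) < min d 1" using x' by (simp add: dist_norm)
   moreover have "norm (x' - y) <= norm (x' - x) + norm x + norm y"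
    using norm_triangle_ineq4[of x' y] norm_triangle_ineq[of "x' - x" x] by simp
   ultimately have "x' - y \<in> B" using y by (simp add: B_def)
   moreover have "x - y \<in> B" using y norm_triangle_ineq4[of x y] by (simp add: B_def)
   moreover have "dist (x' - y) (x - y) < d" using x' by (simp add: dist_norm)
   ultimately show ?thesis using d(2) by (simp add: dist_real_def less_imp_le)
  qed
  have "conv f \<kappa> x' - conv f \<kappa> x = (LBINT y. f y * (\<kappa> (x' - y) - \<kappa> (x - y)))"
   using conv_integrable[OF f g, where x = x'] conv_integrable[OF f g, where x = x] unfolding conv_def
   by (simp add: right_diff_distrib)
  moreover have "\<bar>\<integral>y. f y * (\<kappa> (x' - y) - \<kappa> (x - y)) \<partial>lborel\<bar> <= e / (F + 1) * F"
   unfolding F_def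
  proof (rule integral_weight_bound(2)[where R = R])
   show "continuous_on UNIV (%y. \<kappa> (x' - y) - \<kappa> (x - y))"
    by (intro continuous_intros continuous_on_compose2[OF g]) auto
  qed (use f bound in \<open>auto simp: F_def\<close>)
  moreover have "e / (F + 1) * F < e" using e F by (simp add: field_simps)
  ultimately show "dist (conv f \<kappa> x') (conv f \<kappa> x) < e" by (simp add: dist_real_def)
 qed (use d in auto)
qed

text \<open>Differentiation under the integral sign. Since f vanishes off a ball, all relevant
  arguments x' - y stay in one compact ball, where the gradient of the kernel is uniformly
  continuous; this controls the linearization error uniformly in y.\<close>

lemma conv_has_derivative:
 assumes f: "integrable lborel f" "!!y. y \<notin> cball 0 R ==> f y = 0" and g: "Ck (Suc 0) \<kappa>"
 shows "(conv f \<kappa> has_derivative (%h. \<Sum>i\<in>UNIV. h $ i * conv f (partial i \<kappa>) x)) (at x)"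
 unfolding has_derivative_at_alt
proof (intro conjI allI impI)
 show "bounded_linear (%h :: real^2. \<Sum>i\<in>UNIV. h $ i * conv f (partial i \<kappa>) x)"
  by (intro bounded_linear_sum bounded_linear_mult_const bounded_linear_vec_nth)
 fix e :: real assume e: "e > 0"
 have cg: "continuous_on UNIV \<kappa>" using Ck_mono[OF g] by simp
 have cp: "continuous_on UNIV (partial i \<kappa>)" for i using g by simp
 have dg: "(\<kappa> has_derivative (%h. grad \<kappa> y \<bullet> h)) (at y)" for y
  using g by (intro has_derivative_grad) simp
 have cgrad: "continuous_on S (grad \<kappa>)" for S
  unfolding grad_def[abs_def] by (intro continuous_on_vec_lambda continuous_on_subset[OF cp]) auto
 define F where "F = (LBINT y. \<bar>f y\<bar>)"
 have F: "F \<ge> 0" unfolding F_def by (rule Bochner_Integration.integral_nonneg) simp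
 define B where "B = cball (0 :: real^2) (norm x + \<bar>R\<bar> + 1)"
 have "uniformly_continuous_on B (grad \<kappa>)" unfolding B_def
  by (intro compact_uniformly_continuous cgrad) auto
 moreover have "e / (F + 1) > 0" using e F by simp
 ultimately obtain d where d: "d > 0" "!!a b. a \<in> B ==> b \<in> B ==> dist a b < d ==> dist (grad \<kappa> a) (grad \<kappa> b) < e / (F + 1)"
  unfolding uniformly_continuous_on_def by metis
 show "\<exists>d>0. \<forall>x'. norm (x' - x) < d \<longrightarrow>
   norm (conv f \<kappa> x' - conv f \<kappa> x - (\<Sum>i\<in>UNIV. (x' - x) $ i * conv f (partial i \<kappa>) x)) <= e * norm (x' - x)"
 proof (intro exI[of _ "min d 1"] conjI allI impI)
  fix x' assume x': "norm (x' - x) < min d 1"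
  define h where "h = x' - x"
  have bound: "\<bar>\<kappa> (x' - y) - \<kappa> (x - y) - grad \<kappa> (x - y) \<bullet> h\<bar> <= norm h * (e / (F + 1))" if "y \<in> cball 0 R" for y
  proof -
   have y: "norm y <= \<bar>R\<bar>" using that by simp
   define S where "S = closed_segment (x - y) (x' - y)"
   have inS: "s \<in> B \<and> dist s (x - y) < d" if "s \<in> S" for s
   proof -
    have "norm (s - (x - y)) <= norm ((x' - y) - (x - y))"
     using that segment_bound(1)[of s "x - y" "x' - y"] by (simp add: S_def)
    then have n: "norm (s - (x - y)) < min d 1" using x' by simp
    moreover have "norm s <= norm (s - (x - y)) + norm x + norm y"
     using norm_triangle_ineq[of "s - (x - y)" "x - y"] norm_triangle_ineq4[of x y] by simp
    ultimately show ?thesis using y by (simp add: B_def dist_norm)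
   qed
   have "norm (\<kappa> (x' - y) - \<kappa> (x - y) - grad \<kappa> (x - y) \<bullet> ((x' - y) - (x - y))) <= norm ((x' - y) - (x - y)) * (e / (F + 1))"
   proof (rule differentiable_bound_linearization[where S = S and f' = "%s h. grad \<kappa> s \<bullet> h"])
    show "x - y + t *\<^sub>R ((x' - y) - (x - y)) \<in> S" if "t \<in> {0..1}" for t
     using that unfolding S_def by (auto simp: in_segment algebra_simps intro!: exI[of _ t])
    show "(\<kappa> has_derivative (\<bullet>) (grad \<kappa> s)) (at s within S)" for s
     using dg by (rule has_derivative_at_withinI)
    show "onorm ((\<bullet>) (grad \<kappa> s) - (\<bullet>) (grad \<kappa> (x - y))) <= e / (F + 1)" if s: "s \<in> S" for s
    proof (rule onorm_le)
     fix v :: "real^2"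
     have "x - y \<in> B" using inS[of "x - y"] by (simp add: S_def)
     then have "norm (grad \<kappa> s - grad \<kappa> (x - y)) <= e / (F + 1)" using d(2) inS[OF s] by (metis dist_norm less_imp_le)
     then have "norm (grad \<kappa> s - grad \<kappa> (x - y)) * norm v <= e / (F + 1) * norm v" by (rule mult_right_mono) simp
     then show "norm (((\<bullet>) (grad \<kappa> s) - (\<bullet>) (grad \<kappa> (x - y))) v) <= e / (F + 1) * norm v"
      using Cauchy_Schwarz_ineq2[of "grad \<kappa> s - grad \<kappa> (x - y)" v] by (simp add: inner_diff_left)
    qed
    show "x - y \<in> S" by (simp add: S_def)
   qed
   then show ?thesis by (simp add: h_def)
  qed
  have gh: "grad \<kappa> w \<bullet> h = (\<Sum>i\<in>UNIV. h $ i * partial i \<kappa> w)" for w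
   by (simp add: inner_vec_def grad_def mult.commute)
  have "(LBINT y. f y * (\<kappa> (x' - y) - \<kappa> (x - y) - grad \<kappa> (x - y) \<bullet> h))
    = (LBINT y. f y * \<kappa> (x' - y) - f y * \<kappa> (x - y) - (\<Sum>i\<in>UNIV. h $ i * (f y * partial i \<kappa> (x - y))))"
   unfolding gh by (intro Bochner_Integration.integral_cong refl) (simp add: right_diff_distrib sum_distrib_left mult.left_commute)
  also have "... = conv f \<kappa> x' - conv f \<kappa> x - (\<Sum>i\<in>UNIV. h $ i * conv f (partial i \<kappa>) x)"
   using conv_integrable[OF f cg, where x = x'] conv_integrable[OF f cg, where x = x] conv_integrable[OF f cp, where x = x] unfolding conv_def
   by (simp add: Bochner_Integration.integral_sum)
  finally have eq: "conv f \<kappa> x' - conv f \<kappa> x - (\<Sum>i\<in>UNIV. h $ i * conv f (partial i \<kappa>) x)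
   = (LBINT y. f y * (\<kappa> (x' - y) - \<kappa> (x - y) - grad \<kappa> (x - y) \<bullet> h))" by simp
  have "\<bar>\<integral>y. f y * (\<kappa> (x' - y) - \<kappa> (x - y) - grad \<kappa> (x - y) \<bullet> h) \<partial>lborel\<bar> <= (norm h * (e / (F + 1))) * F"
   unfolding F_def
  proof (rule integral_weight_bound(2)[where R = R])
   show "continuous_on UNIV (%y. \<kappa> (x' - y) - \<kappa> (x - y) - grad \<kappa> (x - y) \<bullet> h)"
    by (intro continuous_intros continuous_on_compose2[OF cg] continuous_on_compose2[OF cgrad[of UNIV]]) auto
  qed (use f bound in \<open>auto simp: F_def\<close>)
  also have "... = norm h * (e / (F + 1) * F)" by simp
  also have "... <= norm h * e" using e F by (intro mult_left_mono) (auto simp: field_simps)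
  finally show "norm (conv f \<kappa> x' - conv f \<kappa> x - (\<Sum>i\<in>UNIV. (x' - x) $ i * conv f (partial i \<kappa>) x)) <= e * norm (x' - x)"
   using eq by (simp add: h_def mult.commute)
 qed (use d in auto)
qed

lemma conv_partial:
 assumes f: "integrable lborel f" "!!y. y \<notin> cball 0 R ==> f y = 0" and g: "Ck (Suc 0) \<kappa>"
 shows "partial i (conv f \<kappa>) = conv f (partial i \<kappa>)"
proof
 fix x
 have "(\<Sum>j\<in>UNIV. axis i 1 $ j * conv f (partial j \<kappa>) x) = (\<Sum>j\<in>UNIV. if j = i then conv f (partial j \<kappa>) x else 0)"
  by (intro sum.cong) (auto simp: axis_def)
 then show "partial i (conv f \<kappa>) x = conv f (partial i \<kappa>) x"
  using partial_eq[OF conv_has_derivative[OF assms]] by simp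
qed

lemma Ck_conv:
 assumes f: "integrable lborel f" "!!y. y \<notin> cball 0 R ==> f y = 0"
 shows "Ck k \<kappa> ==> Ck k (conv f \<kappa>)"
proof (induction k arbitrary: \<kappa>)
 case 0
 then show ?case using conv_continuous[OF f] by simp
next
 case (Suc k)
 then have 1: "Ck (Suc 0) \<kappa>"
 proof -
  have "Ck 0 (partial i \<kappa>)" for i
  proof -
   have "Ck k (partial i \<kappa>)" using Suc.prems by simp
   then show ?thesis by (induction k) (auto dest: Ck_mono simp del: Ck.simps)
  qed
  then show ?thesis using Suc.prems by simp
 qed
 show ?case
  using Suc conv_has_derivative[OF f 1] conv_partial[OF f 1] by (auto simp: differentiable_def)
qed

lemma smooth_conv:
 assumes "integrable lborel f" "!!y. y \<notin> cball 0 R ==> f y = 0" "smooth \<kappa>"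
 shows "smooth (conv f \<kappa>)"
 using Ck_conv[OF assms(1,2)] assms(3) by (auto simp: smooth_def)

text \<open>Lowering w by \<delta>/2 makes room for the error of mollification: at scale \<delta> /
  (8 L) the values of w seen by the kernel differ by at most \<delta>/4. Hence v stays below w and
  vanishes where w < \<delta>/4, which later puts its support inside the open set in question. The
  factor 2 in the gradient bound comes from summing two partial derivatives, each at most L.\<close>

lemma lipschitz_smoothing:
 fixes w :: "real^2 => real"
 assumes L: "L > 0" "!!x y. \<bar>w x - w y\<bar> <= L * norm (x - y)" and w0: "!!x. 0 <= w x"
  and R: "!!x. x \<notin> cball 0 R ==> w x = 0" and \<delta>: "\<delta> > 0"
 obtains v where "smooth v" "!!x. 0 <= v x" "!!x. v x <= w x" "!!x. w x - \<delta> <= v x"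
  "!!x. norm (grad v x) <= 2 * L" "!!x. v x ~= 0 ==> w x \<ge> \<delta> / 4"
proof -
 define \<mu> where "\<mu> = \<delta> / (8 * L)"
 have \<mu>: "\<mu> > 0" using L \<delta> by (simp add: \<mu>_def)
 define u where "u x = max 0 (w x - \<delta> / 2)" for x
 have lip: "\<bar>u x - u y\<bar> <= L * norm (x - y)" for x y using L(2)[of x y] by (auto simp: u_def)
 have u0: "0 <= u x" "u x <= w x" for x using w0[of x] \<delta> by (auto simp: u_def)
 have uR: "u x = 0" if "x \<notin> cball 0 R" for x using R[OF that] \<delta> by (simp add: u_def)
 have cu: "continuous_on UNIV u"
 proof (rule lipschitz_on_continuous_on[of L])
  show "L-lipschitz_on UNIV u" using lip L(1) by (auto simp: lipschitz_on_def dist_norm)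
 qed
 have [measurable]: "u \<in> borel_measurable borel" using cu by (rule borel_measurable_continuous_onI)
 have ui: "integrable lborel u"
 proof -
  have "integrable lborel (%x. indicator (cball 0 R) x *\<^sub>R u x)"
   using borel_integrable_compact[of "cball 0 R" u] cu by (auto simp: continuous_on_subset set_integrable_def)
  moreover have "(%x. indicator (cball 0 R) x *\<^sub>R u x) = u" using uR by (auto simp: indicator_def fun_eq_iff)
  ultimately show ?thesis by simp
 qed
 define v where "v = conv u (eta \<mu>)"
 have sv: "smooth v" unfolding v_def by (rule smooth_conv[OF ui uR smooth_eta])
 have ce: "continuous_on UNIV (eta \<mu>)" by (intro smooth_continuous smooth_eta)
 have int: "integrable lborel (%y. u y * eta \<mu> (x - y))" for x
  by (rule conv_integrable[OF ui _ ce]) (rule uR)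
 have near: "w y <= w x + \<delta> / 4 \<and> w x <= w y + \<delta> / 4" if "eta \<mu> (x - y) ~= 0" for x y
 proof -
  have "\<bar>w x - w y\<bar> <= L * norm (x - y)" by (rule L)
  also have "... <= L * (2 * \<mu>)" using eta_support[OF \<mu> that] L(1) by (intro mult_left_mono) auto
  also have "... = \<delta> / 4" using L(1) by (simp add: \<mu>_def)
  finally show ?thesis by (simp only: abs_le_iff) linarith
 qed
 have upper: "v x <= c" if "!!y. eta \<mu> (x - y) ~= 0 ==> u y <= c" for x c
 proof -
  have "v x <= (LBINT y. c * eta \<mu> (x - y))" unfolding v_def conv_def
  proof (rule integral_mono[OF int])
   show "u y * eta \<mu> (x - y) <= c * eta \<mu> (x - y)" for y
    using that[of y] eta_nonneg[OF \<mu>, of "x - y"] by (cases "eta \<mu> (x - y) = 0") (auto intro: mult_right_mono)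
  qed (intro integrable_mult_right eta_integral_reflect[OF \<mu>])
  then show ?thesis using eta_integral_reflect[OF \<mu>] by simp
 qed
 have lower: "c <= v x" if "!!y. eta \<mu> (x - y) ~= 0 ==> c <= u y" for x c
 proof -
  have "(LBINT y. c * eta \<mu> (x - y)) <= v x" unfolding v_def conv_def
  proof (rule integral_mono[OF _ int])
   show "c * eta \<mu> (x - y) <= u y * eta \<mu> (x - y)" for y
    using that[of y] eta_nonneg[OF \<mu>, of "x - y"] by (cases "eta \<mu> (x - y) = 0") (auto intro: mult_right_mono)
  qed (intro integrable_mult_right eta_integral_reflect[OF \<mu>])
  then show ?thesis using eta_integral_reflect[OF \<mu>] by simp
 qed
 have v0: "0 <= v x" for x by (rule lower) (rule u0)
 have supp: "w x \<ge> \<delta> / 4" if "v x ~= 0" for x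
 proof (rule ccontr)
  assume a: "\<not> w x \<ge> \<delta> / 4"
  have "v x <= 0"
  proof (rule upper)
   fix y assume "eta \<mu> (x - y) ~= 0"
   from near[OF this] a have "w y - \<delta> / 2 <= 0" by linarith
   then show "u y <= 0" by (simp add: u_def)
  qed
  with v0[of x] that show False by simp
 qed
 have vw: "v x <= w x" for x
 proof (rule upper)
  fix y assume "eta \<mu> (x - y) ~= 0"
  from near[OF this] \<delta> have "w y - \<delta> / 2 <= w x" by linarith
  then show "u y <= w x" using w0[of x] by (simp add: u_def)
 qed
 have wv: "w x - \<delta> <= v x" for x
 proof (rule lower)
  fix y assume "eta \<mu> (x - y) ~= 0"
  from near[OF this] have "w x - \<delta> <= w y - \<delta> / 2" using \<delta> by linarith
  then show "w x - \<delta> <= u y" by (simp add: u_def)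
 qed
 \<comment> \<open>Translation invariance moves the increment \<open>h\<close> from the kernel to
   \<open>u\<close>, so the Lipschitz constant is inherited without a loss depending on
   \<open>\<mu>\<close>.\<close>
 have vlip: "\<bar>v (x + h) - v x\<bar> <= L * norm h" for x h
 proof -
  have m: "(%y. u y * eta \<mu> (x + h - y)) \<in> borel_measurable borel" by measurable
  have plus: "lborel = distr lborel borel ((+) h)" by (simp add: lborel_distr_plus)
  have "v (x + h) = (LINT y|distr lborel borel ((+) h). u y * eta \<mu> (x + h - y))"
   unfolding v_def conv_def using plus by simp
  also have "... = (LBINT y. u (h + y) * eta \<mu> (x - y))"
   using m by (subst integral_distr) auto
  finally have e1: "v (x + h) = (LBINT y. u (h + y) * eta \<mu> (x - y))" .
  have i1: "integrable lborel (%y. u (h + y) * eta \<mu> (x - y))"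
  proof -
   have "integrable (distr lborel borel ((+) h)) (%y. u y * eta \<mu> (x + h - y))" using int[where x = "x + h"] plus by simp
   then show ?thesis using m by (subst (asm) integrable_distr_eq) auto
  qed
  have "v (x + h) - v x = (LBINT y. (u (h + y) - u y) * eta \<mu> (x - y))"
   unfolding e1 using i1 int[where x = x] by (simp add: v_def conv_def left_diff_distrib)
  also have "\<bar>...\<bar> <= (LBINT y. \<bar>(u (h + y) - u y) * eta \<mu> (x - y)\<bar>)" by (rule integral_abs_bound)
  also have "... <= (LBINT y. (L * norm h) * eta \<mu> (x - y))"
  proof (rule integral_mono)
   show "integrable lborel (%y. \<bar>(u (h + y) - u y) * eta \<mu> (x - y)\<bar>)"
    using Bochner_Integration.integrable_diff[OF i1 int[where x = x]] by (simp add: left_diff_distrib)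
   show "\<bar>(u (h + y) - u y) * eta \<mu> (x - y)\<bar> <= L * norm h * eta \<mu> (x - y)" for y
    using lip[of "h + y" y] eta_nonneg[OF \<mu>, of "x - y"] by (simp add: abs_mult mult_right_mono)
  qed (intro integrable_mult_right eta_integral_reflect[OF \<mu>])
  finally show ?thesis using eta_integral_reflect[OF \<mu>] by simp
 qed
 have part: "\<bar>partial i v x\<bar> <= L" for i x
 proof -
  have "((%t. v (x + t *\<^sub>R axis i 1)) has_real_derivative partial i v x) (at 0)"
   using DERIV_along_line[OF sv, of x "axis i 1" 0] by (simp add: inner_axis grad_def)
  then have "((%t. (v (x + t *\<^sub>R axis i 1) - v x) / t) \<longlongrightarrow> partial i v x) (at 0)"
   unfolding DERIV_def by simp
  then have "((%t. \<bar>(v (x + t *\<^sub>R axis i 1) - v x) / t\<bar>) \<longlongrightarrow> \<bar>partial i v x\<bar>) (at 0)"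
   by (rule tendsto_rabs)
  moreover have "\<forall>\<^sub>F t in at 0. \<bar>(v (x + t *\<^sub>R axis i 1) - v x) / t\<bar> <= L"
  proof -
   have "\<bar>(v (x + t *\<^sub>R axis i 1) - v x) / t\<bar> <= L" if "t ~= 0" for t
   proof -
    have "\<bar>v (x + t *\<^sub>R axis i 1) - v x\<bar> <= L * \<bar>t\<bar>" using vlip[of x "t *\<^sub>R axis i 1"] by simp
    then show ?thesis using that by (simp add: abs_divide pos_divide_le_eq)
   qed
   then show ?thesis by (auto simp: eventually_at_filter)
  qed
  ultimately show ?thesis by (rule tendsto_upperbound) simp
 qed
 have grad: "norm (grad v x) <= 2 * L" for x
 proof -
  have "norm (grad v x) <= (\<Sum>i\<in>UNIV. \<bar>grad v x $ i\<bar>)" by (rule norm_le_l1_cart)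
  also have "... <= (\<Sum>i\<in>(UNIV :: 2 set). L)" by (intro sum_mono) (simp add: grad_def part)
  finally show ?thesis by simp
 qed
 show thesis by (rule that[OF sv v0 vw wv grad supp])
qed

section \<open>Dilated mollification inside a convex set\<close>

definition moll :: "real^2 => real => real => (real^2 => real) => real^2 => real" where
 "moll z c \<mu> f x = conv f (eta \<mu>) (c *\<^sub>R x + (z - c *\<^sub>R z))"

text \<open>The dilation about \<open>z\<close> compensates the widening of the support by the mollifier.\<close>

lemma dilated_support:
 assumes D: "convex D" "open D" "bounded D" "cball z \<rho> \<subseteq> D" and pos: "\<rho> > 0" "\<mu> > 0"
 obtains Q :: "(real^2) set" where "compact Q" "convex Q" "Q \<subseteq> D"
  "!!x y. y \<in> D ==> norm ((1 + 2 * \<mu> / \<rho>) *\<^sub>R x + (z - (1 + 2 * \<mu> / \<rho>) *\<^sub>R z) - y) <= 2 * \<mu> ==> x \<in> Q"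
proof -
 define c where "c = 1 + 2 * \<mu> / \<rho>"
 have c: "c > 1" using pos by (simp add: c_def)
 \<comment> \<open>With 1 - \<theta> = 1/c, the preimage of y + w under the dilation is the convex
   combination (1 - \<theta>) y + \<theta> b for a point b near z.\<close>
 define \<theta> where "\<theta> = 1 - 1 / c"
 have \<theta>: "0 < \<theta>" "\<theta> <= 1" using c by (auto simp: \<theta>_def)
 define Q where "Q = (%p. (1 - \<theta>) *\<^sub>R fst p + \<theta> *\<^sub>R snd p) ` (closure D \<times> cball z \<rho>)"
 have "compact Q" unfolding Q_def
  by (intro compact_continuous_image continuous_intros compact_Times) (use D in auto)
 moreover have "convex Q" unfolding Q_def
 proof (rule convex_linear_image)
  show "linear (%p :: (real^2) \<times> (real^2). (1 - \<theta>) *\<^sub>R fst p + \<theta> *\<^sub>R snd p)"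
   by (rule linearI) (auto simp: algebra_simps)
  show "convex (closure D \<times> cball z \<rho>)" using D by (intro convex_Times convex_closure) auto
 qed
 moreover have "Q \<subseteq> D"
 proof
  fix x assume "x \<in> Q"
  then obtain y b where yb: "y \<in> closure D" "b \<in> cball z \<rho>" "x = (1 - \<theta>) *\<^sub>R y + \<theta> *\<^sub>R b" by (auto simp: Q_def)
  have "b \<in> interior D" using yb(2) D by (auto simp: interior_open)
  from mem_interior_closure_convex_shrink[OF D(1) this yb(1) \<theta>]
  have "y - \<theta> *\<^sub>R (y - b) \<in> D" using D(2) by (simp add: interior_open)
  then show "x \<in> D" by (simp add: yb(3) algebra_simps)
 qed
 moreover have "x \<in> Q" if y: "y \<in> D" and n: "norm (c *\<^sub>R x + (z - c *\<^sub>R z) - y) <= 2 * \<mu>" for x y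
 proof -
  define w where "w = c *\<^sub>R x + (z - c *\<^sub>R z) - y"
  \<comment> \<open>The dilation factor is made for this point: norm (b - z) <= 2 \<mu> / (c - 1) =
    \<rho>.\<close>
  define b where "b = z + (1 / (c - 1)) *\<^sub>R w"
  have "norm ((1 / (c - 1)) *\<^sub>R w) = norm w / (c - 1)" using c by simp
  also have "... <= 2 * \<mu> / (c - 1)" using n c by (intro divide_right_mono) (auto simp: w_def)
  also have "... = \<rho>" using pos by (simp add: c_def)
  finally have b: "b \<in> cball z \<rho>" by (simp add: b_def dist_norm)
  have "(1 - \<theta>) *\<^sub>R y + \<theta> *\<^sub>R b = x"
  proof -
   have 1: "1 - \<theta> = 1 / c" by (simp add: \<theta>_def)
   have 2: "\<theta> = (c - 1) / c" using c by (simp add: \<theta>_def field_simps)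
   have "\<theta> * (1 / (c - 1)) = 1 / c" using c by (simp add: 2)
   then have "\<theta> *\<^sub>R b = \<theta> *\<^sub>R z + (1 / c) *\<^sub>R w" by (simp add: b_def scaleR_add_right)
   then have "(1 - \<theta>) *\<^sub>R y + \<theta> *\<^sub>R b = (1 / c) *\<^sub>R (y + w) + \<theta> *\<^sub>R z" by (simp add: 1 scaleR_add_right)
   also have "y + w = c *\<^sub>R x + (1 - c) *\<^sub>R z" by (simp add: w_def algebra_simps)
   also have "(1 / c) *\<^sub>R ... = x + ((1 - c) / c) *\<^sub>R z" using c by (simp add: scaleR_add_right)
   also have "((1 - c) / c) = - \<theta>" using c by (simp add: 2 field_simps)
   finally show ?thesis by simp
  qed
  then show ?thesis unfolding Q_def using y b closure_subset by (intro image_eqI[of _ _ "(y, b)"]) auto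
 qed
 ultimately show thesis using that[of Q] by (simp add: c_def)
qed

lemma sqint_bounded_support_integrable:
 fixes f :: "real^2 => real"
 assumes "sqint lborel f" "!!x. x \<notin> cball 0 R ==> f x = 0"
 shows "integrable lborel f"
proof -
 have [measurable]: "f \<in> borel_measurable borel" using assms(1) by (simp add: sqint_def)
 have i: "integrable lborel (%x. indicator (cball 0 R) x + (f x)^2)"
  using assms(1) emeasure_bounded_finite[of "cball (0 :: real^2) R"] by (auto simp: sqint_def)
 have "\<bar>f x\<bar> <= indicator (cball 0 R) x + (f x)^2" for x
  using two_mult_le_sum_squares[of "\<bar>f x\<bar>" 1] assms(2)[of x] abs_ge_zero[of "f x"]
  by (cases "x \<in> cball 0 R") auto
 then show ?thesis
  by (intro Bochner_Integration.integrable_bound[OF i] AE_I2) (simp_all add: order_trans[OF _ abs_ge_self])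
qed

lemma smooth_moll:
 assumes "integrable lborel f" "!!y. y \<notin> cball 0 R ==> f y = 0"
 shows "smooth (moll z c \<mu> f)"
 unfolding moll_def[abs_def] by (intro smooth_affine smooth_conv[OF assms smooth_eta]) auto

text \<open>A Schur test: after Young's inequality under the double integral the kernel integrates
  to 1 in y and to 1/c^2 <= 1 in x. The parameter t lets a small function be weighed against one of
  fixed size.\<close>

lemma moll_bilinear_bound:
 assumes f: "sqint lborel f" "!!x. x \<notin> cball 0 R ==> f x = 0"
  and g: "sqint lborel g" "!!x. x \<notin> cball 0 R ==> g x = 0"
  and \<mu>: "\<mu> > 0" and c: "c \<ge> 1" and t: "t > 0"
 shows "integrable lborel (%x. f x * moll z c \<mu> g x)"
  and "\<bar>\<integral>x. f x * moll z c \<mu> g x \<partial>lborel\<bar> <= (t * (LBINT x. (f x)^2) + (LBINT x. (g x)^2) / t) / 2"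
proof -
 have [measurable]: "f \<in> borel_measurable borel" "g \<in> borel_measurable borel" using f g by (auto simp: sqint_def)
 note fi = sqint_bounded_support_integrable[OF f] and gi = sqint_bounded_support_integrable[OF g]
 define w where "w = z - c *\<^sub>R z"
 define m where "m = moll z c \<mu> g"
 have sm: "smooth m" unfolding m_def by (rule smooth_moll[OF gi g(2)])
 then have cm: "continuous_on UNIV m" by (rule smooth_continuous)
 then have [measurable]: "m \<in> borel_measurable borel" by (rule borel_measurable_continuous_onI)
 obtain e where e: "!!y. y \<in> cball 0 R ==> \<bar>m y\<bar> <= e"
 proof -
  have "compact (m ` cball 0 R)" by (intro compact_continuous_image continuous_on_subset[OF cm]) auto
  then show thesis using that compact_imp_bounded bounded_iff by (metis (no_types, lifting) imageI real_norm_def)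
 qed
 have int: "integrable lborel (%x. f x * m x)"
  by (rule integral_weight_bound(1)[where R = R, OF fi _ cm e]) (use f in auto)
 then show "integrable lborel (%x. f x * moll z c \<mu> g x)" by (simp add: m_def)
 have gint: "integrable lborel (%y. g y * eta \<mu> (c *\<^sub>R x + w - y))" for x
  by (rule conv_integrable[where R = R, OF gi _ smooth_continuous[OF smooth_eta]]) (use g in auto)
 define F where "F = (LBINT x. (f x)^2)"
 define G where "G = (LBINT x. (g x)^2)"
 have FG: "F \<ge> 0" "G \<ge> 0" by (auto simp: F_def G_def)
 have nF: "(nn_integral lborel (%x. ennreal ((f x)^2))) = ennreal F" "(nn_integral lborel (%x. ennreal ((g x)^2))) = ennreal G"
  using f g unfolding F_def G_def by (auto intro!: nn_integral_eq_integral simp: sqint_def)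
 have \<eta>0: "0 <= eta \<mu> u" for u by (rule eta_nonneg[OF \<mu>])
 have pt: "ennreal \<bar>f x * m x\<bar> <= (nn_integral lborel (%y. ennreal (t / 2 * (f x)^2) * ennreal (eta \<mu> (c *\<^sub>R x + w - y))
   + ennreal (1 / (2 * t) * (g y)^2) * ennreal (eta \<mu> (c *\<^sub>R x + w - y))))" for x
 proof -
  have "\<bar>m x\<bar> <= (LBINT y. \<bar>g y * eta \<mu> (c *\<^sub>R x + w - y)\<bar>)"
   unfolding m_def moll_def conv_def w_def by (rule integral_abs_bound)
  then have "\<bar>f x * m x\<bar> <= \<bar>f x\<bar> * (LBINT y. \<bar>g y * eta \<mu> (c *\<^sub>R x + w - y)\<bar>)"
   by (simp only: abs_mult) (intro mult_left_mono, auto)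
  also have "... = (LBINT y. \<bar>f x\<bar> * \<bar>g y * eta \<mu> (c *\<^sub>R x + w - y)\<bar>)" by simp
  finally have "ennreal \<bar>f x * m x\<bar> <= ennreal (LBINT y. \<bar>f x\<bar> * \<bar>g y * eta \<mu> (c *\<^sub>R x + w - y)\<bar>)"
   by (rule ennreal_leI)
  also have "... = (nn_integral lborel (%y. ennreal (\<bar>f x\<bar> * \<bar>g y * eta \<mu> (c *\<^sub>R x + w - y)\<bar>)))"
   using gint by (intro nn_integral_eq_integral[symmetric]) auto
  also have "... <= (nn_integral lborel (%y. ennreal (t / 2 * (f x)^2) * ennreal (eta \<mu> (c *\<^sub>R x + w - y))
   + ennreal (1 / (2 * t) * (g y)^2) * ennreal (eta \<mu> (c *\<^sub>R x + w - y))))"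
  proof (rule nn_integral_mono)
   fix y
   have "2 * (sqrt t * \<bar>f x\<bar>) * (\<bar>g y\<bar> / sqrt t) <= (sqrt t * \<bar>f x\<bar>)^2 + (\<bar>g y\<bar> / sqrt t)^2"
    by (rule two_mult_le_sum_squares)
   then have "\<bar>f x\<bar> * \<bar>g y\<bar> <= t / 2 * (f x)^2 + 1 / (2 * t) * (g y)^2"
    using t by (simp add: power_mult_distrib power_divide)
   then have "\<bar>f x\<bar> * \<bar>g y\<bar> * eta \<mu> (c *\<^sub>R x + w - y) <= (t / 2 * (f x)^2 + 1 / (2 * t) * (g y)^2) * eta \<mu> (c *\<^sub>R x + w - y)"
    by (rule mult_right_mono) (rule \<eta>0)
   moreover have "\<bar>f x\<bar> * \<bar>g y * eta \<mu> (c *\<^sub>R x + w - y)\<bar> = \<bar>f x\<bar> * \<bar>g y\<bar> * eta \<mu> (c *\<^sub>R x + w - y)"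
    by (simp only: abs_mult abs_of_nonneg[OF \<eta>0] mult.assoc)
   ultimately have "ennreal (\<bar>f x\<bar> * \<bar>g y * eta \<mu> (c *\<^sub>R x + w - y)\<bar>) <= ennreal ((t / 2 * (f x)^2 + 1 / (2 * t) * (g y)^2) * eta \<mu> (c *\<^sub>R x + w - y))"
    by (intro ennreal_leI) (simp only:)
   also have "... = ennreal (t / 2 * (f x)^2) * ennreal (eta \<mu> (c *\<^sub>R x + w - y)) + ennreal (1 / (2 * t) * (g y)^2) * ennreal (eta \<mu> (c *\<^sub>R x + w - y))"
   proof -
    have "ennreal ((a + b) * d) = ennreal a * ennreal d + ennreal b * ennreal d" if "0 <= a" "0 <= b" "0 <= d" for a b d
     using that by (simp add: distrib_right ennreal_plus ennreal_mult)
    then show ?thesis using t \<eta>0 by simp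
   qed
   finally show "ennreal (\<bar>f x\<bar> * \<bar>g y * eta \<mu> (c *\<^sub>R x + w - y)\<bar>) <= ennreal (t / 2 * (f x)^2) * ennreal (eta \<mu> (c *\<^sub>R x + w - y))
    + ennreal (1 / (2 * t) * (g y)^2) * ennreal (eta \<mu> (c *\<^sub>R x + w - y))" .
  qed
  finally show ?thesis .
 qed
 have r1: "(nn_integral lborel (%y. ennreal (eta \<mu> (c *\<^sub>R x + w - y)))) = 1" for x
  using eta_nn_integral_affine[OF \<mu>, of "-1" "c *\<^sub>R x + w"] by simp
 have r2: "(nn_integral lborel (%x. ennreal (eta \<mu> (c *\<^sub>R x + w - y)))) <= 1" for y
 proof -
  have "(nn_integral lborel (%x. ennreal (eta \<mu> ((w - y) + c *\<^sub>R x)))) = ennreal (1 / c^2)"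
   using c by (intro eta_nn_integral_affine[OF \<mu>]) auto
  also have "... <= 1" using c by (simp add: one_le_power)
  finally show ?thesis by (simp add: algebra_simps)
 qed
 have "ennreal \<bar>\<integral>x. f x * m x \<partial>lborel\<bar> <= (nn_integral lborel (%x. ennreal \<bar>f x * m x\<bar>))"
  using integral_norm_bound_ennreal[OF int] by simp
 also have "... <= (nn_integral lborel (%x. nn_integral lborel (%y. ennreal (t / 2 * (f x)^2) * ennreal (eta \<mu> (c *\<^sub>R x + w - y))
   + ennreal (1 / (2 * t) * (g y)^2) * ennreal (eta \<mu> (c *\<^sub>R x + w - y)))))"
  by (rule nn_integral_mono) (rule pt)
 also have "... = (nn_integral lborel (%x. nn_integral lborel (%y. ennreal (t / 2 * (f x)^2) * ennreal (eta \<mu> (c *\<^sub>R x + w - y)))))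
   + (nn_integral lborel (%x. nn_integral lborel (%y. ennreal (1 / (2 * t) * (g y)^2) * ennreal (eta \<mu> (c *\<^sub>R x + w - y)))))"
  by (subst nn_integral_add[symmetric]) (auto simp: nn_integral_add)
 also have "(nn_integral lborel (%x. nn_integral lborel (%y. ennreal (t / 2 * (f x)^2) * ennreal (eta \<mu> (c *\<^sub>R x + w - y))))) = ennreal (t / 2) * ennreal F"
 proof -
  have "(nn_integral lborel (%x. nn_integral lborel (%y. ennreal (t / 2 * (f x)^2) * ennreal (eta \<mu> (c *\<^sub>R x + w - y))))) = (nn_integral lborel (%x. ennreal (t / 2) * ennreal ((f x)^2)))"
  proof (rule nn_integral_cong)
   fix x
   have "ennreal (t / 2 * (f x)^2) = ennreal (t / 2) * ennreal ((f x)^2)" using t by (intro ennreal_mult) auto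
   then show "(nn_integral lborel (%y. ennreal (t / 2 * (f x)^2) * ennreal (eta \<mu> (c *\<^sub>R x + w - y)))) = ennreal (t / 2) * ennreal ((f x)^2)"
    by (subst nn_integral_cmult) (simp_all add: r1)
  qed
  then show ?thesis by (simp add: nn_integral_cmult nF)
 qed
 also have "(nn_integral lborel (%x. nn_integral lborel (%y. ennreal (1 / (2 * t) * (g y)^2) * ennreal (eta \<mu> (c *\<^sub>R x + w - y)))))
  = (nn_integral lborel (%y. nn_integral lborel (%x. ennreal (1 / (2 * t) * (g y)^2) * ennreal (eta \<mu> (c *\<^sub>R x + w - y)))))"
  by (rule lborel_pair.Fubini') measurable
 also have "... <= (nn_integral lborel (%y. ennreal (1 / (2 * t) * (g y)^2) * 1))"
 proof (rule nn_integral_mono)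
  fix y
  have "(nn_integral lborel (%x. ennreal (1 / (2 * t) * (g y)^2) * ennreal (eta \<mu> (c *\<^sub>R x + w - y)))) = ennreal (1 / (2 * t) * (g y)^2) * (nn_integral lborel (%x. ennreal (eta \<mu> (c *\<^sub>R x + w - y))))"
   by (rule nn_integral_cmult) measurable
  also have "... <= ennreal (1 / (2 * t) * (g y)^2) * 1" by (intro mult_left_mono r2) simp
  finally show "(nn_integral lborel (%x. ennreal (1 / (2 * t) * (g y)^2) * ennreal (eta \<mu> (c *\<^sub>R x + w - y)))) <= ennreal (1 / (2 * t) * (g y)^2) * 1" .
 qed
 also have "(nn_integral lborel (%y. ennreal (1 / (2 * t) * (g y)^2) * 1)) = ennreal (1 / (2 * t)) * ennreal G"
 proof -
  have "(nn_integral lborel (%y. ennreal (1 / (2 * t) * (g y)^2) * 1)) = (nn_integral lborel (%y. ennreal (1 / (2 * t)) * ennreal ((g y)^2)))"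
   using t by (intro nn_integral_cong) (simp add: ennreal_mult[symmetric])
  then show ?thesis by (simp add: nn_integral_cmult nF)
 qed
 also have "ennreal (t / 2) * ennreal F + ennreal (1 / (2 * t)) * ennreal G = ennreal ((t * F + G / t) / 2)"
 proof -
  have "ennreal (t / 2) * ennreal F + ennreal (1 / (2 * t)) * ennreal G = ennreal (t / 2 * F + 1 / (2 * t) * G)"
   using t FG by (simp add: ennreal_mult[symmetric] flip: ennreal_plus)
  also have "t / 2 * F + 1 / (2 * t) * G = (t * F + G / t) / 2" by (simp add: add_divide_distrib)
  finally show ?thesis .
 qed
 finally have "ennreal \<bar>\<integral>x. f x * m x \<partial>lborel\<bar> <= ennreal ((t * F + G / t) / 2)" by (simp add: add_left_mono)
 then show "\<bar>\<integral>x. f x * moll z c \<mu> g x \<partial>lborel\<bar> <= (t * (LBINT x. (f x)^2) + (LBINT x. (g x)^2) / t) / 2"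
  using t FG by (subst (asm) ennreal_le_iff) (auto simp: m_def F_def G_def)
qed

lemma moll_diff:
 assumes "integrable lborel f" "!!y. y \<notin> cball 0 R ==> f y = 0" "integrable lborel g" "!!y. y \<notin> cball 0 R ==> g y = 0"
 shows "moll z c \<mu> (%y. f y - g y) x = moll z c \<mu> f x - moll z c \<mu> g x"
proof -
 have "integrable lborel (%y. f y * eta \<mu> (c *\<^sub>R x + (z - c *\<^sub>R z) - y))" "integrable lborel (%y. g y * eta \<mu> (c *\<^sub>R x + (z - c *\<^sub>R z) - y))"
  by (rule conv_integrable[where R = R, OF _ _ smooth_continuous[OF smooth_eta]]; use assms in blast)+
 then show ?thesis by (simp add: moll_def conv_def left_diff_distrib)
qed

text \<open>At a point of the open set D the kernel eventually sees only D, where h is continuous;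
  the bound B gives dominated convergence.\<close>

lemma moll_converges_continuous:
 assumes D: "open D" "bounded D" and h: "continuous_on UNIV h" "!!x. \<bar>h x\<bar> <= B"
  and \<mu>: "!!n. \<mu> n > 0" "\<mu> \<longlonglongrightarrow> 0" and c: "c \<longlonglongrightarrow> 1"
 shows "(%n. \<integral>x. (indicator D x * h x) * moll z (c n) (\<mu> n) (%y. indicator D y * h y) x \<partial>lborel)
  \<longlonglongrightarrow> (LBINT x. (indicator D x * h x)^2)"
proof -
 have [measurable]: "h \<in> borel_measurable borel" "D \<in> sets borel" using h D by (auto intro: borel_measurable_continuous_onI)
 define u where "u x = indicator D x * h x" for x
 have [measurable]: "u \<in> borel_measurable borel" unfolding u_def[abs_def] by measurable
 obtain R where R: "D \<subseteq> cball 0 R" using bounded_subset_ballD[OF D(2), of 0] ball_subset_cball by (metis order_trans)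
 have u0: "u y = 0" if "y \<notin> cball 0 R" for y using that R by (auto simp: u_def indicator_def)
 have uB: "\<bar>u x\<bar> <= B * indicator D x" for x using h(2)[of x] by (auto simp: u_def indicator_def)
 have B: "B \<ge> 0" using h(2)[of 0] by linarith
 have iD: "integrable lborel (%x. K * indicator D x)" for K :: real
  using emeasure_bounded_finite[OF D(2)] by (intro integrable_mult_right integrable_real_indicator) auto
 have ui: "integrable lborel u"
 proof (rule Bochner_Integration.integrable_bound[OF iD[of B]])
  show "AE x in lborel. norm (u x) <= norm (B * indicator D x)"
   using uB B by (intro AE_I2) (simp add: order_trans[OF _ abs_ge_self])
 qed simp
 have cu: "integrable lborel (%y. u y * eta m (x - y))" for m x
  by (rule conv_integrable[where R = R, OF ui _ smooth_continuous[OF smooth_eta]]) (rule u0)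
 have mB: "\<bar>moll z (c n) (\<mu> n) u x\<bar> <= B" for n x
 proof -
  have "\<bar>moll z (c n) (\<mu> n) u x\<bar> <= (LBINT y. \<bar>u y * eta (\<mu> n) (c n *\<^sub>R x + (z - c n *\<^sub>R z) - y)\<bar>)"
   unfolding moll_def conv_def by (rule integral_abs_bound)
  also have "... <= (LBINT y. B * eta (\<mu> n) (c n *\<^sub>R x + (z - c n *\<^sub>R z) - y))"
  proof (rule integral_mono)
   show "\<bar>u y * eta (\<mu> n) (c n *\<^sub>R x + (z - c n *\<^sub>R z) - y)\<bar> <= B * eta (\<mu> n) (c n *\<^sub>R x + (z - c n *\<^sub>R z) - y)" for y
   proof -
    have "\<bar>u y\<bar> <= B" using uB[of y] B by (cases "y \<in> D") auto
    then have "\<bar>u y\<bar> * eta (\<mu> n) (c n *\<^sub>R x + (z - c n *\<^sub>R z) - y) <= B * eta (\<mu> n) (c n *\<^sub>R x + (z - c n *\<^sub>R z) - y)"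
     by (rule mult_right_mono) (rule eta_nonneg[OF \<mu>(1)])
    then show ?thesis by (simp only: abs_mult abs_of_nonneg[OF eta_nonneg[OF \<mu>(1)]])
   qed
  qed (use cu eta_integral_reflect[OF \<mu>(1)] in auto)
  finally show ?thesis using eta_integral_reflect[OF \<mu>(1)] by simp
 qed
 have lim: "(%n. moll z (c n) (\<mu> n) u x) \<longlonglongrightarrow> h x" if x: "x \<in> D" for x
  unfolding tendsto_iff
 proof (intro allI impI)
  fix e :: real assume e: "e > 0"
  obtain d1 where d1: "d1 > 0" "!!y. dist y x < d1 ==> dist (h y) (h x) < e / 2"
   using h(1) e unfolding continuous_on_iff by (metis UNIV_I half_gt_zero)
  obtain d2 where d2: "d2 > 0" "ball x d2 \<subseteq> D" using D(1) x open_contains_ball by blast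
  define d where "d = min d1 d2"
  have d: "d > 0" using d1 d2 by (simp add: d_def)
  have l: "(%n. norm (c n *\<^sub>R x + (z - c n *\<^sub>R z) - x) + 2 * \<mu> n) \<longlonglongrightarrow> norm (1 *\<^sub>R x + (z - 1 *\<^sub>R z) - x) + 2 * 0"
   by (intro tendsto_intros c \<mu>(2))
  then have "\<forall>\<^sub>F n in sequentially. norm (c n *\<^sub>R x + (z - c n *\<^sub>R z) - x) + 2 * \<mu> n < d"
   using d by (intro order_tendstoD(2)[OF l]) simp
  then show "\<forall>\<^sub>F n in sequentially. dist (moll z (c n) (\<mu> n) u x) (h x) < e"
  proof eventually_elim
   case (elim n)
   define x' where "x' = c n *\<^sub>R x + (z - c n *\<^sub>R z)"
   have near: "\<bar>(u y - h x) * eta (\<mu> n) (x' - y)\<bar> <= e / 2 * eta (\<mu> n) (x' - y)" for y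
   proof (cases "eta (\<mu> n) (x' - y) = 0")
    case False
    from eta_support[OF \<mu>(1) this] have "norm (x' - y) <= 2 * \<mu> n" .
    then have "dist y x < d" using elim norm_triangle_ineq4[of "x' - x" "x' - y"]
     by (simp add: x'_def[symmetric] dist_norm norm_minus_commute)
    then have "\<bar>u y - h x\<bar> <= e / 2" using d1(2)[of y] d2(2) by (auto simp: d_def u_def dist_real_def dist_commute subset_eq)
    then have "\<bar>u y - h x\<bar> * eta (\<mu> n) (x' - y) <= e / 2 * eta (\<mu> n) (x' - y)"
     by (rule mult_right_mono) (rule eta_nonneg[OF \<mu>(1)])
    then show ?thesis by (simp only: abs_mult abs_of_nonneg[OF eta_nonneg[OF \<mu>(1)]])
   qed simp
   have r: "integrable lborel (%y. eta (\<mu> n) (x' - y))" "(LBINT y. eta (\<mu> n) (x' - y)) = 1"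
    using eta_integral_reflect[OF \<mu>(1)] by auto
   have i: "integrable lborel (%y. (u y - h x) * eta (\<mu> n) (x' - y))"
    using cu[where x = x'] r by (simp add: left_diff_distrib)
   have "moll z (c n) (\<mu> n) u x - h x = (LBINT y. (u y - h x) * eta (\<mu> n) (x' - y))"
    using cu[where x = x'] r by (simp add: left_diff_distrib moll_def conv_def x'_def)
   also have "\<bar>...\<bar> <= (LBINT y. \<bar>(u y - h x) * eta (\<mu> n) (x' - y)\<bar>)" by (rule integral_abs_bound)
   also have "... <= (LBINT y. e / 2 * eta (\<mu> n) (x' - y))"
    using near i r by (intro integral_mono) auto
   finally show ?case using r e by (simp add: dist_real_def)
  qed
 qed
 have [measurable]: "moll z (c n) (\<mu> n) u \<in> borel_measurable borel" for n
  by (intro borel_measurable_continuous_onI smooth_continuous smooth_moll[OF ui u0]) auto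
 have "(%n. \<integral>x. u x * moll z (c n) (\<mu> n) u x \<partial>lborel) \<longlonglongrightarrow> (LBINT x. (u x)^2)"
 proof (rule integral_dominated_convergence[where w = "%x. (B * B) * indicator D x"])
  show "AE x in lborel. (%n. u x * moll z (c n) (\<mu> n) u x) \<longlonglongrightarrow> (u x)^2"
  proof (rule AE_I2)
   fix x show "(%n. u x * moll z (c n) (\<mu> n) u x) \<longlonglongrightarrow> (u x)^2"
   proof (cases "x \<in> D")
    case True
    have "(%n. u x * moll z (c n) (\<mu> n) u x) \<longlonglongrightarrow> u x * h x" by (intro tendsto_intros lim True)
    then show ?thesis using True by (simp add: u_def power2_eq_square)
   qed (simp add: u_def)
  qed
  show "AE x in lborel. norm (u x * moll z (c n) (\<mu> n) u x) <= (B * B) * indicator D x" for n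
  proof (rule AE_I2)
   fix x
   have "\<bar>u x\<bar> * \<bar>moll z (c n) (\<mu> n) u x\<bar> <= (B * indicator D x) * B" by (intro mult_mono uB mB) (use B in auto)
   then show "norm (u x * moll z (c n) (\<mu> n) u x) <= (B * B) * indicator D x" by (simp add: abs_mult mult_ac)
  qed
 qed (use iD in auto)
 then show ?thesis by (simp add: u_def[abs_def])
qed

text \<open>Convergence of the quadratic form is what the orthogonality arguments consume. Density
  of bounded continuous functions reduces it to the preceding lemma, because the form is bounded
  uniformly in n.\<close>

lemma moll_converges:
 assumes D: "open D" "bounded D" and f: "sqint lborel f" "!!x. x \<notin> D ==> f x = 0"
  and \<mu>: "!!n. \<mu> n > 0" "\<mu> \<longlonglongrightarrow> 0" and c: "!!n. c n \<ge> 1" "c \<longlonglongrightarrow> 1"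
 shows "(%n. \<integral>x. f x * moll z (c n) (\<mu> n) f x \<partial>lborel) \<longlonglongrightarrow> (LBINT x. (f x)^2)"
 unfolding tendsto_iff
proof (intro allI impI)
 fix e :: real assume e: "e > 0"
 obtain R where R: "D \<subseteq> cball 0 R" using bounded_subset_ballD[OF D(2), of 0] ball_subset_cball by (metis order_trans)
 define F where "F = (LBINT x. (f x)^2)"
 have F: "F \<ge> 0" by (simp add: F_def)
 \<comment> \<open>The number 9 F + 9 collects the coefficients of \<open>s\<close> in the final
   estimate, where U <= 2 F + 2 has been inserted.\<close>
 define s where "s = min 1 (e / (9 * F + 9))"
 have s: "s > 0" "s <= 1" "s * (9 * F + 9) <= e"
 proof -
  show "s > 0" using e F by (simp add: s_def)
  show "s <= 1" by (simp add: s_def)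
  have "s * (9 * F + 9) <= e / (9 * F + 9) * (9 * F + 9)" using F by (intro mult_right_mono) (auto simp: s_def)
  then show "s * (9 * F + 9) <= e" using F by simp
 qed
 have Db: "D \<in> sets borel" using D by simp
 have s2: "s^2 > 0" using s by simp
 obtain h B where h: "continuous_on UNIV h" "!!x. \<bar>h x\<bar> <= B" and q: "(LBINT x. (f x - indicator D x * h x)^2) < s^2"
  using L2_continuous_approximation[OF Db D(2) f s2] by blast
 define u where "u x = indicator D x * h x" for x
 define d where "d x = f x - u x" for x
 have [measurable]: "h \<in> borel_measurable borel" "D \<in> sets borel" using h D by (auto intro: borel_measurable_continuous_onI)
 have B: "B \<ge> 0" using h(2)[of 0] by linarith
 have su: "sqint lborel u" unfolding sqint_def
 proof
  have i: "integrable lborel (%x. (B * B) * indicator D x)"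
   using emeasure_bounded_finite[OF D(2)] by (intro integrable_mult_right integrable_real_indicator) auto
  have "\<bar>h x\<bar> * \<bar>h x\<bar> <= B * B" for x by (intro mult_mono h B) auto
  then show "integrable lborel (%x. (norm (u x))^2)"
   by (intro Bochner_Integration.integrable_bound[OF i]) (auto simp: u_def indicator_def power2_eq_square intro!: AE_I2)
 qed (simp add: u_def[abs_def])
 have sd: "sqint lborel d" unfolding d_def by (rule sqint_diff[OF f(1) su])
 have f0: "f x = 0" "u x = 0" "d x = 0" if "x \<notin> cball 0 R" for x
 proof -
  have "x \<notin> D" using that R by blast
  then show "f x = 0" "u x = 0" "d x = 0" using f(2)[of x] by (auto simp: u_def d_def indicator_def)
 qed
 define U where "U = (LBINT x. (u x)^2)"
 define q where "q = (LBINT x. (d x)^2)"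
 have q: "0 <= q" "q < s^2" using \<open>(LBINT x. (f x - indicator D x * h x)^2) < s^2\<close> by (auto simp: q_def d_def u_def)
 have qs: "q / s <= s" using q s by (simp add: pos_divide_le_eq power2_eq_square)
 have U: "U \<ge> 0" "U <= 2 * F + 2"
 proof -
  show "U \<ge> 0" by (simp add: U_def)
  have "(LBINT x. (norm (f x + (-1) *\<^sub>R d x))^2) <= 2 * (LBINT x. (norm (f x))^2) + 2 * (LBINT x. (norm ((-1) *\<^sub>R d x))^2)"
   by (rule l2n_add_le[OF f(1) sqint_scaleR[OF sd]])
  moreover have "f x + (-1) *\<^sub>R d x = u x" "(norm ((-1) *\<^sub>R d x))^2 = (d x)^2" for x
   by (simp_all add: d_def power2_commute)
  ultimately have "U <= 2 * F + 2 * q" by (simp only: U_def F_def q_def real_norm_def power2_abs)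
  moreover have "s^2 <= 1" using s by (simp add: power_le_one)
  ultimately show "U <= 2 * F + 2" using q by linarith
 qed
 have FU: "\<bar>F - U\<bar> <= (s * (2 * F + 2 * U) + q / s) / 2"
 proof -
  define k where "k x = f x + u x" for x
  have sk: "sqint lborel k" unfolding k_def by (rule sqint_add[OF f(1) su])
  have K: "(LBINT x. (k x)^2) <= 2 * F + 2 * U"
   using l2n_add_le[OF f(1) su] by (simp add: k_def F_def U_def)
  have "F - U = (LBINT x. (f x)^2 - (u x)^2)"
   using f(1) su by (simp add: F_def U_def sqint_def)
  also have "... = (LBINT x. k x * d x)"
   by (intro Bochner_Integration.integral_cong refl) (simp add: k_def d_def power2_eq_square algebra_simps)
  finally have "F - U = (LBINT x. k x * d x)" .
  then have "\<bar>F - U\<bar> <= (LBINT x. \<bar>k x * d x\<bar>)" by (simp only: integral_abs_bound)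
  also have "... <= (LBINT x. s / 2 * (k x)^2 + 1 / (2 * s) * (d x)^2)"
  proof (rule integral_mono)
   show "integrable lborel (%x. \<bar>k x * d x\<bar>)" using sqint_mult_integrable[OF sk sd] by simp
   show "integrable lborel (%x. s / 2 * (k x)^2 + 1 / (2 * s) * (d x)^2)" using sk sd by (auto simp: sqint_def)
   fix x
   have "2 * (sqrt s * \<bar>k x\<bar>) * (\<bar>d x\<bar> / sqrt s) <= (sqrt s * \<bar>k x\<bar>)^2 + (\<bar>d x\<bar> / sqrt s)^2"
    by (rule two_mult_le_sum_squares)
   then show "\<bar>k x * d x\<bar> <= s / 2 * (k x)^2 + 1 / (2 * s) * (d x)^2"
    using s by (simp add: power_mult_distrib power_divide abs_mult)
  qed
  also have "... = s / 2 * (LBINT x. (k x)^2) + 1 / (2 * s) * q" using sk sd by (simp add: sqint_def q_def)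
  also have "... <= s / 2 * (2 * F + 2 * U) + 1 / (2 * s) * q" using s K by (intro add_right_mono mult_left_mono) auto
  also have "... = (s * (2 * F + 2 * U) + q / s) / 2" by (simp add: add_divide_distrib)
  finally show ?thesis .
 qed
 have "\<forall>\<^sub>F n in sequentially. \<bar>(LBINT x. u x * moll z (c n) (\<mu> n) u x) - U\<bar> < e / 2"
  using tendstoD[OF moll_converges_continuous[OF D h \<mu> c(2), of z], of "e / 2"] e
  unfolding u_def[symmetric] U_def by (simp add: dist_real_def)
 then show "\<forall>\<^sub>F n in sequentially. dist (LBINT x. f x * moll z (c n) (\<mu> n) f x) (LBINT x. (f x)^2) < e"
 proof eventually_elim
  case (elim n)
  define m where "m = moll z (c n) (\<mu> n)"
  note bb = moll_bilinear_bound[where R = R and c = "c n" and \<mu> = "\<mu> n" and z = z, OF _ _ _ _ \<mu>(1) c(1)]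
  have fi: "integrable lborel f" "integrable lborel u" "integrable lborel d"
   using sqint_bounded_support_integrable[where R = R] f su sd f0 by auto
  have md: "m f x = m u x + m d x" for x
   using moll_diff[where R = R, OF fi(1) _ fi(2), of z "c n" "\<mu> n" x] f0 by (simp add: m_def d_def[abs_def])
  have b1: "integrable lborel (%x. u x * m u x)" "integrable lborel (%x. u x * m d x)" "integrable lborel (%x. d x * m f x)"
   unfolding m_def by (rule bb(1)[where t = 1]; use f0 su sd f in auto)+
  have "(LBINT x. f x * m f x) = (LBINT x. u x * m u x + u x * m d x + d x * m f x)"
   by (intro Bochner_Integration.integral_cong refl) (simp add: md d_def algebra_simps)
  also have "... = (LBINT x. u x * m u x) + (LBINT x. u x * m d x) + (LBINT x. d x * m f x)"
   using b1 by simp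
  finally have split: "(LBINT x. f x * m f x) = (LBINT x. u x * m u x) + (LBINT x. u x * m d x) + (LBINT x. d x * m f x)" .
  have e1: "\<bar>\<integral>x. u x * m d x \<partial>lborel\<bar> <= (s * U + q / s) / 2"
   unfolding m_def U_def q_def by (rule bb(2)) (use f0 su sd s in auto)
  have e2: "\<bar>\<integral>x. d x * m f x \<partial>lborel\<bar> <= (q / s + s * F) / 2"
  proof -
   have "\<bar>\<integral>x. d x * m f x \<partial>lborel\<bar> <= ((1 / s) * q + F / (1 / s)) / 2"
    unfolding m_def F_def q_def by (rule bb(2)) (use f0 f sd s in auto)
   then show ?thesis by (simp add: mult.commute)
  qed
  have "\<bar>(LBINT x. f x * m f x) - F\<bar> < e / 2 + ((s * U + q / s) / 2 + (q / s + s * F) / 2 + (s * (2 * F + 2 * U) + q / s) / 2)"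
   using elim e1 e2 FU unfolding split m_def[symmetric] by linarith
  also have "... = e / 2 + (3 * (q / s) + s * (3 * F + 3 * U)) / 2"
  proof -
   have "e / 2 + ((s * U + Q) / 2 + (Q + s * F) / 2 + (s * (2 * F + 2 * U) + Q) / 2) = e / 2 + (3 * Q + s * (3 * F + 3 * U)) / 2" for Q
    by (simp add: field_simps)
   then show ?thesis .
  qed
  also have "... <= e / 2 + (3 * s + s * (3 * F + 3 * (2 * F + 2))) / 2"
   using qs U s by (intro add_left_mono divide_right_mono add_mono mult_left_mono) auto
  also have "... = e / 2 + s * (9 * F + 9) / 2" by (simp add: algebra_simps)
  also have "... <= e" using s by simp
  finally show ?case by (simp add: dist_real_def m_def F_def)
 qed
qed

section \<open>Weak uniqueness and the approximate Helmholtz decomposition\<close>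

lemma test_functionI:
 assumes "smooth \<phi>" "compact Q" "Q \<subseteq> D" "!!x. x \<notin> Q ==> \<phi> x = 0"
 shows "test_function D \<phi>"
proof -
 have "{x. \<phi> x ~= 0} \<subseteq> Q" using assms(4) by blast
 then have c: "closure {x. \<phi> x ~= 0} \<subseteq> Q" using assms(2) by (intro closure_minimal compact_imp_closed)
 then have "compact (closure {x. \<phi> x ~= 0})" using assms(2) by (metis closed_closure compact_Int_closed inf.absorb_iff2)
 then show ?thesis using assms(1,3) c by (auto simp: test_function_def)
qed

lemma conv_nonzero:
 assumes "conv f \<kappa> x ~= 0" obtains y where "f y ~= 0" "\<kappa> (x - y) ~= 0"
proof -
 have "\<exists>y. f y * \<kappa> (x - y) ~= 0"
 proof (rule ccontr)
  assume "\<not> ?thesis"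
  then have "conv f \<kappa> x = (LINT y|(lborel :: (real^2) measure). 0)"
   unfolding conv_def by (intro Bochner_Integration.integral_cong) auto
  with assms show False by simp
 qed
 then show thesis using that by auto
qed

lemma test_function_moll:
 assumes D: "convex D" "open D" "bounded D" "cball z \<rho> \<subseteq> D" and pos: "\<rho> > 0" "\<mu> > 0"
  and f: "integrable lborel f" "!!x. x \<notin> D ==> f x = 0"
 shows "test_function D (moll z (1 + 2 * \<mu> / \<rho>) \<mu> f)"
proof -
 obtain Q :: "(real^2) set" where Q: "compact Q" "convex Q" "Q \<subseteq> D"
  "!!x y. y \<in> D ==> norm ((1 + 2 * \<mu> / \<rho>) *\<^sub>R x + (z - (1 + 2 * \<mu> / \<rho>) *\<^sub>R z) - y) <= 2 * \<mu> ==> x \<in> Q"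
  using dilated_support[OF D pos] by blast
 obtain R where R: "D \<subseteq> cball 0 R" using bounded_subset_ballD[OF D(3), of 0] ball_subset_cball by (metis order_trans)
 show ?thesis
 proof (rule test_functionI[OF _ Q(1,3)])
  show "smooth (moll z (1 + 2 * \<mu> / \<rho>) \<mu> f)" by (rule smooth_moll[where R = R, OF f(1)]) (use f(2) R in blast)
  fix x assume x: "x \<notin> Q"
  show "moll z (1 + 2 * \<mu> / \<rho>) \<mu> f x = 0"
  proof (rule ccontr)
   assume "moll z (1 + 2 * \<mu> / \<rho>) \<mu> f x ~= 0"
   then obtain y where "f y ~= 0" "eta \<mu> ((1 + 2 * \<mu> / \<rho>) *\<^sub>R x + (z - (1 + 2 * \<mu> / \<rho>) *\<^sub>R z) - y) ~= 0"
    unfolding moll_def by (rule conv_nonzero)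
   then show False using Q(4) eta_support[OF pos(2)] f(2) x by blast
  qed
 qed
qed

lemma integral_representative:
 fixes f g k :: "'a::euclidean_space => 'b::euclidean_space"
 assumes D: "D \<in> sets borel" and g: "g \<in> borel_measurable borel" "!!x. x \<notin> D ==> g x = 0"
  and fg: "AE x in lebesgue_on D. f x = g x" "f \<in> borel_measurable (lebesgue_on D)" and k: "k \<in> borel_measurable borel"
 shows "integral\<^sup>L (lebesgue_on D) (%x. f x \<bullet> k x) = (LBINT x. g x \<bullet> k x)"
  and "integral\<^sup>L (lebesgue_on D) (%x. (norm (f x))^2) = (LBINT x. (norm (g x))^2)"
proof -
 have m: "h \<in> borel_measurable (lebesgue_on D)" if "h \<in> borel_measurable borel" for h :: "'a => 'c::euclidean_space"
  using that by (intro measurable_restrict_space1 measurable_completion) simp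
 have [measurable]: "f \<in> borel_measurable (lebesgue_on D)" "g \<in> borel_measurable (lebesgue_on D)" "k \<in> borel_measurable (lebesgue_on D)"
  using fg(2) m g(1) k by auto
 have "integral\<^sup>L (lebesgue_on D) (%x. f x \<bullet> k x) = integral\<^sup>L (lebesgue_on D) (%x. g x \<bullet> k x)"
  by (rule integral_cong_AE) (use fg(1) in \<open>auto elim!: eventually_mono\<close>)
 also have "... = (LBINT x. indicator D x *\<^sub>R (g x \<bullet> k x))"
  using g(1) k by (intro integral_lebesgue_on_lborel(2) D) simp
 also have "(%x. indicator D x *\<^sub>R (g x \<bullet> k x)) = (%x. g x \<bullet> k x)" using g(2) by (auto simp: indicator_def fun_eq_iff)
 finally show "integral\<^sup>L (lebesgue_on D) (%x. f x \<bullet> k x) = (LBINT x. g x \<bullet> k x)" .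
 have "integral\<^sup>L (lebesgue_on D) (%x. (norm (f x))^2) = integral\<^sup>L (lebesgue_on D) (%x. (norm (g x))^2)"
  by (rule integral_cong_AE) (use fg(1) in \<open>auto elim!: eventually_mono\<close>)
 also have "... = (LBINT x. indicator D x *\<^sub>R (norm (g x))^2)"
  using g(1) by (intro integral_lebesgue_on_lborel(2) D) simp
 also have "(%x. indicator D x *\<^sub>R (norm (g x))^2) = (%x. (norm (g x))^2)" using g(2) by (auto simp: indicator_def fun_eq_iff)
 finally show "integral\<^sup>L (lebesgue_on D) (%x. (norm (f x))^2) = (LBINT x. (norm (g x))^2)" .
qed

lemma open_convex_cball:
 assumes "open D" "D ~= {}" obtains z \<rho> where "\<rho> > 0" "cball z \<rho> \<subseteq> (D :: (real^2) set)"
 using assms open_contains_cball by blast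

lemma mollifier_sequence:
 assumes "\<rho> > 0"
 shows "!!n. (0::real) < 1 / real (Suc n)" "(%n. 1 / real (Suc n)) \<longlonglongrightarrow> 0"
  "!!n. 1 <= 1 + 2 * (1 / real (Suc n)) / \<rho>" "(%n. 1 + 2 * (1 / real (Suc n)) / \<rho>) \<longlonglongrightarrow> 1"
proof -
 show l: "(%n. 1 / real (Suc n)) \<longlonglongrightarrow> 0" using LIMSEQ_inverse_real_of_nat by (simp add: inverse_eq_divide)
 have "(%n. 1 + 2 * (1 / real (Suc n)) / \<rho>) \<longlonglongrightarrow> 1 + 2 * 0 / \<rho>" by (intro tendsto_intros l) (use assms in simp)
 then show "(%n. 1 + 2 * (1 / real (Suc n)) / \<rho>) \<longlonglongrightarrow> 1" by simp
qed (use assms in auto)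

text \<open>The fundamental lemma of the calculus of variations in L^2: f is tested with its own
  dilated mollifications, which are test functions, and the pairings converge to the squared
  norm.\<close>

lemma weakly_zero_L2:
 assumes D: "convex D" "open D" "bounded D" and Dne: "D ~= {}" and f: "sqint (lebesgue_on D) f"
  and orth: "!!\<phi>. test_function D \<phi> ==> integral\<^sup>L (lebesgue_on D) (%x. f x * \<phi> x) = 0"
 shows "integral\<^sup>L (lebesgue_on D) (%x. (f x)^2) = (0::real)"
proof -
 obtain z \<rho> where \<rho>: "\<rho> > 0" "cball z \<rho> \<subseteq> D" using open_convex_cball[OF D(2) Dne] .
 have Db: "D \<in> sets borel" using D by simp
 obtain g where g: "g \<in> borel_measurable borel" "!!x. x \<notin> D ==> g x = 0"
  "AE x in lebesgue_on D. f x = g x" "sqint lborel g"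
  using sqint_borel_representative[OF Db f] by blast
 have fm: "f \<in> borel_measurable (lebesgue_on D)" using f by (simp add: sqint_def)
 obtain R where R: "D \<subseteq> cball 0 R" using bounded_subset_ballD[OF D(3), of 0] ball_subset_cball by (metis order_trans)
 have gi: "integrable lborel g" by (rule sqint_bounded_support_integrable[where R = R, OF g(4)]) (use g(2) R in blast)
 note ms = mollifier_sequence[OF \<rho>(1)]
 have "(LBINT x. g x * moll z (1 + 2 * (1 / real (Suc n)) / \<rho>) (1 / real (Suc n)) g x) = 0" for n
 proof -
  have t: "test_function D (moll z (1 + 2 * (1 / real (Suc n)) / \<rho>) (1 / real (Suc n)) g)"
   by (rule test_function_moll[OF D \<rho>(2,1) ms(1) gi g(2)])
  then have "moll z (1 + 2 * (1 / real (Suc n)) / \<rho>) (1 / real (Suc n)) g \<in> borel_measurable borel"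
   by (intro borel_measurable_continuous_onI smooth_continuous) (simp add: test_function_def)
  from integral_representative(1)[OF Db g(1,2,3) fm this] orth[OF t] show ?thesis by simp
 qed
 then have "(%n. 0) \<longlonglongrightarrow> (LBINT x. (g x)^2)"
  using moll_converges[OF D(2,3) g(4,2) ms(1,2,3,4), of z] by simp
 then have "(LBINT x. (g x)^2) = 0" by (simp add: LIMSEQ_const_iff)
 then show ?thesis using integral_representative(2)[OF Db g(1,2,3) fm, of "%x. 0"] by simp
qed

text \<open>The rotated gradient, with the sign for which the inner product of
  \<open>\<tau> x\<close> and \<open>curl \<phi> x\<close> is the integrand in
  \<open>has_weak_rot\<close>.\<close>

definition curl :: "(real^2 => real) => real^2 => real^2" where
 "curl \<psi> x = vector [partial 2 \<psi> x, - partial 1 \<psi> x]"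

lemma curl_continuous: "smooth \<psi> ==> continuous_on S (curl \<psi>)"
proof -
 assume s: "smooth \<psi>"
 have "curl \<psi> = (%x. \<chi> i. if i = 1 then partial 2 \<psi> x else - partial 1 \<psi> x)"
  by (auto simp: curl_def vec_eq_iff forall_2 fun_eq_iff)
 moreover have "continuous_on S (%x. if i = (1::2) then partial 2 \<psi> x else - partial 1 \<psi> x)" for i
  using s by (cases "i = 1") (simp_all add: smooth_continuous smooth_partial continuous_on_minus)
 ultimately show ?thesis by (simp add: continuous_on_vec_lambda)
qed

lemma inner_real2: "(x :: real^2) \<bullet> y = x $ 1 * y $ 1 + x $ 2 * y $ 2"
 by (simp add: inner_vec_def sum_2)

text \<open>The stream function is the convolution of the second component with \<open>etaH\<close>; its other
 derivative comes from the orthogonality to the gradients of the reflected translates of \<open>etaH\<close>.\<close>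

lemma mollified_stream_function:
 fixes g :: "real^2 => real^2"
 assumes D: "convex D" "open D" "bounded D" "cball z \<rho> \<subseteq> D" and pos: "\<rho> > 0" "\<mu> > 0"
  and g: "!!i. integrable lborel (%x. g x $ i)" "!!x. x \<notin> D ==> g x = 0"
  and orth: "!!v. smooth v ==> (LBINT x. g x \<bullet> grad v x) = 0"
 obtains \<psi> where "test_function D \<psi>"
  "!!x i. curl \<psi> x $ i = moll z (1 + 2 * \<mu> / \<rho>) \<mu> (%x. g x $ i) x"
proof -
 define c where "c = 1 + 2 * \<mu> / \<rho>"
 have c: "c > 1" using pos by (simp add: c_def)
 define T where "T x = c *\<^sub>R x + (z - c *\<^sub>R z)" for x
 obtain Q :: "(real^2) set" where Q: "compact Q" "convex Q" "Q \<subseteq> D"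
  "!!x y. y \<in> D ==> norm (T x - y) <= 2 * \<mu> ==> x \<in> Q"
  using dilated_support[OF D pos] unfolding T_def c_def by blast
 obtain R where R: "D \<subseteq> cball 0 R" using bounded_subset_ballD[OF D(3), of 0] ball_subset_cball by (metis order_trans)
 have g0: "g y $ i = 0" if "y \<notin> cball 0 R" for y i
 proof -
  have "y \<notin> D" using that R by blast
  then show ?thesis using g(2) by simp
 qed
 define W where "W = conv (%x. g x $ 2) (etaH \<mu>)"
 have sW: "smooth W" unfolding W_def by (rule smooth_conv[where R = R, OF g(1) _ smooth_etaH]) (rule g0)
 have CkH: "Ck (Suc 0) (etaH \<mu>)" by (rule smooth_Ck[OF smooth_etaH])
 have pW: "partial i W = conv (%x. g x $ 2) (partial i (etaH \<mu>))" for i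
  unfolding W_def by (rule conv_partial[where R = R, OF g(1) _ CkH]) (rule g0)
 have pW1: "partial 1 W = conv (%x. g x $ 2) (eta \<mu>)" unfolding pW partial_etaH ..
 \<comment> \<open>The reflected kernel is a smooth function on the plane; orthogonality of
   \<open>g\<close> to its gradient exchanges the first component of \<open>g\<close> for the
   second.\<close>
 have pW2: "partial 2 W x = - conv (%x. g x $ 1) (eta \<mu>) x" for x
 proof -
  define v where "v y = etaH \<mu> (x - y)" for y
  have "smooth (%y. etaH \<mu> ((-1) *\<^sub>R y + x))" by (rule smooth_affine[OF smooth_etaH])
  then have sv: "smooth v" by (simp add: v_def[abs_def])
  have pv: "partial i v y = - partial i (etaH \<mu>) (x - y)" for i y
   using partial_affine(1)[of "etaH \<mu>" "-1" y x i] smooth_differentiable[OF smooth_etaH] by (simp add: v_def[abs_def])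
  have i1: "integrable lborel (%y. g y $ 1 * eta \<mu> (x - y))"
   by (rule conv_integrable[where R = R, OF g(1) _ smooth_continuous[OF smooth_eta]]) (rule g0)
  have i2: "integrable lborel (%y. g y $ 2 * partial 2 (etaH \<mu>) (x - y))"
   by (rule conv_integrable[where R = R, OF g(1) _ smooth_continuous[OF smooth_partial[OF smooth_etaH]]]) (rule g0)
  have "(%y. g y \<bullet> grad v y) = (%y. - (g y $ 1 * eta \<mu> (x - y)) - g y $ 2 * partial 2 (etaH \<mu>) (x - y))"
   by (auto simp: inner_real2 grad_def pv partial_etaH)
  then have "0 = - conv (%x. g x $ 1) (eta \<mu>) x - conv (%x. g x $ 2) (partial 2 (etaH \<mu>)) x"
   using orth[OF sv] i1 i2 by (simp add: conv_def)
  then show ?thesis by (simp add: pW)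
 qed
 \<comment> \<open>The factor 1/c undoes the chain rule for the dilation \<open>T\<close>, and the
   sign matches the orientation of \<open>curl\<close>.\<close>
 define \<psi> where "\<psi> x = - (1 / c) * W (T x)" for x
 have sWT: "smooth (%x. W (T x))" unfolding T_def by (rule smooth_affine[OF sW])
 have s\<psi>: "smooth \<psi>" unfolding \<psi>_def[abs_def] by (intro smooth_mult smooth_const sWT)
 have p\<psi>: "partial i \<psi> x = - partial i W (T x)" for i x
 proof -
  have "partial i \<psi> x = - (1 / c) * partial i (%x. W (T x)) x" unfolding \<psi>_def[abs_def] by (rule partial_cmult[OF sWT])
  also have "partial i (%x. W (T x)) x = c * partial i W (T x)"
   unfolding T_def by (rule partial_affine(1)[OF smooth_differentiable[OF sW]])
  finally show ?thesis using c by simp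
 qed
 have curl\<psi>: "curl \<psi> x $ i = moll z c \<mu> (%x. g x $ i) x" for x i
  using exhaust_2[of i] by (auto simp: curl_def p\<psi> pW1 pW2 moll_def T_def)
 have m0: "moll z c \<mu> (%x. g x $ i) x = 0" if x: "x \<notin> Q" for x i
 proof (rule ccontr)
  assume "moll z c \<mu> (%x. g x $ i) x ~= 0"
  then obtain y where y: "g y $ i ~= 0" "eta \<mu> (T x - y) ~= 0" unfolding moll_def T_def by (rule conv_nonzero)
  have "y \<in> D" using g(2)[of y] y(1) by force
  then show False using Q(4) eta_support[OF pos(2) y(2)] x by blast
 qed
 have grad0: "(\<psi> has_derivative (%h. 0)) (at x)" if "x \<notin> Q" for x
 proof -
  have "partial 1 \<psi> x = 0" "partial 2 \<psi> x = 0"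
   using curl\<psi>[of x 1] curl\<psi>[of x 2] m0[OF that] by (auto simp: curl_def)
  then have "grad \<psi> x \<bullet> h = 0" for h by (simp add: inner_real2 grad_def)
  then show ?thesis using has_derivative_grad[OF smooth_differentiable[OF s\<psi>], of x] by simp
 qed
 have conn: "connected (- Q)" using Q by (intro connected_complement_bounded_convex compact_imp_bounded) auto
 have opn: "open (- Q)" using Q(1) by (intro open_Compl compact_imp_closed)
 obtain RQ where RQ: "Q \<subseteq> cball 0 RQ" using Q(1) bounded_subset_ballD[OF compact_imp_bounded[OF Q(1)], of 0] ball_subset_cball by (metis order_trans)
 \<comment> \<open>The point \<open>p\<close> lies so far to the left that its image under
   \<open>T\<close> is left of \<open>D\<close>, where the one-sided kernel gives zero. The gradient
   of \<open>\<psi>\<close> vanishes on the connected complement of \<open>Q\<close>, so this single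
   value determines \<open>\<psi>\<close> there.\<close>
 define s where "s = \<bar>RQ\<bar> + \<bar>R\<bar> + \<bar>(z - c *\<^sub>R z) $ 1\<bar> + 1"
 define p where "p = - (s *\<^sub>R axis (1::2) (1::real))"
 have s0: "s > 0" by (simp add: s_def)
 have pQ: "p \<in> - Q"
 proof
  assume "p \<in> Q"
  then have "norm p <= RQ" using RQ by auto
  then show False using s0 by (simp add: p_def s_def)
 qed
 have \<psi>p: "\<psi> p = 0"
 proof (rule ccontr)
  assume "\<psi> p ~= 0"
  then have "W (T p) ~= 0" by (simp add: \<psi>_def)
  then obtain y where y: "g y $ 2 ~= 0" "etaH \<mu> (T p - y) ~= 0" unfolding W_def by (rule conv_nonzero)
  have "y \<in> cball 0 R" using g0[of y 2] y(1) by blast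
  then have "\<bar>y $ 1\<bar> <= R" using component_le_norm_cart[of y 1] by simp
  moreover have "c * s \<ge> s" using c s0 by simp
  ultimately have "(T p - y) $ 1 <= 0" by (simp add: T_def p_def s_def)
  then have "bump_int ((T p - y) $ 1 / \<mu>) = 0" using pos by (intro bump_int_le_0) (simp add: divide_nonpos_pos)
  then show False using y(2) by (simp add: etaH_def)
 qed
 have "\<psi> x = 0" if "x \<notin> Q" for x
 proof -
  have "\<psi> x = \<psi> p"
   by (rule has_derivative_zero_unique_connected[OF opn conn grad0]) (use that pQ in auto)
  then show ?thesis using \<psi>p by simp
 qed
 then have "test_function D \<psi>" by (rule test_functionI[OF s\<psi> Q(1,3)])
 then show thesis using that curl\<psi> by (simp add: c_def)
qed

lemma bounded_continuous_sqint:
 fixes k :: "real^2 => 'b::euclidean_space"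
 assumes D: "open D" "bounded D" and k: "continuous_on UNIV k"
 shows "sqint (lebesgue_on D) k"
 unfolding sqint_def
proof
 have [measurable]: "k \<in> borel_measurable borel" "D \<in> sets borel" using k D by (auto intro: borel_measurable_continuous_onI)
 show "k \<in> borel_measurable (lebesgue_on D)" by (intro measurable_restrict_space1 measurable_completion) simp
 have "compact (closure D)" using D by simp
 then have "compact ((%x. (norm (k x))^2) ` closure D)"
  by (intro compact_continuous_image continuous_intros continuous_on_subset[OF k]) auto
 then have "bounded ((%x. (norm (k x))^2) ` closure D)" by (rule compact_imp_bounded)
 then obtain B where B: "!!x. x \<in> closure D ==> norm ((norm (k x))^2) <= B" unfolding bounded_iff by blast
 have "integrable lborel (%x. B * indicator D x)"
  using emeasure_bounded_finite[OF D(2)] by (intro integrable_mult_right integrable_real_indicator) auto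
 then have "integrable lborel (%x. indicator D x *\<^sub>R (norm (k x))^2)"
 proof (rule Bochner_Integration.integrable_bound)
  show "AE x in lborel. norm (indicator D x *\<^sub>R (norm (k x))^2) <= norm (B * indicator D x)"
  proof (rule AE_I2)
   fix x show "norm (indicator D x *\<^sub>R (norm (k x))^2) <= norm (B * indicator D x)"
    using B[of x] closure_subset[of D] by (cases "x \<in> D") auto
  qed
 qed measurable
 then show "integrable (lebesgue_on D) (%x. (norm (k x))^2)"
  by (subst integral_lebesgue_on_lborel(1)) auto
qed

lemma finite_measure_lebesgue_on:
 assumes "open D" "bounded D" shows "finite_measure (lebesgue_on (D :: (real^2) set))"
proof (rule finite_measureI)
 have "D \<in> sets borel" "emeasure lborel D < \<infinity>" using assms emeasure_bounded_finite by auto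
 then show "emeasure (lebesgue_on D) (space (lebesgue_on D)) ~= \<infinity>"
  by (simp add: emeasure_restrict_space space_restrict_space)
qed

text \<open>If the distance to all such sums were positive, the residual r of the best approximation
  would be orthogonal to all gradients and all curls. Orthogonality to gradients makes each
  mollification of r the curl of a test function; orthogonality to curls then annihilates the
  pairing of r with its mollifications, whose limit is the squared norm of r.\<close>

lemma helmholtz_density:
 assumes D: "convex D" "open D" "bounded D" and Dne: "D ~= {}" and \<tau>: "sqint (lebesgue_on D) \<tau>" and e: "e > 0"
 obtains v \<psi> where "smooth v" "test_function D \<psi>"
  "integral\<^sup>L (lebesgue_on D) (%x. (norm (\<tau> x - (grad v x + curl \<psi> x)))^2) < (e::real)"
proof (rule ccontr)
 assume no: "\<not> thesis"
 note main = that
 obtain z \<rho> where \<rho>: "\<rho> > 0" "cball z \<rho> \<subseteq> D" using open_convex_cball[OF D(2) Dne] .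
 define X where "X = {%x. grad v x + curl \<psi> x | v \<psi>. smooth v \<and> test_function D \<psi>}"
 have t0: "test_function D (%x. 0)" by (rule test_functionI[OF smooth_const, of "{}"]) auto
 have sm: "smooth \<psi>" if "test_function D \<psi>" for \<psi> using that by (simp add: test_function_def)
 have cont: "continuous_on UNIV x" if "x \<in> X" for x
  using that unfolding X_def by (auto intro!: continuous_intros grad_continuous curl_continuous sm)
 have X1: "sqint (lebesgue_on D) x" if "x \<in> X" for x
  by (rule bounded_continuous_sqint[OF D(2,3) cont[OF that]])
 have X2: "X ~= {}" unfolding X_def using t0 smooth_const[of 0] by blast
 have X3: "(%t. x t + c *\<^sub>R y t) \<in> X" if xy: "x \<in> X" "y \<in> X" for x y c
 proof -
  obtain v \<psi> v' \<psi>' where v: "smooth v" "test_function D \<psi>" "x = (%x. grad v x + curl \<psi> x)"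
   "smooth v'" "test_function D \<psi>'" "y = (%x. grad v' x + curl \<psi>' x)"
   using xy unfolding X_def by blast
  have s: "smooth (%x. v x + c * v' x)" "smooth (%x. \<psi> x + c * \<psi>' x)"
   using v sm by (auto intro!: smooth_add smooth_mult smooth_const)
  have p: "partial i (%x. a x + c * b x) x = partial i a x + c * partial i b x" if "smooth a" "smooth b" for a b i x
   using partial_add[OF that(1) smooth_mult[OF smooth_const that(2)], of i c x] partial_cmult[OF that(2), of i c x] by (simp only:)
  have k: "compact (closure {x. \<psi> x ~= 0})" "closure {x. \<psi> x ~= 0} \<subseteq> D"
   "compact (closure {x. \<psi>' x ~= 0})" "closure {x. \<psi>' x ~= 0} \<subseteq> D"
   using v(2) v(5) by (simp_all only: test_function_def)
  have t: "test_function D (%x. \<psi> x + c * \<psi>' x)"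
  proof (rule test_functionI[OF s(2)])
   show "compact (closure {x. \<psi> x ~= 0} \<union> closure {x. \<psi>' x ~= 0})"
    by (intro compact_Un k)
   show "closure {x. \<psi> x ~= 0} \<union> closure {x. \<psi>' x ~= 0} \<subseteq> D"
    by (intro Un_least k)
   fix x assume "x \<notin> closure {x. \<psi> x ~= 0} \<union> closure {x. \<psi>' x ~= 0}"
   then have "x \<notin> {x. \<psi> x ~= 0}" "x \<notin> {x. \<psi>' x ~= 0}"
    using closure_subset[THEN subsetD, of x "{x. \<psi> x ~= 0}"] closure_subset[THEN subsetD, of x "{x. \<psi>' x ~= 0}"] by (metis UnCI)+
   then show "\<psi> x + c * \<psi>' x = 0" by simp
  qed
  have "(%t. x t + c *\<^sub>R y t) = (%x. grad (%x. v x + c * v' x) x + curl (%x. \<psi> x + c * \<psi>' x) x)"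
  proof
   fix a
   have "partial i (%x. v x + c * v' x) a = partial i v a + c * partial i v' a"
    "partial i (%x. \<psi> x + c * \<psi>' x) a = partial i \<psi> a + c * partial i \<psi>' a" for i
    by (rule p[OF v(1,4)], rule p[OF sm[OF v(2)] sm[OF v(5)]])
   then show "x a + c *\<^sub>R y a = grad (%x. v x + c * v' x) a + curl (%x. \<psi> x + c * \<psi>' x) a"
    unfolding v(3,6) by (simp add: vec_eq_iff forall_2 grad_def curl_def algebra_simps)
  qed
  then show ?thesis unfolding X_def using s t by blast
 qed
 have low: "e <= integral\<^sup>L (lebesgue_on D) (%t. (norm (\<tau> t - x t))^2)" if xX: "x \<in> X" for x
 proof (rule ccontr)
  assume "\<not> ?thesis"
  then have less: "integral\<^sup>L (lebesgue_on D) (%t. (norm (\<tau> t - x t))^2) < e" by simp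
  obtain v \<psi> where v: "smooth v" "test_function D \<psi>" "x = (%x. grad v x + curl \<psi> x)"
   using xX unfolding X_def by blast
  have thesis by (rule main[OF v(1,2)]) (use less v(3) in simp)
  with no show False ..
 qed
 obtain r where r: "sqint (lebesgue_on D) r" "!!x. x \<in> X ==> integral\<^sup>L (lebesgue_on D) (%t. r t \<bullet> x t) = 0"
  "0 < integral\<^sup>L (lebesgue_on D) (%t. (norm (r t))^2)"
  using L2_orthogonal_residual[OF finite_measure_lebesgue_on[OF D(2,3)] \<tau> X1 X2 X3 e low] by blast
 have Db: "D \<in> sets borel" using D by simp
 obtain g where g: "g \<in> borel_measurable borel" "!!x. x \<notin> D ==> g x = 0"
  "AE x in lebesgue_on D. r x = g x" "sqint lborel g"
  using sqint_borel_representative[OF Db r(1)] by blast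
 have rm: "r \<in> borel_measurable (lebesgue_on D)" using r(1) by (simp add: sqint_def)
 have orth: "(LBINT x. g x \<bullet> x' x) = 0" if "x' \<in> X" for x'
  using integral_representative(1)[OF Db g(1,2,3) rm borel_measurable_continuous_onI[OF cont[OF that]]] r(2)[OF that] by simp
 have grad_const: "grad (%x. 0) x = 0" "curl (%x. 0) x = 0" for x
 proof -
  have "partial i (%x. 0) x = 0" for i by (simp add: partial_def)
  then show "grad (%x. 0) x = 0" "curl (%x. 0) x = 0"
   by (simp_all add: grad_def curl_def vec_eq_iff forall_2)
 qed
 have orthg: "(LBINT x. g x \<bullet> grad v x) = 0" if "smooth v" for v
 proof -
  have "(%x. grad v x + curl (%x. 0) x) \<in> X" unfolding X_def using that t0 by blast
  from orth[OF this] show ?thesis by (simp add: grad_const)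
 qed
 have orthc: "(LBINT x. g x \<bullet> curl \<psi> x) = 0" if "test_function D \<psi>" for \<psi>
 proof -
  have "(%x. grad (%x. 0) x + curl \<psi> x) \<in> X" unfolding X_def using that smooth_const[of 0] by blast
  from orth[OF this] show ?thesis by (simp add: grad_const)
 qed
 have gi: "sqint lborel (%x. g x $ i)" for i
  unfolding sqint_def
 proof
  have [measurable]: "g \<in> borel_measurable borel" by fact
  show m: "(%x. g x $ i) \<in> borel_measurable lborel"
  proof -
   have "(%x. g x \<bullet> axis i 1) \<in> borel_measurable lborel" by measurable
   then show ?thesis by (simp add: inner_axis)
  qed
  have "integrable lborel (%x. (norm (g x))^2)" using g(4) by (simp add: sqint_def)
  then show "integrable lborel (%x. (norm (g x $ i))^2)"
  proof (rule Bochner_Integration.integrable_bound)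
   show "AE x in lborel. norm ((norm (g x $ i))^2) <= norm ((norm (g x))^2)"
   proof (rule AE_I2)
    fix x
    have "\<bar>g x $ i\<bar>^2 <= (norm (g x))^2" by (intro power_mono component_le_norm_cart abs_ge_zero)
    then show "norm ((norm (g x $ i))^2) <= norm ((norm (g x))^2)" by simp
   qed
   show "(%x. (norm (g x $ i))^2) \<in> borel_measurable lborel" using m by simp
  qed
 qed
 obtain R where R: "D \<subseteq> cball 0 R" using bounded_subset_ballD[OF D(3), of 0] ball_subset_cball by (metis order_trans)
 have g0: "g y $ i = 0" if "y \<notin> D" for y i using g(2)[OF that] by simp
 have g0R: "g y $ i = 0" if y: "y \<notin> cball 0 R" for y i
 proof (rule g0)
  show "y \<notin> D" using y R by blast
 qed
 have gint: "integrable lborel (%x. g x $ i)" for i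
  by (rule sqint_bounded_support_integrable[where R = R, OF gi]) (rule g0R)
 note ms = mollifier_sequence[OF \<rho>(1)]
 define m where "m n i = moll z (1 + 2 * (1 / real (Suc n)) / \<rho>) (1 / real (Suc n)) (%x. g x $ i)" for n i
 have lim: "(%n. \<integral>x. g x $ i * m n i x \<partial>lborel) \<longlonglongrightarrow> (LBINT x. (g x $ i)^2)" for i
  unfolding m_def by (rule moll_converges[OF D(2,3) gi g0 ms])
 have mint: "integrable lborel (%x. g x $ i * m n i x)" for i n
  unfolding m_def
  by (rule moll_bilinear_bound(1)[where R = R and t = 1, OF gi _ gi _ ms(1,3)])
   (rule g0R, assumption, rule g0R, assumption, simp)
 have sum0: "(LBINT x. g x $ 1 * m n 1 x) + (LBINT x. g x $ 2 * m n 2 x) = 0" for n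
 proof -
  obtain \<psi> where \<psi>: "test_function D \<psi>" "!!x i. curl \<psi> x $ i = m n i x"
   using mollified_stream_function[OF D \<rho>(2,1) ms(1) gint g(2) orthg] unfolding m_def by blast
  have "(LBINT x. g x $ 1 * m n 1 x + g x $ 2 * m n 2 x) = 0"
   using orthc[OF \<psi>(1)] by (simp add: inner_real2 \<psi>(2))
  then show ?thesis using mint by simp
 qed
 have "(%n. 0) \<longlonglongrightarrow> (LBINT x. (g x $ 1)^2) + (LBINT x. (g x $ 2)^2)"
  using tendsto_add[OF lim[of 1] lim[of 2]] by (simp only: sum0)
 then have "(LBINT x. (g x $ 1)^2) + (LBINT x. (g x $ 2)^2) = 0" by (simp add: LIMSEQ_const_iff)
 moreover have "(LBINT x. (norm (g x))^2) = (LBINT x. (g x $ 1)^2) + (LBINT x. (g x $ 2)^2)"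
  using gi[of 1] gi[of 2] by (simp add: power2_norm_eq_inner inner_real2 sqint_def flip: power2_eq_square)
 ultimately show False using integral_representative(2)[OF Db g(1,2,3) rm, of "%x. 0"] r(3) by simp
qed

section \<open>Convex polygons\<close>

fun poly_path :: "(real^2) list => real => real^2" where
 "poly_path [a, b] = linepath a b"
| "poly_path (a # b # c # xs) = linepath a b +++ poly_path (b # c # xs)"
| "poly_path _ = linepath 0 0"

text \<open>The edges of the open polygonal line; \<open>edges\<close> contains the closing edge in
  addition.\<close>

definition chain :: "(real^2) list => ((real^2) \<times> (real^2)) set" where
 "chain vs = set (zip vs (tl vs))"

lemma poly_path_start: "2 <= length vs ==> pathstart (poly_path vs) = hd vs"
 by (induction vs rule: poly_path.induct) auto

lemma poly_path_finish: "2 <= length vs ==> pathfinish (poly_path vs) = last vs"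
 by (induction vs rule: poly_path.induct) auto

lemma poly_path_image: "2 <= length vs ==> path_image (poly_path vs) = (\<Union>(a, b)\<in>chain vs. closed_segment a b)"
proof (induction vs rule: poly_path.induct)
 case (2 a b c xs)
 have "path_image (poly_path (a # b # c # xs)) = closed_segment a b \<union> path_image (poly_path (b # c # xs))"
  using poly_path_start[of "b # c # xs"] by (simp add: path_image_join)
 then show ?case using 2 by (simp add: chain_def)
qed (auto simp: chain_def)

lemma chain_vertices: "(u, v) \<in> chain vs ==> u \<in> set vs \<and> v \<in> set (tl vs)"
 unfolding chain_def by (auto dest: set_zip_leftD set_zip_rightD)

text \<open>The first vertex does not occur in the remaining list, so the first edge can meet the
  rest only in its second endpoint.\<close>

lemma poly_path_arc:
 assumes "2 <= length vs" "distinct vs"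
  "!!a b c d. (a, b) \<in> chain vs ==> (c, d) \<in> chain vs ==> (a, b) ~= (c, d) ==>
   closed_segment a b \<inter> closed_segment c d = {a, b} \<inter> {c, d}"
 shows "arc (poly_path vs)"
 using assms
proof (induction vs rule: poly_path.induct)
 case (1 a b)
 then show ?case by simp
next
 case (2 a b c xs)
 have sub: "chain (b # c # xs) \<subseteq> chain (a # b # c # xs)" by (auto simp: chain_def)
 have ab: "(a, b) \<in> chain (a # b # c # xs)" by (simp add: chain_def)
 have "arc (poly_path (b # c # xs))"
 proof (rule 2(1))
  show "closed_segment u v \<inter> closed_segment u' v' = {u, v} \<inter> {u', v'}"
   if "(u, v) \<in> chain (b # c # xs)" "(u', v') \<in> chain (b # c # xs)" "(u, v) ~= (u', v')" for u v u' v'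
   using 2(4)[of u v u' v'] sub that by blast
 qed (use 2(3) in auto)
 moreover have "path_image (linepath a b) \<inter> path_image (poly_path (b # c # xs)) \<subseteq> {b}"
 proof
  fix x assume x: "x \<in> path_image (linepath a b) \<inter> path_image (poly_path (b # c # xs))"
  then obtain u v where uv: "(u, v) \<in> chain (b # c # xs)" "x \<in> closed_segment u v"
   using poly_path_image[of "b # c # xs"] by auto
  have mem: "u \<in> set (b # c # xs)" "v \<in> set (b # c # xs)" using chain_vertices[OF uv(1)] by auto
  have "a \<notin> set (b # c # xs)" using 2(3) by simp
  then have "u ~= a" "v ~= a" using mem by auto
  moreover have "x \<in> {a, b} \<inter> {u, v}"
   using 2(4)[OF ab subsetD[OF sub uv(1)]] \<open>u ~= a\<close> x uv(2) by auto
  ultimately show "x \<in> {b}" by auto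
 qed
 ultimately show ?case
 proof -
  assume A: "arc (poly_path (b # c # xs))" "path_image (linepath a b) \<inter> path_image (poly_path (b # c # xs)) \<subseteq> {b}"
  have st: "pathstart (poly_path (b # c # xs)) = b" using poly_path_start[of "b # c # xs"] by simp
  have "arc (linepath a b)" using 2(3) by (intro arc_linepath) auto
  then show ?thesis unfolding poly_path.simps using A st by (intro arc_join) simp_all
 qed
qed auto

lemma zip_append_last: "zip (x # xs) (xs @ [y]) = zip (x # xs) xs @ [(last (x # xs), y)]"
proof (induction xs arbitrary: x)
 case (Cons a xs)
 from Cons.IH[of a] show ?case by (simp only: append_Cons zip_Cons_Cons last_ConsR list.distinct not_False_eq_True)
qed simp

lemma edges_chain: assumes "vs ~= []" shows "edges vs = insert (last vs, hd vs) (chain vs)"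
proof -
 obtain x xs where vs: "vs = x # xs" using assms by (cases vs) auto
 have "zip vs (rotate1 vs) = zip (x # xs) (xs @ [x])" by (simp only: vs rotate1.simps)
 also have "... = zip (x # xs) xs @ [(last (x # xs), x)]" by (rule zip_append_last)
 finally have "set (zip vs (rotate1 vs)) = set (zip (x # xs) xs @ [(last (x # xs), x)])" by (rule arg_cong)
 then have "edges vs = insert (last (x # xs), x) (set (zip (x # xs) xs))"
  unfolding edges_def set_append by (simp only: list.set Un_insert_right Un_empty_right)
 moreover have "chain vs = set (zip (x # xs) xs)" "last vs = last (x # xs)" "hd vs = x"
  by (simp_all only: chain_def vs list.sel)
 ultimately show ?thesis by (simp only:)
qed

lemma simple_polygon_segments:
 assumes "simple_polygon vs" "(a, b) \<in> edges vs" "(c, d) \<in> edges vs" "(a, b) ~= (c, d)"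
 shows "closed_segment a b \<inter> closed_segment c d = {a, b} \<inter> {c, d}"
proof -
 have all: "\<forall>(a, b)\<in>edges vs. \<forall>(c, d)\<in>edges vs. (a, b) ~= (c, d) \<longrightarrow>
   closed_segment a b \<inter> closed_segment c d = {a, b} \<inter> {c, d}"
  using assms(1) unfolding simple_polygon_def by (elim conjE)
 from bspec[OF bspec[OF all assms(2), unfolded prod.case] assms(3), unfolded prod.case, THEN mp, OF assms(4)]
 show ?thesis .
qed

text \<open>Prepares the use of Jordan's theorem: the open polygonal line and the closing edge are
  two arcs that share only their endpoints.\<close>

lemma polygon_boundary_simple_loop:
 assumes "simple_polygon vs"
 obtains \<gamma> where "simple_path \<gamma>" "pathfinish \<gamma> = pathstart \<gamma>" "path_image \<gamma> = polygon_boundary vs"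
proof -
 have len: "3 <= length vs" and dis: "distinct vs"
  and seg: "!!a b c d. (a, b) \<in> edges vs ==> (c, d) \<in> edges vs ==> (a, b) ~= (c, d) ==>
   closed_segment a b \<inter> closed_segment c d = {a, b} \<inter> {c, d}"
  using assms simple_polygon_segments[OF assms] by (simp_all only: simple_polygon_def)
 have ne: "vs ~= []" using len by auto
 have len2: "2 <= length vs" using len by simp
 note E = edges_chain[OF ne]
 define l where "l = linepath (last vs) (hd vs)"
 have lh: "last vs ~= hd vs" using dis len by (cases vs) auto
 have arc1: "arc (poly_path vs)" using poly_path_arc[OF len2 dis] seg E by simp
 have arc2: "arc l" using lh by (simp add: l_def)
 have int: "path_image (poly_path vs) \<inter> path_image l \<subseteq> {pathstart (poly_path vs), pathstart l}"
 proof
  fix x assume x: "x \<in> path_image (poly_path vs) \<inter> path_image l"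
  then obtain u v where uv: "(u, v) \<in> chain vs" "x \<in> closed_segment u v" using poly_path_image[OF len2] by auto
  have "hd vs \<notin> set (tl vs)" using dis ne by (cases vs) auto
  then have "(u, v) ~= (last vs, hd vs)" using chain_vertices[OF uv(1)] by auto
  then have "closed_segment u v \<inter> closed_segment (last vs) (hd vs) = {u, v} \<inter> {last vs, hd vs}"
   by (intro seg) (use uv(1) E in simp_all)
  then have "x \<in> {last vs, hd vs}" using x uv(2) by (auto simp: l_def)
  then show "x \<in> {pathstart (poly_path vs), pathstart l}" using poly_path_start[OF len2] by (auto simp: l_def)
 qed
 have "simple_path (poly_path vs +++ l)"
  by (rule simple_path_join_loop[OF arc1 arc2 _ _ int]) (simp_all add: poly_path_start[OF len2] poly_path_finish[OF len2] l_def)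
 moreover have "pathfinish (poly_path vs +++ l) = pathstart (poly_path vs +++ l)"
  using poly_path_start[OF len2] by (simp add: l_def)
 moreover have "path_image (poly_path vs +++ l) = polygon_boundary vs"
  using poly_path_finish[OF len2] poly_path_image[OF len2]
  by (subst path_image_join) (auto simp: l_def polygon_boundary_def E)
 ultimately show thesis using that by blast
qed

lemma polygon_boundary_compact: "compact (polygon_boundary vs)"
 unfolding polygon_boundary_def by (intro compact_UN) (auto simp: edges_def)

lemma region_open: "open (region vs)"
 unfolding region_def by (intro open_inside compact_imp_closed polygon_boundary_compact)

lemma region_bounded: "bounded (region vs)"
 unfolding region_def by (intro bounded_inside compact_imp_bounded polygon_boundary_compact)

text \<open>A convex region is connected, hence a full component of the complement of the boundary
  curve; by Jordan-Brouwer such a component has the whole curve as its frontier.\<close>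

lemma region_frontier:
 assumes K: "simple_polygon vs" "convex (region vs)" "region vs ~= {}"
 shows "frontier (region vs) = polygon_boundary vs"
proof -
 let ?B = "polygon_boundary vs"
 obtain \<gamma> where \<gamma>: "simple_path \<gamma>" "pathfinish \<gamma> = pathstart \<gamma>" "path_image \<gamma> = ?B"
  using polygon_boundary_simple_loop[OF K(1)] .
 have "?B homeomorphic sphere (0::complex) 1"
  using homeomorphic_simple_path_image_circle[OF \<gamma>(1,2), of 1 0] \<gamma>(3) by simp
 moreover have "sphere (0::complex) 1 homeomorphic sphere (0::real^2) 1"
  by (rule homeomorphic_spheres_gen) auto
 ultimately have hom: "?B homeomorphic sphere (0::real^2) 1" by (rule homeomorphic_trans)
 obtain x where x: "x \<in> region vs" using K(3) by auto
 have sub: "region vs \<subseteq> - ?B" unfolding region_def using inside_no_overlap[of ?B] by blast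
 have "region vs = connected_component_set (- ?B) x"
 proof
  show "region vs \<subseteq> connected_component_set (- ?B) x"
   by (rule connected_component_maximal[OF x convex_connected[OF K(2)] sub])
  show "connected_component_set (- ?B) x \<subseteq> region vs"
   using x unfolding region_def by (auto intro: inside_same_component)
 qed
 then have "region vs \<in> components (- ?B)" using x sub by (auto simp: components_def)
 then show ?thesis by (intro Jordan_Brouwer_frontier[OF hom]) auto
qed

section \<open>Inner normals and the triangles over the edges\<close>

lemma edges_finite: "finite (edges vs)" by (simp add: edges_def)

definition cross :: "real^2 => real^2 => real" where
 "cross u v = u $ 1 * v $ 2 - v $ 1 * u $ 2"

lemma edge_ne: assumes "simple_polygon vs" "(a, b) \<in> edges vs" shows "a ~= b"
proof -
 have len: "3 <= length vs" and dis: "distinct vs" using assms by (auto simp: simple_polygon_def)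
 have ne: "vs ~= []" using len by auto
 have "last vs ~= hd vs" using dis len by (cases vs) auto
 moreover have "a ~= b" if h: "(a, b) \<in> chain vs"
 proof -
  obtain i where i: "i < length (tl vs)" "a = vs ! i" "b = tl vs ! i" using h by (auto simp: chain_def set_zip)
  then have "b = vs ! Suc i" by (simp add: nth_tl)
  then show ?thesis using dis i nth_eq_iff_index_eq[of vs i "Suc i"] by simp
 qed
 ultimately show ?thesis using assms(2) edges_chain[OF ne] by auto
qed

lemma edge_in_frontier:
 assumes K: "simple_polygon vs" "convex (region vs)" "region vs ~= {}" and e: "(a, b) \<in> edges vs"
 shows "closed_segment a b \<subseteq> frontier (region vs)"
 using region_frontier[OF K] e by (auto simp: polygon_boundary_def)

text \<open>A supporting line at the midpoint of the edge contains the whole edge, because both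
  endpoints lie on its nonnegative side and the midpoint is their mean. Sliding z against the normal
  by any t < r stays in the ball, which gives the distance bound.\<close>

lemma edge_inner_normal:
 assumes K: "simple_polygon vs" "convex (region vs)" and e: "(a, b) \<in> edges vs" and B: "ball z r \<subseteq> region vs" "r > 0"
 obtains \<nu> where "norm \<nu> = 1" "\<nu> \<bullet> (b - a) = 0" "!!x. x \<in> region vs ==> 0 < \<nu> \<bullet> (x - a)"
  "r <= \<nu> \<bullet> (z - a)"
proof -
 let ?D = "region vs"
 have ne: "?D ~= {}" using B by auto
 define m where "m = midpoint a b"
 have fr: "closed_segment a b \<subseteq> frontier ?D" by (rule edge_in_frontier[OF K ne e])
 have inm: "interior ?D = ?D" by (rule interior_open[OF region_open])
 have m: "m \<in> closure ?D" "m \<notin> ?D" "a \<in> closure ?D" "b \<in> closure ?D"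
  using fr by (auto simp: m_def frontier_def inm midpoint_in_closed_segment subset_eq)
 have ri: "rel_interior (closure ?D) = ?D"
  using convex_rel_interior_closure[OF K(2)] rel_interior_open[OF region_open] by simp
 obtain \<nu>0 where \<nu>0: "\<nu>0 ~= 0" "!!y. y \<in> closure ?D ==> \<nu>0 \<bullet> m <= \<nu>0 \<bullet> y" "!!y. y \<in> ?D ==> \<nu>0 \<bullet> m < \<nu>0 \<bullet> y"
  using supporting_hyperplane_rel_boundary[OF convex_closure[OF K(2)] m(1)] m(2) unfolding ri by blast
 have "\<nu>0 \<bullet> m = (\<nu>0 \<bullet> a + \<nu>0 \<bullet> b) / 2" by (simp add: m_def midpoint_def inner_add_right)
 then have ab: "\<nu>0 \<bullet> a = \<nu>0 \<bullet> m" "\<nu>0 \<bullet> b = \<nu>0 \<bullet> m" using \<nu>0(2)[OF m(3)] \<nu>0(2)[OF m(4)] by auto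
 define \<nu> where "\<nu> = (1 / norm \<nu>0) *\<^sub>R \<nu>0"
 have n0: "norm \<nu>0 > 0" using \<nu>0(1) by simp
 have 1: "norm \<nu> = 1" using n0 by (simp add: \<nu>_def)
 have 2: "\<nu> \<bullet> (b - a) = 0" by (simp add: \<nu>_def inner_diff_right ab)
 have 3: "0 < \<nu> \<bullet> (x - a)" if "x \<in> ?D" for x
 proof -
  have "\<nu> \<bullet> (x - a) = (\<nu>0 \<bullet> x - \<nu>0 \<bullet> m) / norm \<nu>0"
   by (simp add: \<nu>_def inner_diff_right ab diff_divide_distrib)
  moreover have "0 < (\<nu>0 \<bullet> x - \<nu>0 \<bullet> m) / norm \<nu>0" using \<nu>0(3)[OF that] n0 by (intro divide_pos_pos) simp_all
  ultimately show ?thesis by simp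
 qed
 have "r <= \<nu> \<bullet> (z - a)"
 proof (rule field_le_epsilon)
  fix \<epsilon> :: real assume "\<epsilon> > 0"
  define t where "t = max 0 (r - \<epsilon>)"
  have t: "0 <= t" "t < r" "r <= t + \<epsilon>" using B(2) \<open>\<epsilon> > 0\<close> by (auto simp: t_def)
  have "z - t *\<^sub>R \<nu> \<in> ball z r" using 1 t by (simp add: dist_norm)
  then have "0 < \<nu> \<bullet> (z - t *\<^sub>R \<nu> - a)" using 3 B(1) by blast
  also have "... = \<nu> \<bullet> (z - a) - t" using 1 by (simp add: inner_diff_right norm_eq_1)
  finally show "r <= \<nu> \<bullet> (z - a) + \<epsilon>" using t by linarith
 qed
 then show thesis using that[OF 1 2 3] by blast
qed

text \<open>In the plane w is a multiple of the rotated normal, so the area spanned with w is the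
  length of w times the height.\<close>

lemma cross_normal:
 assumes "norm \<nu> = 1" "\<nu> \<bullet> w = 0"
 shows "\<bar>cross u w\<bar> = norm w * \<bar>\<nu> \<bullet> u\<bar>"
proof -
 have n: "\<nu> $ 1 * \<nu> $ 1 + \<nu> $ 2 * \<nu> $ 2 = 1" using assms(1) by (simp add: norm_eq_1 inner_vec_def sum_2)
 have p: "\<nu> $ 1 * w $ 1 + \<nu> $ 2 * w $ 2 = 0" using assms(2) by (simp add: inner_vec_def sum_2)
 define k where "k = \<nu> $ 1 * w $ 2 - \<nu> $ 2 * w $ 1"
 have w1: "w $ 1 = - k * \<nu> $ 2" using n p unfolding k_def by algebra
 have w2: "w $ 2 = k * \<nu> $ 1" using n p unfolding k_def by algebra
 have "(norm w)^2 = k^2" using n by (simp add: power2_norm_eq_inner inner_vec_def sum_2 w1 w2) algebra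
 then have "norm w = \<bar>k\<bar>" by (metis norm_ge_zero abs_of_nonneg real_sqrt_abs)
 moreover have "cross u w = k * (\<nu> \<bullet> u)" by (simp add: cross_def w1 w2 inner_vec_def sum_2 algebra_simps)
 ultimately show ?thesis by (simp add: abs_mult)
qed

lemma segment_interior:
 fixes D :: "'a::euclidean_space set"
 assumes "convex D" "open D" "z \<in> D" "y \<in> closure D" "0 <= s" "s < 1"
 shows "z + s *\<^sub>R (y - z) \<in> D"
proof -
 have "y - (1 - s) *\<^sub>R (y - z) \<in> interior D"
  by (rule mem_interior_closure_convex_shrink) (use assms in \<open>auto simp: interior_open\<close>)
 then show ?thesis using assms(2) by (simp add: interior_open algebra_simps)
qed

text \<open>Of two frontier points on one ray from z, the nearer one would lie in the open set D by
  convexity.\<close>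

lemma ray_frontier_unique:
 fixes D :: "'a::euclidean_space set"
 assumes D: "convex D" "open D" "z \<in> D" and y: "y \<in> frontier D" "y' \<in> frontier D"
  and s: "0 < s" "0 < s'" and eq: "z + s *\<^sub>R (y - z) = z + s' *\<^sub>R (y' - z)"
 shows "y = y'"
proof -
 have main: "\<not> s < s'" if "y \<in> frontier D" "y' \<in> frontier D" "0 < s" "0 < s'" "z + s *\<^sub>R (y - z) = z + s' *\<^sub>R (y' - z)"
  for y y' :: 'a and s s' :: real
 proof
  assume "s < s'"
  have "y' = z + (s / s') *\<^sub>R (y - z)"
  proof -
   have "s *\<^sub>R (y - z) = s' *\<^sub>R (y' - z)" using that(5) by simp
   then have "(1 / s') *\<^sub>R (s *\<^sub>R (y - z)) = (1 / s') *\<^sub>R (s' *\<^sub>R (y' - z))" by simp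
   then show ?thesis using that(4) by (simp add: algebra_simps)
  qed
  moreover have "z + (s / s') *\<^sub>R (y - z) \<in> D"
   by (rule segment_interior[OF D]) (use that \<open>s < s'\<close> in \<open>auto simp: frontier_def\<close>)
  ultimately show False using that(2) D(2) by (simp add: frontier_def interior_open)
 qed
 have "s = s'" using main[OF y s eq] main[OF y(2,1) s(2,1) eq[symmetric]] by simp
 then show ?thesis using eq s by simp
qed

text \<open>The open triangle with apex z over the edge e. By Cramer's rule s and t are the
  coordinates of x - z in the basis u, v; the quotient t / s selects the point of the edge that is
  hit by the ray, and s is the relative distance from z.\<close>

definition fan :: "real^2 => (real^2) \<times> (real^2) => (real^2) set" where
 "fan z e = {x. let u = fst e - z; v = snd e - fst e; s = cross (x - z) v / cross u v; t = cross u (x - z) / cross u v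
  in 0 < t \<and> t < s \<and> s < 1}"

lemma fan_borel: "fan z e \<in> sets borel"
proof -
 have "continuous_on UNIV (%x. cross (x - z) v)" "continuous_on UNIV (%x. cross v (x - z))" for v
  unfolding cross_def by (auto intro!: continuous_intros)
 then have [measurable]: "(%x. cross (x - z) v) \<in> borel_measurable borel" "(%x. cross v (x - z)) \<in> borel_measurable borel" for v
  by (auto intro: borel_measurable_continuous_onI)
 show ?thesis unfolding fan_def Let_def by measurable
qed

lemma fan_coordinates:
 assumes d: "cross u v ~= 0" and uv: "u = fst e - z" "v = snd e - fst e"
 shows "z + s *\<^sub>R u + t *\<^sub>R v \<in> fan z e \<longleftrightarrow> 0 < t \<and> t < s \<and> s < 1"
  and "x = z + (cross (x - z) v / cross u v) *\<^sub>R u + (cross u (x - z) / cross u v) *\<^sub>R v"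
proof -
 have "cross (s *\<^sub>R u + t *\<^sub>R v) v = s * cross u v" "cross u (s *\<^sub>R u + t *\<^sub>R v) = t * cross u v"
  by (simp_all add: cross_def algebra_simps)
 then show "z + s *\<^sub>R u + t *\<^sub>R v \<in> fan z e \<longleftrightarrow> 0 < t \<and> t < s \<and> s < 1"
  using d by (simp add: fan_def Let_def uv[symmetric] add.assoc)
 define y where "y = x - z"
 have "cross u v *\<^sub>R y = cross y v *\<^sub>R u + cross u y *\<^sub>R v"
  by (simp add: vec_eq_iff forall_2 cross_def algebra_simps)
 then have "(1 / cross u v) *\<^sub>R (cross u v *\<^sub>R y) = (1 / cross u v) *\<^sub>R (cross y v *\<^sub>R u + cross u y *\<^sub>R v)" by simp
 then have "y = (cross y v / cross u v) *\<^sub>R u + (cross u y / cross u v) *\<^sub>R v" using d by (simp add: scaleR_add_right)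
 then show "x = z + (cross (x - z) v / cross u v) *\<^sub>R u + (cross u (x - z) / cross u v) *\<^sub>R v"
  by (simp add: y_def add.assoc algebra_simps)
qed

lemma fan_rayD:
 assumes d: "cross (a - z) (b - a) ~= 0" and x: "x \<in> fan z (a, b)"
 obtains s \<theta> where "0 < s" "s < 1" "0 < \<theta>" "\<theta> < 1" "x = z + s *\<^sub>R (linepath a b \<theta> - z)"
proof -
 define u v where "u = a - z" and "v = b - a"
 define s t where "s = cross (x - z) v / cross u v" and "t = cross u (x - z) / cross u v"
 have st: "0 < t" "t < s" "s < 1" using x by (auto simp: fan_def Let_def u_def v_def s_def t_def)
 have "x = z + s *\<^sub>R u + t *\<^sub>R v"
  using fan_coordinates(2)[of u v "(a, b)" z x] d by (simp add: u_def v_def s_def t_def)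
 also have "... = z + s *\<^sub>R (linepath a b (t / s) - z)"
  using st by (simp add: u_def v_def linepath_def algebra_simps)
 finally have xe: "x = z + s *\<^sub>R (linepath a b (t / s) - z)" .
 show thesis by (rule that[of s "t / s"]) (use st xe in auto)
qed

text \<open>Substituting t = s \<theta> gives polar coordinates whose rays end on the edge; the
  Jacobian is s times twice the area of the triangle.\<close>

lemma nn_integral_fan:
 fixes F :: "real^2 => ennreal"
 assumes [measurable]: "F \<in> borel_measurable borel" and d: "cross (a - z) (b - a) ~= 0"
 shows "(nn_integral lborel (%x. F x * indicator (fan z (a, b)) x))
  = ennreal \<bar>cross (a - z) (b - a)\<bar> * (nn_integral lborel (%s. nn_integral lborel (%\<theta>. ennreal s * F (z + s *\<^sub>R (linepath a b \<theta> - z))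
    * indicator {0<..<1} \<theta> * indicator {0<..<1} s)))"
proof -
 define u v where "u = a - z" and "v = b - a"
 have [measurable]: "fan z (a, b) \<in> sets borel" by (rule fan_borel)
 have d': "u $ 1 * v $ 2 - v $ 1 * u $ 2 ~= 0" using d by (simp add: cross_def u_def v_def)
 have "(nn_integral lborel (%x. F x * indicator (fan z (a, b)) x)) = ennreal \<bar>cross u v\<bar> *
   (nn_integral lborel (%s. nn_integral lborel (%t. F (z + s *\<^sub>R u + t *\<^sub>R v) * indicator (fan z (a, b)) (z + s *\<^sub>R u + t *\<^sub>R v))))"
  unfolding cross_def by (rule nn_integral_linear_change[OF _ d']) measurable
 also have "(nn_integral lborel (%s. nn_integral lborel (%t. F (z + s *\<^sub>R u + t *\<^sub>R v) * indicator (fan z (a, b)) (z + s *\<^sub>R u + t *\<^sub>R v))))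
  = (nn_integral lborel (%s. nn_integral lborel (%\<theta>. ennreal s * F (z + s *\<^sub>R (linepath a b \<theta> - z)) * indicator {0<..<1} \<theta> * indicator {0<..<1} s)))"
 proof (rule nn_integral_cong)
  fix s :: real
  have ind: "indicator (fan z (a, b)) (z + s *\<^sub>R u + t *\<^sub>R v) = (indicator {t. 0 < t \<and> t < s \<and> s < 1} t :: ennreal)" for t
   using fan_coordinates(1)[of u v "(a, b)" z s t] d by (auto simp: u_def v_def indicator_def)
  show "(nn_integral lborel (%t. F (z + s *\<^sub>R u + t *\<^sub>R v) * indicator (fan z (a, b)) (z + s *\<^sub>R u + t *\<^sub>R v)))
   = (nn_integral lborel (%\<theta>. ennreal s * F (z + s *\<^sub>R (linepath a b \<theta> - z)) * indicator {0<..<1} \<theta> * indicator {0<..<1} s))"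
  proof (cases "0 < s \<and> s < 1")
   case False
   then have "{t. 0 < t \<and> t < s \<and> s < 1} = {}" by auto
   then have "indicator (fan z (a, b)) (z + s *\<^sub>R u + t *\<^sub>R v) = (0 :: ennreal)" for t unfolding ind by simp
   moreover have "indicator {0<..<1} s = (0 :: ennreal)" using False by (auto simp: indicator_def)
   ultimately show ?thesis by simp
  next
   case True
   have "(nn_integral lborel (%t. F (z + s *\<^sub>R u + t *\<^sub>R v) * indicator (fan z (a, b)) (z + s *\<^sub>R u + t *\<^sub>R v)))
    = ennreal \<bar>s\<bar> * (nn_integral lborel (%\<theta>. F (z + s *\<^sub>R u + (0 + s * \<theta>) *\<^sub>R v) * indicator (fan z (a, b)) (z + s *\<^sub>R u + (0 + s * \<theta>) *\<^sub>R v)))"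
    by (rule nn_integral_real_affine) (use True in auto)
   also have "... = (nn_integral lborel (%\<theta>. ennreal s * (F (z + s *\<^sub>R u + (s * \<theta>) *\<^sub>R v) * indicator (fan z (a, b)) (z + s *\<^sub>R u + (s * \<theta>) *\<^sub>R v))))"
    using True by (subst nn_integral_cmult) auto
   also have "... = (nn_integral lborel (%\<theta>. ennreal s * F (z + s *\<^sub>R (linepath a b \<theta> - z)) * indicator {0<..<1} \<theta> * indicator {0<..<1} s))"
   proof (rule nn_integral_cong)
    fix \<theta> :: real
    have p: "z + s *\<^sub>R u + (s * \<theta>) *\<^sub>R v = z + s *\<^sub>R (linepath a b \<theta> - z)"
     by (simp add: u_def v_def linepath_def algebra_simps)
    have i: "indicator (fan z (a, b)) (z + s *\<^sub>R u + (s * \<theta>) *\<^sub>R v) = (indicator {0<..<1} \<theta> :: ennreal)"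
     unfolding ind using True by (auto simp: indicator_def zero_less_mult_iff)
    show "ennreal s * (F (z + s *\<^sub>R u + (s * \<theta>) *\<^sub>R v) * indicator (fan z (a, b)) (z + s *\<^sub>R u + (s * \<theta>) *\<^sub>R v))
     = ennreal s * F (z + s *\<^sub>R (linepath a b \<theta> - z)) * indicator {0<..<1} \<theta> * indicator {0<..<1} s"
     unfolding i unfolding p using True by (simp add: mult.assoc)
   qed
   finally show ?thesis .
  qed
 qed
 finally show ?thesis by (simp add: u_def v_def)
qed

text \<open>A point common to two fans would lie on a ray that ends in the relative interior of two
  edges; but a ray meets the frontier once, and distinct edges share at most vertices.\<close>

lemma fans_disjoint:
 assumes K: "simple_polygon vs" "convex (region vs)" and z: "z \<in> region vs"
  and d: "!!a b. (a, b) \<in> edges vs ==> cross (a - z) (b - a) ~= 0"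
 shows "(\<Sum>e\<in>edges vs. indicator (fan z e) x) <= (indicator (region vs) x :: ennreal)"
proof -
 have ne: "region vs ~= {}" using z by auto
 have inD: "x \<in> region vs" if h: "e \<in> edges vs" "x \<in> fan z e" for e
 proof -
  obtain a b where e: "e = (a, b)" by (cases e)
  obtain s \<theta> where s: "0 < s" "s < 1" "0 < \<theta>" "\<theta> < 1" "x = z + s *\<^sub>R (linepath a b \<theta> - z)"
   using fan_rayD[OF d[OF h(1)[unfolded e]] h(2)[unfolded e]] by metis
  have "linepath a b \<theta> \<in> closed_segment a b" using s by (intro linepath_in_path) auto
  then have "linepath a b \<theta> \<in> frontier (region vs)" using edge_in_frontier[OF K ne] h(1) e by blast
  then have "linepath a b \<theta> \<in> closure (region vs)" by (simp add: frontier_def)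
  then show ?thesis unfolding s(5) by (intro segment_interior K region_open z) (use s in auto)
 qed
 have unique: "e = e'" if h: "e \<in> edges vs" "x \<in> fan z e" "e' \<in> edges vs" "x \<in> fan z e'" for e e'
 proof (rule ccontr)
  assume nee: "e ~= e'"
  obtain a b a' b' where e: "e = (a, b)" "e' = (a', b')" by (cases e, cases e') auto
  obtain s \<theta> where s: "0 < s" "s < 1" "0 < \<theta>" "\<theta> < 1" "x = z + s *\<^sub>R (linepath a b \<theta> - z)"
   using fan_rayD[OF d[OF h(1)[unfolded e]] h(2)[unfolded e]] by metis
  obtain s' \<theta>' where s': "0 < s'" "s' < 1" "0 < \<theta>'" "\<theta>' < 1" "x = z + s' *\<^sub>R (linepath a' b' \<theta>' - z)"
   using fan_rayD[OF d[OF h(3)[unfolded e]] h(4)[unfolded e]] by metis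
  have m: "linepath a b \<theta> \<in> closed_segment a b" "linepath a' b' \<theta>' \<in> closed_segment a' b'"
   by (intro linepath_in_path; use s s' in simp)+
  have "linepath a b \<theta> = linepath a' b' \<theta>'"
  proof (rule ray_frontier_unique[OF K(2) region_open z])
   show "linepath a b \<theta> \<in> frontier (region vs)" "linepath a' b' \<theta>' \<in> frontier (region vs)"
    using m edge_in_frontier[OF K ne] h(1,3) unfolding e by blast+
   show "0 < s" "0 < s'" "z + s *\<^sub>R (linepath a b \<theta> - z) = z + s' *\<^sub>R (linepath a' b' \<theta>' - z)"
    using s(1) s'(1) s(5) s'(5) by simp_all
  qed
  then have "linepath a b \<theta> \<in> closed_segment a b \<inter> closed_segment a' b'" using m by simp
  moreover have "closed_segment a b \<inter> closed_segment a' b' = {a, b} \<inter> {a', b'}"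
   using h(1,3) nee unfolding e by (rule simple_polygon_segments[OF K(1)])
  ultimately have "linepath a b \<theta> \<in> {a, b}" by blast
  moreover have "a ~= b" using edge_ne[OF K(1)] h(1) e by blast
  moreover have "linepath a b \<theta> - a = \<theta> *\<^sub>R (b - a)" "b - linepath a b \<theta> = (1 - \<theta>) *\<^sub>R (b - a)"
   by (simp_all add: linepath_def algebra_simps)
  ultimately show False using s(3,4) by auto
 qed
 show ?thesis
 proof (cases "\<exists>e\<in>edges vs. x \<in> fan z e")
  case True
  then obtain e where e: "e \<in> edges vs" "x \<in> fan z e" by blast
  have "(\<Sum>e'\<in>edges vs. indicator (fan z e') x) = (\<Sum>e'\<in>edges vs. if e' = e then 1 else (0 :: ennreal))"
  proof (rule sum.cong[OF refl])
   fix e' assume e': "e' \<in> edges vs"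
   show "indicator (fan z e') x = (if e' = e then 1 else (0 :: ennreal))"
   proof (cases "e' = e")
    case False
    then have "x \<notin> fan z e'" using unique[OF e' _ e] by metis
    then show ?thesis using False by simp
   qed (simp add: e(2))
  qed
  then show ?thesis using e inD[OF e] by (simp add: edges_finite)
 next
  case False
  then have "(\<Sum>e'\<in>edges vs. indicator (fan z e') x) = (\<Sum>e'\<in>edges vs. (0 :: ennreal))"
   by (intro sum.cong[OF refl]) (simp add: indicator_def)
  then show ?thesis by simp
 qed
qed

lemma fan_integrals_le:
 fixes F :: "real^2 => ennreal"
 assumes K: "simple_polygon vs" "convex (region vs)" and z: "z \<in> region vs"
  and d: "!!a b. (a, b) \<in> edges vs ==> cross (a - z) (b - a) ~= 0" and [measurable]: "F \<in> borel_measurable borel"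
 shows "(\<Sum>(a, b)\<in>edges vs. ennreal \<bar>cross (a - z) (b - a)\<bar> * (nn_integral lborel (%s. nn_integral lborel (%\<theta>. ennreal s * F (z + s *\<^sub>R (linepath a b \<theta> - z))
    * indicator {0<..<1} \<theta> * indicator {0<..<1} s))))
  <= (nn_integral lborel (%x. F x * indicator (region vs) x))"
proof -
 have [measurable]: "fan z e \<in> sets borel" "region vs \<in> sets borel" for e
  using fan_borel region_open by auto
 have "(\<Sum>(a, b)\<in>edges vs. ennreal \<bar>cross (a - z) (b - a)\<bar> * (nn_integral lborel (%s. nn_integral lborel (%\<theta>. ennreal s * F (z + s *\<^sub>R (linepath a b \<theta> - z))
    * indicator {0<..<1} \<theta> * indicator {0<..<1} s))))
  = (\<Sum>e\<in>edges vs. nn_integral lborel (%x. F x * indicator (fan z e) x))"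
  using d by (intro sum.cong refl) (auto simp: nn_integral_fan)
 also have "... = (nn_integral lborel (%x. (\<Sum>e\<in>edges vs. F x * indicator (fan z e) x)))"
  by (rule nn_integral_sum[symmetric]) measurable
 also have "... = (nn_integral lborel (%x. F x * (\<Sum>e\<in>edges vs. indicator (fan z e) x)))"
  by (simp add: sum_distrib_left)
 also have "... <= (nn_integral lborel (%x. F x * indicator (region vs) x))"
  by (intro nn_integral_mono mult_left_mono fans_disjoint K z d) auto
 finally show ?thesis .
qed

section \<open>Poincare, Friedrichs and trace inequalities\<close>

lemma nn_integral_interval:
 fixes k :: "real => real"
 assumes "continuous_on UNIV k" "!!s. s \<in> {\<alpha>..\<beta>} ==> 0 <= k s"
 shows "(nn_integral lborel (%s. ennreal (k s) * indicator {\<alpha>..\<beta>} s)) = ennreal (integral {\<alpha>..\<beta>} k)"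
  and "(nn_integral lborel (%s. ennreal (k s) * indicator {\<alpha><..<\<beta>} s)) = ennreal (integral {\<alpha>..\<beta>} k)"
proof -
 have [measurable]: "k \<in> borel_measurable borel" using assms(1) by (rule borel_measurable_continuous_onI)
 define k' where "k' s = (if s \<in> {\<alpha>..\<beta>} then k s else 0)" for s
 have "(k has_integral integral {\<alpha>..\<beta>} k) {\<alpha>..\<beta>}"
  by (intro integrable_integral integrable_continuous_interval continuous_on_subset[OF assms(1)]) auto
 then have hi: "(k' has_integral integral {\<alpha>..\<beta>} k) UNIV" unfolding k'_def by (simp only: has_integral_restrict_UNIV)
 have [measurable]: "k' \<in> borel_measurable borel" unfolding k'_def[abs_def] by measurable
 have "(nn_integral lborel (%s. ennreal (k' s))) = ennreal (integral {\<alpha>..\<beta>} k)"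
  by (rule nn_integral_has_integral_lborel[OF _ _ hi]) (use assms(2) in \<open>auto simp: k'_def\<close>)
 moreover have "ennreal (k' s) = ennreal (k s) * indicator {\<alpha>..\<beta>} s" for s by (simp add: k'_def indicator_def)
 ultimately show 1: "(nn_integral lborel (%s. ennreal (k s) * indicator {\<alpha>..\<beta>} s)) = ennreal (integral {\<alpha>..\<beta>} k)" by simp
 have "AE s in lborel. s ~= \<alpha>" "AE s in lborel. s ~= \<beta>" by (rule AE_lborel_singleton)+
 then have "AE s in lborel. ennreal (k s) * indicator {\<alpha><..<\<beta>} s = ennreal (k s) * indicator {\<alpha>..\<beta>} s"
  by eventually_elim (auto simp: indicator_def)
 from nn_integral_cong_AE[OF this] 1
 show "(nn_integral lborel (%s. ennreal (k s) * indicator {\<alpha><..<\<beta>} s)) = ennreal (integral {\<alpha>..\<beta>} k)" by simp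
qed

lemma segment_difference_bound:
 assumes v: "smooth v"
 shows "ennreal ((v y - v x)^2) <= ennreal ((norm (y - x))^2) * (nn_integral lborel (%t. ennreal ((norm (grad v (x + t *\<^sub>R (y - x))))^2) * indicator {0<..<1} t))"
proof -
 define k where "k t = grad v (x + t *\<^sub>R (y - x)) \<bullet> (y - x)" for t
 have cg: "continuous_on UNIV (%t::real. grad v (x + t *\<^sub>R (y - x)))"
  by (intro continuous_on_compose2[OF grad_continuous[OF v, of UNIV]] continuous_intros) auto
 have ck: "continuous_on UNIV k" unfolding k_def[abs_def] by (intro continuous_intros cg)
 have "(k has_integral (v (x + 1 *\<^sub>R (y - x)) - v (x + 0 *\<^sub>R (y - x)))) {0..1}"
  unfolding k_def
  by (rule fundamental_theorem_of_calculus)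
   (auto intro!: DERIV_subset[OF DERIV_along_line[OF v]] simp flip: has_real_derivative_iff_has_vector_derivative)
 then have I: "integral {0..1} (%t. 1 * k t) = v y - v x" by (simp add: integral_unique)
 have "(v y - v x)^2 <= integral {0..1} (%t::real. 1^2) * integral {0..1} (%t. (k t)^2)"
  unfolding I[symmetric] by (rule integral_CS_interval) (auto intro: continuous_on_subset[OF ck])
 also have "... = integral {0..1} (%t. (k t)^2)" by simp
 also have "... <= integral {0..1} (%t. (norm (y - x))^2 * (norm (grad v (x + t *\<^sub>R (y - x))))^2)"
 proof (rule integral_le)
  show "(%t. (k t)^2) integrable_on {0..1}"
   by (intro integrable_continuous_interval continuous_intros continuous_on_subset[OF ck]) auto
  show "(%t. (norm (y - x))^2 * (norm (grad v (x + t *\<^sub>R (y - x))))^2) integrable_on {0..1}"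
   by (intro integrable_continuous_interval continuous_intros continuous_on_subset[OF cg]) auto
  fix t :: real
  have "\<bar>k t\<bar>\<^sup>2 <= (norm (grad v (x + t *\<^sub>R (y - x))) * norm (y - x))^2"
   unfolding k_def by (intro power_mono Cauchy_Schwarz_ineq2 abs_ge_zero)
  then show "(k t)^2 <= (norm (y - x))^2 * (norm (grad v (x + t *\<^sub>R (y - x))))^2"
   by (simp add: power_mult_distrib mult.commute)
 qed
 finally have "ennreal ((v y - v x)^2) <= ennreal (integral {0..1} (%t. (norm (y - x))^2 * (norm (grad v (x + t *\<^sub>R (y - x))))^2))"
  by (rule ennreal_leI)
 also have "... = (nn_integral lborel (%t. ennreal ((norm (y - x))^2 * (norm (grad v (x + t *\<^sub>R (y - x))))^2) * indicator {0<..<1} t))"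
  by (rule nn_integral_interval(2)[symmetric]) (auto intro!: continuous_intros cg)
 also have "... = (nn_integral lborel (%t. ennreal ((norm (y - x))^2) * (ennreal ((norm (grad v (x + t *\<^sub>R (y - x))))^2) * indicator {0<..<1} t)))"
  by (intro nn_integral_cong) (simp add: ennreal_mult mult.assoc)
 also have "... = ennreal ((norm (y - x))^2) * (nn_integral lborel (%t. ennreal ((norm (grad v (x + t *\<^sub>R (y - x))))^2) * indicator {0<..<1} t))"
 proof (rule nn_integral_cmult)
  have "(%t. (norm (grad v (x + t *\<^sub>R (y - x))))^2) \<in> borel_measurable borel"
   by (intro borel_measurable_continuous_onI continuous_intros cg)
  then show "(%t. ennreal ((norm (grad v (x + t *\<^sub>R (y - x))))^2) * indicator {0<..<1} t) \<in> borel_measurable lborel"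
   by measurable
 qed
 finally show ?thesis .
qed

text \<open>The double integral of $|v(x) - v(y)|^2$ is bounded by integrating along the segment from
 \<open>x\<close> to \<open>y\<close>; a point \<open>x + t (y - x)\<close> is an affine image of \<open>y\<close> if \<open>t \<ge> 1/2\<close> and of \<open>x\<close> otherwise.\<close>

lemma poincare_convex:
 fixes D :: "(real^2) set"
 assumes D: "convex D" "open D" "bounded D" "D ~= {}" and h: "!!x y. x \<in> D ==> y \<in> D ==> norm (y - x) <= h"
  and v: "smooth v" and \<epsilon>: "\<epsilon> > 0"
 obtains c where "(nn_integral lborel (%x. ennreal ((v x - c)^2) * indicator D x))
  <= ennreal (4 * h^2) * (nn_integral lborel (%x. ennreal ((norm (grad v x))^2) * indicator D x)) + ennreal \<epsilon>"
proof -
 have [measurable]: "D \<in> sets borel" using D by simp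
 have [measurable]: "v \<in> borel_measurable borel" "grad v \<in> borel_measurable borel"
  using v by (auto intro!: borel_measurable_continuous_onI smooth_continuous grad_continuous)
 define G where "G x = ennreal ((norm (grad v x))^2) * indicator D x" for x
 have [measurable]: "G \<in> borel_measurable borel" unfolding G_def[abs_def] by measurable
 define A where "A = (nn_integral lborel (%x. G x))"
 define f where "f y = (nn_integral lborel (%x. ennreal ((v x - v y)^2) * indicator D x))" for y
 have [measurable]: "f \<in> borel_measurable borel" unfolding f_def[abs_def] by measurable
 define m where "m = emeasure lborel D"
 have m: "0 < m" "m < \<infinity>"
 proof -
  show "m < \<infinity>" unfolding m_def by (rule emeasure_bounded_finite[OF D(3)])
  have "m ~= 0"
  proof
   assume "m = 0"
   then have "negligible D" unfolding m_def negligible_iff_null_sets by (auto intro!: null_sets_completionI simp: null_sets_def)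
   then show False using open_not_negligible[OF D(2,4)] by simp
  qed
  then show "0 < m" by (simp add: zero_less_iff_neq_zero)
 qed
 \<comment> \<open>\<open>f y\<close> measures the deviation of \<open>v\<close> from the constant
   \<open>v y\<close>. This bounds its integral over all \<open>y\<close>, so some \<open>y\<close>
   does about as well as the mean.\<close>
 have avg: "(nn_integral lborel (%y. f y * indicator D y)) <= ennreal (4 * h^2) * A * m"
 proof -
  have "(nn_integral lborel (%y. f y * indicator D y)) <= (nn_integral lborel (%y. nn_integral lborel (%x. nn_integral lborel (%t. ennreal (h^2) * (G (x + t *\<^sub>R (y - x)) * indicator D x * indicator D y * indicator {0<..<1} t)))))"
  proof (rule nn_integral_mono)
   fix y
   have "f y * indicator D y = (nn_integral lborel (%x. ennreal ((v x - v y)^2) * indicator D x * indicator D y))"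
    unfolding f_def by (rule nn_integral_multc[symmetric]) measurable
   also have "... <= (nn_integral lborel (%x. nn_integral lborel (%t. ennreal (h^2) * (G (x + t *\<^sub>R (y - x)) * indicator D x * indicator D y * indicator {0<..<1} t))))"
   proof (rule nn_integral_mono)
    fix x
    show "ennreal ((v x - v y)^2) * indicator D x * indicator D y <= (nn_integral lborel (%t. ennreal (h^2) * (G (x + t *\<^sub>R (y - x)) * indicator D x * indicator D y * indicator {0<..<1} t)))"
    proof (cases "x \<in> D \<and> y \<in> D")
     case True
     have "x + t *\<^sub>R (y - x) \<in> D" if "t \<in> {0<..<1}" for t
     proof -
      have "(1 - t) *\<^sub>R x + t *\<^sub>R y \<in> D" by (rule convexD[OF D(1)]) (use True that in auto)
      then show ?thesis by (simp add: algebra_simps)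
     qed
     then have eq: "ennreal ((norm (grad v (x + t *\<^sub>R (y - x))))^2) * indicator {0<..<1} t = G (x + t *\<^sub>R (y - x)) * indicator {0<..<1} t" for t
      by (cases "t \<in> {0<..<1}") (simp_all add: G_def)
     have "ennreal ((v y - v x)^2) <= ennreal ((norm (y - x))^2) * (nn_integral lborel (%t. G (x + t *\<^sub>R (y - x)) * indicator {0<..<1} t))"
      using segment_difference_bound[OF v, of y x] unfolding eq .
     also have "... <= ennreal (h^2) * (nn_integral lborel (%t. G (x + t *\<^sub>R (y - x)) * indicator {0<..<1} t))"
      using h[of x y] True by (intro mult_right_mono ennreal_leI power_mono) auto
     also have "... = (nn_integral lborel (%t. ennreal (h^2) * (G (x + t *\<^sub>R (y - x)) * indicator {0<..<1} t)))"
      by (rule nn_integral_cmult[symmetric]) measurable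
     finally show ?thesis using True by (simp add: power2_commute)
    qed auto
   qed
   finally show "f y * indicator D y <= (nn_integral lborel (%x. nn_integral lborel (%t. ennreal (h^2) * (G (x + t *\<^sub>R (y - x)) * indicator D x * indicator D y * indicator {0<..<1} t))))" .
  qed
  also have "... = (nn_integral lborel (%y. nn_integral lborel (%t. nn_integral lborel (%x. ennreal (h^2) * (G (x + t *\<^sub>R (y - x)) * indicator D x * indicator D y * indicator {0<..<1} t)))))"
   by (intro nn_integral_cong lborel_pair.Fubini') measurable
  also have "... = (nn_integral lborel (%t. nn_integral lborel (%y. nn_integral lborel (%x. ennreal (h^2) * (G (x + t *\<^sub>R (y - x)) * indicator D x * indicator D y * indicator {0<..<1} t)))))"
   by (rule lborel_pair.Fubini') measurable
  also have "... <= (nn_integral lborel (%t. ennreal (4 * h^2) * A * m * indicator {0<..<1::real} t))"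
  proof (rule nn_integral_mono)
   fix t :: real
   \<comment> \<open>The substitution costs 1/c^2, and one of t and 1 - t is at least 1/2; hence the
     factor 4.\<close>
   have sc: "(nn_integral lborel (%x. G (w + c *\<^sub>R x))) <= 4 * A" if c: "c \<ge> 1 / 2" for w c
   proof -
    have "A = ennreal (\<bar>c\<bar> ^ DIM(real^2)) * (nn_integral lborel (%x. G (w + c *\<^sub>R x)))"
     unfolding A_def by (rule nn_integral_lborel_affine) (use c in auto)
    then have Ac: "A = ennreal (c^2) * (nn_integral lborel (%x. G (w + c *\<^sub>R x)))" by simp
    have "(1 / 2)^2 <= c^2" by (rule power_mono) (use c in auto)
    then have "1 <= 4 * c^2" by (simp add: power2_eq_square)
    then have one: "1 <= ennreal (4 * c^2)" by simp
    have "(nn_integral lborel (%x. G (w + c *\<^sub>R x))) = 1 * (nn_integral lborel (%x. G (w + c *\<^sub>R x)))" by simp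
    also have "... <= ennreal (4 * c^2) * (nn_integral lborel (%x. G (w + c *\<^sub>R x)))" by (intro mult_right_mono one) simp
    also have "ennreal (4 * c^2) = 4 * ennreal (c^2)" by (simp add: ennreal_mult)
    finally show ?thesis unfolding Ac by (simp only: mult.assoc)
   qed
   have im: "(nn_integral lborel (%y. c * indicator D y)) = c * m" for c :: ennreal
    unfolding m_def by (rule nn_integral_cmult_indicator) simp
   have Gm: "(nn_integral lborel (%y. nn_integral lborel (%x. G (x + t *\<^sub>R (y - x)) * indicator D x * indicator D y))) <= 4 * A * m"
   proof (cases "t \<ge> 1 / 2")
    case True
    have "(nn_integral lborel (%y. nn_integral lborel (%x. G (x + t *\<^sub>R (y - x)) * indicator D x * indicator D y)))
     = (nn_integral lborel (%x. nn_integral lborel (%y. G (x + t *\<^sub>R (y - x)) * indicator D x * indicator D y)))"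
     by (rule lborel_pair.Fubini') measurable
    also have "... <= (nn_integral lborel (%x. 4 * A * indicator D x))"
    proof (rule nn_integral_mono)
     fix x
     have "(nn_integral lborel (%y. G (x + t *\<^sub>R (y - x)) * indicator D x * indicator D y)) <= (nn_integral lborel (%y. G ((x - t *\<^sub>R x) + t *\<^sub>R y) * indicator D x))"
      by (intro nn_integral_mono) (simp add: indicator_def algebra_simps)
     also have "... = (nn_integral lborel (%y. G ((x - t *\<^sub>R x) + t *\<^sub>R y))) * indicator D x" by (rule nn_integral_multc) measurable
     also have "... <= 4 * A * indicator D x" by (intro mult_right_mono sc True) simp
     finally show "(nn_integral lborel (%y. G (x + t *\<^sub>R (y - x)) * indicator D x * indicator D y)) <= 4 * A * indicator D x" .
    qed
    finally show ?thesis unfolding im .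
   next
    case False
    have "(nn_integral lborel (%y. nn_integral lborel (%x. G (x + t *\<^sub>R (y - x)) * indicator D x * indicator D y))) <= (nn_integral lborel (%y. 4 * A * indicator D y))"
    proof (rule nn_integral_mono)
     fix y
     have "(nn_integral lborel (%x. G (x + t *\<^sub>R (y - x)) * indicator D x * indicator D y)) <= (nn_integral lborel (%x. G (t *\<^sub>R y + (1 - t) *\<^sub>R x) * indicator D y))"
      by (intro nn_integral_mono) (simp add: indicator_def algebra_simps)
     also have "... = (nn_integral lborel (%x. G (t *\<^sub>R y + (1 - t) *\<^sub>R x))) * indicator D y" by (rule nn_integral_multc) measurable
     also have "... <= 4 * A * indicator D y" by (intro mult_right_mono sc) (use False in auto)
     finally show "(nn_integral lborel (%x. G (x + t *\<^sub>R (y - x)) * indicator D x * indicator D y)) <= 4 * A * indicator D y" .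
    qed
    then show ?thesis unfolding im .
   qed
   have "(nn_integral lborel (%y. nn_integral lborel (%x. ennreal (h^2) * (G (x + t *\<^sub>R (y - x)) * indicator D x * indicator D y * indicator {0<..<1} t))))
    = ennreal (h^2) * ((nn_integral lborel (%y. nn_integral lborel (%x. G (x + t *\<^sub>R (y - x)) * indicator D x * indicator D y))) * indicator {0<..<1} t)"
    by (simp add: nn_integral_cmult nn_integral_multc)
   also have "... <= ennreal (h^2) * (4 * A * m * indicator {0<..<1} t)" by (intro mult_left_mono mult_right_mono Gm) auto
   also have "... = ennreal (4 * h^2) * A * m * indicator {0<..<1} t" by (simp add: ennreal_mult mult_ac)
   finally show "(nn_integral lborel (%y. nn_integral lborel (%x. ennreal (h^2) * (G (x + t *\<^sub>R (y - x)) * indicator D x * indicator D y * indicator {0<..<1} t))))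
    <= ennreal (4 * h^2) * A * m * indicator {0<..<1} t" .
  qed
  also have "... = ennreal (4 * h^2) * A * m" by (simp add: nn_integral_cmult)
  finally show ?thesis .
 qed
 \<comment> \<open>The slack \<open>\<epsilon>\<close> makes the contradiction with the mean strict,
   since the region has positive finite area.\<close>
 have "\<exists>y\<in>D. f y <= ennreal (4 * h^2) * A + ennreal \<epsilon>"
 proof (cases "ennreal (4 * h^2) * A = \<infinity>")
  case True
  then show ?thesis using D(4) by auto
 next
  case fin: False
  define Q where "Q = ennreal (4 * h^2) * A"
  show ?thesis
  proof (rule ccontr)
   assume "\<not> ?thesis"
   then have "Q + ennreal \<epsilon> <= f y" if "y \<in> D" for y using that by (force simp: Q_def)
   then have "(nn_integral lborel (%y. (Q + ennreal \<epsilon>) * indicator D y)) <= (nn_integral lborel (%y. f y * indicator D y))"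
    by (intro nn_integral_mono) (simp add: indicator_def)
   also have "... <= Q * m" using avg by (simp add: Q_def)
   finally have "(Q + ennreal \<epsilon>) * m <= Q * m" unfolding m_def by (simp add: nn_integral_cmult_indicator)
   then have "Q * m + ennreal \<epsilon> * m <= Q * m + 0" by (simp add: distrib_right)
   moreover have "Q * m ~= \<infinity>" using fin m by (simp add: Q_def ennreal_mult_eq_top_iff)
   ultimately have "ennreal \<epsilon> * m <= 0" by (metis ennreal_add_left_cancel_le infinity_ennreal_def)
   then show False using m \<epsilon> by simp
  qed
 qed
 then obtain y where "y \<in> D" "f y <= ennreal (4 * h^2) * A + ennreal \<epsilon>" by blast
 then show thesis using that[of "v y"] by (simp add: f_def A_def G_def[abs_def])
qed

lemma test_function_zero: assumes "test_function D \<psi>" "x \<notin> D" shows "\<psi> x = 0"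
proof (rule ccontr)
 assume "\<psi> x ~= 0"
 then have "x \<in> {x. \<psi> x ~= 0}" by simp
 then have "x \<in> closure {x. \<psi> x ~= 0}" by (rule subsetD[OF closure_subset])
 then show False using assms unfolding test_function_def by auto
qed

lemma test_function_grad_zero: assumes "test_function D \<psi>" "x \<notin> D" shows "grad \<psi> x = 0"
proof -
 let ?S = "closure {x. \<psi> x ~= 0}"
 have x: "x \<in> - ?S" using assms unfolding test_function_def by auto
 have 0: "0 = \<psi> y" if y: "y \<in> - ?S" for y
 proof (rule ccontr)
  assume "0 ~= \<psi> y"
  then have "y \<in> {x. \<psi> x ~= 0}" by simp
  then have "y \<in> ?S" by (rule subsetD[OF closure_subset])
  then show False using y by simp
 qed
 have "((%x. 0) has_derivative (%h. 0)) (at x)" by simp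
 then have "(\<psi> has_derivative (%h. 0)) (at x)"
  by (rule has_derivative_transform_within_open[where s = "- ?S", OF _ open_Compl[OF closed_closure] x 0])
 from partial_eq[OF this] show ?thesis by (simp add: grad_def vec_eq_iff)
qed

text \<open>Poincare on a ball of radius 3 h around a point of D gives closeness to some constant c.
  A translate of D lies in the ball but off D, where \<psi> vanishes, so c itself is controlled. The
  constant is 4 times 4 (6 h)^2, the ball having diameter 6 h.\<close>

lemma friedrichs_test_function:
 fixes D :: "(real^2) set"
 assumes D: "open D" "bounded D" "D ~= {}" and h: "!!x y. x \<in> D ==> y \<in> D ==> norm (y - x) <= h" and h0: "h > 0"
  and \<psi>: "test_function D \<psi>"
 shows "(nn_integral lborel (%x. ennreal ((\<psi> x)^2) * indicator D x)) <= ennreal (576 * h^2) * (nn_integral lborel (%x. ennreal ((norm (grad \<psi> x))^2) * indicator D x))"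
proof (rule ennreal_le_epsilon)
 fix \<epsilon> :: real assume \<epsilon>: "\<epsilon> > 0"
 obtain z where z: "z \<in> D" using D(3) by auto
 define B where "B = ball z (3 * h)"
 have sm: "smooth \<psi>" using \<psi> by (simp add: test_function_def)
 have [measurable]: "D \<in> sets borel" "B \<in> sets borel" using D by (simp_all add: B_def)
 have [measurable]: "\<psi> \<in> borel_measurable borel" "grad \<psi> \<in> borel_measurable borel"
  using sm by (auto intro!: borel_measurable_continuous_onI smooth_continuous grad_continuous)
 have DB: "D \<subseteq> B"
 proof
  fix x assume "x \<in> D"
  from h[OF z this] h0 show "x \<in> B" by (simp add: B_def dist_norm norm_minus_commute)
 qed
 note zero = test_function_zero[OF \<psi>] and gzero = test_function_grad_zero[OF \<psi>]
 have hB: "norm (y - x) <= 6 * h" if "x \<in> B" "y \<in> B" for x y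
 proof -
  have "norm (y - x) <= norm (y - z) + norm (z - x)" using norm_triangle_ineq[of "y - z" "z - x"] by simp
  then show ?thesis using that by (simp add: B_def dist_norm norm_minus_commute)
 qed
 obtain c where c: "(nn_integral lborel (%x. ennreal ((\<psi> x - c)^2) * indicator B x))
   <= ennreal (4 * (6 * h)^2) * (nn_integral lborel (%x. ennreal ((norm (grad \<psi> x))^2) * indicator B x)) + ennreal (\<epsilon> / 4)"
  by (rule poincare_convex[of B "6 * h" \<psi> "\<epsilon> / 4"]) (use hB sm \<epsilon> h0 in \<open>simp_all add: B_def\<close>)
 define P where "P = (nn_integral lborel (%x. ennreal ((\<psi> x - c)^2) * indicator B x))"
 have PD: "(nn_integral lborel (%x. ennreal ((\<psi> x - c)^2) * indicator D x)) <= P"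
  unfolding P_def using DB by (intro nn_integral_mono mult_left_mono) (auto simp: indicator_def)
 \<comment> \<open>The length 3 h / 2 exceeds the bound h on the diameter of \<open>D\<close>, and h
   + 3 h / 2 is still below 3 h.\<close>
 define w where "w = (3 / 2 * h) *\<^sub>R axis (1::2) (1::real)"
 have nw: "norm w = 3 / 2 * h" using h0 by (simp add: w_def)
 have cD: "(nn_integral lborel (%x. ennreal (c^2) * indicator D x)) <= P"
 proof -
  have "(nn_integral lborel (%x. ennreal (c^2) * indicator D x)) <= (nn_integral lborel (%x. ennreal ((\<psi> (w + 1 *\<^sub>R x) - c)^2) * indicator B (w + 1 *\<^sub>R x)))"
  proof (rule nn_integral_mono)
   fix x show "ennreal (c^2) * indicator D x <= ennreal ((\<psi> (w + 1 *\<^sub>R x) - c)^2) * indicator B (w + 1 *\<^sub>R x)"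
   proof (cases "x \<in> D")
    case True
    have "w + x \<notin> D"
    proof
     assume "w + x \<in> D"
     from h[OF True this] nw h0 show False by simp
    qed
    moreover have "w + x \<in> B"
    proof -
     have "norm (w + x - z) <= norm w + norm (x - z)" using norm_triangle_ineq[of w "x - z"] by (simp add: algebra_simps)
     then have "norm (w + x - z) < 3 * h" using h[OF z True] nw h0 by linarith
     then show ?thesis by (simp add: B_def dist_norm norm_minus_commute)
    qed
    ultimately show ?thesis using zero by (simp add: indicator_def)
   qed simp
  qed
  also have "... = P"
   unfolding P_def using nn_integral_lborel_affine[of "%x. ennreal ((\<psi> x - c)^2) * indicator B x" 1 w] by simp
  finally show ?thesis .
 qed
 have "(nn_integral lborel (%x. ennreal ((\<psi> x)^2) * indicator D x)) <= (nn_integral lborel (%x. 2 * (ennreal ((\<psi> x - c)^2) * indicator D x) + 2 * (ennreal (c^2) * indicator D x)))"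
 proof (rule nn_integral_mono)
  fix x
  have "(\<psi> x)^2 <= 2 * (\<psi> x - c)^2 + 2 * c^2" using norm_add_square_le[of "\<psi> x - c" c] by simp
  then have "ennreal ((\<psi> x)^2) <= ennreal (2 * (\<psi> x - c)^2 + 2 * c^2)" by (rule ennreal_leI)
  also have "... = 2 * ennreal ((\<psi> x - c)^2) + 2 * ennreal (c^2)" by (simp add: ennreal_plus ennreal_mult)
  finally show "ennreal ((\<psi> x)^2) * indicator D x <= 2 * (ennreal ((\<psi> x - c)^2) * indicator D x) + 2 * (ennreal (c^2) * indicator D x)"
   by (simp add: indicator_def)
 qed
 also have "... = 2 * (nn_integral lborel (%x. ennreal ((\<psi> x - c)^2) * indicator D x)) + 2 * (nn_integral lborel (%x. ennreal (c^2) * indicator D x))"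
  by (subst nn_integral_add) (simp_all add: nn_integral_cmult)
 also have "... <= 2 * P + 2 * P" by (intro add_mono mult_left_mono PD cD) auto
 also have "... = 4 * P" by (simp flip: distrib_right)
 also have "... <= 4 * (ennreal (4 * (6 * h)^2) * (nn_integral lborel (%x. ennreal ((norm (grad \<psi> x))^2) * indicator B x)) + ennreal (\<epsilon> / 4))"
  using c by (intro mult_left_mono) (auto simp: P_def)
 also have "(nn_integral lborel (%x. ennreal ((norm (grad \<psi> x))^2) * indicator B x)) = (nn_integral lborel (%x. ennreal ((norm (grad \<psi> x))^2) * indicator D x))"
  using gzero DB by (intro nn_integral_cong) (auto simp: indicator_def)
 also have "4 * (ennreal (4 * (6 * h)^2) * N + ennreal (\<epsilon> / 4)) = ennreal (576 * h^2) * N + ennreal \<epsilon>" for N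
 proof -
  have "4 * ennreal (4 * (6 * h)^2) = ennreal (4 * (4 * (6 * h)^2))" "4 * ennreal (\<epsilon> / 4) = ennreal (4 * (\<epsilon> / 4))"
   using ennreal_mult[of 4 "4 * (6 * h)^2"] ennreal_mult[of 4 "\<epsilon> / 4"] \<epsilon> by simp_all
  then show ?thesis by (simp add: distrib_left power_mult_distrib flip: mult.assoc)
 qed
 finally show "(nn_integral lborel (%x. ennreal ((\<psi> x)^2) * indicator D x)) <= ennreal (576 * h^2) * (nn_integral lborel (%x. ennreal ((norm (grad \<psi> x))^2) * indicator D x)) + ennreal \<epsilon>" .
qed

text \<open>On each ray from z the boundary value of u^2 is the integral of the derivative of s^2
  u^2, which has a factor s to match the Jacobian of the fan coordinates. The height of z over each
  edge is at least r, so that Jacobian is at least s times r times the edge length.\<close>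

lemma trace_inequality:
 assumes K: "simple_polygon vs" "convex (region vs)" and B: "ball z r \<subseteq> region vs" "r > 0"
  and h: "!!x y. x \<in> closure (region vs) ==> y \<in> closure (region vs) ==> norm (y - x) <= h" and u: "smooth u"
 shows "(\<Sum>(a, b)\<in>edges vs. ennreal (r * norm (b - a)) * (nn_integral lborel (%\<theta>. ennreal ((u (linepath a b \<theta>))^2) * indicator {0<..<1} \<theta>)))
  <= (nn_integral lborel (%x. ennreal (2 * (u x)^2 + 2 * h * \<bar>u x\<bar> * norm (grad u x)) * indicator (region vs) x))"
proof -
 let ?D = "region vs"
 have z: "z \<in> ?D" using B by auto
 have ne: "?D ~= {}" using z by auto
 have h0: "h \<ge> 0" using h[of z z] z closure_subset by fastforce
 have crs: "r * norm (b - a) <= \<bar>cross (a - z) (b - a)\<bar>" if e: "(a, b) \<in> edges vs" for a b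
 proof -
  obtain \<nu> where \<nu>: "norm \<nu> = 1" "\<nu> \<bullet> (b - a) = 0" "r <= \<nu> \<bullet> (z - a)"
   using edge_inner_normal[OF K e B] by metis
  have "\<nu> \<bullet> (a - z) = - (\<nu> \<bullet> (z - a))" by (simp add: inner_diff_right)
  then have "r <= \<bar>\<nu> \<bullet> (a - z)\<bar>" using \<nu>(3) by linarith
  then have "norm (b - a) * r <= norm (b - a) * \<bar>\<nu> \<bullet> (a - z)\<bar>" by (intro mult_left_mono) auto
  then show ?thesis by (simp add: cross_normal[OF \<nu>(1,2)] mult.commute)
 qed
 have cne: "cross (a - z) (b - a) ~= 0" if e: "(a, b) \<in> edges vs" for a b
 proof -
  have "0 < r * norm (b - a)" using edge_ne[OF K(1) e] B(2) by simp
  then show ?thesis using crs[OF e] by auto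
 qed
 define F where "F x = 2 * (u x)^2 + 2 * h * \<bar>u x\<bar> * norm (grad u x)" for x
 have F0: "0 <= F x" for x using h0 by (simp add: F_def)
 have cF: "continuous_on UNIV F" unfolding F_def[abs_def]
  by (intro continuous_intros smooth_continuous[OF u] grad_continuous[OF u])
 have Fm: "(%x. ennreal (F x)) \<in> borel_measurable borel"
  using borel_measurable_continuous_onI[OF cF] by measurable
 have point: "ennreal ((u y)^2) <= (nn_integral lborel (%s. ennreal s * ennreal (F (z + s *\<^sub>R (y - z))) * indicator {0<..<1} s))"
  if y: "y \<in> closure ?D" for y
 proof -
  define U where "U s = u (z + s *\<^sub>R (y - z))" for s
  define U' where "U' s = grad u (z + s *\<^sub>R (y - z)) \<bullet> (y - z)" for s
  have dU: "(U has_real_derivative U' s) (at s)" for s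
   unfolding U_def U'_def by (rule DERIV_along_line[OF u])
  have d2: "((%s. s^2 * (U s)^2) has_real_derivative (2 * s * (U s)^2 + s^2 * (2 * U s * U' s))) (at s)" for s
   by (auto intro!: derivative_eq_intros dU simp: power2_eq_square)
  have hi: "((%s. 2 * s * (U s)^2 + s^2 * (2 * U s * U' s)) has_integral (1^2 * (U 1)^2 - 0^2 * (U 0)^2)) {0..1}"
   by (rule fundamental_theorem_of_calculus)
    (auto intro!: DERIV_subset[OF d2] simp flip: has_real_derivative_iff_has_vector_derivative)
  have cl: "continuous_on UNIV (%s::real. F (z + s *\<^sub>R (y - z)))"
   by (intro continuous_on_compose2[OF cF] continuous_intros) auto
  have "(u y)^2 = integral {0..1} (%s. 2 * s * (U s)^2 + s^2 * (2 * U s * U' s))"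
   using integral_unique[OF hi] by (simp add: U_def)
  also have "... <= integral {0..1} (%s. s * F (z + s *\<^sub>R (y - z)))"
  proof (rule integral_le)
   show "(%s. 2 * s * (U s)^2 + s^2 * (2 * U s * U' s)) integrable_on {0..1}" using hi by blast
   show "(%s. s * F (z + s *\<^sub>R (y - z))) integrable_on {0..1}"
    by (intro integrable_continuous_interval continuous_intros continuous_on_subset[OF cl]) auto
   fix s :: real assume s: "s \<in> {0..1}"
   have yz: "norm (y - z) <= h" using h[of z y] y z closure_subset by blast
   have U': "\<bar>U' s\<bar> <= norm (grad u (z + s *\<^sub>R (y - z))) * h"
    unfolding U'_def by (rule order_trans[OF Cauchy_Schwarz_ineq2 mult_left_mono[OF yz norm_ge_zero]])
   have "U s * U' s <= \<bar>U s\<bar> * (norm (grad u (z + s *\<^sub>R (y - z))) * h)"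
    using mult_left_mono[OF U', of "\<bar>U s\<bar>"] abs_ge_self[of "U s * U' s"] by (simp add: abs_mult)
   moreover have "0 <= \<bar>U s\<bar> * (norm (grad u (z + s *\<^sub>R (y - z))) * h)" using h0 by simp
   ultimately have "s * (U s * U' s) <= s * (\<bar>U s\<bar> * (norm (grad u (z + s *\<^sub>R (y - z))) * h))"
    "s * (\<bar>U s\<bar> * (norm (grad u (z + s *\<^sub>R (y - z))) * h)) <= 1 * (\<bar>U s\<bar> * (norm (grad u (z + s *\<^sub>R (y - z))) * h))"
    using s by (auto intro!: mult_left_mono mult_left_le_one_le)
   then have "s * (U s * U' s) <= 1 * (\<bar>U s\<bar> * (norm (grad u (z + s *\<^sub>R (y - z))) * h))" by linarith
   then have "s * (2 * (s * (U s * U' s))) <= s * (2 * (1 * (\<bar>U s\<bar> * (norm (grad u (z + s *\<^sub>R (y - z))) * h))))"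
    using s by (intro mult_left_mono) auto
   then show "2 * s * (U s)^2 + s^2 * (2 * U s * U' s) <= s * F (z + s *\<^sub>R (y - z))"
    by (simp add: F_def U_def power2_eq_square algebra_simps)
  qed
  finally have "ennreal ((u y)^2) <= ennreal (integral {0..1} (%s. s * F (z + s *\<^sub>R (y - z))))" by (rule ennreal_leI)
  also have "... = (nn_integral lborel (%s. ennreal (s * F (z + s *\<^sub>R (y - z))) * indicator {0<..<1} s))"
   by (rule nn_integral_interval(2)[symmetric]) (use F0 in \<open>auto intro!: continuous_intros cl\<close>)
  also have "... = (nn_integral lborel (%s. ennreal s * ennreal (F (z + s *\<^sub>R (y - z))) * indicator {0<..<1} s))"
   by (intro nn_integral_cong) (auto simp: indicator_def ennreal_mult F0)
  finally show ?thesis .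
 qed
 have "(\<Sum>(a, b)\<in>edges vs. ennreal (r * norm (b - a)) * (nn_integral lborel (%\<theta>. ennreal ((u (linepath a b \<theta>))^2) * indicator {0<..<1} \<theta>)))
  <= (\<Sum>(a, b)\<in>edges vs. ennreal \<bar>cross (a - z) (b - a)\<bar> * (nn_integral lborel (%s. nn_integral lborel (%\<theta>. ennreal s * ennreal (F (z + s *\<^sub>R (linepath a b \<theta> - z)))
    * indicator {0<..<1} \<theta> * indicator {0<..<1} s))))"
 proof (rule sum_mono)
  fix e assume "e \<in> edges vs"
  then obtain a b where e: "e = (a, b)" "(a, b) \<in> edges vs" by (cases e) auto
  have cl: "continuous_on UNIV (%p. linepath a b (snd p) :: real^2)" unfolding linepath_def by (intro continuous_intros)
  have Fc: "(%p :: real \<times> real. F (z + fst p *\<^sub>R (linepath a b (snd p) - z))) \<in> borel_measurable borel"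
   by (intro borel_measurable_continuous_onI continuous_on_compose2[OF cF] continuous_intros cl) auto
  have "(nn_integral lborel (%\<theta>. ennreal ((u (linepath a b \<theta>))^2) * indicator {0<..<1} \<theta>))
   <= (nn_integral lborel (%\<theta>. nn_integral lborel (%s. ennreal s * ennreal (F (z + s *\<^sub>R (linepath a b \<theta> - z))) * indicator {0<..<1} \<theta> * indicator {0<..<1} s)))"
  proof (rule nn_integral_mono)
   fix \<theta> :: real
   show "ennreal ((u (linepath a b \<theta>))^2) * indicator {0<..<1} \<theta> <= (nn_integral lborel (%s. ennreal s * ennreal (F (z + s *\<^sub>R (linepath a b \<theta> - z))) * indicator {0<..<1} \<theta> * indicator {0<..<1} s))"
   proof (cases "\<theta> \<in> {0<..<1}")
    case True
    have "linepath a b \<theta> \<in> closed_segment a b" using True by (intro linepath_in_path) auto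
    then have "linepath a b \<theta> \<in> frontier ?D" using edge_in_frontier[OF K ne e(2)] by blast
    then have "linepath a b \<theta> \<in> closure ?D" by (simp add: frontier_def)
    from point[OF this] show ?thesis using True by simp
   qed simp
  qed
  also have "... = (nn_integral lborel (%s. nn_integral lborel (%\<theta>. ennreal s * ennreal (F (z + s *\<^sub>R (linepath a b \<theta> - z))) * indicator {0<..<1} \<theta> * indicator {0<..<1} s)))"
  proof (rule lborel_pair.Fubini')
   have [measurable]: "(%p :: real \<times> real. F (z + fst p *\<^sub>R (linepath a b (snd p) - z))) \<in> borel_measurable (lborel \<Otimes>\<^sub>M lborel)"
    using Fc by (simp add: lborel_prod)
   show "(%(s, \<theta>). ennreal s * ennreal (F (z + s *\<^sub>R (linepath a b \<theta> - z))) * indicator {0<..<1} \<theta> * indicator {0<..<1} s) \<in> borel_measurable (lborel \<Otimes>\<^sub>M lborel)"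
    unfolding split_beta by measurable
  qed
  finally have "ennreal (r * norm (b - a)) * (nn_integral lborel (%\<theta>. ennreal ((u (linepath a b \<theta>))^2) * indicator {0<..<1} \<theta>))
   <= ennreal \<bar>cross (a - z) (b - a)\<bar> * (nn_integral lborel (%s. nn_integral lborel (%\<theta>. ennreal s * ennreal (F (z + s *\<^sub>R (linepath a b \<theta> - z))) * indicator {0<..<1} \<theta> * indicator {0<..<1} s)))"
   by (intro mult_mono ennreal_leI crs e(2)) auto
  then show "(case e of (a, b) => ennreal (r * norm (b - a)) * (nn_integral lborel (%\<theta>. ennreal ((u (linepath a b \<theta>))^2) * indicator {0<..<1} \<theta>)))
   <= (case e of (a, b) => ennreal \<bar>cross (a - z) (b - a)\<bar> * (nn_integral lborel (%s. nn_integral lborel (%\<theta>. ennreal s * ennreal (F (z + s *\<^sub>R (linepath a b \<theta> - z))) * indicator {0<..<1} \<theta> * indicator {0<..<1} s))))"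
   unfolding e(1) prod.case .
 qed
 also have "... <= (nn_integral lborel (%x. ennreal (F x) * indicator ?D x))"
  by (rule fan_integrals_le[OF K z cne Fm])
 finally show ?thesis unfolding F_def .
qed

section \<open>Polynomials on convex sets\<close>

text \<open>Polynomials seen through their restrictions to lines, in any dimension: the boundary
  weight estimate is applied both in the plane and on the unit interval.\<close>

definition line_poly :: "nat => ('a::euclidean_space => real) => bool" where
 "line_poly l q \<longleftrightarrow> continuous_on UNIV q \<and> (\<forall>a v. \<exists>P. degree P <= l \<and> (\<forall>t. q (a + t *\<^sub>R v) = poly P t))"

text \<open>x is a combination of a point of D with weight k and of z with weight 1 - k; the same
  combination with the ball around z is a ball of radius (1 - k) r around x inside D.\<close>

lemma infdist_complement_ge:
 fixes D :: "'a::euclidean_space set"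
 assumes D: "convex D" "bounded D" and B: "ball z r \<subseteq> D" and l: "0 < k" "k < 1"
  and x: "z + (1 / k) *\<^sub>R (x - z) \<in> D"
 shows "(1 - k) * r <= infdist x (- D)"
proof -
 have ne: "- D ~= {}" using D(2) not_bounded_UNIV by (metis Compl_empty_eq double_complement)
 show ?thesis unfolding infdist_notempty[OF ne]
 proof (rule cINF_greatest[OF ne])
  fix y assume y: "y \<in> - D"
  show "(1 - k) * r <= dist x y"
  proof (rule ccontr)
   assume "\<not> ?thesis"
   then have yx: "norm (y - x) < (1 - k) * r" by (simp add: dist_norm norm_minus_commute)
   have "norm ((1 / (1 - k)) *\<^sub>R (y - x)) = norm (y - x) / (1 - k)" using l by simp
   also have "... < r" using yx l by (simp add: pos_divide_less_eq mult.commute)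
   finally have "z + (1 / (1 - k)) *\<^sub>R (y - x) \<in> D" using B by (auto simp: dist_norm)
   then have "k *\<^sub>R (z + (1 / k) *\<^sub>R (x - z)) + (1 - k) *\<^sub>R (z + (1 / (1 - k)) *\<^sub>R (y - x)) \<in> D"
    using x l by (intro convexD[OF D(1)]) auto
   moreover have "k *\<^sub>R (z + (1 / k) *\<^sub>R (x - z)) + (1 - k) *\<^sub>R (z + (1 / (1 - k)) *\<^sub>R (y - x)) = y"
    using l by (simp add: scaleR_add_right) (simp add: algebra_simps)
   ultimately show False using y by simp
  qed
 qed
qed

text \<open>Along each ray from \<open>z\<close> the endpoint bound for polynomials applies; integrating over the
 dilates of \<open>D\<close> produces the weight.\<close>

lemma weighted_norm_bound:
 fixes D :: "'a::euclidean_space set" and q :: "'a => real"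
 assumes D: "convex D" "open D" "bounded D" and B: "ball z r \<subseteq> D" "r > 0" and q: "line_poly l q"
 shows "ennreal r * (nn_integral lborel (%x. ennreal ((q x)^2) * indicator D x))
  <= ennreal (20 * (real l + real DIM('a) + 1)^2) * (nn_integral lborel (%x. ennreal (infdist x (- D) * (q x)^2) * indicator D x))"
proof -
 define N where "N = DIM('a)"
 define C where "C = 20 * (real l + real N + 1)^2"
 have [measurable]: "D \<in> sets borel" using D by simp
 have cq: "continuous_on UNIV q" using q by (simp add: line_poly_def)
 then have [measurable]: "q \<in> borel_measurable borel" by (rule borel_measurable_continuous_onI)
 define b where "b x = infdist x (- D)" for x
 have b0: "0 <= b x" for x by (simp add: b_def infdist_nonneg)
 have cb: "continuous_on UNIV b" unfolding b_def[abs_def] by (intro continuous_intros)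
 have [measurable]: "b \<in> borel_measurable borel" using cb by (rule borel_measurable_continuous_onI)
 have zD: "z \<in> D" using B by auto
 have pt: "ennreal ((q y)^2) <= ennreal C * (nn_integral lborel (%k. ennreal (k ^ N) * ennreal ((q (z + k *\<^sub>R (y - z)))^2) * indicator {0<..<1} k))" for y
 proof -
  obtain P where P: "degree P <= l" "!!t. q (z + t *\<^sub>R (y - z)) = poly P t" using q unfolding line_poly_def by metis
  \<comment> \<open>The factor t^N, with N the dimension, pays for the Jacobian k^N of the dilation
    at the price of a higher degree; at t = 1 it does not change the value.\<close>
  define Q where "Q = monom 1 N * P"
  have pQ: "poly Q t = t ^ N * poly P t" for t by (simp add: Q_def poly_monom)
  have "degree Q <= N + l" unfolding Q_def by (rule order_trans[OF degree_mult_le]) (use P(1) degree_monom_le[of "1::real" N] in linarith)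
  from poly_endpoint_bound[OF this] have "(poly Q 1)^2 <= C * integral {0..1} (%x. (poly Q x)^2)"
   by (simp add: C_def add.commute)
  also have "integral {0..1} (%x. (poly Q x)^2) <= integral {0..1} (%x. x ^ N * (poly P x)^2)"
  proof (rule integral_le)
   fix x :: real assume x: "x \<in> {0..1}"
   have "x ^ N * x ^ N <= x ^ N * 1" using x by (intro mult_left_mono power_le_one) auto
   then have "(x ^ N * x ^ N) * (poly P x)^2 <= x ^ N * (poly P x)^2" by (intro mult_right_mono) auto
   moreover have "(poly Q x)^2 = (x ^ N * x ^ N) * (poly P x)^2" unfolding pQ power2_eq_square by (simp only: mult_ac)
   ultimately show "(poly Q x)^2 <= x ^ N * (poly P x)^2" by linarith
  qed (intro integrable_continuous_interval continuous_intros)+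
  finally have "(q y)^2 <= C * integral {0..1} (%x. x ^ N * (poly P x)^2)"
   using P(2)[of 1] by (simp add: pQ C_def mult_left_mono)
  then have "ennreal ((q y)^2) <= ennreal (C * integral {0..1} (%x. x ^ N * (poly P x)^2))" by (rule ennreal_leI)
  also have "... = ennreal C * ennreal (integral {0..1} (%x. x ^ N * (poly P x)^2))"
   by (rule ennreal_mult) (auto simp: C_def intro!: Henstock_Kurzweil_Integration.integral_nonneg integrable_continuous_interval continuous_intros)
  also have "ennreal (integral {0..1} (%x. x ^ N * (poly P x)^2)) = (nn_integral lborel (%k. ennreal (k ^ N * (poly P k)^2) * indicator {0<..<1} k))"
   by (rule nn_integral_interval(2)[symmetric]) (auto intro!: continuous_intros)
  also have "... = (nn_integral lborel (%k. ennreal (k ^ N) * ennreal ((q (z + k *\<^sub>R (y - z)))^2) * indicator {0<..<1} k))"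
   by (intro nn_integral_cong) (auto simp: indicator_def ennreal_mult P(2))
  finally show ?thesis .
 qed
 have "(nn_integral lborel (%y. ennreal ((q y)^2) * indicator D y))
  <= (nn_integral lborel (%y. ennreal C * (nn_integral lborel (%k. ennreal (k ^ N) * ennreal ((q (z + k *\<^sub>R (y - z)))^2) * indicator {0<..<1} k * indicator D y))))"
 proof (rule nn_integral_mono)
  fix y
  show "ennreal ((q y)^2) * indicator D y <= ennreal C * (nn_integral lborel (%k. ennreal (k ^ N) * ennreal ((q (z + k *\<^sub>R (y - z)))^2) * indicator {0<..<1} k * indicator D y))"
   using pt[of y] by (cases "y \<in> D") simp_all
 qed
 also have "... = ennreal C * (nn_integral lborel (%y. nn_integral lborel (%k. ennreal (k ^ N) * ennreal ((q (z + k *\<^sub>R (y - z)))^2) * indicator {0<..<1} k * indicator D y)))"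
  by (rule nn_integral_cmult) measurable
 also have "(nn_integral lborel (%y. nn_integral lborel (%k. ennreal (k ^ N) * ennreal ((q (z + k *\<^sub>R (y - z)))^2) * indicator {0<..<1} k * indicator D y)))
  = (nn_integral lborel (%k. nn_integral lborel (%y. ennreal (k ^ N) * ennreal ((q (z + k *\<^sub>R (y - z)))^2) * indicator {0<..<1} k * indicator D y)))"
  by (rule lborel_pair.Fubini') measurable
 also have "... = (nn_integral lborel (%k. nn_integral lborel (%x. ennreal ((q x)^2) * indicator D (z + (1 / k) *\<^sub>R (x - z)) * indicator {0<..<1} k)))"
 proof (rule nn_integral_cong)
  fix k :: real
  show "(nn_integral lborel (%y. ennreal (k ^ N) * ennreal ((q (z + k *\<^sub>R (y - z)))^2) * indicator {0<..<1} k * indicator D y))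
   = (nn_integral lborel (%x. ennreal ((q x)^2) * indicator D (z + (1 / k) *\<^sub>R (x - z)) * indicator {0<..<1} k))"
  proof (cases "k \<in> {0<..<1}")
   case True
   then have l: "0 < k" "k < 1" by auto
   define f where "f x = ennreal ((q x)^2) * indicator D (z + (1 / k) *\<^sub>R (x - z))" for x
   have [measurable]: "f \<in> borel_measurable borel" unfolding f_def[abs_def] by measurable
   have "(nn_integral lborel (%x. f x)) = ennreal (\<bar>k\<bar> ^ DIM('a)) * (nn_integral lborel (%y. f ((z - k *\<^sub>R z) + k *\<^sub>R y)))"
    by (rule nn_integral_lborel_affine) (use l in auto)
   also have "... = (nn_integral lborel (%y. ennreal (k ^ N) * f ((z - k *\<^sub>R z) + k *\<^sub>R y)))"
    using l by (subst nn_integral_cmult) (auto simp: N_def)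
   also have "... = (nn_integral lborel (%y. ennreal (k ^ N) * ennreal ((q (z + k *\<^sub>R (y - z)))^2) * indicator D y))"
   proof (rule nn_integral_cong)
    fix y
    have 1: "(z - k *\<^sub>R z) + k *\<^sub>R y = z + k *\<^sub>R (y - z)" by (simp add: algebra_simps)
    have 2: "z + (1 / k) *\<^sub>R ((z + k *\<^sub>R (y - z)) - z) = y" using l by simp
    show "ennreal (k ^ N) * f ((z - k *\<^sub>R z) + k *\<^sub>R y) = ennreal (k ^ N) * ennreal ((q (z + k *\<^sub>R (y - z)))^2) * indicator D y"
     unfolding f_def 1 2 by (simp only: mult.assoc)
   qed
   finally show ?thesis using True by (simp add: f_def)
  qed simp
 qed
 also have "... = (nn_integral lborel (%x. nn_integral lborel (%k. ennreal ((q x)^2) * indicator D (z + (1 / k) *\<^sub>R (x - z)) * indicator {0<..<1} k)))"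
  by (rule lborel_pair.Fubini') measurable
 also have "... <= (nn_integral lborel (%x. ennreal (b x / r) * ennreal ((q x)^2) * indicator D x))"
 proof (rule nn_integral_mono)
  fix x
  \<comment> \<open>For fixed \<open>x\<close> only factors k >= 1 - b x / r contribute, so the
    integral over k is at most b x / r: this is how the weight arises.\<close>
  have "ennreal ((q x)^2) * indicator D (z + (1 / k) *\<^sub>R (x - z)) * indicator {0<..<1} k
    <= (ennreal ((q x)^2) * indicator D x) * indicator {1 - b x / r..1} k" for k :: real
  proof (cases "k \<in> {0<..<1} \<and> z + (1 / k) *\<^sub>R (x - z) \<in> D")
   case True
   then have l: "0 < k" "k < 1" by auto
   have "(1 - k) * r <= b x" unfolding b_def using infdist_complement_ge[OF D(1,3) B(1) l] True by simp
   then have "1 - k <= b x / r" using B(2) by (simp add: pos_le_divide_eq)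
   moreover have "x \<in> D"
   proof -
    have "z + k *\<^sub>R ((z + (1 / k) *\<^sub>R (x - z)) - z) \<in> D"
     by (rule segment_interior[OF D(1,2) zD]) (use True l closure_subset in auto)
    then show ?thesis using l by simp
   qed
   ultimately show ?thesis using True by (simp add: indicator_def)
  qed (auto simp: indicator_def)
  then have "(nn_integral lborel (%k. ennreal ((q x)^2) * indicator D (z + (1 / k) *\<^sub>R (x - z)) * indicator {0<..<1} k))
    <= (nn_integral lborel (%k. (ennreal ((q x)^2) * indicator D x) * indicator {1 - b x / r..1} k))"
   by (rule nn_integral_mono)
  also have "... = (ennreal ((q x)^2) * indicator D x) * ennreal (b x / r)"
   using b0[of x] B(2) by (simp add: nn_integral_cmult_indicator)
  finally show "(nn_integral lborel (%k. ennreal ((q x)^2) * indicator D (z + (1 / k) *\<^sub>R (x - z)) * indicator {0<..<1} k))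
   <= ennreal (b x / r) * ennreal ((q x)^2) * indicator D x" by (simp only: mult_ac)
 qed
 finally have "(nn_integral lborel (%y. ennreal ((q y)^2) * indicator D y)) <= ennreal C * (nn_integral lborel (%x. ennreal (b x / r) * ennreal ((q x)^2) * indicator D x))"
  by (simp add: mult_left_mono)
 then have "ennreal r * (nn_integral lborel (%y. ennreal ((q y)^2) * indicator D y)) <= ennreal r * (ennreal C * (nn_integral lborel (%x. ennreal (b x / r) * ennreal ((q x)^2) * indicator D x)))"
  by (rule mult_left_mono) simp
 also have "... = ennreal C * (ennreal r * (nn_integral lborel (%x. ennreal (b x / r) * ennreal ((q x)^2) * indicator D x)))" by (simp only: mult_ac)
 also have "ennreal r * (nn_integral lborel (%x. ennreal (b x / r) * ennreal ((q x)^2) * indicator D x)) = (nn_integral lborel (%x. ennreal r * (ennreal (b x / r) * ennreal ((q x)^2) * indicator D x)))"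
  by (rule nn_integral_cmult[symmetric]) measurable
 also have "... = (nn_integral lborel (%x. ennreal (b x * (q x)^2) * indicator D x))"
 proof (rule nn_integral_cong)
  fix x
  have "ennreal r * ennreal (b x / r) = ennreal (b x)" using B(2) b0[of x] by (simp flip: ennreal_mult)
  then have "ennreal r * (ennreal (b x / r) * ennreal ((q x)^2) * indicator D x) = ennreal (b x) * ennreal ((q x)^2) * indicator D x"
   by (simp only: mult.assoc[symmetric])
  then show "ennreal r * (ennreal (b x / r) * ennreal ((q x)^2) * indicator D x) = ennreal (b x * (q x)^2) * indicator D x"
   using b0[of x] by (simp add: ennreal_mult)
 qed
 finally show ?thesis by (simp add: C_def N_def b_def)
qed

text \<open>A nonempty bounded open convex set of reals is an interval (s, e), and \<beta> is at
  most the distance to either end. So \<beta>^2 is bounded by the Legendre weight (t - s) (e -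
  t).\<close>

lemma slice_inverse_estimate:
 fixes T :: "real set"
 assumes T: "open T" "convex T" "bounded T" and P: "degree P <= l" and \<beta>: "!!t. t \<in> T ==> 0 <= \<beta> t"
  "!!t t'. t \<in> T ==> t' \<notin> T ==> \<beta> t <= \<bar>t - t'\<bar>"
 shows "(nn_integral lborel (%t. ennreal ((\<beta> t * poly (pderiv P) t)^2) * indicator T t))
  <= ennreal (real l * (real l + 1)) * (nn_integral lborel (%t. ennreal ((poly P t)^2) * indicator T t))"
proof (cases "T = {}")
 case False
 define s e where "s = Inf T" and "e = Sup T"
 have bd: "bdd_below T" "bdd_above T" using T(3) by (auto simp: bounded_imp_bdd_below bounded_imp_bdd_above)
 have Tse: "T = {s<..<e}"
 proof
  show "T \<subseteq> {s<..<e}"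
  proof
   fix t assume t: "t \<in> T"
   then obtain d where d: "d > 0" "ball t d \<subseteq> T" using T(1) open_contains_ball by blast
   have "t - d / 2 \<in> T" "t + d / 2 \<in> T" using d by (auto simp: dist_real_def intro!: subsetD[OF d(2)])
   then have "s <= t - d / 2" "t + d / 2 <= e" using bd by (auto simp: s_def e_def intro: cInf_lower cSup_upper)
   then show "t \<in> {s<..<e}" using d(1) by simp
  qed
  show "{s<..<e} \<subseteq> T"
  proof
   fix t assume t: "t \<in> {s<..<e}"
   obtain t1 where t1: "t1 \<in> T" "t1 < t" using t cInf_lessD[OF False, of t] by (auto simp: s_def)
   obtain t2 where t2: "t2 \<in> T" "t < t2" using t less_cSupD[OF False, of t] by (auto simp: e_def)
   have "{t1..t2} \<subseteq> T" using T(2) t1 t2 by (metis closed_segment_eq_real_ivl closed_segment_subset less_imp_le order_trans)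
   then show "t \<in> T" using t1 t2 by auto
  qed
 qed
 have se: "s <= e" using False Tse by auto
 have "(nn_integral lborel (%t. ennreal ((\<beta> t * poly (pderiv P) t)^2) * indicator T t))
  <= (nn_integral lborel (%t. ennreal ((t - s) * (e - t) * (poly (pderiv P) t)^2) * indicator {s<..<e} t))"
 proof (rule nn_integral_mono)
  fix t
  show "ennreal ((\<beta> t * poly (pderiv P) t)^2) * indicator T t <= ennreal ((t - s) * (e - t) * (poly (pderiv P) t)^2) * indicator {s<..<e} t"
  proof (cases "t \<in> T")
   case True
   have "s \<notin> T" "e \<notin> T" unfolding Tse by auto
   then have "\<beta> t <= t - s" "\<beta> t <= e - t" using \<beta>(2)[OF True] True[unfolded Tse] by fastforce+
   then have "\<beta> t * \<beta> t <= (t - s) * (e - t)" using \<beta>(1)[OF True] by (intro mult_mono) auto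
   then have "(\<beta> t * \<beta> t) * (poly (pderiv P) t)^2 <= (t - s) * (e - t) * (poly (pderiv P) t)^2" by (intro mult_right_mono) auto
   moreover have "(\<beta> t * poly (pderiv P) t)^2 = (\<beta> t * \<beta> t) * (poly (pderiv P) t)^2" unfolding power2_eq_square by (simp only: mult_ac)
   ultimately have "(\<beta> t * poly (pderiv P) t)^2 <= (t - s) * (e - t) * (poly (pderiv P) t)^2" by linarith
   then show ?thesis using True Tse by (simp add: ennreal_leI)
  qed simp
 qed
 also have "... = ennreal (integral {s..e} (%t. (t - s) * (e - t) * (poly (pderiv P) t)^2))"
  by (rule nn_integral_interval(2)) (auto intro!: continuous_intros mult_nonneg_nonneg)
 also have "... <= ennreal (real l * (real l + 1) * integral {s..e} (%t. (poly P t)^2))"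
  by (rule ennreal_leI[OF poly_weighted_deriv_bound[OF se P]])
 also have "... = ennreal (real l * (real l + 1)) * ennreal (integral {s..e} (%t. (poly P t)^2))"
  by (rule ennreal_mult) (auto intro!: Henstock_Kurzweil_Integration.integral_nonneg integrable_continuous_interval continuous_intros)
 also have "ennreal (integral {s..e} (%t. (poly P t)^2)) = (nn_integral lborel (%t. ennreal ((poly P t)^2) * indicator {s<..<e} t))"
  by (rule nn_integral_interval(2)[symmetric]) (auto intro!: continuous_intros)
 finally show ?thesis by (simp only: Tse)
qed simp

lemma nn_integral_real2_swap:
 fixes f :: "real^2 => ennreal"
 assumes [measurable]: "f \<in> borel_measurable borel"
 shows "(nn_integral lborel (%x. f x)) = (nn_integral lborel (%t. nn_integral lborel (%s. f (vector [s, t]))))"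
proof -
 have V: "(%p. vector [fst p, snd p] :: real^2) = (%p. fst p *\<^sub>R axis 1 1 + snd p *\<^sub>R axis 2 1)"
  by (auto simp: vec_eq_iff forall_2 axis_def)
 have "(%p. vector [fst p, snd p] :: real^2) \<in> borel_measurable (borel :: (real \<times> real) measure)"
  unfolding V by (intro borel_measurable_continuous_onI continuous_intros)
 then have [measurable]: "(%p. vector [fst p, snd p] :: real^2) \<in> borel_measurable (lborel \<Otimes>\<^sub>M lborel)" by (simp add: lborel_prod)
 have "(%(s, t). f (vector [s, t])) \<in> borel_measurable (lborel \<Otimes>\<^sub>M lborel)" unfolding split_beta by measurable
 then show ?thesis unfolding nn_integral_real2[OF assms] by (rule lborel_pair.Fubini'[symmetric])
qed

text \<open>On every line parallel to the i-th axis the distance to the complement is at most the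
  distance within the slice, so the one-dimensional estimate applies slice by slice. The weight has
  the scaling inverse to the derivative, hence no power of the diameter appears.\<close>

lemma infdist_slice:
 fixes D :: "(real^2) set"
 assumes D: "convex D" "open D" "bounded D" and q: "line_poly l q" "smooth q"
 shows "(nn_integral lborel (%x. ennreal ((infdist x (- D) * partial i q x)^2) * indicator D x))
  <= ennreal (real l * (real l + 1)) * (nn_integral lborel (%x. ennreal ((q x)^2) * indicator D x))"
proof -
 have [measurable]: "D \<in> sets borel" using D by simp
 have [measurable]: "q \<in> borel_measurable borel" "partial i q \<in> borel_measurable borel"
  using q by (auto intro!: borel_measurable_continuous_onI smooth_continuous smooth_partial)
 have "continuous_on UNIV (%x :: real^2. infdist x (- D))" by (intro continuous_intros)
 then have [measurable]: "(%x. infdist x (- D)) \<in> borel_measurable borel" by (rule borel_measurable_continuous_onI)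
 define C where "C = ennreal (real l * (real l + 1))"
 have slice: "(nn_integral lborel (%t. ennreal ((infdist (a + t *\<^sub>R axis i 1) (- D) * partial i q (a + t *\<^sub>R axis i 1))^2) * indicator D (a + t *\<^sub>R axis i 1)))
  <= C * (nn_integral lborel (%t. ennreal ((q (a + t *\<^sub>R axis i 1))^2) * indicator D (a + t *\<^sub>R axis i 1)))" for a :: "real^2"
 proof -
  obtain P where P: "degree P <= l" "!!t. q (a + t *\<^sub>R axis i 1) = poly P t" using q(1) unfolding line_poly_def by metis
  have dP: "partial i q (a + t *\<^sub>R axis i 1) = poly (pderiv P) t" for t
  proof -
   have "((%t. q (a + t *\<^sub>R axis i 1)) has_real_derivative partial i q (a + t *\<^sub>R axis i 1)) (at t)"
    using DERIV_along_line[OF q(2), of a "axis i 1" t] by (simp add: inner_axis grad_def)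
   then show ?thesis using DERIV_unique[OF _ poly_DERIV[of P t]] unfolding P(2) by blast
  qed
  define T where "T = {t. a + t *\<^sub>R axis i 1 \<in> D}"
  have "continuous_on UNIV (%t. a + t *\<^sub>R axis i (1::real) :: real^2)" by (intro continuous_intros)
  from open_vimage[OF D(2) this] have oT: "open T" by (simp add: T_def vimage_def)
  have cT: "convex T" unfolding convex_def T_def
  proof (intro ballI allI impI, unfold mem_Collect_eq)
   fix x y u v :: real assume *: "a + x *\<^sub>R axis i 1 \<in> D" "a + y *\<^sub>R axis i 1 \<in> D" "0 <= u" "0 <= v" "u + v = 1"
   have "u *\<^sub>R (a + x *\<^sub>R axis i 1) + v *\<^sub>R (a + y *\<^sub>R axis i 1) \<in> D" using * by (intro convexD[OF D(1)])
   moreover have "u *\<^sub>R (a + x *\<^sub>R axis i 1) + v *\<^sub>R (a + y *\<^sub>R axis i 1) = (u + v) *\<^sub>R a + (u *\<^sub>R x + v *\<^sub>R y) *\<^sub>R axis i 1"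
    by (simp add: algebra_simps)
   ultimately show "a + (u *\<^sub>R x + v *\<^sub>R y) *\<^sub>R axis i 1 \<in> D" using *(5) by simp
  qed
  have bT: "bounded T"
  proof -
   obtain M where M: "!!x. x \<in> D ==> norm x <= M" using D(3) bounded_iff by blast
   have "norm t <= M + norm a" if t: "t \<in> T" for t
   proof -
    have "norm (t *\<^sub>R axis i (1::real)) <= norm (a + t *\<^sub>R axis i 1) + norm a"
     using norm_triangle_ineq4[of "a + t *\<^sub>R axis i 1" a] by simp
    then show ?thesis using M[of "a + t *\<^sub>R axis i 1"] t by (simp add: T_def)
   qed
   then show ?thesis unfolding bounded_iff by blast
  qed
  have ind: "indicator D (a + t *\<^sub>R axis i 1) = (indicator T t :: ennreal)" for t by (simp add: T_def indicator_def)
  show ?thesis unfolding ind P(2) dP C_def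
  proof (rule slice_inverse_estimate[OF oT cT bT P(1)])
   show "0 <= infdist (a + t *\<^sub>R axis i 1) (- D)" for t by (rule infdist_nonneg)
   fix t t' assume "t \<in> T" "t' \<notin> T"
   then have "infdist (a + t *\<^sub>R axis i 1) (- D) <= dist (a + t *\<^sub>R axis i 1) (a + t' *\<^sub>R axis i 1)"
    by (intro infdist_le) (simp add: T_def)
   also have "... = norm ((t - t') *\<^sub>R axis i (1::real) :: real^2)" by (simp add: dist_norm algebra_simps)
   finally show "infdist (a + t *\<^sub>R axis i 1) (- D) <= \<bar>t - t'\<bar>" by simp
  qed
 qed
 define F where "F x = ennreal ((infdist x (- D) * partial i q x)^2) * indicator D x" for x
 define H where "H x = ennreal ((q x)^2) * indicator D x" for x
 have [measurable]: "F \<in> borel_measurable borel" "H \<in> borel_measurable borel"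
  unfolding F_def[abs_def] H_def[abs_def] by measurable
 have sl: "(nn_integral lborel (%t. F (a + t *\<^sub>R axis i 1))) <= C * (nn_integral lborel (%t. H (a + t *\<^sub>R axis i 1)))" for a
  unfolding F_def H_def by (rule slice)
 have vm: "(%s. vector [s, t] :: real^2) \<in> borel_measurable borel" "(%s. vector [t, s] :: real^2) \<in> borel_measurable borel" for t :: real
 proof -
  have "(%s. vector [s, t] :: real^2) = (%s. s *\<^sub>R axis 1 1 + t *\<^sub>R axis 2 1)" "(%s. vector [t, s] :: real^2) = (%s. t *\<^sub>R axis 1 1 + s *\<^sub>R axis 2 1)"
   by (auto simp: vec_eq_iff forall_2 axis_def)
  then show "(%s. vector [s, t] :: real^2) \<in> borel_measurable borel" "(%s. vector [t, s] :: real^2) \<in> borel_measurable borel"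
   by (auto intro!: borel_measurable_continuous_onI continuous_intros)
 qed
 have "(nn_integral lborel (%x. F x)) <= C * (nn_integral lborel (%x. H x))"
 proof -
  consider "i = 1" | "i = 2" using exhaust_2[of i] by blast
  then show ?thesis
  proof cases
   case 1
   have v: "vector [s, t] = vector [0, t] + s *\<^sub>R axis i 1" for s t :: real by (simp add: 1 vec_eq_iff forall_2 axis_def)
   have "(nn_integral lborel (%x. F x)) = (nn_integral lborel (%t. nn_integral lborel (%s. F (vector [0, t] + s *\<^sub>R axis i 1))))"
    by (subst nn_integral_real2_swap) (simp_all flip: v)
   also have "... <= (nn_integral lborel (%t. C * (nn_integral lborel (%s. H (vector [0, t] + s *\<^sub>R axis i 1)))))" by (intro nn_integral_mono sl)
   also have "... = C * (nn_integral lborel (%t. nn_integral lborel (%s. H (vector [0, t] + s *\<^sub>R axis i 1))))"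
    by (rule nn_integral_cmult) (use vm in measurable)
   also have "(nn_integral lborel (%t. nn_integral lborel (%s. H (vector [0, t] + s *\<^sub>R axis i 1)))) = (nn_integral lborel (%x. H x))"
    by (subst nn_integral_real2_swap[of H]) (simp_all flip: v)
   finally show ?thesis .
  next
   case 2
   have v: "vector [s, t] = vector [s, 0] + t *\<^sub>R axis i 1" for s t :: real by (simp add: 2 vec_eq_iff forall_2 axis_def)
   have "(nn_integral lborel (%x. F x)) = (nn_integral lborel (%s. nn_integral lborel (%t. F (vector [s, 0] + t *\<^sub>R axis i 1))))"
    by (subst nn_integral_real2) (simp_all flip: v)
   also have "... <= (nn_integral lborel (%s. C * (nn_integral lborel (%t. H (vector [s, 0] + t *\<^sub>R axis i 1)))))" by (intro nn_integral_mono sl)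
   also have "... = C * (nn_integral lborel (%s. nn_integral lborel (%t. H (vector [s, 0] + t *\<^sub>R axis i 1))))"
    by (rule nn_integral_cmult) (use vm in measurable)
   also have "(nn_integral lborel (%s. nn_integral lborel (%t. H (vector [s, 0] + t *\<^sub>R axis i 1)))) = (nn_integral lborel (%x. H x))"
    by (subst nn_integral_real2[of H]) (simp_all flip: v)
   finally show ?thesis .
  qed
 qed
 then show ?thesis by (simp add: F_def H_def C_def)
qed

section \<open>The lower bound\<close>

lemma lborel_shift:
 fixes f :: "real^2 => real"
 assumes "f \<in> borel_measurable borel"
 shows "(LBINT x. f (x + c)) = (LBINT x. f x)"
proof -
 have "(LBINT x. f x) = (LINT x|distr lborel borel ((+) c). f x)" by (simp add: lborel_distr_plus)
 also have "... = (LBINT x. f (c + x))" by (rule integral_distr) (use assms in auto)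
 finally show ?thesis by (simp add: add.commute)
qed

lemma continuous_compact_support_integrable:
 fixes f :: "real^2 => real"
 assumes f: "continuous_on UNIV f" and R: "!!x. x \<notin> cball 0 R ==> f x = 0"
 shows "integrable lborel f"
proof -
 have "integrable lborel (%x. indicator (cball 0 R) x *\<^sub>R f x)"
  by (rule borel_integrable_compact) (auto intro: continuous_on_subset[OF f])
 moreover have "(%x. indicator (cball 0 R) x *\<^sub>R f x) = f"
 proof
  fix x show "indicator (cball 0 R) x *\<^sub>R f x = f x" by (cases "x \<in> cball 0 R") (simp_all add: R)
 qed
 ultimately show ?thesis by simp
qed

lemma smooth_local_lipschitz:
 assumes f: "smooth f"
 obtains M where "M \<ge> 0" "!!x y. x \<in> cball 0 R ==> y \<in> cball 0 R ==> \<bar>f x - f y\<bar> <= M * norm (x - y)"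
proof -
 have "compact (grad f ` cball 0 R)" by (intro compact_continuous_image grad_continuous[OF f]) simp
 then obtain M where M: "M > 0" "!!y. y \<in> grad f ` cball 0 R ==> norm y <= M"
  using compact_imp_bounded bounded_pos by metis
 have "norm (f x - f y) <= M * norm (x - y)" if "x \<in> cball 0 R" "y \<in> cball 0 R" for x y
 proof (rule differentiable_bound[OF _ _ _ that])
  show "convex (cball (0::real^2) R)" by simp
  fix x assume x: "x \<in> cball (0::real^2) R"
  show "(f has_derivative (%h. grad f x \<bullet> h)) (at x within cball 0 R)"
   by (rule has_derivative_at_withinI[OF has_derivative_grad[OF smooth_differentiable[OF f]]])
  show "onorm (%h. grad f x \<bullet> h) <= M"
  proof (rule onorm_le)
   fix h
   have "norm (grad f x \<bullet> h) <= norm (grad f x) * norm h" using Cauchy_Schwarz_ineq2[of "grad f x" h] by simp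
   also have "... <= M * norm h" using M(2)[of "grad f x"] x by (intro mult_right_mono) auto
   finally show "norm (grad f x \<bullet> h) <= M * norm h" .
  qed
 qed
 with M(1) show ?thesis by (intro that[of M]) auto
qed

definition diffq :: "(real^2 => real) => 2 => real => real^2 => real" where
 "diffq f i t x = (f (x + t *\<^sub>R axis i 1) - f x) / t"

lemma diffq_tendsto:
 assumes f: "smooth f" and t: "t \<longlonglongrightarrow> 0" "!!n::nat. t n ~= 0"
 shows "(%n. diffq f i (t n) x) \<longlonglongrightarrow> partial i f x"
proof -
 have "((%h. (f (x + (0 + h) *\<^sub>R axis i 1) - f (x + 0 *\<^sub>R axis i 1)) / h) \<longlongrightarrow> grad f (x + 0 *\<^sub>R axis i 1) \<bullet> axis i 1) (at 0)"
  using DERIV_along_line[OF f, of x "axis i 1" 0] unfolding DERIV_def .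
 then have "((%h. diffq f i h x) \<longlongrightarrow> partial i f x) (at 0)" by (simp add: diffq_def inner_axis grad_def)
 moreover have "filterlim t (at 0) sequentially" using t by (simp add: filterlim_at)
 ultimately show ?thesis by (rule filterlim_compose)
qed

text \<open>Dominated convergence: the quotients are bounded by local Lipschitz constants, and those
  of \<psi> vanish outside the ball enlarged by the maximal step 1.\<close>

lemma diffq_product_tendsto:
 assumes v: "smooth v" and \<psi>: "smooth \<psi>" "!!x. x \<notin> cball 0 R ==> \<psi> x = 0"
  and t: "t \<longlonglongrightarrow> 0" "!!n::nat. t n ~= 0" "!!n. \<bar>t n\<bar> <= 1"
 shows "(%n. \<integral>x. diffq v i (t n) x * diffq \<psi> j (t n) x \<partial>lborel) \<longlonglongrightarrow> (LBINT x. partial i v x * partial j \<psi> x)"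
proof -
 obtain M where M: "M \<ge> 0" "!!x y. x \<in> cball 0 (R + 2) ==> y \<in> cball 0 (R + 2) ==> \<bar>v x - v y\<bar> <= M * norm (x - y)"
  using smooth_local_lipschitz[OF v, of "R + 2"] by metis
 obtain N where N: "N \<ge> 0" "!!x y. x \<in> cball 0 (R + 2) ==> y \<in> cball 0 (R + 2) ==> \<bar>\<psi> x - \<psi> y\<bar> <= N * norm (x - y)"
  using smooth_local_lipschitz[OF \<psi>(1), of "R + 2"] by metis
 have c: "continuous_on UNIV (%x. diffq f i s x)" if "smooth f" for f i s
  unfolding diffq_def divide_inverse by (intro continuous_intros continuous_on_compose2[OF smooth_continuous[OF that, of UNIV]]) auto
 have q: "\<bar>diffq f i s x\<bar> <= L" if s: "s ~= 0" "\<bar>s\<bar> <= 1" and x: "x \<in> cball 0 (R + 1)"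
  and L: "!!x y. x \<in> cball 0 (R + 2) ==> y \<in> cball 0 (R + 2) ==> \<bar>f x - f y\<bar> <= L * norm (x - y)" for f i s x L
 proof -
  have "norm (x + s *\<^sub>R axis i 1) <= norm x + \<bar>s\<bar>" using norm_triangle_ineq[of x "s *\<^sub>R axis i 1"] by simp
  then have "\<bar>f (x + s *\<^sub>R axis i 1) - f x\<bar> <= L * norm ((x + s *\<^sub>R axis i 1) - x)" using x s by (intro L) auto
  then have "\<bar>f (x + s *\<^sub>R axis i 1) - f x\<bar> <= L * \<bar>s\<bar>" by simp
  then show ?thesis using s by (simp add: diffq_def pos_divide_le_eq)
 qed
 show ?thesis
 proof (rule integral_dominated_convergence[where w = "%x. (M * N) * indicator (cball 0 (R + 1)) x"])
  show "(%x. partial i v x * partial j \<psi> x) \<in> borel_measurable lborel"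
   using smooth_continuous[OF smooth_partial[OF v]] smooth_continuous[OF smooth_partial[OF \<psi>(1)]]
   by (simp, intro borel_measurable_continuous_onI continuous_intros) auto
  show "(%x. diffq v i (t n) x * diffq \<psi> j (t n) x) \<in> borel_measurable lborel" for n
   by (simp, intro borel_measurable_continuous_onI continuous_intros c v \<psi>)
  show "integrable lborel (%x :: real^2. (M * N) * indicator (cball 0 (R + 1)) x)"
   using emeasure_bounded_finite[OF bounded_cball, of "0 :: real^2" "R + 1"] by (intro integrable_mult_right) (auto simp: integrable_indicator_iff less_top[symmetric])
  show "AE x in lborel. (%n. diffq v i (t n) x * diffq \<psi> j (t n) x) \<longlonglongrightarrow> partial i v x * partial j \<psi> x"
   by (intro AE_I2 tendsto_mult diffq_tendsto v \<psi> t)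
  show "AE x in lborel. norm (diffq v i (t n) x * diffq \<psi> j (t n) x) <= (M * N) * indicator (cball 0 (R + 1)) x" for n
  proof (rule AE_I2)
   fix x :: "real^2"
   show "norm (diffq v i (t n) x * diffq \<psi> j (t n) x) <= (M * N) * indicator (cball 0 (R + 1)) x"
   proof (cases "x \<in> cball 0 (R + 1)")
    case True
    have "\<bar>diffq v i (t n) x\<bar> * \<bar>diffq \<psi> j (t n) x\<bar> <= M * N"
     by (intro mult_mono q[OF t(2,3) True M(2)] q[OF t(2,3) True N(2)] M(1)) auto
    then show ?thesis using True by (simp add: abs_mult)
   next
    case False
    have "norm x <= norm (x + t n *\<^sub>R axis j 1) + \<bar>t n\<bar>" using norm_triangle_ineq4[of "x + t n *\<^sub>R axis j 1" "t n *\<^sub>R axis j 1"] by simp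
    with False t(3)[of n] have "x + t n *\<^sub>R axis j 1 \<notin> cball 0 R" "x \<notin> cball 0 R" by auto
    then have "diffq \<psi> j (t n) x = 0" by (simp add: diffq_def \<psi>(2) del: mem_cball_0)
    then show ?thesis using False by simp
   qed
  qed
 qed
qed

text \<open>Both sides expand into integrals of products of translates, which depend only on the
  difference of the two shifts; reversing the sign of the step exchanges the two directions.\<close>

lemma diffq_exchange:
 fixes v \<psi> :: "real^2 => real"
 assumes v: "continuous_on UNIV v" and \<psi>: "continuous_on UNIV \<psi>" "!!x. x \<notin> cball 0 R ==> \<psi> x = 0"
 shows "(LBINT x. diffq v i t x * diffq \<psi> j t x) = (LBINT x. diffq v j (- t) x * diffq \<psi> i (- t) x)"
proof -
 define e where "e i = t *\<^sub>R (axis i 1 :: real^2)" for i :: 2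
 have cp: "continuous_on UNIV (%x. v (x + c) * \<psi> (x + d))" for c d
  by (intro continuous_intros continuous_on_compose2[OF v] continuous_on_compose2[OF \<psi>(1)]) auto
 have I: "integrable lborel (%x. v (x + c) * \<psi> (x + d))" for c d
 proof (rule continuous_compact_support_integrable[OF cp, of "R + norm d"])
  fix x :: "real^2" assume "x \<notin> cball 0 (R + norm d)"
  moreover have "norm x <= norm (x + d) + norm d" using norm_triangle_ineq4[of "x + d" d] by simp
  ultimately have "x + d \<notin> cball 0 R" by simp
  from \<psi>(2)[OF this] show "v (x + c) * \<psi> (x + d) = 0" by simp
 qed
 define P where "P c d = (LBINT x. v (x + c) * \<psi> (x + d))" for c d
 have sh: "P c d = P (c - d) 0" for c d
 proof -
  have "P c d = (LBINT x. (%x. v (x + (c - d)) * \<psi> (x + 0)) (x + d))" by (simp add: P_def add.assoc)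
  also have "... = P (c - d) 0" unfolding P_def
   by (rule lborel_shift) (rule borel_measurable_continuous_onI[OF cp])
  finally show ?thesis .
 qed
 have "(LBINT x. diffq v i t x * diffq \<psi> j t x)
  = (LBINT x. ((v (x + e i) * \<psi> (x + e j) - v (x + e i) * \<psi> (x + 0)) - (v (x + 0) * \<psi> (x + e j) - v (x + 0) * \<psi> (x + 0))) / (t * t))"
  by (intro Bochner_Integration.integral_cong) (auto simp: diffq_def e_def algebra_simps)
 also have "... = ((P (e i) (e j) - P (e i) 0) - (P 0 (e j) - P 0 0)) / (t * t)"
  unfolding integral_divide_zero by (simp only: P_def Bochner_Integration.integral_diff Bochner_Integration.integrable_diff I)
 also have "... = ((P (- e j) (- e i) - P (- e j) 0) - (P 0 (- e i) - P 0 0)) / (t * t)"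
  by (subst (1 3 4 6) sh) simp
 also have "... = (LBINT x. ((v (x + - e j) * \<psi> (x + - e i) - v (x + - e j) * \<psi> (x + 0)) - (v (x + 0) * \<psi> (x + - e i) - v (x + 0) * \<psi> (x + 0))) / (t * t))"
  unfolding integral_divide_zero by (simp only: P_def Bochner_Integration.integral_diff Bochner_Integration.integrable_diff I)
 also have "... = (LBINT x. diffq v j (- t) x * diffq \<psi> i (- t) x)"
  by (intro Bochner_Integration.integral_cong) (auto simp: diffq_def e_def algebra_simps)
 finally show ?thesis .
qed

text \<open>Difference quotients may be moved from one factor to the other by translation; this avoids
 the symmetry of second derivatives.\<close>

lemma grad_curl_orthogonal:
 assumes v: "smooth v" and \<psi>: "smooth \<psi>" "!!x. x \<notin> cball 0 R ==> \<psi> x = 0"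
 shows "(LBINT x. grad v x \<bullet> curl \<psi> x) = 0"
proof -
 define t where "t n = 1 / real (Suc n)" for n
 have t0: "t \<longlonglongrightarrow> 0" unfolding t_def[abs_def] by (rule lim_1_over_real_power[of 1, simplified] LIMSEQ_inverse_real_of_nat[unfolded inverse_eq_divide])
 have t1: "t n ~= 0" "\<bar>t n\<bar> <= 1" for n by (auto simp: t_def)
 have "(%n. \<integral>x. diffq v 1 (t n) x * diffq \<psi> 2 (t n) x \<partial>lborel) \<longlonglongrightarrow> (LBINT x. partial 1 v x * partial 2 \<psi> x)"
  by (rule diffq_product_tendsto[OF v \<psi> t0 t1])
 moreover have "(%n. \<integral>x. diffq v 2 (- t n) x * diffq \<psi> 1 (- t n) x \<partial>lborel) \<longlonglongrightarrow> (LBINT x. partial 2 v x * partial 1 \<psi> x)"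
  by (rule diffq_product_tendsto[OF v \<psi>]) (use tendsto_minus[OF t0] t1 in auto)
 moreover have "(LBINT x. diffq v 1 (t n) x * diffq \<psi> 2 (t n) x) = (LBINT x. diffq v 2 (- t n) x * diffq \<psi> 1 (- t n) x)" for n
  by (rule diffq_exchange[OF smooth_continuous[OF v] smooth_continuous[OF \<psi>(1)] \<psi>(2)])
 ultimately have eq: "(LBINT x. partial 1 v x * partial 2 \<psi> x) = (LBINT x. partial 2 v x * partial 1 \<psi> x)"
  using LIMSEQ_unique by simp
 have z: "partial i \<psi> x = 0" if "x \<notin> cball 0 (R + 1)" for i and x :: "real^2"
 proof -
  have x: "x \<in> - cball 0 R" using that by auto
  have 0: "0 = \<psi> y" if "y \<in> - cball 0 R" for y using \<psi>(2)[of y] that by (simp del: mem_cball_0)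
  have "(\<psi> has_derivative (%h. 0)) (at x)"
   by (rule has_derivative_transform_within_open[where s = "- cball 0 R" and f = "%x. 0", OF _ open_Compl[OF closed_cball] x 0]) simp_all
  from partial_eq[OF this] show ?thesis .
 qed
 have I: "integrable lborel (%x. partial i v x * partial j \<psi> x)" for i j
  by (rule continuous_compact_support_integrable[where R = "R + 1"])
   (auto intro!: continuous_on_mult smooth_continuous[OF smooth_partial] v \<psi> simp: z simp del: mem_cball_0)
 have "(LBINT x. grad v x \<bullet> curl \<psi> x) = (LBINT x. partial 1 v x * partial 2 \<psi> x - partial 2 v x * partial 1 \<psi> x)"
  by (simp add: inner_real2 grad_def curl_def)
 then show ?thesis by (simp add: eq I Bochner_Integration.integral_diff)
qed

section \<open>Absorption and assembly of the lower bound\<close>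

lemma integral_Young:
 assumes "sqint M f" "sqint M g" "s > 0"
 shows "\<bar>\<integral>x. f x \<bullet> g x \<partial>M\<bar> <= (LINT x|M. (norm (f x))^2) / (2 * s) + s / 2 * (LINT x|M. (norm (g x))^2)"
proof -
 define F G I where "F = (LINT x|M. (norm (f x))^2)" and "G = (LINT x|M. (norm (g x))^2)" and "I = (LINT x|M. f x \<bullet> g x)"
 have "0 <= F + 2 * c * I + c^2 * G" for c
  unfolding F_def G_def I_def integral_norm_square_combination[OF assms(1,2), symmetric] by simp
 from this[of s] this[of "- s"] have *: "2 * s * \<bar>I\<bar> <= F + s^2 * G" by (auto simp: abs_if)
 have "\<bar>I\<bar> = (2 * s * \<bar>I\<bar>) / (2 * s)" using assms(3) by simp
 also have "... <= (F + s^2 * G) / (2 * s)" by (rule divide_right_mono[OF *]) (use assms(3) in simp)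
 also have "... = F / (2 * s) + s / 2 * G" using assms(3) by (simp add: add_divide_distrib power2_eq_square)
 finally show ?thesis by (simp add: F_def G_def I_def)
qed

text \<open>Translates the inequalities stated with nonnegative integrals into Bochner integrals;
  for continuous functions on a bounded open set both are finite.\<close>

lemma nn_integral_continuous_region:
 fixes D :: "(real^2) set"
 assumes D: "open D" "bounded D" and k: "continuous_on UNIV k" "!!x. 0 <= k x"
 shows "integrable (lebesgue_on D) k"
  and "(nn_integral lborel (%x. ennreal (k x) * indicator D x)) = ennreal (integral\<^sup>L (lebesgue_on D) k)"
proof -
 have "continuous_on UNIV (%x. sqrt (k x))" by (intro continuous_intros k(1))
 from bounded_continuous_sqint[OF D this] show I: "integrable (lebesgue_on D) k"
  using k(2) by (simp add: sqint_def)
 have "(nn_integral lborel (%x. ennreal (k x) * indicator D x)) = (nn_integral (lebesgue_on D) (%x. ennreal (k x)))"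
  by (rule nn_integral_lebesgue_on[symmetric]) (use D borel_measurable_continuous_onI[OF k(1)] in auto)
 also have "... = ennreal (integral\<^sup>L (lebesgue_on D) k)" by (rule nn_integral_eq_integral[OF I]) (simp add: k(2))
 finally show "(nn_integral lborel (%x. ennreal (k x) * indicator D x)) = ennreal (integral\<^sup>L (lebesgue_on D) k)" .
qed

lemma nn_integral_continuous_unit:
 assumes k: "continuous_on UNIV k" "!!x. 0 <= k x"
 shows "integrable (lebesgue_on {0..1::real}) k"
  and "(nn_integral lborel (%t. ennreal (k t) * indicator {0<..<1} t)) = ennreal (integral\<^sup>L (lebesgue_on {0..1}) k)"
proof -
 show I: "integrable (lebesgue_on {0..1}) k" by (rule continuous_imp_integrable_real[OF continuous_on_subset[OF k(1)]]) simp
 show "(nn_integral lborel (%t. ennreal (k t) * indicator {0<..<1} t)) = ennreal (integral\<^sup>L (lebesgue_on {0..1}) k)"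
  unfolding nn_integral_interval(2)[OF k] by (subst lebesgue_integral_eq_integral[OF I]) simp_all
qed

lemma diameter_region_bound:
 assumes "x \<in> closure (region vs)" "y \<in> closure (region vs)"
 shows "norm (y - x) <= diameter (region vs)"
proof -
 have "dist y x <= diameter (closure (region vs))"
  by (rule diameter_bounded_bound[OF bounded_closure[OF region_bounded] assms(2,1)])
 then show ?thesis by (simp add: dist_norm diameter_closure[OF region_bounded])
qed

lemma diameter_region_pos:
 assumes "region vs ~= {}" shows "0 < diameter (region vs)"
proof -
 obtain z \<rho> where z: "\<rho> > 0" "cball z \<rho> \<subseteq> region vs" by (rule open_convex_cball[OF region_open assms])
 have "z \<in> closure (region vs)" "z + \<rho> *\<^sub>R axis 1 1 \<in> closure (region vs)"
  using z by (auto intro!: subsetD[OF closure_subset] subsetD[OF z(2)] simp: dist_norm)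
 from diameter_region_bound[OF this] z(1) show ?thesis by simp
qed

lemma edge_length_norm: "edge_length (a, b) = norm (b - a)"
 by (simp add: edge_length_def dist_norm norm_minus_commute)

lemma boundary_sum_real:
 assumes k: "continuous_on UNIV k" "!!x. 0 <= k x" and r: "0 <= r"
 shows "(\<Sum>(a, b)\<in>edges vs. ennreal (r * norm (b - a)) * (nn_integral lborel (%\<theta>. ennreal (k (linepath a b \<theta>)) * indicator {0<..<1} \<theta>)))
  = ennreal (r * boundary_integral vs k)"
proof -
 have c: "continuous_on UNIV (%t. k (linepath a b t))" for a b
  unfolding linepath_def by (intro continuous_on_compose2[OF k(1)] continuous_intros) auto
 have "(\<Sum>(a, b)\<in>edges vs. ennreal (r * norm (b - a)) * (nn_integral lborel (%\<theta>. ennreal (k (linepath a b \<theta>)) * indicator {0<..<1} \<theta>)))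
  = (\<Sum>e\<in>edges vs. ennreal (case e of (a, b) => r * (norm (b - a) * integral\<^sup>L (lebesgue_on {0..1}) (%t. k (linepath a b t)))))"
 proof (rule sum.cong[OF refl])
  fix e assume "e \<in> edges vs"
  show "(case e of (a, b) => ennreal (r * norm (b - a)) * (nn_integral lborel (%\<theta>. ennreal (k (linepath a b \<theta>)) * indicator {0<..<1} \<theta>)))
   = ennreal (case e of (a, b) => r * (norm (b - a) * integral\<^sup>L (lebesgue_on {0..1}) (%t. k (linepath a b t))))"
   using nn_integral_continuous_unit(2)[OF c[of "fst e" "snd e"] k(2)] r k(2)
   by (cases e) (simp add: mult.assoc[symmetric] ennreal_mult)
 qed
 also have "... = ennreal (\<Sum>e\<in>edges vs. (case e of (a, b) => r * (norm (b - a) * integral\<^sup>L (lebesgue_on {0..1}) (%t. k (linepath a b t)))))"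
  by (rule sum_ennreal) (auto intro!: mult_nonneg_nonneg Bochner_Integration.integral_nonneg k(2) r)
 also have "(\<Sum>e\<in>edges vs. (case e of (a, b) => r * (norm (b - a) * integral\<^sup>L (lebesgue_on {0..1}) (%t. k (linepath a b t))))) = r * boundary_integral vs k"
  unfolding boundary_integral_def sum_distrib_left by (intro sum.cong) (auto simp: edge_length_norm)
 finally show ?thesis .
qed

lemma boundary_Young:
 assumes g: "L2_boundary vs g" and u: "continuous_on UNIV u" and s: "s > 0"
 shows "\<bar>boundary_integral vs (%x. g x * u x)\<bar> <= boundary_integral vs (%x. (u x)^2) / (2 * s) + s / 2 * boundary_integral vs (%x. (g x)^2)"
proof -
 let ?I = "%f a b. integral\<^sup>L (lebesgue_on {0..1}) (%t. f (linepath a b t))"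
 have "\<bar>boundary_integral vs (%x. g x * u x)\<bar> <= (\<Sum>(a, b)\<in>edges vs. \<bar>edge_length (a, b) * ?I (%x. g x * u x) a b\<bar>)"
  unfolding boundary_integral_def by (rule order_trans[OF sum_abs]) (simp add: split_beta)
 also have "... <= (\<Sum>(a, b)\<in>edges vs. edge_length (a, b) * (?I (%x. (u x)^2) a b / (2 * s) + s / 2 * ?I (%x. (g x)^2) a b))"
 proof (rule sum_mono)
  fix e assume e: "e \<in> edges vs"
  obtain a b where ab: "e = (a, b)" by (cases e)
  have sg: "sqint (lebesgue_on {0..1}) (%t. g (linepath a b t))"
   using g e unfolding L2_boundary_def ab L2_on_sqint by blast
  have c: "continuous_on UNIV (%t. u (linepath a b t))"
   unfolding linepath_def by (intro continuous_on_compose2[OF u] continuous_intros) auto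
  have "integrable (lebesgue_on {0..1}) (%t. (u (linepath a b t))^2)" "integrable (lebesgue_on {0..1}) (%t. u (linepath a b t))"
   by (auto intro!: continuous_imp_integrable_real continuous_intros continuous_on_subset[OF c])
  then have su: "sqint (lebesgue_on {0..1}) (%t. u (linepath a b t))" by (auto simp: sqint_def)
  from integral_Young[OF su sg s]
  have "\<bar>?I (%x. g x * u x) a b\<bar> <= ?I (%x. (u x)^2) a b / (2 * s) + s / 2 * ?I (%x. (g x)^2) a b" by (simp add: mult.commute)
  then have "edge_length e * \<bar>?I (%x. g x * u x) a b\<bar> <= edge_length e * (?I (%x. (u x)^2) a b / (2 * s) + s / 2 * ?I (%x. (g x)^2) a b)"
   by (rule mult_left_mono) (simp add: edge_length_def)
  moreover have "0 <= edge_length e" by (simp add: edge_length_def)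
  ultimately show "(case e of (a, b) => \<bar>edge_length (a, b) * ?I (%x. g x * u x) a b\<bar>)
   <= (case e of (a, b) => edge_length (a, b) * (?I (%x. (u x)^2) a b / (2 * s) + s / 2 * ?I (%x. (g x)^2) a b))"
   by (simp add: ab abs_mult)
 qed
 also have "... = boundary_integral vs (%x. (u x)^2) / (2 * s) + s / 2 * boundary_integral vs (%x. (g x)^2)"
  unfolding boundary_integral_def sum_divide_distrib sum_distrib_left sum.distrib[symmetric]
  by (intro sum.cong) (auto simp: algebra_simps)
 finally show ?thesis .
qed

lemma boundary_integral_nonneg: "(!!x. 0 <= f x) ==> 0 <= boundary_integral vs f"
 unfolding boundary_integral_def by (intro sum_nonneg) (auto simp: edge_length_def intro!: mult_nonneg_nonneg Bochner_Integration.integral_nonneg)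

text \<open>The fractions 1/2 + 1/16 + 1/16 + 1/16 leave 5/16 of V on the left, and 16/5 <=
  4.\<close>

lemma absorb_terms:
 fixes V a b c A B C :: real
 assumes "V > 0" "V = a + b + c" "a <= V / 2" "c <= V / 16 + C" "b <= (V / 16 + A) + (V / 16 + B)" "0 <= A" "0 <= B" "0 <= C"
 shows "V <= 4 * (A + B + C)"
proof -
 have "5 * V <= 16 * (A + B + C)" using assms(2-5) by argo
 then show ?thesis using assms by argo
qed

text \<open>All Young parameters are tuned so that the part involving the squared norm V of \<tau>
  becomes V/16; what remains carries exactly the powers of h in the stabilization.\<close>

lemma stability_lower:
 fixes vs :: polygon
 defines "D \<equiv> region vs" and "h \<equiv> diameter (region vs)"
 assumes K: "simple_polygon vs" "convex (region vs)" and B: "ball z r \<subseteq> region vs" "r > 0"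
  and \<gamma>: "\<gamma> > 0" "\<gamma> * h <= r"
  and \<tau>: "sqint (lebesgue_on D) \<tau>" and d: "has_weak_div D \<tau> (weak_div D \<tau>)" and \<rho>: "has_weak_rot D \<tau> \<rho>"
  and g: "has_normal_trace vs \<tau> g"
 shows "(LINT x|lebesgue_on D. (norm (\<tau> x))^2) <= 4 * (216 / \<gamma> * (h * boundary_integral vs (%x. (g x)^2))
  + 68 * (h^2 * (LINT x|lebesgue_on D. (weak_div D \<tau> x)^2)) + 6912 * (h^2 * (LINT x|lebesgue_on D. (\<rho> x)^2)))"
proof -
 let ?M = "lebesgue_on D"
 define V where "V = (LINT x|?M. (norm (\<tau> x))^2)"
 define d where "d = weak_div D \<tau>"
 define S where "S = (LINT x|?M. (d x)^2)"
 define T where "T = (LINT x|?M. (\<rho> x)^2)"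
 define Y where "Y = boundary_integral vs (%x. (g x)^2)"
 have D: "open D" "bounded D" "convex D" using K by (simp_all add: D_def region_open region_bounded)
 have "z \<in> D" using B by (auto simp: D_def)
 then have Dne: "D ~= {}" by blast
 have Dm [measurable]: "D \<in> sets borel" using D by simp
 have h: "h > 0" unfolding h_def by (rule diameter_region_pos) (use Dne in \<open>simp add: D_def\<close>)
 have hc: "norm (y - x) <= h" if "x \<in> closure D" "y \<in> closure D" for x y
  using diameter_region_bound that by (simp add: D_def h_def)
 have hD: "norm (y - x) <= h" if "x \<in> D" "y \<in> D" for x y
  by (rule hc) (use that closure_subset in auto)
 have pos: "0 <= V" "0 <= S" "0 <= T" "0 <= Y"
  unfolding V_def S_def T_def Y_def by (simp_all add: boundary_integral_nonneg)
 have sd: "sqint ?M d" and s\<rho>: "sqint ?M \<rho>" using assms(10) \<rho> unfolding d_def has_weak_div_def has_weak_rot_def L2_on_sqint by blast+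
 show ?thesis
 \<comment> \<open>The approximate decomposition needs a positive tolerance, which will be
   V/4.\<close>
 proof (cases "V = 0")
  case True
  have "0 <= 4 * (216 / \<gamma> * (h * Y) + 68 * (h^2 * S) + 6912 * (h^2 * T))" using pos h \<gamma> by simp
  then show ?thesis using True by (simp add: V_def S_def T_def Y_def d_def)
 next
  case False
  then have V: "V > 0" using pos by simp
  have V4: "V / 4 > 0" using V by simp
  obtain v \<psi> where v: "smooth v" and \<psi>: "test_function D \<psi>"
   and R: "(LINT x|?M. (norm (\<tau> x - (grad v x + curl \<psi> x)))^2) < V / 4" by (rule helmholtz_density[OF D(3,1,2) Dne \<tau> V4])
  have s\<psi>: "smooth \<psi>" using \<psi> by (simp add: test_function_def)
  have sv: "sqint ?M (grad v)" "sqint ?M (curl \<psi>)"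
   by (auto intro!: bounded_continuous_sqint D grad_continuous curl_continuous v s\<psi>)
  have sR: "sqint ?M (%x. \<tau> x - (grad v x + curl \<psi> x))" by (intro sqint_diff sqint_add \<tau> sv)
  have orth: "(LINT x|?M. grad v x \<bullet> curl \<psi> x) = 0"
  proof -
   obtain Rr where Rr: "!!x. x \<in> D ==> norm x <= Rr" using D(2) bounded_iff by blast
   have "\<psi> x = 0" if "x \<notin> cball 0 Rr" for x
    by (rule test_function_zero[OF \<psi>]) (use that Rr in auto)
   from grad_curl_orthogonal[OF v s\<psi> this] have 0: "(LBINT x. grad v x \<bullet> curl \<psi> x) = 0" .
   have "(LINT x|?M. grad v x \<bullet> curl \<psi> x) = (LBINT x. indicator D x *\<^sub>R (grad v x \<bullet> curl \<psi> x))"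
    by (intro integral_lebesgue_on_lborel(2) Dm borel_measurable_continuous_onI continuous_on_inner grad_continuous curl_continuous v s\<psi>)
   also have "... = (LBINT x. grad v x \<bullet> curl \<psi> x)"
   proof (rule Bochner_Integration.integral_cong[OF refl])
    fix x
    have "curl \<psi> x = 0" if "x \<notin> D" using test_function_grad_zero[OF \<psi> that] by (simp add: grad_def curl_def vec_eq_iff forall_2)
    then show "indicator D x *\<^sub>R (grad v x \<bullet> curl \<psi> x) = grad v x \<bullet> curl \<psi> x" by (cases "x \<in> D") auto
   qed
   finally show ?thesis using 0 by simp
  qed
  define Gv where "Gv = (LINT x|?M. (norm (grad v x))^2)"
  define Gs where "Gs = (LINT x|?M. (norm (curl \<psi> x))^2)"
  \<comment> \<open>Gradient and curl are orthogonal, so their squared norms add up to that of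
    \<open>\<tau>\<close> minus the remainder, which is at most 2 V + 2 (V/4) <= 3 V.\<close>
  have G: "Gv + Gs <= 3 * V" "0 <= Gv" "0 <= Gs"
  proof -
   show "0 <= Gv" "0 <= Gs" by (auto simp: Gv_def Gs_def)
   have "Gv + Gs = (LINT x|?M. (norm (grad v x + 1 *\<^sub>R curl \<psi> x))^2)"
    unfolding integral_norm_square_combination[OF sv] orth by (simp add: Gv_def Gs_def)
   also have "... = (LINT x|?M. (norm (\<tau> x + (-1) *\<^sub>R (\<tau> x - (grad v x + curl \<psi> x))))^2)" by simp
   also have "... <= 2 * V + 2 * (LINT x|?M. (norm ((-1) *\<^sub>R (\<tau> x - (grad v x + curl \<psi> x))))^2)"
    unfolding V_def by (rule l2n_add_le[OF \<tau> sqint_scaleR[OF sR]])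
   also have "... = 2 * V + 2 * (LINT x|?M. (norm (\<tau> x - (grad v x + curl \<psi> x)))^2)" by (simp add: norm_minus_commute)
   finally show "Gv + Gs <= 3 * V" using R V by linarith
  qed
  have split: "V = (LINT x|?M. \<tau> x \<bullet> (\<tau> x - (grad v x + curl \<psi> x))) + (LINT x|?M. \<tau> x \<bullet> grad v x) + (LINT x|?M. \<tau> x \<bullet> curl \<psi> x)"
  proof -
   have "V = (LINT x|?M. (\<tau> x \<bullet> (\<tau> x - (grad v x + curl \<psi> x)) + \<tau> x \<bullet> grad v x) + \<tau> x \<bullet> curl \<psi> x)"
    unfolding V_def by (intro Bochner_Integration.integral_cong) (auto simp: inner_diff_right inner_add_right power2_norm_eq_inner)
   also have "... = (LINT x|?M. \<tau> x \<bullet> (\<tau> x - (grad v x + curl \<psi> x))) + (LINT x|?M. \<tau> x \<bullet> grad v x) + (LINT x|?M. \<tau> x \<bullet> curl \<psi> x)"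
    by (simp only: Bochner_Integration.integral_add Bochner_Integration.integrable_add sqint_inner_integrable[OF \<tau> sR] sqint_inner_integrable[OF \<tau> sv(1)] sqint_inner_integrable[OF \<tau> sv(2)])
   finally show ?thesis .
  qed
  \<comment> \<open>Young with parameter 2: V/4 from \<open>\<tau>\<close> and at most V/4 from the
    remainder.\<close>
  have p1: "(LINT x|?M. \<tau> x \<bullet> (\<tau> x - (grad v x + curl \<psi> x))) <= V / 2"
   using integral_Young[OF \<tau> sR, of 2] R by (simp add: V_def)
  have p2: "(LINT x|?M. \<tau> x \<bullet> curl \<psi> x) <= V / 16 + 6912 * (h^2 * T)"
  proof -
   have eq: "(LINT x|?M. \<tau> x \<bullet> curl \<psi> x) = - (LINT x|?M. \<psi> x \<bullet> \<rho> x)"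
    using conjunct2[OF \<rho>[unfolded has_weak_rot_def], rule_format, OF \<psi>] by (simp add: inner_real2 curl_def mult.commute)
   have sps: "sqint ?M \<psi>" by (intro bounded_continuous_sqint D smooth_continuous s\<psi>)
   have ng: "norm (grad \<psi> x) = norm (curl \<psi> x)" for x
    by (simp add: norm_eq_sqrt_inner inner_real2 grad_def curl_def add.commute)
   have "ennreal (LINT x|?M. (\<psi> x)^2) <= ennreal (576 * h^2) * ennreal Gs"
    using friedrichs_test_function[OF D(1,2) Dne hD h \<psi>]
    unfolding nn_integral_continuous_region(2)[OF D(1,2) continuous_on_power[OF smooth_continuous[OF s\<psi>]] zero_le_power2]
     nn_integral_continuous_region(2)[OF D(1,2) continuous_on_power[OF continuous_on_norm[OF grad_continuous[OF s\<psi>]]] zero_le_power2]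
    by (simp add: ng Gs_def)
   also have "... = ennreal (576 * h^2 * Gs)" using G by (simp add: ennreal_mult)
   finally have "(LINT x|?M. (\<psi> x)^2) <= 576 * h^2 * Gs" using G h by (subst (asm) ennreal_le_iff) auto
   also have "... <= 576 * h^2 * (3 * V)" using G by (intro mult_left_mono) auto
   finally have F: "(LINT x|?M. (\<psi> x)^2) <= 576 * h^2 * (3 * V)" .
   \<comment> \<open>13824 is 8 times 3 times 576, with 576 the Friedrichs constant and 3 from the
     bound on \<open>Gs\<close>.\<close>
   have "- (LINT x|?M. \<psi> x \<bullet> \<rho> x) <= (LINT x|?M. (\<psi> x)^2) / (2 * (13824 * h^2)) + (13824 * h^2) / 2 * T"
    using integral_Young[OF sps s\<rho>, of "13824 * h^2"] h by (simp add: T_def)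
   also have "(LINT x|?M. (\<psi> x)^2) / (2 * (13824 * h^2)) <= 576 * h^2 * (3 * V) / (2 * (13824 * h^2))"
    by (rule divide_right_mono[OF F]) simp
   also have "576 * h^2 * (3 * V) / (2 * (13824 * h^2)) = V / 16" using h by simp
   finally show ?thesis by (simp add: eq mult.assoc)
  qed
  have hV: "0 < h^2 * V" using h V by simp
  obtain c where c: "(nn_integral lborel (%x. ennreal ((v x - c)^2) * indicator D x))
   <= ennreal (4 * h^2) * (nn_integral lborel (%x. ennreal ((norm (grad v x))^2) * indicator D x)) + ennreal (h^2 * V)"
   by (rule poincare_convex[OF D(3,1,2) Dne hD v hV])
  \<comment> \<open>Subtracting the Poincare constant leaves the gradient unchanged and makes volume
    and boundary norms of the function controllable by the gradient, up to the chosen slack.\<close>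
  define u where "u x = v x + (- c)" for x
  have u: "smooth u" unfolding u_def[abs_def] by (intro smooth_add v smooth_const)
  have gu: "grad u x = grad v x" for x
  proof -
   have "partial i u x = partial i v x" for i
    unfolding u_def[abs_def] partial_add[OF v smooth_const] partial_eq[OF has_derivative_const] by simp
   then show ?thesis by (simp add: grad_def)
  qed
  define U where "U = (LINT x|?M. (u x)^2)"
  have U: "U <= 13 * h^2 * V"
  proof -
   have "ennreal U <= ennreal (4 * h^2) * ennreal Gv + ennreal (h^2 * V)"
    using c
     nn_integral_continuous_region(2)[OF D(1,2) continuous_on_power[OF smooth_continuous[OF u], of _ 2] zero_le_power2]
     nn_integral_continuous_region(2)[OF D(1,2) continuous_on_power[OF continuous_on_norm[OF grad_continuous[OF v]], of _ 2] zero_le_power2]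
    by (simp add: u_def U_def Gv_def)
   also have "... = ennreal (4 * h^2 * Gv + h^2 * V)" using G V by (simp add: ennreal_mult ennreal_plus)
   finally have "U <= 4 * h^2 * Gv + h^2 * V" using G V by (subst (asm) ennreal_le_iff) auto
   also have "4 * h^2 * Gv <= 4 * h^2 * (3 * V)" using G by (intro mult_left_mono) auto
   finally show ?thesis by (simp add: mult_ac)
  qed
  have cu: "continuous_on UNIV u" "continuous_on UNIV (grad u)" by (intro smooth_continuous grad_continuous u)+
  \<comment> \<open>The mixed term of the trace inequality splits into u^2 and h^2 |grad u|^2, both
    with integrals of order h^2 V; then r >= \<gamma> h is used.\<close>
  have bu: "boundary_integral vs (%x. (u x)^2) <= 54 * h * V / \<gamma>"
  proof -
   let ?F = "%x. 2 * (u x)^2 + 2 * h * \<bar>u x\<bar> * norm (grad u x)"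
   have cF: "continuous_on UNIV ?F" by (intro continuous_intros cu)
   have F0: "0 <= ?F x" for x using h by simp
   have "ennreal (r * boundary_integral vs (%x. (u x)^2)) <= ennreal (LINT x|?M. ?F x)"
    using trace_inequality[OF K B hc[unfolded D_def] u]
    unfolding boundary_sum_real[OF continuous_on_power[OF cu(1)] zero_le_power2 less_imp_le[OF B(2)]]
     D_def[symmetric] nn_integral_continuous_region(2)[OF D(1,2) cF F0] .
   then have "r * boundary_integral vs (%x. (u x)^2) <= (LINT x|?M. ?F x)"
    by (subst (asm) ennreal_le_iff) (auto intro!: Bochner_Integration.integral_nonneg F0)
   also have "... <= (LINT x|?M. 3 * (u x)^2 + h^2 * (norm (grad u x))^2)"
   proof (rule integral_mono)
    show "integrable ?M ?F" by (rule nn_integral_continuous_region(1)[OF D(1,2) cF F0])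
    show "integrable ?M (%x. 3 * (u x)^2 + h^2 * (norm (grad u x))^2)"
     by (rule nn_integral_continuous_region(1)[OF D(1,2)]) (auto intro!: continuous_intros cu)
    fix x
    show "?F x <= 3 * (u x)^2 + h^2 * (norm (grad u x))^2"
     using two_mult_le_sum_squares[of "\<bar>u x\<bar>" "h * norm (grad u x)"] by (simp add: power_mult_distrib mult_ac)
   qed
   also have "... = 3 * U + h^2 * Gv"
   proof -
    have "integrable ?M (%x. (u x)^2)" "integrable ?M (%x. (norm (grad v x))^2)"
     by (rule nn_integral_continuous_region(1)[OF D(1,2)], auto intro!: continuous_intros cu grad_continuous v)+
    then show ?thesis by (simp add: gu U_def Gv_def)
   qed
   also have "... <= 3 * (13 * h^2 * V) + h^2 * (3 * V)" using U G by (intro add_mono mult_left_mono) auto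
   also have "... <= 54 * h^2 * V" using V by (simp add: algebra_simps)
   finally have 1: "r * boundary_integral vs (%x. (u x)^2) <= 54 * h^2 * V" .
   have "(\<gamma> * h) * boundary_integral vs (%x. (u x)^2) <= r * boundary_integral vs (%x. (u x)^2)"
    by (intro mult_right_mono \<gamma>(2) boundary_integral_nonneg) simp
   with 1 have "h * (\<gamma> * boundary_integral vs (%x. (u x)^2)) <= h * (54 * h * V)" by (simp add: power2_eq_square mult_ac)
   then have "\<gamma> * boundary_integral vs (%x. (u x)^2) <= 54 * h * V" using h by simp
   then show ?thesis using \<gamma>(1) by (simp add: pos_le_divide_eq mult.commute)
  qed
  have p3: "(LINT x|?M. \<tau> x \<bullet> grad v x) <= (V / 16 + 216 / \<gamma> * (h * Y)) + (V / 16 + 68 * (h^2 * S))"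
  proof -
   have "boundary_integral vs (%x. g x * u x) = (LINT x|?M. \<tau> x \<bullet> grad u x) + (LINT x|?M. d x * u x)"
    using conjunct2[OF g[unfolded has_normal_trace_def], rule_format, OF u] unfolding D_def d_def .
   then have eq: "(LINT x|?M. \<tau> x \<bullet> grad v x) = boundary_integral vs (%x. g x * u x) - (LINT x|?M. u x \<bullet> d x)"
    by (simp add: gu mult.commute)
   have su: "sqint ?M u" by (intro bounded_continuous_sqint D cu)
   \<comment> \<open>136 is 8 times 17, and 17 exceeds the factor 13 in the bound on
     \<open>U\<close>.\<close>
   have "- (LINT x|?M. u x \<bullet> d x) <= U / (2 * (136 * h^2)) + (136 * h^2) / 2 * S"
    using integral_Young[OF su sd, of "136 * h^2"] h by (simp add: S_def U_def)
   also have "U / (2 * (136 * h^2)) <= (17 * h^2 * V) / (2 * (136 * h^2))"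
    by (rule divide_right_mono) (use U V in \<open>auto intro: order_trans[OF U]\<close>)
   also have "(17 * h^2 * V) / (2 * (136 * h^2)) = V / 16" using h by simp
   finally have a: "- (LINT x|?M. u x \<bullet> d x) <= V / 16 + 68 * (h^2 * S)" by (simp add: mult.assoc)
   \<comment> \<open>432 is 8 times the factor 54 in \<open>bu\<close>, so the boundary norm of
     \<open>u\<close> contributes V/16.\<close>
   have s: "432 * h / \<gamma> > 0" using h \<gamma> by simp
   have "boundary_integral vs (%x. g x * u x) <= boundary_integral vs (%x. (u x)^2) / (2 * (432 * h / \<gamma>)) + (432 * h / \<gamma>) / 2 * Y"
    using boundary_Young[OF _ cu(1) s, of vs g] g unfolding has_normal_trace_def Y_def by linarith
   also have "boundary_integral vs (%x. (u x)^2) / (2 * (432 * h / \<gamma>)) <= (54 * h * V / \<gamma>) / (2 * (432 * h / \<gamma>))"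
    by (rule divide_right_mono[OF bu]) (use s in simp)
   also have "(54 * h * V / \<gamma>) / (2 * (432 * h / \<gamma>)) = V / 16" using h \<gamma> by (simp add: field_simps)
   finally have b: "boundary_integral vs (%x. g x * u x) <= V / 16 + 216 / \<gamma> * (h * Y)" by simp
   show ?thesis unfolding eq using a b by linarith
  qed
  have q: "0 <= 216 / \<gamma> * (h * Y)" "0 <= 68 * (h^2 * S)" "0 <= 6912 * (h^2 * T)" using pos h \<gamma> by auto
  have "V <= 4 * (216 / \<gamma> * (h * Y) + 68 * (h^2 * S) + 6912 * (h^2 * T))"
   by (rule absorb_terms[OF V split p1 p2 p3 q])
  then show ?thesis by (simp add: V_def S_def T_def Y_def d_def)
 qed
qed

section \<open>Bounds for the divergence and the rotation\<close>

lemma smooth1_id: "smooth1 (%x. x)"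
proof -
 have "dk k (%x. x)" for k
 proof (cases k)
  case (Suc n)
  then show ?thesis by (auto intro!: exI[of _ "%x. 1"] dk_const derivative_eq_intros)
 qed (simp add: continuous_on_id)
 then show ?thesis by (simp add: smooth1_def)
qed

lemma smooth_coordinate: "smooth (%x. x $ i)"
 using smooth_comp1[OF smooth1_id, of "axis i 1" 0] by (simp add: inner_axis' )

lemma smooth_power: "smooth f ==> smooth (%x. f x ^ n)"
 by (induction n) (simp_all add: smooth_const smooth_mult)

lemma smooth_sum: "finite A ==> (!!i. i \<in> A ==> smooth (f i)) ==> smooth (%x. \<Sum>i\<in>A. f i x)"
 by (induction A rule: finite_induct) (simp_all add: smooth_const smooth_add)

lemma smooth1_poly: "smooth1 (poly H)"
proof -
 have "dk k (poly H)" for k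
 proof (induction k arbitrary: H)
  case (Suc k)
  show ?case unfolding dk.simps by (intro exI[of _ "poly (pderiv H)"] conjI allI poly_DERIV Suc)
 qed (simp add: continuous_on_poly continuous_on_id)
 then show ?thesis by (simp add: smooth1_def)
qed

lemma polys_smooth: assumes "q \<in> polys l" shows "smooth q"
proof -
 obtain c where q: "q = (%x. \<Sum>i\<le>l. \<Sum>j\<le>l - i. c i j * (x $ 1) ^ i * (x $ 2) ^ j)" using assms by (auto simp: polys_def)
 show ?thesis unfolding q by (intro smooth_sum smooth_mult smooth_const smooth_power smooth_coordinate) auto
qed

lemma polys_line_poly: assumes "q \<in> polys l" shows "line_poly l q"
proof -
 obtain c where q: "q = (%x. \<Sum>i\<le>l. \<Sum>j\<le>l - i. c i j * (x $ 1) ^ i * (x $ 2) ^ j)" using assms by (auto simp: polys_def)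
 have "\<exists>P. degree P <= l \<and> (\<forall>t. q (a + t *\<^sub>R v) = poly P t)" for a v
 proof (intro exI conjI allI)
  define P where "P = (\<Sum>i\<le>l. \<Sum>j\<le>l - i. smult (c i j) ([:a $ 1, v $ 1:] ^ i * [:a $ 2, v $ 2:] ^ j))"
  show "q (a + t *\<^sub>R v) = poly P t" for t
   by (simp add: q P_def poly_sum mult.assoc)
  have deg: "degree ([:x, y:] ^ n) <= n" for x y :: real and n
   using degree_power_le[of "[:x, y:]" n] degree_pCons_le[of x "[:y:]"] by (simp add: order_trans mult_le_cancel2)
  show "degree P <= l" unfolding P_def
  proof (intro degree_sum_le)
   fix i j assume ij: "i \<in> {..l}" "j \<in> {..l - i}"
   have "degree (smult (c i j) ([:a $ 1, v $ 1:] ^ i * [:a $ 2, v $ 2:] ^ j)) <= degree ([:a $ 1, v $ 1:] ^ i) + degree ([:a $ 2, v $ 2:] ^ j)"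
    by (rule order_trans[OF degree_smult_le degree_mult_le])
   also have "... <= i + j" by (intro add_mono deg)
   finally show "degree (smult (c i j) ([:a $ 1, v $ 1:] ^ i * [:a $ 2, v $ 2:] ^ j)) <= l" using ij by simp
  qed auto
 qed
 then show ?thesis unfolding line_poly_def using smooth_continuous[OF polys_smooth[OF assms]] by blast
qed

lemma norm_real2_square: "(norm (x :: real^2))^2 = (x $ 1)^2 + (x $ 2)^2"
 unfolding power2_norm_eq_inner inner_real2 by (simp add: power2_eq_square)

text \<open>Test with \<open>b d\<close>, where \<open>b\<close> is a smoothed distance to the boundary.\<close>

lemma polynomial_volume_bound:
 fixes D :: "(real^2) set"
 assumes D: "convex D" "open D" "bounded D" and B: "ball z r \<subseteq> D" "r > 0"
  and d: "smooth d" "line_poly l d" and p: "l + 1 <= p"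
  and V: "V \<ge> 0" "!!\<phi>. test_function D \<phi> ==> \<bar>integral\<^sup>L (lebesgue_on D) (%x. d x * \<phi> x)\<bar> <= V * l2n (lebesgue_on D) (grad \<phi>)"
 shows "r * l2n (lebesgue_on D) d <= 720 * real p ^ 3 * V"
proof -
 let ?M = "lebesgue_on D"
 define N where "N = (LINT x|?M. (d x)^2)"
 have N0: "0 <= N" by (simp add: N_def)
 have lN: "l2n ?M d = sqrt N" by (simp add: l2n_def N_def)
 define b where "b x = infdist x (- D)" for x
 have b0: "0 <= b x" for x by (simp add: b_def infdist_nonneg)
 have ne: "- D ~= {}" using D(3) not_bounded_UNIV by (metis Compl_empty_eq double_complement)
 have cb: "continuous_on UNIV b" unfolding b_def[abs_def] by (intro continuous_intros)
 have cd: "continuous_on UNIV d" "continuous_on UNIV (grad d)" by (intro smooth_continuous grad_continuous d)+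
 have lip: "\<bar>b x - b y\<bar> <= 1 * norm (x - y)" for x y
  using infdist_triangle[of x "- D" y] infdist_triangle[of y "- D" x] by (simp add: b_def dist_norm norm_minus_commute abs_le_iff)
 obtain Rr where Rr: "!!x. x \<in> D ==> norm x <= Rr" using D(3) bounded_iff by blast
 have bz: "b x = 0" if "x \<notin> D" for x using that by (simp add: b_def)
 have bR: "b x = 0" if "x \<notin> cball 0 Rr" for x by (rule bz) (use that Rr in auto)
 define E where "E = (LINT x|?M. b x * (d x)^2)"
 have I: "integrable ?M k" if "continuous_on UNIV k" "!!x. 0 <= k x" for k :: "real^2 => real"
  by (rule nn_integral_continuous_region(1)[OF D(2,3) that])
 have p1: "1 <= real p" using p by simp
 \<comment> \<open>Two coordinate directions, each contributing l (l + 1) <= p^2.\<close>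
 have grad_part: "(LINT x|?M. (b x)^2 * (norm (grad d x))^2) <= 2 * (real p)^2 * N"
 proof -
  have ll: "real l * (real l + 1) <= (real p)^2"
  proof -
   have "real l <= real p" "real l + 1 <= real p" using p by linarith+
   then show ?thesis unfolding power2_eq_square by (intro mult_mono) auto
  qed
  have sl: "(LINT x|?M. (b x * partial i d x)^2) <= (real p)^2 * N" for i
  proof -
   have c: "continuous_on UNIV (%x. (b x * partial i d x)^2)" by (intro continuous_intros cb smooth_continuous smooth_partial d)
   have "ennreal (LINT x|?M. (b x * partial i d x)^2) <= ennreal (real l * (real l + 1)) * ennreal N"
    using infdist_slice[OF D d(2,1), of i]
    unfolding b_def[symmetric] nn_integral_continuous_region(2)[OF D(2,3) c zero_le_power2]
     nn_integral_continuous_region(2)[OF D(2,3) continuous_on_power[OF cd(1)] zero_le_power2] N_def .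
   also have "... = ennreal (real l * (real l + 1) * N)" using N0 by (simp add: ennreal_mult)
   finally have "(LINT x|?M. (b x * partial i d x)^2) <= real l * (real l + 1) * N" using N0 by (subst (asm) ennreal_le_iff) auto
   also have "... <= (real p)^2 * N" by (rule mult_right_mono[OF ll N0])
   finally show ?thesis .
  qed
  have "(LINT x|?M. (b x)^2 * (norm (grad d x))^2) = (LINT x|?M. (b x * partial 1 d x)^2 + (b x * partial 2 d x)^2)"
   by (intro Bochner_Integration.integral_cong) (auto simp: norm_real2_square grad_def power_mult_distrib algebra_simps)
  moreover have "integrable ?M (%x. (b x * partial i d x)^2)" for i
   by (intro I continuous_intros cb smooth_continuous smooth_partial d) simp
  ultimately have "(LINT x|?M. (b x)^2 * (norm (grad d x))^2) = (LINT x|?M. (b x * partial 1 d x)^2) + (LINT x|?M. (b x * partial 2 d x)^2)" by simp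
  then show ?thesis using sl[of 1] sl[of 2] by linarith
 qed
 \<comment> \<open>The weighted norm \<open>E\<close> is compared with the pairing of
   \<open>d\<close> and v d, where v approximates the distance \<open>b\<close> from below within
   \<open>\<delta>\<close>; the loss \<delta> N is at most the arbitrary \<open>e\<close>.\<close>
 have E: "E <= 4 * real p * V * sqrt N"
 proof (rule field_le_epsilon)
  fix e :: real assume e: "e > 0"
  define \<delta> where "\<delta> = e / (N + 1)"
  have \<delta>: "\<delta> > 0" "\<delta> * N <= e" using e N0 by (auto simp: \<delta>_def field_simps)
  obtain v where v: "smooth v" "!!x. 0 <= v x" "!!x. v x <= b x" "!!x. b x - \<delta> <= v x"
   "!!x. norm (grad v x) <= 2 * 1" "!!x. v x ~= 0 ==> b x \<ge> \<delta> / 4"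
   by (rule lipschitz_smoothing[OF zero_less_one lip b0 bR \<delta>(1)]) (assumption | blast)+
  define \<phi> where "\<phi> x = v x * d x" for x
  have s\<phi>: "smooth \<phi>" unfolding \<phi>_def[abs_def] by (intro smooth_mult v d)
  have t\<phi>: "test_function D \<phi>"
  proof (rule test_functionI[OF s\<phi>, of "{x. \<delta> / 4 <= b x}"])
   have sub: "{x. \<delta> / 4 <= b x} \<subseteq> D"
   proof
    fix x assume "x \<in> {x. \<delta> / 4 <= b x}"
    then have "b x ~= 0" using \<delta> by auto
    then show "x \<in> D" using bz by blast
   qed
   show "{x. \<delta> / 4 <= b x} \<subseteq> D" by (rule sub)
   have "closed {x. \<delta> / 4 <= b x}" by (intro closed_Collect_le continuous_intros cb)
   then show "compact {x. \<delta> / 4 <= b x}" using bounded_subset[OF D(3) sub] compact_eq_bounded_closed by blast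
   fix x assume "x \<notin> {x. \<delta> / 4 <= b x}"
   then have "v x = 0" using v(6)[of x] by auto
   then show "\<phi> x = 0" by (simp add: \<phi>_def)
  qed
  have g\<phi>: "grad \<phi> x = v x *\<^sub>R grad d x + d x *\<^sub>R grad v x" for x
   by (simp add: grad_def \<phi>_def[abs_def] partial_mult smooth_differentiable v(1) d(1) vec_eq_iff)
  have gp: "(norm (grad \<phi> x))^2 <= 2 * ((b x)^2 * (norm (grad d x))^2) + 8 * (d x)^2" for x
  proof -
   have "(norm (grad \<phi> x))^2 <= 2 * (norm (v x *\<^sub>R grad d x))^2 + 2 * (norm (d x *\<^sub>R grad v x))^2"
    unfolding g\<phi> by (rule norm_add_square_le)
   also have "... = 2 * ((v x)^2 * (norm (grad d x))^2) + 2 * ((d x)^2 * (norm (grad v x))^2)"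
    by (simp add: power_mult_distrib)
   also have "... <= 2 * ((b x)^2 * (norm (grad d x))^2) + 2 * ((d x)^2 * 2^2)"
   proof (intro add_mono mult_left_mono mult_right_mono)
    show "(v x)^2 <= (b x)^2" by (rule power_mono[OF v(3,2)])
    show "(norm (grad v x))^2 <= 2^2" using v(5)[of x] by (intro power_mono) auto
   qed auto
   finally show ?thesis by simp
  qed
  have "(LINT x|?M. (norm (grad \<phi> x))^2) <= (LINT x|?M. 2 * ((b x)^2 * (norm (grad d x))^2) + 8 * (d x)^2)"
   by (intro integral_mono gp I continuous_intros cb cd grad_continuous[OF s\<phi>]) auto
  also have "... = 2 * (LINT x|?M. (b x)^2 * (norm (grad d x))^2) + 8 * N"
  proof -
   have "integrable ?M (%x. (b x)^2 * (norm (grad d x))^2)" "integrable ?M (%x. (d x)^2)"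
    by (intro I continuous_intros cb cd; simp)+
   then show ?thesis by (simp add: N_def)
  qed
  also have "... <= 2 * (2 * (real p)^2 * N) + 8 * N" using mult_left_mono[OF grad_part, of 2] by linarith
  \<comment> \<open>4 p^2 N from the gradient of \<open>d\<close> and 8 N from the gradient of the
    smoothed distance add up to at most 12 p^2 N.\<close>
  also have "... <= (4 * real p)^2 * N"
  proof -
   have "1 <= (real p)^2" using p1 by simp
   then have "1 * N <= (real p)^2 * N" by (rule mult_right_mono[OF _ N0])
   moreover have "(4 * real p)^2 * N = 16 * ((real p)^2 * N)" "2 * (2 * (real p)^2 * N) = 4 * ((real p)^2 * N)" by (simp_all add: power_mult_distrib)
   ultimately show ?thesis using N0 by linarith
  qed
  finally have "sqrt (LINT x|?M. (norm (grad \<phi> x))^2) <= sqrt ((4 * real p)^2 * N)" by (rule real_sqrt_le_mono)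
  then have lg: "l2n ?M (grad \<phi>) <= 4 * real p * sqrt N" using p1 by (simp add: l2n_def real_sqrt_mult)
  have "E - \<delta> * N = (LINT x|?M. b x * (d x)^2 - \<delta> * (d x)^2)"
  proof -
   have "integrable ?M (%x. b x * (d x)^2)" "integrable ?M (%x. (d x)^2)"
    by (intro I continuous_intros cb cd; simp add: b0)+
   then show ?thesis by (simp add: N_def E_def)
  qed
  also have "... <= (LINT x|?M. d x * \<phi> x)"
  proof (rule integral_mono)
   show "integrable ?M (%x. b x * (d x)^2 - \<delta> * (d x)^2)"
    by (intro Bochner_Integration.integrable_diff integrable_mult_right I continuous_intros cb cd) (simp_all add: b0)
   have "integrable ?M (%x. v x * (d x)^2)" by (intro I continuous_intros smooth_continuous v cd) (simp add: v(2))
   then show "integrable ?M (%x. d x * \<phi> x)" by (simp add: \<phi>_def power2_eq_square mult_ac)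
   fix x
   have "(b x - \<delta>) * (d x)^2 <= v x * (d x)^2" by (rule mult_right_mono[OF v(4)]) simp
   then show "b x * (d x)^2 - \<delta> * (d x)^2 <= d x * \<phi> x" by (simp add: \<phi>_def power2_eq_square algebra_simps)
  qed
  also have "... <= V * l2n ?M (grad \<phi>)" using V(2)[OF t\<phi>] by linarith
  also have "... <= V * (4 * real p * sqrt N)" by (rule mult_left_mono[OF lg V(1)])
  finally show "E <= 4 * real p * V * sqrt N + e" using \<delta>(2) by (simp add: mult_ac)
 qed
 \<comment> \<open>The dimension 2 enters as l + 2 + 1, and l + 3 <= 3 p because l < p.\<close>
 have W: "r * N <= 180 * (real p)^2 * E"
 proof -
  have c: "continuous_on UNIV (%x. b x * (d x)^2)" by (intro continuous_intros cb cd)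
  have E0: "0 <= E" by (simp add: E_def b0)
  have "ennreal r * ennreal N <= ennreal (20 * (real l + 3)^2) * ennreal E"
   using weighted_norm_bound[OF D B d(2)]
   unfolding b_def[symmetric] nn_integral_continuous_region(2)[OF D(2,3) c mult_nonneg_nonneg[OF b0 zero_le_power2]]
     nn_integral_continuous_region(2)[OF D(2,3) continuous_on_power[OF cd(1)] zero_le_power2] N_def[symmetric] E_def[symmetric]
   by (simp add: add.assoc)
  then have "ennreal (r * N) <= ennreal (20 * (real l + 3)^2 * E)" using B(2) N0 E0 by (simp add: ennreal_mult)
  then have "r * N <= 20 * (real l + 3)^2 * E" using E0 by (subst (asm) ennreal_le_iff) auto
  also have "... <= 20 * (3 * real p)^2 * E" using p by (intro mult_left_mono mult_right_mono power_mono E0) auto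
  finally show ?thesis by (simp add: power_mult_distrib)
 qed
 \<comment> \<open>The bound on \<open>E\<close> is linear in sqrt N while the left side is
   quadratic, so one factor sqrt N cancels. The power p^3 is p^2 from the weight times p from the
   gradient.\<close>
 have "r * N <= 180 * (real p)^2 * (4 * real p * V * sqrt N)"
  by (rule order_trans[OF W mult_left_mono[OF E]]) simp
 also have "... = sqrt N * (720 * real p ^ 3 * V)" by (simp add: power2_eq_square power3_eq_cube)
 finally have 1: "sqrt N * (r * sqrt N) <= sqrt N * (720 * real p ^ 3 * V)" using N0 by (simp add: mult_ac flip: power2_eq_square)
 show ?thesis
 proof (cases "N = 0")
  case True then show ?thesis using V(1) by (simp add: lN)
 next
  case False
  then have "0 < sqrt N" using N0 by simp
  with 1 show ?thesis unfolding lN by simp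
 qed
qed

text \<open>Ties the representative picked by the choice operator to the polynomial one: their
  difference is weakly zero, so both have the same norm.\<close>

lemma weak_derivative_unique:
 fixes D :: "(real^2) set"
 assumes D: "convex D" "open D" "bounded D" "D ~= {}" and d: "sqint (lebesgue_on D) d" "sqint (lebesgue_on D) d'"
  and eq: "!!\<phi>. test_function D \<phi> ==> integral\<^sup>L (lebesgue_on D) (%x. d x * \<phi> x) = integral\<^sup>L (lebesgue_on D) (%x. d' x * \<phi> x)"
 shows "integral\<^sup>L (lebesgue_on D) (%x. (d x)^2) = integral\<^sup>L (lebesgue_on D) (%x. (d' x)^2 :: real)"
proof -
 have sd: "sqint (lebesgue_on D) (%x. d x - d' x)" by (rule sqint_diff[OF d])
 have "integral\<^sup>L (lebesgue_on D) (%x. (d x - d' x)^2) = 0"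
 proof (rule weakly_zero_L2[OF D sd])
  fix \<phi> assume \<phi>: "test_function D \<phi>"
  have "sqint (lebesgue_on D) \<phi>"
   using \<phi> by (intro bounded_continuous_sqint D smooth_continuous) (simp add: test_function_def)
  then have "integrable (lebesgue_on D) (%x. d x * \<phi> x)" "integrable (lebesgue_on D) (%x. d' x * \<phi> x)"
   by (intro sqint_mult_integrable d; assumption)+
  then show "integral\<^sup>L (lebesgue_on D) (%x. (d x - d' x) * \<phi> x) = 0"
   using eq[OF \<phi>] by (simp add: left_diff_distrib)
 qed
 then have "AE x in lebesgue_on D. (d x - d' x)^2 = 0"
  using sd by (subst (asm) integral_nonneg_eq_0_iff_AE) (auto simp: sqint_def)
 then have ae: "AE x in lebesgue_on D. (d x)^2 = (d' x)^2" by eventually_elim simp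
 show ?thesis
  by (rule integral_cong_AE[OF _ _ ae]) (use d in \<open>auto simp: sqint_def\<close>)
qed

text \<open>Divergence and rotation are treated alike because the gradient and the curl of a test
  function have the same pointwise norm. The constant is 720 squared.\<close>

lemma div_rot_bound:
 assumes D: "convex D" "open D" "bounded D" "D ~= {}" and B: "ball z r \<subseteq> D" "r > 0" and p: "1 <= p"
  and \<tau>: "sqint (lebesgue_on D) \<tau>"
 shows "has_weak_div D \<tau> d ==> q \<in> polys (p - 1) ==> has_weak_div D \<tau> q ==>
   r^2 * (LINT x|lebesgue_on D. (d x)^2) <= 518400 * real p ^ 6 * (LINT x|lebesgue_on D. (norm (\<tau> x))^2)"
  and "has_weak_rot D \<tau> d ==> q \<in> polys (p - 1) ==> has_weak_rot D \<tau> q ==>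
   r^2 * (LINT x|lebesgue_on D. (d x)^2) <= 518400 * real p ^ 6 * (LINT x|lebesgue_on D. (norm (\<tau> x))^2)"
proof -
 let ?M = "lebesgue_on D"
 have main: "r^2 * (LINT x|?M. (d x)^2) <= 518400 * real p ^ 6 * (LINT x|?M. (norm (\<tau> x))^2)"
  if d: "sqint ?M d" and q: "q \<in> polys (p - 1)" "sqint ?M q"
   and eq: "!!\<phi>. test_function D \<phi> ==> (LINT x|?M. d x * \<phi> x) = (LINT x|?M. q x * \<phi> x)"
   and bd: "!!\<phi>. test_function D \<phi> ==> \<bar>\<integral>x. q x * \<phi> x \<partial>?M\<bar> <= l2n ?M \<tau> * l2n ?M (grad \<phi>)" for d q
 proof -
  have "r * l2n ?M q <= 720 * real p ^ 3 * l2n ?M \<tau>"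
   by (rule polynomial_volume_bound[OF D(1,2,3) B polys_smooth[OF q(1)] polys_line_poly[OF q(1)] _ l2n_nonneg bd]) (use p in simp)
  then have "(r * l2n ?M q)^2 <= (720 * real p ^ 3 * l2n ?M \<tau>)^2" by (rule power_mono) (use B l2n_nonneg[of ?M q] in simp)
  then have "r^2 * (LINT x|?M. (q x)^2) <= 518400 * real p ^ 6 * (LINT x|?M. (norm (\<tau> x))^2)"
   by (simp add: power_mult_distrib l2n_square flip: power_mult)
  moreover have "(LINT x|?M. (d x)^2) = (LINT x|?M. (q x)^2)" by (rule weak_derivative_unique[OF D d q(2) eq])
  ultimately show ?thesis by simp
 qed
 {
  fix \<phi> assume \<phi>: "test_function D \<phi>"
  have s: "smooth \<phi>" using \<phi> by (simp add: test_function_def)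
  have "sqint ?M (grad \<phi>)" "sqint ?M (curl \<phi>)" by (intro bounded_continuous_sqint D grad_continuous curl_continuous s)+
  note integral_inner_le_l2n[OF \<tau> this(1)] integral_inner_le_l2n[OF \<tau> this(2)]
  moreover have "(%x. \<tau> x \<bullet> curl \<phi> x) = (%x. \<tau> x $ 1 * partial 2 \<phi> x - \<tau> x $ 2 * partial 1 \<phi> x)"
   by (auto simp: inner_real2 curl_def)
  moreover have "l2n ?M (curl \<phi>) = l2n ?M (grad \<phi>)"
   by (simp add: l2n_def norm_real2_square grad_def curl_def add.commute)
  ultimately have "\<bar>\<integral>x. \<tau> x \<bullet> grad \<phi> x \<partial>?M\<bar> <= l2n ?M \<tau> * l2n ?M (grad \<phi>)"
   "\<bar>\<integral>x. \<tau> x $ 1 * partial 2 \<phi> x - \<tau> x $ 2 * partial 1 \<phi> x \<partial>?M\<bar> <= l2n ?M \<tau> * l2n ?M (grad \<phi>)"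
   unfolding \<open>(%x. \<tau> x \<bullet> curl \<phi> x) = _\<close> by simp_all
 }
 note bounds = this
 show "r^2 * (LINT x|?M. (d x)^2) <= 518400 * real p ^ 6 * (LINT x|?M. (norm (\<tau> x))^2)"
  if "has_weak_div D \<tau> d" "q \<in> polys (p - 1)" "has_weak_div D \<tau> q"
  by (rule main[of d q]) (use that bounds(1) in \<open>simp_all add: has_weak_div_def L2_on_sqint\<close>)
 show "r^2 * (LINT x|?M. (d x)^2) <= 518400 * real p ^ 6 * (LINT x|?M. (norm (\<tau> x))^2)"
  if "has_weak_rot D \<tau> d" "q \<in> polys (p - 1)" "has_weak_rot D \<tau> q"
  by (rule main[of d q]) (use that bounds(2) in \<open>simp_all add: has_weak_rot_def L2_on_sqint\<close>)
qed

section \<open>Bounds for the normal trace\<close>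

lemma orthogonal_expansion:
 fixes x :: "real^2"
 assumes \<nu>: "norm \<nu> = 1" "\<nu> \<bullet> w = 0" and w: "w ~= 0"
 shows "x = (\<nu> \<bullet> x) *\<^sub>R \<nu> + (x \<bullet> w / (norm w)^2) *\<^sub>R w"
proof -
 define y where "y = x - ((\<nu> \<bullet> x) *\<^sub>R \<nu> + (x \<bullet> w / (norm w)^2) *\<^sub>R w)"
 have nw: "(norm w)^2 = w \<bullet> w" "w \<bullet> w ~= 0" "\<nu> \<bullet> \<nu> = 1" using w \<nu>(1) by (auto simp: power2_norm_eq_inner norm_eq_1)
 have 1: "\<nu> \<bullet> y = 0" by (simp add: y_def inner_diff_right inner_add_right nw \<nu>(2))
 have 2: "y \<bullet> w = 0" by (simp add: y_def inner_diff_left inner_add_left nw \<nu>(2))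
 have "\<bar>cross y w\<bar> = 0" using cross_normal[OF \<nu>, of y] 1 by simp
 then have c: "y $ 1 * w $ 2 - w $ 1 * y $ 2 = 0" by (simp add: cross_def)
 have "(y \<bullet> y) * (w \<bullet> w) = (y \<bullet> w)^2 + (y $ 1 * w $ 2 - w $ 1 * y $ 2)^2"
  unfolding inner_real2 by (simp add: power2_eq_square algebra_simps)
 then have "y = 0" using 2 c nw(2) by simp
 then show ?thesis by (simp add: y_def)
qed

definition edge_param :: "real^2 => real^2 => real^2 => real" where
 "edge_param a b x = (x - a) \<bullet> (b - a) / (norm (b - a))^2"

text \<open>The distance to the endpoints on the unit interval; outside it is negative, so
  positivity detects the open interval.\<close>

definition tent :: "real => real" where "tent t = min t (1 - t)"

text \<open>A roof over the edge of small width: its support stays inside the polygon although it does not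
 vanish on the edge.\<close>

definition roof :: "real => real^2 => real^2 => real^2 => real^2 => real" where
 "roof \<epsilon> \<nu> a b x = max 0 (norm (b - a) * tent (edge_param a b x) - \<bar>\<nu> \<bullet> (x - a)\<bar> / \<epsilon>)"

lemma edge_param_linepath: "a ~= b ==> edge_param a b (linepath a b t) = t"
proof -
 assume "a ~= b"
 moreover have "linepath a b t - a = t *\<^sub>R (b - a)" by (simp add: linepath_def algebra_simps)
 ultimately show ?thesis by (simp add: edge_param_def power2_norm_eq_inner)
qed

lemma edge_coordinates:
 assumes "norm \<nu> = 1" "\<nu> \<bullet> (b - a) = 0" "a ~= b"
 shows "x = a + (\<nu> \<bullet> (x - a)) *\<^sub>R \<nu> + edge_param a b x *\<^sub>R (b - a)"
  and "\<nu> \<bullet> ((a + s *\<^sub>R \<nu> + t *\<^sub>R (b - a)) - a) = s" "edge_param a b (a + s *\<^sub>R \<nu> + t *\<^sub>R (b - a)) = t"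
proof -
 show "x = a + (\<nu> \<bullet> (x - a)) *\<^sub>R \<nu> + edge_param a b x *\<^sub>R (b - a)"
  using orthogonal_expansion[OF assms(1,2), of "x - a"] assms(3) by (simp add: edge_param_def algebra_simps)
 have 0: "(a + s *\<^sub>R \<nu> + t *\<^sub>R (b - a)) - a = s *\<^sub>R \<nu> + t *\<^sub>R (b - a)" by simp
 have 1: "\<nu> \<bullet> \<nu> = 1" "(b - a) \<bullet> (b - a) ~= 0" using assms by (auto simp: norm_eq_1)
 show "\<nu> \<bullet> ((a + s *\<^sub>R \<nu> + t *\<^sub>R (b - a)) - a) = s" unfolding 0 inner_add_right inner_scaleR_right assms(2) 1 by simp
 show "edge_param a b (a + s *\<^sub>R \<nu> + t *\<^sub>R (b - a)) = t"
  unfolding edge_param_def 0 inner_add_left inner_scaleR_left assms(2) power2_norm_eq_inner using 1(2) by simp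
qed

lemma abs_edge_param_diff: "\<bar>edge_param a b x - edge_param a b y\<bar> <= norm (x - y) / norm (b - a)"
proof -
 have "edge_param a b x - edge_param a b y = (x - y) \<bullet> (b - a) / (norm (b - a))^2"
  by (simp add: edge_param_def inner_diff_left diff_divide_distrib)
 also have "\<bar>...\<bar> <= (norm (x - y) * norm (b - a)) / (norm (b - a))^2"
  unfolding abs_divide using Cauchy_Schwarz_ineq2[of "x - y" "b - a"] by (simp add: divide_right_mono)
 finally show ?thesis by (cases "b = a") (simp_all add: power2_eq_square)
qed

lemma tent_bounds: "tent t <= t" "tent t <= 1 - t" "tent t <= 1 / 2" "\<bar>tent s - tent t\<bar> <= \<bar>s - t\<bar>"
 by (auto simp: tent_def min_def)

text \<open>The slope is at most 1 along the edge, since \<open>tent\<close> is scaled by the edge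
  length, and 1 / \<epsilon> across it.\<close>

lemma roof_props:
 assumes \<nu>: "norm \<nu> = 1" and ab: "a ~= b" and \<epsilon>: "\<epsilon> > 0"
 shows "0 <= roof \<epsilon> \<nu> a b x" and "\<bar>roof \<epsilon> \<nu> a b x - roof \<epsilon> \<nu> a b y\<bar> <= (1 + 1 / \<epsilon>) * norm (x - y)"
  and "0 < roof \<epsilon> \<nu> a b x ==> \<bar>\<nu> \<bullet> (x - a)\<bar> < \<epsilon> * (norm (b - a) * tent (edge_param a b x))"
  and "roof \<epsilon> \<nu> a b x <= max 0 (norm (b - a) * tent (edge_param a b x))"
proof -
 let ?l = "norm (b - a)"
 have l: "?l > 0" using ab by simp
 show "0 <= roof \<epsilon> \<nu> a b x" by (simp add: roof_def)
 show "roof \<epsilon> \<nu> a b x <= max 0 (?l * tent (edge_param a b x))" unfolding roof_def by (intro max.mono) (use \<epsilon> in auto)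
 have "?l * \<bar>tent (edge_param a b x) - tent (edge_param a b y)\<bar> <= ?l * (norm (x - y) / ?l)"
  by (intro mult_left_mono order_trans[OF tent_bounds(4) abs_edge_param_diff]) simp
 then have 1: "\<bar>?l * tent (edge_param a b x) - ?l * tent (edge_param a b y)\<bar> <= norm (x - y)"
  using l by (simp add: abs_mult flip: right_diff_distrib)
 have "\<bar>\<nu> \<bullet> (x - a) - \<nu> \<bullet> (y - a)\<bar> = \<bar>\<nu> \<bullet> (x - y)\<bar>" by (simp add: inner_diff_right)
 also have "... <= norm (x - y)" using Cauchy_Schwarz_ineq2[of \<nu> "x - y"] \<nu> by simp
 finally have "\<bar>\<bar>\<nu> \<bullet> (x - a)\<bar> - \<bar>\<nu> \<bullet> (y - a)\<bar>\<bar> <= norm (x - y)" by linarith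
 then have 2: "\<bar>\<bar>\<nu> \<bullet> (x - a)\<bar> / \<epsilon> - \<bar>\<nu> \<bullet> (y - a)\<bar> / \<epsilon>\<bar> <= norm (x - y) / \<epsilon>"
  using \<epsilon> by (simp add: divide_right_mono flip: diff_divide_distrib)
 have "\<bar>max 0 (A - S) - max 0 (A' - S')\<bar> <= \<bar>A - A'\<bar> + \<bar>S - S'\<bar>" for A A' S S' :: real by (auto simp: max_def)
 from this[of "?l * tent (edge_param a b x)" "\<bar>\<nu> \<bullet> (x - a)\<bar> / \<epsilon>" "?l * tent (edge_param a b y)" "\<bar>\<nu> \<bullet> (y - a)\<bar> / \<epsilon>"] 1 2
 have "\<bar>roof \<epsilon> \<nu> a b x - roof \<epsilon> \<nu> a b y\<bar> <= norm (x - y) + norm (x - y) / \<epsilon>" unfolding roof_def by linarith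
 then show "\<bar>roof \<epsilon> \<nu> a b x - roof \<epsilon> \<nu> a b y\<bar> <= (1 + 1 / \<epsilon>) * norm (x - y)" by (simp add: distrib_right)
 assume "0 < roof \<epsilon> \<nu> a b x"
 then have "\<bar>\<nu> \<bullet> (x - a)\<bar> / \<epsilon> < ?l * tent (edge_param a b x)" by (simp add: roof_def max_def split: if_splits)
 then show "\<bar>\<nu> \<bullet> (x - a)\<bar> < \<epsilon> * (?l * tent (edge_param a b x))" using \<epsilon> by (simp add: pos_divide_less_eq mult.commute)
qed

text \<open>Smoothing requires a bounded support. A point with positive roof has an edge parameter
  in (0, 1) and a height of at most \<epsilon> times the edge length.\<close>

lemma roof_bounded_support:
 assumes \<nu>: "norm \<nu> = 1" "\<nu> \<bullet> (b - a) = 0" and ab: "a ~= b" and \<epsilon>: "\<epsilon> > 0"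
  and x: "x \<notin> cball 0 (norm a + (\<epsilon> + 1) * norm (b - a))"
 shows "roof \<epsilon> \<nu> a b x = 0"
proof (rule ccontr)
 let ?l = "norm (b - a)" let ?t = "edge_param a b x"
 assume "roof \<epsilon> \<nu> a b x ~= 0"
 then have "0 < roof \<epsilon> \<nu> a b x" using roof_props(1)[OF \<nu>(1) ab \<epsilon>, of x] by linarith
 from roof_props(3)[OF \<nu>(1) ab \<epsilon> this] have s: "\<bar>\<nu> \<bullet> (x - a)\<bar> < \<epsilon> * (?l * tent ?t)" .
 then have "0 < \<epsilon> * (?l * tent ?t)" by linarith
 then have t: "0 < tent ?t" using \<epsilon> ab by (simp add: zero_less_mult_iff)
 have "?l * tent ?t <= ?l * 1" using tent_bounds(3)[of ?t] by (intro mult_left_mono) auto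
 then have "\<epsilon> * (?l * tent ?t) <= \<epsilon> * ?l" using \<epsilon> by (intro mult_left_mono) auto
 then have s': "\<bar>\<nu> \<bullet> (x - a)\<bar> <= \<epsilon> * ?l" using s by linarith
 have "norm x <= norm a + \<bar>\<nu> \<bullet> (x - a)\<bar> * norm \<nu> + \<bar>?t\<bar> * ?l"
  using edge_coordinates(1)[OF \<nu> ab, of x] norm_triangle_ineq[of "a + (\<nu> \<bullet> (x - a)) *\<^sub>R \<nu>" "?t *\<^sub>R (b - a)"]
   norm_triangle_ineq[of a "(\<nu> \<bullet> (x - a)) *\<^sub>R \<nu>"] by simp
 moreover have "\<bar>?t\<bar> * ?l <= 1 * ?l" using t tent_bounds(1,2)[of ?t] by (intro mult_right_mono) auto
 ultimately have "norm x <= norm a + (\<epsilon> + 1) * ?l" using s' \<nu>(1) by (simp add: distrib_right)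
 then show False using x by simp
qed

text \<open>Let k be the height of x relative to that of z. Then x lies between z and the point of
  the edge line with parameter t, and t falls into [0, 1] because the tangential displacement
  towards z is at most k h / l, which the hypothesis keeps below the distance of the edge parameter
  of x to 0 and 1.\<close>

lemma cusp_in_region:
 assumes K: "simple_polygon vs" "convex (region vs)" and e: "(a, b) \<in> edges vs" and B: "ball z r \<subseteq> region vs" "r > 0"
  and \<nu>: "norm \<nu> = 1" "\<nu> \<bullet> (b - a) = 0" "r <= \<nu> \<bullet> (z - a)"
  and x: "0 < \<nu> \<bullet> (x - a)" "diameter (region vs) * (\<nu> \<bullet> (x - a)) < r * (norm (b - a) * tent (edge_param a b x))"
 shows "x \<in> region vs"
proof -
 let ?h = "diameter (region vs)" let ?l = "norm (b - a)" let ?\<sigma> = "%x. \<nu> \<bullet> (x - a)" let ?\<theta> = "edge_param a b"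
 have ab: "a ~= b" by (rule edge_ne[OF K(1) e])
 then have l: "?l > 0" by simp
 have zD: "z \<in> region vs" using B by auto
 then have ne: "region vs ~= {}" by blast
 have h: "?h > 0" by (rule diameter_region_pos[OF ne])
 have seg: "closed_segment a b \<subseteq> closure (region vs)" using edge_in_frontier[OF K ne e] by (auto simp: frontier_def)
 then have cl: "a \<in> closure (region vs)" "b \<in> closure (region vs)" "z \<in> closure (region vs)"
  using zD closure_subset by (auto intro: subsetD[OF seg])
 have lh: "?l <= ?h" by (rule diameter_region_bound[OF cl(1,2)])
 have za: "norm (z - a) <= ?h" "norm (z - b) <= ?h" by (rule diameter_region_bound[OF cl(1,3)], rule diameter_region_bound[OF cl(2,3)])
 have pa: "?\<theta> a = 0" "?\<theta> b = 1" using edge_param_linepath[OF ab, of 0] edge_param_linepath[OF ab, of 1] by (simp_all add: linepath_def)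
 have tz: "\<bar>?\<theta> z\<bar> <= ?h / ?l" "\<bar>1 - ?\<theta> z\<bar> <= ?h / ?l"
 proof -
  have "norm (z - a) / ?l <= ?h / ?l" "norm (b - z) / ?l <= ?h / ?l" using za l by (auto intro!: divide_right_mono simp: norm_minus_commute)
  then show "\<bar>?\<theta> z\<bar> <= ?h / ?l" "\<bar>1 - ?\<theta> z\<bar> <= ?h / ?l"
   using abs_edge_param_diff[of a b z a] abs_edge_param_diff[of a b b z] by (simp_all add: pa)
 qed
 have sz: "?\<sigma> z > 0" using \<nu>(3) B(2) by linarith
 define k where "k = ?\<sigma> x / ?\<sigma> z"
 have k0: "0 < k" using x sz by (simp add: k_def)
 have kh: "k * (?h / ?l) < tent (?\<theta> x)"
 proof -
  have "?\<sigma> x * r <= ?\<sigma> x * ?\<sigma> z" using \<nu>(3) x(1) by (intro mult_left_mono) auto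
  then have "k <= ?\<sigma> x / r" using sz B(2) x(1) unfolding k_def by (intro divide_left_mono \<nu>(3)) auto
  then have "k * (?h / ?l) <= (?\<sigma> x / r) * (?h / ?l)" using h l by (intro mult_right_mono) auto
  also have "... = (?h * ?\<sigma> x) / (r * ?l)" by simp
  also have "... < tent (?\<theta> x)" using x(2) B(2) l by (simp add: pos_divide_less_eq mult_ac)
  finally show ?thesis .
 qed
 have k1: "k < 1"
 proof -
  have "1 <= ?h / ?l" using lh l by simp
  then have "k * 1 <= k * (?h / ?l)" using k0 by (intro mult_left_mono) auto
  then show ?thesis using kh tent_bounds(3)[of "?\<theta> x"] by linarith
 qed
 define t where "t = (?\<theta> x - k * ?\<theta> z) / (1 - k)"
 have "k * ?\<theta> z <= k * (?h / ?l)" "k * (1 - ?\<theta> z) <= k * (?h / ?l)" by (intro mult_left_mono order_trans[OF abs_ge_self tz(1)] order_trans[OF abs_ge_self tz(2)] less_imp_le[OF k0])+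
 then have "k * ?\<theta> z < ?\<theta> x" "k * (1 - ?\<theta> z) < 1 - ?\<theta> x" using kh tent_bounds(1,2)[of "?\<theta> x"] by linarith+
 then have t01: "0 <= t" "t <= 1" using k1 by (auto simp: t_def pos_divide_le_eq algebra_simps)
 define y where "y = linepath a b t"
 have y: "y = a + t *\<^sub>R (b - a)" by (simp add: y_def linepath_def algebra_simps)
 have "y \<in> closure (region vs)" using seg linepath_in_path[of t a b] t01 by (auto simp: y_def)
 then have in1: "z + (1 - k) *\<^sub>R (y - z) \<in> region vs"
  by (intro segment_interior[OF K(2) region_open zD]) (use k0 k1 in auto)
 have "z + (1 - k) *\<^sub>R (y - z) = k *\<^sub>R z + (1 - k) *\<^sub>R y" by (simp add: algebra_simps)
 also have "... = k *\<^sub>R (a + ?\<sigma> z *\<^sub>R \<nu> + ?\<theta> z *\<^sub>R (b - a)) + (1 - k) *\<^sub>R (a + t *\<^sub>R (b - a))"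
  using edge_coordinates(1)[OF \<nu>(1,2) ab, of z] y by simp
 also have "... = a + (k * ?\<sigma> z) *\<^sub>R \<nu> + (k * ?\<theta> z + (1 - k) * t) *\<^sub>R (b - a)" by (simp add: scaleR_add_right scaleR_add_left scaleR_diff_left)
 also have "k * ?\<sigma> z = ?\<sigma> x" using sz by (simp add: k_def)
 also have "k * ?\<theta> z + (1 - k) * t = ?\<theta> x" using k1 by (simp add: t_def)
 also have "a + ?\<sigma> x *\<^sub>R \<nu> + ?\<theta> x *\<^sub>R (b - a) = x" by (rule edge_coordinates(1)[OF \<nu>(1,2) ab, symmetric])
 finally show ?thesis using in1 by simp
qed

text \<open>Above the edge line a positive roof forces x into the open region; on the line it forces
  x into the relative interior of the edge. Neither can happen on another edge, so test functions
  built from the roof see one edge only.\<close>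

lemma roof_other_edges:
 assumes K: "simple_polygon vs" "convex (region vs)" and e: "(a, b) \<in> edges vs" and B: "ball z r \<subseteq> region vs" "r > 0"
  and \<nu>: "norm \<nu> = 1" "\<nu> \<bullet> (b - a) = 0" "!!x. x \<in> region vs ==> 0 < \<nu> \<bullet> (x - a)" "r <= \<nu> \<bullet> (z - a)"
  and \<epsilon>: "\<epsilon> > 0" "diameter (region vs) * \<epsilon> <= r"
  and f: "(c, d) \<in> edges vs" "(c, d) ~= (a, b)" and x: "x \<in> closed_segment c d"
 shows "roof \<epsilon> \<nu> a b x = 0"
proof (rule ccontr)
 let ?l = "norm (b - a)" let ?t = "edge_param a b x" let ?h = "diameter (region vs)"
 have ab: "a ~= b" by (rule edge_ne[OF K(1) e])
 have ne: "region vs ~= {}" using B by auto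
 have h: "?h > 0" by (rule diameter_region_pos[OF ne])
 assume "roof \<epsilon> \<nu> a b x ~= 0"
 then have "0 < roof \<epsilon> \<nu> a b x" using roof_props(1)[OF \<nu>(1) ab \<epsilon>(1), of x] by linarith
 from roof_props(3)[OF \<nu>(1) ab \<epsilon>(1) this] have s: "\<bar>\<nu> \<bullet> (x - a)\<bar> < \<epsilon> * (?l * tent ?t)" .
 then have "0 < \<epsilon> * (?l * tent ?t)" by linarith
 then have t: "0 < tent ?t" using \<epsilon> ab by (simp add: zero_less_mult_iff)
 have fr: "x \<in> frontier (region vs)" using edge_in_frontier[OF K ne f(1)] x by blast
 then have xn: "x \<notin> region vs" and xc: "x \<in> closure (region vs)" using region_open by (auto simp: frontier_def interior_open)
 have "closure (region vs) \<subseteq> {x. 0 <= \<nu> \<bullet> (x - a)}"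
 proof (rule closure_minimal)
  show "region vs \<subseteq> {x. 0 <= \<nu> \<bullet> (x - a)}" using \<nu>(3) less_imp_le by blast
  show "closed {x. 0 <= \<nu> \<bullet> (x - a)}" by (intro closed_Collect_le continuous_intros)
 qed
 then have s0: "0 <= \<nu> \<bullet> (x - a)" using xc by blast
 show False
 proof (cases "0 < \<nu> \<bullet> (x - a)")
  case True
  have "?h * (\<nu> \<bullet> (x - a)) < ?h * (\<epsilon> * (?l * tent ?t))" using s True h by (intro mult_strict_left_mono) auto
  also have "... = (?h * \<epsilon>) * (?l * tent ?t)" by simp
  also have "... <= r * (?l * tent ?t)" by (rule mult_right_mono[OF \<epsilon>(2)]) (use t in simp)
  finally show False using cusp_in_region[OF K e B \<nu>(1,2,4) True] xn by blast
 next
  case False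
  then have "\<nu> \<bullet> (x - a) = 0" using s0 by simp
  then have xe: "x = linepath a b ?t" using edge_coordinates(1)[OF \<nu>(1,2) ab, of x] by (simp add: linepath_def algebra_simps)
  have t01: "0 < ?t" "?t < 1" using t tent_bounds(1,2)[of ?t] by linarith+
  have "x \<in> closed_segment a b" by (subst xe, rule linepath_in_path) (use t01 in auto)
  then have "x \<in> {a, b} \<inter> {c, d}" using simple_polygon_segments[OF K(1) e f(1)] f(2) x by blast
  moreover have "edge_param a b a = 0" "edge_param a b b = 1"
   using edge_param_linepath[OF ab, of 0] edge_param_linepath[OF ab, of 1] by (simp_all add: linepath_def)
  ultimately show False using t01 by auto
 qed
qed

section \<open>Polynomials on a single edge\<close>

lemma unit_integral:
 fixes k :: "real => real"
 assumes "continuous_on UNIV k"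
 shows "integrable (lebesgue_on {0..1}) k" "integral\<^sup>L (lebesgue_on {0..1}) k = integral {0..1} k"
proof -
 show I: "integrable (lebesgue_on {0..1}) k" by (rule continuous_imp_integrable_real[OF continuous_on_subset[OF assms]]) simp
 show "integral\<^sup>L (lebesgue_on {0..1}) k = integral {0..1} k" by (rule lebesgue_integral_eq_integral[OF I]) simp
qed

lemma continuous_tent: "continuous_on S tent"
 unfolding tent_def[abs_def] by (intro continuous_intros)

text \<open>The boundary weight estimate in dimension one, on (0, 1) with the ball of radius 1/2
  about the midpoint; 360 is 2 times 20 times 9, with 9 from p + 2 <= 3 p.\<close>

lemma tent_mass_bound:
 assumes G: "degree G <= p" and p: "1 <= p"
 shows "(LINT t|lebesgue_on {0..1}. (poly G t)^2) <= 360 * (real p)^2 * (LINT t|lebesgue_on {0..1}. tent t * (poly G t)^2)"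
proof -
 let ?T = "{0<..<1::real}"
 have lp: "line_poly p (poly G)" unfolding line_poly_def
 proof (intro conjI allI)
  show "continuous_on UNIV (poly G)" by (intro continuous_intros)
  fix a v :: real
  have "degree (pcompose G [:a, v:]) <= p" using G by (simp add: degree_pcompose)
  then show "\<exists>P. degree P <= p \<and> (\<forall>t. poly G (a + t *\<^sub>R v) = poly P t)"
   by (intro exI[of _ "pcompose G [:a, v:]"]) (simp add: poly_pcompose)
 qed
 define A where "A = (LINT t|lebesgue_on {0..1}. (poly G t)^2)"
 define E where "E = (LINT t|lebesgue_on {0..1}. tent t * (poly G t)^2)"
 have mt: "0 <= max 0 (tent t) * (poly G t)^2" for t by simp
 have cm: "continuous_on UNIV (%t. max 0 (tent t) * (poly G t)^2)" by (intro continuous_intros continuous_tent)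
 have E': "E = (LINT t|lebesgue_on {0..1}. max 0 (tent t) * (poly G t)^2)"
  unfolding E_def by (intro Bochner_Integration.integral_cong) (auto simp: tent_def)
 have 1: "(nn_integral lborel (%t. ennreal ((poly G t)^2) * indicator ?T t)) = ennreal A" unfolding A_def
  by (rule nn_integral_continuous_unit(2)) (auto intro!: continuous_intros)
 have "(nn_integral lborel (%t. ennreal (infdist t (- ?T) * (poly G t)^2) * indicator ?T t))
  <= (nn_integral lborel (%t. ennreal (max 0 (tent t) * (poly G t)^2) * indicator ?T t))"
 proof (rule nn_integral_mono)
  fix t :: real
  have "infdist t (- ?T) <= max 0 (tent t)" if t: "t \<in> ?T"
  proof -
   have "infdist t (- ?T) <= dist t 0" "infdist t (- ?T) <= dist t 1" by (intro infdist_le; simp)+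
   then show ?thesis using t by (auto simp: tent_def dist_real_def)
  qed
  then show "ennreal (infdist t (- ?T) * (poly G t)^2) * indicator ?T t <= ennreal (max 0 (tent t) * (poly G t)^2) * indicator ?T t"
   by (cases "t \<in> ?T") (auto intro!: ennreal_leI mult_right_mono)
 qed
 also have "... = ennreal E" unfolding E' by (rule nn_integral_continuous_unit(2)[OF cm mt])
 finally have 2: "(nn_integral lborel (%t. ennreal (infdist t (- ?T) * (poly G t)^2) * indicator ?T t)) <= ennreal E" .
 have "ball (1 / 2) (1 / 2) \<subseteq> ?T" by (auto simp: dist_real_def abs_if split: if_splits)
 from weighted_norm_bound[OF _ _ _ this _ lp]
 have "ennreal (1 / 2) * ennreal A <= ennreal (20 * (real p + 2)^2) * (nn_integral lborel (%t. ennreal (infdist t (- ?T) * (poly G t)^2) * indicator ?T t))"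
  unfolding 1[symmetric] by (simp add: add.assoc)
 also have "... <= ennreal (20 * (real p + 2)^2) * ennreal E" by (rule mult_left_mono[OF 2]) simp
 finally have "ennreal (1 / 2 * A) <= ennreal (20 * (real p + 2)^2 * E)"
  by (subst (1 2) ennreal_mult) (auto simp: A_def E')
 then have "1 / 2 * A <= 20 * (real p + 2)^2 * E" by (subst (asm) ennreal_le_iff) (auto simp: E')
 also have "... <= 20 * (3 * real p)^2 * E" using p by (intro mult_left_mono mult_right_mono power_mono) (auto simp: E')
 finally show ?thesis by (simp add: A_def E_def power_mult_distrib)
qed

text \<open>In coordinates normal and tangential to the edge of length l, the strip has width 2
  \<epsilon> l \<open>tent t\<close> over the parameter t, and the Jacobian is l.\<close>

lemma strip_integral_le:
 fixes F :: "real^2 => real" and G :: "real => real"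
 assumes \<nu>: "norm \<nu> = 1" "\<nu> \<bullet> (b - a) = 0" and ab: "a ~= b" and \<epsilon>: "\<epsilon> > 0" and D: "open D" "bounded D"
  and F: "continuous_on UNIV F" "!!x. 0 <= F x" and G: "continuous_on UNIV G" "!!x. 0 <= G x"
  and F0: "!!x. \<not> \<bar>\<nu> \<bullet> (x - a)\<bar> < \<epsilon> * (norm (b - a) * tent (edge_param a b x)) ==> F x = 0"
  and FG: "!!x. \<bar>\<nu> \<bullet> (x - a)\<bar> < \<epsilon> * (norm (b - a) * tent (edge_param a b x)) ==> F x <= G (edge_param a b x)"
 shows "(LINT x|lebesgue_on D. F x) <= 2 * \<epsilon> * (norm (b - a))^2 * (LINT t|lebesgue_on {0..1}. tent t * G t)"
proof -
 let ?l = "norm (b - a)"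
 have l: "?l > 0" using ab by simp
 define c where "c t = \<epsilon> * (?l * tent t)" for t
 have cc: "continuous_on UNIV c" unfolding c_def[abs_def] by (intro continuous_intros continuous_tent)
 have [measurable]: "c \<in> borel_measurable borel" "G \<in> borel_measurable borel" by (rule borel_measurable_continuous_onI, fact)+
 have Fm: "(%x. ennreal (F x)) \<in> borel_measurable borel" using borel_measurable_continuous_onI[OF F(1)] by measurable
 have det: "\<bar>\<nu> $ 1 * (b - a) $ 2 - (b - a) $ 1 * \<nu> $ 2\<bar> = ?l"
  using cross_normal[OF \<nu>, of \<nu>] \<nu>(1) by (simp add: cross_def norm_eq_1)
 have E0: "0 <= (LINT t|lebesgue_on {0..1}. max 0 (tent t) * G t)" using G(2) by (intro Bochner_Integration.integral_nonneg) simp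
 have Et: "(LINT t|lebesgue_on {0..1}. tent t * G t) = (LINT t|lebesgue_on {0..1}. max 0 (tent t) * G t)"
  by (intro Bochner_Integration.integral_cong) (auto simp: tent_def)
 have "ennreal (LINT x|lebesgue_on D. F x) = (nn_integral lborel (%x. ennreal (F x) * indicator D x))"
  by (rule nn_integral_continuous_region(2)[OF D F, symmetric])
 also have "... <= (nn_integral lborel (%x. ennreal (F x)))" by (intro nn_integral_mono) (auto simp: indicator_def)
 also have "... = ennreal ?l * (nn_integral lborel (%s. nn_integral lborel (%t. ennreal (F (a + s *\<^sub>R \<nu> + t *\<^sub>R (b - a))))))"
  unfolding det[symmetric] by (rule nn_integral_linear_change[OF Fm]) (use det l in auto)
 also have "... <= ennreal ?l * (nn_integral lborel (%s. nn_integral lborel (%t. ennreal (G t) * (if \<bar>s\<bar> <= c t then 1 else 0) * indicator {0<..<1} t)))"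
 proof (intro mult_left_mono nn_integral_mono)
  fix s t :: real
  let ?x = "a + s *\<^sub>R \<nu> + t *\<^sub>R (b - a)"
  note x = edge_coordinates(2,3)[OF \<nu> ab, of s t]
  show "ennreal (F ?x) <= ennreal (G t) * (if \<bar>s\<bar> <= c t then 1 else 0) * indicator {0<..<1} t"
  proof (cases "\<bar>s\<bar> < c t")
   case True
   then have "0 < \<epsilon> * (?l * tent t)" unfolding c_def by linarith
   then have "0 < tent t" using \<epsilon> l by (simp add: zero_less_mult_iff)
   then have "t \<in> {0<..<1}" using tent_bounds(1,2)[of t] by auto
   moreover have "F ?x <= G t" using FG[of ?x] True unfolding x c_def by simp
   ultimately show ?thesis using True by (simp add: ennreal_leI)
  next
   case False
   then have "F ?x = 0" using F0[of ?x] unfolding x c_def by simp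
   then show ?thesis by simp
  qed
 qed simp
 also have "(nn_integral lborel (%s. nn_integral lborel (%t. ennreal (G t) * (if \<bar>s\<bar> <= c t then 1 else 0) * indicator {0<..<1} t)))
  = (nn_integral lborel (%t. nn_integral lborel (%s. ennreal (G t) * (if \<bar>s\<bar> <= c t then 1 else 0) * indicator {0<..<1} t)))"
  by (rule lborel_pair.Fubini'[symmetric]) measurable
 also have "... = (nn_integral lborel (%t. ennreal (2 * \<epsilon> * ?l * (max 0 (tent t) * G t)) * indicator {0<..<1} t))"
 proof (rule nn_integral_cong)
  fix t :: real
  show "(nn_integral lborel (%s. ennreal (G t) * (if \<bar>s\<bar> <= c t then 1 else 0) * indicator {0<..<1} t))
   = ennreal (2 * \<epsilon> * ?l * (max 0 (tent t) * G t)) * indicator {0<..<1} t"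
  proof (cases "t \<in> {0<..<1}")
   case True
   then have t: "0 <= tent t" by (auto simp: tent_def)
   then have c0: "0 <= c t" using \<epsilon> l by (simp add: c_def)
   have "(nn_integral lborel (%s. ennreal (G t) * (if \<bar>s\<bar> <= c t then 1 else 0) * indicator {0<..<1} t)) = (nn_integral lborel (%s. ennreal (G t) * indicator {- c t..c t} s))"
    using True by (intro nn_integral_cong) (auto simp: indicator_def abs_le_iff)
   also have "... = ennreal (G t) * ennreal (2 * c t)" using c0 by (simp add: nn_integral_cmult_indicator)
   also have "... = ennreal (G t * (2 * c t))" using G(2) c0 by (simp add: ennreal_mult)
   also have "G t * (2 * c t) = 2 * \<epsilon> * ?l * (max 0 (tent t) * G t)" using t by (simp add: c_def)
   finally show ?thesis using True by simp
  qed simp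
 qed
 also have "... = ennreal (LINT t|lebesgue_on {0..1}. 2 * \<epsilon> * ?l * (max 0 (tent t) * G t))"
  by (rule nn_integral_continuous_unit(2)) (use \<epsilon> l G(2) in \<open>auto intro!: continuous_intros continuous_tent G(1)\<close>)
 also have "ennreal ?l * ... = ennreal (?l * (LINT t|lebesgue_on {0..1}. 2 * \<epsilon> * ?l * (max 0 (tent t) * G t)))"
  using \<epsilon> l E0 by (intro ennreal_mult[symmetric]) auto
 finally have "(LINT x|lebesgue_on D. F x) <= ?l * (LINT t|lebesgue_on {0..1}. 2 * \<epsilon> * ?l * (max 0 (tent t) * G t))"
  using \<epsilon> l E0 by (subst (asm) ennreal_le_iff) auto
 also have "(LINT t|lebesgue_on {0..1}. 2 * \<epsilon> * ?l * (max 0 (tent t) * G t)) = 2 * \<epsilon> * ?l * (LINT t|lebesgue_on {0..1}. max 0 (tent t) * G t)"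
  by (rule integral_mult_right_zero)
 finally show ?thesis unfolding Et by (simp only: power2_eq_square mult_ac)
qed

text \<open>The normal trace is defined by testing over the whole boundary; the factor v vanishes on
  all other edges and reduces the identity to this edge, with an arbitrary polynomial H along
  it.\<close>

lemma edge_test_function:
 fixes H :: "real poly"
 assumes K: "simple_polygon vs" "convex (region vs)" and e: "(a, b) \<in> edges vs" and B: "ball z r \<subseteq> region vs" "r > 0"
  and \<nu>: "norm \<nu> = 1" "\<nu> \<bullet> (b - a) = 0" "!!x. x \<in> region vs ==> 0 < \<nu> \<bullet> (x - a)" "r <= \<nu> \<bullet> (z - a)"
  and \<epsilon>: "\<epsilon> > 0" "diameter (region vs) * \<epsilon> <= r"
  and v: "smooth v" "!!x. 0 <= v x" "!!x. v x <= roof \<epsilon> \<nu> a b x"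
 defines "\<phi> \<equiv> %x. poly H (edge_param a b x) * v x"
 shows "smooth \<phi>"
  and "grad \<phi> x = poly H (edge_param a b x) *\<^sub>R grad v x + (v x * poly (pderiv H) (edge_param a b x) / (norm (b - a))^2) *\<^sub>R (b - a)"
  and "has_normal_trace vs \<tau> g ==> norm (b - a) * (LINT t|lebesgue_on {0..1}. g (linepath a b t) * (poly H t * v (linepath a b t)))
   = (LINT x|lebesgue_on (region vs). \<tau> x \<bullet> grad \<phi> x) + (LINT x|lebesgue_on (region vs). weak_div (region vs) \<tau> x * \<phi> x)"
proof -
 have ab: "a ~= b" by (rule edge_ne[OF K(1) e])
 define u where "u = (1 / (norm (b - a))^2) *\<^sub>R (b - a)"
 define c where "c = - (a \<bullet> (b - a)) / (norm (b - a))^2"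
 have ep: "edge_param a b x = u \<bullet> x + c" for x
  by (simp add: edge_param_def u_def c_def inner_diff_left[of x a] inner_commute[of "b - a" x] diff_divide_distrib)
 have s1: "smooth (%x. poly H (u \<bullet> x + c))" by (rule smooth_comp1[OF smooth1_poly])
 show s: "smooth \<phi>" unfolding \<phi>_def ep by (intro smooth_mult s1 v)
 show "grad \<phi> x = poly H (edge_param a b x) *\<^sub>R grad v x + (v x * poly (pderiv H) (edge_param a b x) / (norm (b - a))^2) *\<^sub>R (b - a)"
  unfolding \<phi>_def ep grad_def partial_mult[OF smooth_differentiable[OF s1] smooth_differentiable[OF v(1)]] partial_comp1[OF poly_DERIV]
  by (simp add: vec_eq_iff u_def)
 assume g: "has_normal_trace vs \<tau> g"
 have zero: "v x = 0" if "(c, d) \<in> edges vs" "(c, d) ~= (a, b)" "x \<in> closed_segment c d" for c d x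
  using roof_other_edges[OF K e B \<nu> \<epsilon> that] v(2,3)[of x] by simp
 have "boundary_integral vs (%x. g x * \<phi> x)
  = (\<Sum>f\<in>edges vs. if f = (a, b) then norm (b - a) * (LINT t|lebesgue_on {0..1}. g (linepath a b t) * (poly H t * v (linepath a b t))) else 0)"
  unfolding boundary_integral_def
 proof (rule sum.cong[OF refl])
  fix f assume f: "f \<in> edges vs"
  obtain c d where cd: "f = (c, d)" by (cases f)
  show "(case f of (a, b) => edge_length (a, b) * (LINT t|lebesgue_on {0..1}. g (linepath a b t) * \<phi> (linepath a b t)))
   = (if f = (a, b) then norm (b - a) * (LINT t|lebesgue_on {0..1}. g (linepath a b t) * (poly H t * v (linepath a b t))) else 0)"
  proof (cases "f = (a, b)")
   case True
   then show ?thesis by (simp add: edge_length_norm \<phi>_def edge_param_linepath[OF ab])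
  next
   case False
   have "(LINT t|lebesgue_on {0..1}. g (linepath c d t) * \<phi> (linepath c d t)) = (LINT t|lebesgue_on {0..1::real}. 0)"
   proof (rule Bochner_Integration.integral_cong[OF refl])
    fix t assume "t \<in> space (lebesgue_on {0..1::real})"
    then have "linepath c d t \<in> closed_segment c d" by (intro linepath_in_path) simp
    then have "v (linepath c d t) = 0" using zero f False cd by blast
    then show "g (linepath c d t) * \<phi> (linepath c d t) = 0" by (simp add: \<phi>_def)
   qed
   then show ?thesis using False by (auto simp: cd)
  qed
 qed
 also have "... = norm (b - a) * (LINT t|lebesgue_on {0..1}. g (linepath a b t) * (poly H t * v (linepath a b t)))"
  using e by (simp add: edges_finite)
 finally show "norm (b - a) * (LINT t|lebesgue_on {0..1}. g (linepath a b t) * (poly H t * v (linepath a b t)))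
   = (LINT x|lebesgue_on (region vs). \<tau> x \<bullet> grad \<phi> x) + (LINT x|lebesgue_on (region vs). weak_div (region vs) \<tau> x * \<phi> x)"
  using conjunct2[OF g[unfolded has_normal_trace_def], rule_format, OF s] by simp
qed

text \<open>Polynomials are dense in L^2 of the unit interval, by continuous approximation and
  Stone-Weierstrass. Replacing one factor f by f - H bounds the weighted integral by a constant over
  s, for every s > 0.\<close>

lemma orthogonal_polynomials_zero:
 fixes f :: "real => real"
 assumes f: "sqint (lebesgue_on {0..1}) f" and w: "continuous_on UNIV w" "!!t. 0 <= w t" "!!t. t \<in> {0..1} ==> w t <= B"
  and orth: "!!H. (LINT t|lebesgue_on {0..1}. f t * (poly H t * w t)) = 0"
 shows "(LINT t|lebesgue_on {0..1}. (f t)^2 * w t) = 0"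
proof -
 let ?M = "lebesgue_on {0..1::real}"
 define F where "F = (LINT t|?M. (f t)^2)"
 define X where "X = (LINT t|?M. (f t)^2 * w t)"
 have F0: "0 <= F" by (simp add: F_def)
 have X0: "0 <= X" unfolding X_def using w by (intro Bochner_Integration.integral_nonneg) simp
 have B0: "0 <= B" using order_trans[OF w(2)[of 0] w(3)[of 0]] by simp
 have cs: "sqint ?M k" if "continuous_on UNIV k" for k :: "real => real"
  using unit_integral(1)[OF that] unit_integral(1)[OF continuous_on_power[OF that, of 2]] by (simp add: sqint_def)
 obtain f' where f': "f' \<in> borel_measurable borel" "!!t. t \<notin> {0..1} ==> f' t = 0" "AE t in ?M. f t = f' t" "sqint lborel f'"
  by (rule sqint_borel_representative[OF borel_closed[OF closed_atLeastAtMost] f]) (simp del: atLeastAtMost_iff, blast?)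
 have key: "X <= (F / 2 + 2 * B^2) / s" if s: "s > 0" for s
 proof -
  \<comment> \<open>With this accuracy the Young remainder, of order s e, is again of order 1 /
    s.\<close>
  define e where "e = 1 / s^2"
  have e: "e > 0" using s by (simp add: e_def)
  obtain h Bh where h: "continuous_on UNIV h" "!!t. \<bar>h t\<bar> <= Bh" "(LBINT t. (f' t - indicator {0..1} t * h t)^2) < e"
   by (rule L2_continuous_approximation[OF _ _ f'(4,2) e, of "{0..1}"]) auto
  obtain q where q: "real_polynomial_function q" "!!t. t \<in> {0..1} ==> \<bar>h t - q t\<bar> < sqrt e"
   using Stone_Weierstrass_real_polynomial_function[OF compact_Icc continuous_on_subset[OF h(1)], of 0 1 "sqrt e"] e by auto
  obtain cf n where cf: "q = (%x. \<Sum>i\<le>n. cf i * x ^ i)" using q(1) real_polynomial_function_iff_sum by blast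
  define H where "H = (\<Sum>i\<le>n. monom (cf i) i)"
  have qH: "q t = poly H t" for t by (simp add: cf H_def poly_sum poly_monom)
  have sH: "sqint ?M (%t. f t - h t)" "sqint ?M (%t. h t - poly H t)" by (intro sqint_diff f cs h continuous_intros)+
  have hm: "(%t. (f' t - h t)^2) \<in> borel_measurable borel"
   using f'(1) borel_measurable_continuous_onI[OF h(1)] by measurable
  have "(%t. (f' t - h t)^2) \<in> borel_measurable ?M"
   by (rule measurable_restrict_space1, rule measurable_completion) (use hm in simp)
  moreover have "AE t in ?M. (f t - h t)^2 = (f' t - h t)^2" using f'(3) by eventually_elim simp
  moreover have "(%t. (f t - h t)^2) \<in> borel_measurable ?M" using sH(1) by (auto simp: sqint_def)
  ultimately have "(LINT t|?M. (f t - h t)^2) = (LINT t|?M. (f' t - h t)^2)" by (intro integral_cong_AE)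
  also have "... = (LBINT t. indicator {0..1} t *\<^sub>R (f' t - h t)^2)"
   by (rule integral_lebesgue_on_lborel(2)) (use f'(1) borel_measurable_continuous_onI[OF h(1)] in auto)
  also have "... = (LBINT t. (f' t - indicator {0..1} t * h t)^2)"
  proof (rule Bochner_Integration.integral_cong[OF refl])
   fix t show "indicator {0..1} t *\<^sub>R (f' t - h t)^2 = (f' t - indicator {0..1} t * h t)^2"
    by (cases "t \<in> {0..1}") (simp_all add: f'(2) del: atLeastAtMost_iff)
  qed
  finally have a1: "(LINT t|?M. (f t - h t)^2) < e" using h(3) by simp
  have "(LINT t|?M. (h t - poly H t)^2) <= (LINT t|?M. e)"
  proof (rule integral_mono)
   show "integrable ?M (%t. (h t - poly H t)^2)" "integrable ?M (%t. e)" by (intro unit_integral continuous_intros h)+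
   fix t assume "t \<in> space ?M"
   then have "\<bar>h t - poly H t\<bar>\<^sup>2 <= (sqrt e)^2" using q(2)[of t] by (intro power_mono) (auto simp: qH)
   then show "(h t - poly H t)^2 <= e" using e by simp
  qed
  also have "... = e" by (subst unit_integral(2)) simp_all
  finally have a2: "(LINT t|?M. (h t - poly H t)^2) <= e" .
  have sfH: "sqint ?M (%t. f t - poly H t)" by (intro sqint_diff f cs continuous_intros)
  have "(LINT t|?M. (norm ((f t - h t) + (h t - poly H t)))^2) <= 2 * (LINT t|?M. (norm (f t - h t))^2) + 2 * (LINT t|?M. (norm (h t - poly H t))^2)"
   by (rule l2n_add_le[OF sH])
  then have a3: "(LINT t|?M. (f t - poly H t)^2) <= 4 * e" using a1 a2 by simp
  have wsq: "((f t - poly H t) * w t)^2 <= B^2 * (f t - poly H t)^2" if "t \<in> {0..1}" for t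
   unfolding power_mult_distrib using power_mono[OF w(3)[OF that] w(2), of 2] by (simp add: mult.commute mult_right_mono)
  have wm: "w \<in> borel_measurable ?M" using unit_integral(1)[OF w(1)] by auto
  have sw: "sqint ?M (%t. (f t - poly H t) * w t)" unfolding sqint_def
  proof (intro conjI)
   show m: "(%t. (f t - poly H t) * w t) \<in> borel_measurable ?M" using sfH wm by (auto simp: sqint_def)
   have "integrable ?M (%t. B^2 * (f t - poly H t)^2)" using sfH by (auto simp: sqint_def)
   then show "integrable ?M (%t. (norm ((f t - poly H t) * w t))^2)"
    by (rule Bochner_Integration.integrable_bound) (use m wsq in \<open>auto intro!: AE_I2\<close>)
  qed
  have "(LINT t|?M. ((f t - poly H t) * w t)^2) <= (LINT t|?M. B^2 * (f t - poly H t)^2)"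
   by (rule integral_mono) (use sw sfH wsq in \<open>auto simp: sqint_def\<close>)
  also have "... <= B^2 * (4 * e)" using mult_left_mono[OF a3, of "B^2"] by simp
  finally have a4: "(LINT t|?M. ((f t - poly H t) * w t)^2) <= B^2 * (4 * e)" .
  have I1: "integrable ?M (%t. f t * ((f t - poly H t) * w t))" by (rule sqint_mult_integrable[OF f sw])
  have I2: "integrable ?M (%t. f t * (poly H t * w t))" by (rule sqint_mult_integrable[OF f cs]) (intro continuous_intros w)
  have "X = (LINT t|?M. f t * ((f t - poly H t) * w t) + f t * (poly H t * w t))"
   unfolding X_def by (intro Bochner_Integration.integral_cong) (auto simp: power2_eq_square algebra_simps)
  also have "... = (LINT t|?M. f t * ((f t - poly H t) * w t))"
   using Bochner_Integration.integral_add[OF I1 I2] orth[of H] by simp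
  also have "... <= F / (2 * s) + s / 2 * (LINT t|?M. ((f t - poly H t) * w t)^2)"
   using integral_Young[OF f sw s] by (simp add: F_def)
  also have "... <= F / (2 * s) + s / 2 * (B^2 * (4 * e))" using s by (intro add_left_mono mult_left_mono a4) auto
  also have "... = (F / 2 + 2 * B^2) / s" using s by (simp add: e_def field_simps power2_eq_square)
  finally show ?thesis .
 qed
 have "X <= 0"
 proof (rule ccontr)
  assume "\<not> X <= 0"
  then have X: "X > 0" by simp
  define Y where "Y = F / 2 + 2 * B^2"
  have Y: "Y \<ge> 0" using F0 by (simp add: Y_def)
  have "X <= Y / ((Y + 1) / X)" unfolding Y_def by (rule key) (use X Y in \<open>simp add: Y_def\<close>)
  then have "X * (Y + 1) <= Y * X" using X Y by (simp add: field_simps)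
  then show False using X by (simp add: algebra_simps)
 qed
 then show ?thesis using X0 by (simp add: X_def)
qed

lemma AE_unit_interior: "AE t in lebesgue_on {0..1::real}. t \<in> {0<..<1}"
proof -
 have "{0, 1::real} \<in> null_sets lebesgue" by (rule finite_imp_null_set_lborel[THEN null_sets_completionI]) simp
 then have "AE t in lebesgue. t \<notin> {0, 1::real}" by (rule AE_not_in)
 then have *: "AE t in lebesgue. t \<in> {0..1} \<longrightarrow> t \<in> {0<..<1::real}" by (rule eventually_mono) auto
 have "(AE t in lebesgue_on {0..1::real}. t \<in> {0<..<1}) \<longleftrightarrow> (AE t in lebesgue. t \<in> {0..1} \<longrightarrow> t \<in> {0<..<1::real})"
  by (rule AE_restrict_space_iff) simp
 then show ?thesis using * by (rule iffD2)
qed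

lemma roof_linepath_ge:
 assumes "\<nu> \<bullet> (b - a) = 0" "a ~= b"
 shows "norm (b - a) * tent t <= roof \<epsilon> \<nu> a b (linepath a b t)"
proof -
 have "linepath a b t - a = t *\<^sub>R (b - a)" by (simp add: linepath_def algebra_simps)
 then have "\<nu> \<bullet> (linepath a b t - a) = 0" using assms(1) by simp
 then show ?thesis unfolding roof_def edge_param_linepath[OF assms(2)] by simp
qed

lemma smooth_roof:
 assumes \<nu>: "norm \<nu> = 1" "\<nu> \<bullet> (b - a) = 0" and ab: "a ~= b" and \<epsilon>: "\<epsilon> > 0" and \<delta>: "\<delta> > 0"
 obtains v where "smooth v" "!!x. 0 <= v x" "!!x. v x <= roof \<epsilon> \<nu> a b x" "!!x. roof \<epsilon> \<nu> a b x - \<delta> <= v x"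
  "!!x. norm (grad v x) <= 2 * (1 + 1 / \<epsilon>)" "!!x. v x ~= 0 ==> roof \<epsilon> \<nu> a b x \<ge> \<delta> / 4"
proof -
 have L: "0 < 1 + 1 / \<epsilon>" using \<epsilon> by (simp add: add_pos_pos)
 show ?thesis
  by (rule lipschitz_smoothing[OF L roof_props(2)[OF \<nu>(1) ab \<epsilon>] roof_props(1)[OF \<nu>(1) ab \<epsilon>]
    roof_bounded_support[OF \<nu> ab \<epsilon>] \<delta>]) (assumption | rule that)+
qed

text \<open>The products of polynomials with a smoothed roof are admissible test functions.\<close>

lemma normal_trace_edge_unique:
 assumes K: "simple_polygon vs" "convex (region vs)" and e: "(a, b) \<in> edges vs" and B: "ball z r \<subseteq> region vs" "r > 0"
  and g: "has_normal_trace vs \<tau> g" "has_normal_trace vs \<tau> g'"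
 shows "AE t in lebesgue_on {0..1}. g (linepath a b t) = g' (linepath a b t)"
proof -
 let ?M = "lebesgue_on {0..1::real}" let ?h = "diameter (region vs)" let ?l = "norm (b - a)"
 obtain \<nu> where \<nu>: "norm \<nu> = 1" "\<nu> \<bullet> (b - a) = 0" "!!x. x \<in> region vs ==> 0 < \<nu> \<bullet> (x - a)" "r <= \<nu> \<bullet> (z - a)"
  by (rule edge_inner_normal[OF K e B]) (assumption | blast)+
 have ab: "a ~= b" by (rule edge_ne[OF K(1) e])
 then have l: "?l > 0" by simp
 have ne: "region vs ~= {}" using B by auto
 have h: "?h > 0" by (rule diameter_region_pos[OF ne])
 define \<epsilon> where "\<epsilon> = r / ?h"
 have \<epsilon>: "\<epsilon> > 0" "?h * \<epsilon> <= r" using B(2) h by (auto simp: \<epsilon>_def)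
 define f where "f t = g (linepath a b t) - g' (linepath a b t)" for t
 have sg: "sqint ?M (%t. g (linepath a b t))" "sqint ?M (%t. g' (linepath a b t))"
  using g e unfolding has_normal_trace_def L2_boundary_def L2_on_sqint by blast+
 have sf: "sqint ?M f" unfolding f_def[abs_def] by (rule sqint_diff[OF sg])
 \<comment> \<open>The smoothed roof is known to be positive only where the roof exceeds
   \<open>\<delta>\<close>. With \<delta> = l / (n + 1) this covers all parameters whose tent value
   is above 1 / (n + 1), and countably many n exhaust the open edge.\<close>
 have pos: "AE t in ?M. \<not> 1 / real (Suc n) < tent t \<or> f t = 0" for n
 proof -
  define \<delta> where "\<delta> = ?l / real (Suc n)"
  have \<delta>: "\<delta> > 0" using l by (simp add: \<delta>_def)
  obtain v where v: "smooth v" "!!x. 0 <= v x" "!!x. v x <= roof \<epsilon> \<nu> a b x" "!!x. roof \<epsilon> \<nu> a b x - \<delta> <= v x"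
   "!!x. norm (grad v x) <= 2 * (1 + 1 / \<epsilon>)" "!!x. v x ~= 0 ==> roof \<epsilon> \<nu> a b x \<ge> \<delta> / 4"
   by (rule smooth_roof[OF \<nu>(1,2) ab \<epsilon>(1) \<delta>]) (assumption | blast)+
  define w where "w t = v (linepath a b t)" for t
  have cw: "continuous_on UNIV w" unfolding w_def[abs_def] linepath_def
   by (intro continuous_on_compose2[OF smooth_continuous[OF v(1), of UNIV]] continuous_intros) auto
  have w0: "0 <= w t" for t by (simp add: w_def v(2))
  have wB: "w t <= ?l" if "t \<in> {0..1}" for t
  proof -
   have "w t <= max 0 (?l * tent t)"
    using order_trans[OF v(3) roof_props(4)[OF \<nu>(1) ab \<epsilon>(1)], of "linepath a b t"] unfolding w_def edge_param_linepath[OF ab] .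
   also have "... <= ?l" using tent_bounds(3)[of t] l mult_left_mono[of "tent t" 1 ?l] by simp
   finally show ?thesis .
  qed
  have cp: "sqint ?M (%t. poly H t * w t)" for H
  proof -
   have c: "continuous_on UNIV (%t. poly H t * w t)" by (intro continuous_intros cw)
   show ?thesis using unit_integral(1)[OF c] unit_integral(1)[OF continuous_on_power[OF c, of 2]] by (simp add: sqint_def)
  qed
  have orth: "(LINT t|?M. f t * (poly H t * w t)) = 0" for H
  proof -
   note T = edge_test_function(3)[OF K e B \<nu>(1,2) \<nu>(3) \<nu>(4) \<epsilon> v(1) v(2) v(3), where H = H, simplified]
   have "?l * (LINT t|?M. g (linepath a b t) * (poly H t * w t)) = ?l * (LINT t|?M. g' (linepath a b t) * (poly H t * w t))"
    unfolding w_def T[OF g(1)] T[OF g(2)] ..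
   then have "(LINT t|?M. g (linepath a b t) * (poly H t * w t)) = (LINT t|?M. g' (linepath a b t) * (poly H t * w t))" using l by simp
   then show ?thesis
    by (simp add: f_def left_diff_distrib Bochner_Integration.integral_diff[OF sqint_mult_integrable[OF sg(1) cp] sqint_mult_integrable[OF sg(2) cp]])
  qed
  have z: "(LINT t|?M. (f t)^2 * w t) = 0" by (rule orthogonal_polynomials_zero[OF sf cw w0 wB orth])
  have I: "integrable ?M (%t. (f t)^2 * w t)"
  proof (rule Bochner_Integration.integrable_bound)
   show "integrable ?M (%t. ?l * (f t)^2)" using sf by (simp add: sqint_def)
   show "(%t. (f t)^2 * w t) \<in> borel_measurable ?M" using sf unit_integral(1)[OF cw] by (auto simp: sqint_def)
   have "(f t)^2 * w t <= ?l * (f t)^2" if "t \<in> {0..1}" for t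
    using mult_right_mono[OF wB[OF that], of "(f t)^2"] by (simp add: mult.commute)
   then show "AE t in ?M. norm ((f t)^2 * w t) <= norm (?l * (f t)^2)" using w0 by (intro AE_I2) simp
  qed
  have "AE t in ?M. (f t)^2 * w t = 0" using z w0 by (subst (asm) integral_nonneg_eq_0_iff_AE[OF I]) auto
  then show ?thesis
  proof eventually_elim
   case (elim t)
   show ?case
   proof (rule disjCI)
    assume "\<not> f t = 0"
    then have "w t = 0" using elim by simp
    moreover have "?l * tent t - \<delta> <= w t"
     unfolding w_def using v(4)[of "linepath a b t"] roof_linepath_ge[OF \<nu>(2) ab, of t \<epsilon>] by linarith
    ultimately have "?l * tent t <= ?l * (1 / real (Suc n))" by (simp add: \<delta>_def)
    then have "tent t <= 1 / real (Suc n)" by (rule mult_left_le_imp_le) (rule l)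
    then show "\<not> 1 / real (Suc n) < tent t" by linarith
   qed
  qed
 qed
 have "AE t in ?M. \<forall>n. \<not> 1 / real (Suc n) < tent t \<or> f t = 0" unfolding AE_all_countable using pos by blast
 moreover note AE_unit_interior
 ultimately show ?thesis
 proof eventually_elim
  case (elim t)
  then have "0 < tent t" by (auto simp: tent_def)
  then obtain n where "inverse (real (Suc n)) < tent t" using reals_Archimedean by blast
  then have "1 / real (Suc n) < tent t" by (simp add: inverse_eq_divide)
  then have "f t = 0" using elim by blast
  then show ?case by (simp add: f_def)
 qed
qed

text \<open>Let l be the edge length, \<Gamma> the squared norm of G on the unit interval and P =
  360 p^2. Testing with G times the exact roof would give at least l^2 \<Gamma> / P by
  \<open>tent_mass_bound\<close>. The smoothing loss and two Young terms each take a quarter of it;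
  multiplying the remaining quarter by 4 P produces the factor P^2.\<close>

lemma edge_weighted_estimate:
 fixes vs :: polygon and G :: "real poly"
 defines "M \<equiv> lebesgue_on (region vs)" and "h \<equiv> diameter (region vs)"
 assumes K: "simple_polygon vs" "convex (region vs)" and e: "(a, b) \<in> edges vs" and B: "ball z r \<subseteq> region vs" "r > 0"
  and \<tau>: "sqint M \<tau>" "sqint M (weak_div (region vs) \<tau>)" and g: "has_normal_trace vs \<tau> g"
  and G: "degree G <= p" "1 <= p" "!!t. t \<in> {0<..<1} ==> g (linepath a b t) = poly G t"
  and \<epsilon>: "\<epsilon> > 0" "h * \<epsilon> <= r" "\<epsilon> <= 1" "real p * \<epsilon> <= 1"
 shows "(norm (b - a))^2 * (LINT t|lebesgue_on {0..1}. (poly G t)^2) <= (360 * (real p)^2)^2 *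
  (144 * (LINT x|M. (norm (\<tau> x))^2) / \<epsilon> + \<epsilon> * (norm (b - a))^2 * (LINT x|M. (weak_div (region vs) \<tau> x)^2))"
proof -
 let ?l = "norm (b - a)" let ?U = "lebesgue_on {0..1::real}"
 define d where "d = weak_div (region vs) \<tau>"
 obtain \<nu> where \<nu>: "norm \<nu> = 1" "\<nu> \<bullet> (b - a) = 0" "!!x. x \<in> region vs ==> 0 < \<nu> \<bullet> (x - a)" "r <= \<nu> \<bullet> (z - a)"
  by (rule edge_inner_normal[OF K e B]) (assumption | blast)+
 have ab: "a ~= b" by (rule edge_ne[OF K(1) e])
 then have l: "?l > 0" by simp
 have p: "1 <= real p" using G(2) by simp
 define P where "P = 360 * (real p)^2"
 have P: "P > 0" using p by (simp add: P_def)
 define \<Gamma> where "\<Gamma> = (LINT t|?U. (poly G t)^2)"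
 have \<Gamma>0: "0 <= \<Gamma>" by (simp add: \<Gamma>_def)
 \<comment> \<open>Makes the smoothing loss l \<delta> \<Gamma> equal to a quarter of l^2 \<Gamma> /
   P.\<close>
 define \<delta> where "\<delta> = ?l / (4 * P)"
 have \<delta>: "\<delta> > 0" using l P by (simp add: \<delta>_def)
 obtain v where v: "smooth v" "!!x. 0 <= v x" "!!x. v x <= roof \<epsilon> \<nu> a b x" "!!x. roof \<epsilon> \<nu> a b x - \<delta> <= v x"
   "!!x. norm (grad v x) <= 2 * (1 + 1 / \<epsilon>)" "!!x. v x ~= 0 ==> roof \<epsilon> \<nu> a b x \<ge> \<delta> / 4"
  by (rule smooth_roof[OF \<nu>(1,2) ab \<epsilon>(1) \<delta>]) (assumption | blast)+
 let ?t = "edge_param a b"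
 define \<phi> where "\<phi> = (%x. poly G (?t x) * v x)"
 note T = edge_test_function[OF K e B \<nu>(1,2) _ \<nu>(4) \<epsilon>(1) \<epsilon>(2)[unfolded h_def] v(1,2,3), where H = G, folded \<phi>_def, OF \<nu>(3)]
 have s\<phi>: "smooth \<phi>" by (rule T(1))
 have T2: "grad \<phi> x = poly G (?t x) *\<^sub>R grad v x + (v x * poly (pderiv G) (?t x) / ?l^2) *\<^sub>R (b - a)" for x by (rule T(2))
 have inside: "\<bar>\<nu> \<bullet> (x - a)\<bar> < \<epsilon> * (?l * tent (?t x))" if "roof \<epsilon> \<nu> a b x \<ge> \<delta> / 4" for x
  by (rule roof_props(3)[OF \<nu>(1) ab \<epsilon>(1)]) (use that \<delta> in linarith)
 have v0: "v x = 0" if "\<not> \<bar>\<nu> \<bullet> (x - a)\<bar> < \<epsilon> * (?l * tent (?t x))" for x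
  using inside[OF v(6)] that by blast
 have cr: "continuous_on UNIV (roof \<epsilon> \<nu> a b)"
  unfolding roof_def[abs_def] edge_param_def divide_inverse
  by (intro continuous_intros continuous_on_compose2[OF continuous_tent[of UNIV]]) auto
 \<comment> \<open>\<open>\<phi>\<close> vanishes on the open set where the roof is below
   \<delta>/4, so its gradient vanishes there too; this set contains the whole outside of the
   strip.\<close>
 have g0: "grad \<phi> x = 0" if x: "\<not> \<bar>\<nu> \<bullet> (x - a)\<bar> < \<epsilon> * (?l * tent (?t x))" for x
 proof -
  let ?S = "{x. \<delta> / 4 <= roof \<epsilon> \<nu> a b x}"
  have x: "x \<in> - ?S" using x inside by blast
  have cl: "closed ?S" by (intro closed_Collect_le continuous_intros cr)
  have 0: "0 = \<phi> y" if "y \<in> - ?S" for y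
  proof -
   have "v y = 0" using v(6)[of y] that by blast
   then show ?thesis by (simp add: \<phi>_def)
  qed
  have "(\<phi> has_derivative (%h. 0)) (at x)"
   by (rule has_derivative_transform_within_open[where s = "- ?S" and f = "%x. 0", OF _ open_Compl[OF cl] x 0]) simp_all
  from partial_eq[OF this] show ?thesis by (simp add: grad_def vec_eq_iff)
 qed
 have vl: "v x <= ?l * tent (?t x)" if "\<bar>\<nu> \<bullet> (x - a)\<bar> < \<epsilon> * (?l * tent (?t x))" for x
 proof -
  have "0 < \<epsilon> * (?l * tent (?t x))" using that by linarith
  then have "0 < ?l * tent (?t x)" using \<epsilon>(1) by (simp add: zero_less_mult_iff)
  then show ?thesis using order_trans[OF v(3) roof_props(4)[OF \<nu>(1) ab \<epsilon>(1)], of x] by simp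
 qed
 have ct: "continuous_on UNIV tent" by (rule continuous_tent)
 \<comment> \<open>The strip width gives one factor \<open>tent\<close> and the squared test
   function two more. Their product is bounded by half the Legendre weight where G' occurs, and by
   1/8 where G occurs.\<close>
 have t3: "tent t * (tent t)^2 <= t * (1 - t) / 2" "tent t * (tent t)^2 <= 1 / 8" "0 <= tent t" if "t \<in> {0..1}" for t
 proof -
  show t0: "0 <= tent t" using that by (auto simp: tent_def)
  have 2: "(tent t)^2 <= (1 / 2)^2" by (rule power_mono[OF tent_bounds(3) t0])
  have "tent t <= 2 * (t * (1 - t))"
  proof (cases "t <= 1 / 2")
   case True
   then have "t * 1 <= t * (2 * (1 - t))" using that by (intro mult_left_mono) auto
   then show ?thesis using tent_bounds(1)[of t] by linarith
  next
   case False
   then have "1 * (1 - t) <= (2 * t) * (1 - t)" using that by (intro mult_right_mono) auto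
   then show ?thesis using tent_bounds(2)[of t] by (simp add: mult.assoc)
  qed
  then have "tent t * (tent t)^2 <= (2 * (t * (1 - t))) * (1 / 2)^2" using 2 t0 by (intro mult_mono) auto
  then show "tent t * (tent t)^2 <= t * (1 - t) / 2" by (simp add: power2_eq_square)
  have "tent t * (tent t)^2 <= (1 / 2) * (1 / 2)^2" using 2 t0 by (intro mult_mono tent_bounds) auto
  then show "tent t * (tent t)^2 <= 1 / 8" by (simp add: power2_eq_square)
 qed
 define L where "L = 1 + 1 / \<epsilon>"
 have L: "L^2 <= 4 / \<epsilon>^2" "0 <= L"
 proof -
  show "0 <= L" using \<epsilon>(1) by (simp add: L_def)
  moreover have "L <= 2 / \<epsilon>" using \<epsilon> by (simp add: L_def field_simps)
  ultimately have "L^2 <= (2 / \<epsilon>)^2" by (intro power_mono)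
  then show "L^2 <= 4 / \<epsilon>^2" by (simp add: power_divide)
 qed
 \<comment> \<open>The slope across the edge, of order 1/\<epsilon>, dominates: p \<epsilon> <= 1
   puts the tangential contribution p^2 under 1/\<epsilon>^2, and the strip contributes a factor
   \<epsilon> l^2.\<close>
 have I1: "(LINT x|M. (norm (grad \<phi> x))^2) <= 36 * ?l^2 * \<Gamma> / \<epsilon>"
 proof -
  define G1 where "G1 t = 2 * ((tent t)^2 * (poly (pderiv G) t)^2) + 8 * L^2 * (poly G t)^2" for t
  have c1: "continuous_on UNIV G1" unfolding G1_def[abs_def] by (intro continuous_intros ct)
  have "(LINT x|M. (norm (grad \<phi> x))^2) <= 2 * \<epsilon> * ?l^2 * (LINT t|?U. tent t * G1 t)" unfolding M_def
  proof (rule strip_integral_le[OF \<nu>(1,2) ab \<epsilon>(1) region_open region_bounded])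
   show "continuous_on UNIV (%x. (norm (grad \<phi> x))^2)" by (intro continuous_intros grad_continuous s\<phi>)
   show "continuous_on UNIV G1" by (rule c1)
   show "0 <= G1 t" for t by (simp add: G1_def)
   show "(norm (grad \<phi> x))^2 = 0" if "\<not> \<bar>\<nu> \<bullet> (x - a)\<bar> < \<epsilon> * (?l * tent (?t x))" for x using g0[OF that] by simp
   show "(norm (grad \<phi> x))^2 <= G1 (?t x)" if x: "\<bar>\<nu> \<bullet> (x - a)\<bar> < \<epsilon> * (?l * tent (?t x))" for x
   proof -
    have "(norm (grad \<phi> x))^2 <= 2 * (norm (poly G (?t x) *\<^sub>R grad v x))^2 + 2 * (norm ((v x * poly (pderiv G) (?t x) / ?l^2) *\<^sub>R (b - a)))^2"
     unfolding T2 by (rule norm_add_square_le)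
    also have "(norm (poly G (?t x) *\<^sub>R grad v x))^2 <= (poly G (?t x))^2 * (4 * L^2)"
    proof -
     have "(norm (grad v x))^2 <= (2 * L)^2" using v(5)[of x] by (intro power_mono) (auto simp: L_def)
     then show ?thesis by (simp add: power_mult_distrib mult_left_mono)
    qed
    also have "(norm ((v x * poly (pderiv G) (?t x) / ?l^2) *\<^sub>R (b - a)))^2 = (v x / ?l)^2 * (poly (pderiv G) (?t x))^2"
     using l by (simp add: power_mult_distrib power_divide power2_eq_square)
    also have "... <= (tent (?t x))^2 * (poly (pderiv G) (?t x))^2"
    proof (intro mult_right_mono power_mono)
     show "v x / ?l <= tent (?t x)" using vl[OF x] l by (simp add: pos_divide_le_eq mult.commute)
     show "0 <= v x / ?l" using v(2) by simp
    qed simp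
    finally show ?thesis by (simp add: G1_def mult_ac)
   qed
  qed simp
  also have "(LINT t|?U. tent t * G1 t) <= (LINT t|?U. (t - 0) * (1 - t) * (poly (pderiv G) t)^2 + 4 * L^2 * (poly G t)^2)"
  proof (rule integral_mono)
   show "integrable ?U (%t. tent t * G1 t)" "integrable ?U (%t. (t - 0) * (1 - t) * (poly (pderiv G) t)^2 + 4 * L^2 * (poly G t)^2)"
    by (intro unit_integral(1) continuous_intros ct c1)+
   fix t assume "t \<in> space ?U"
   then have t: "t \<in> {0..1}" by simp
   have "(tent t * (tent t)^2) * (2 * (poly (pderiv G) t)^2) <= (t * (1 - t) / 2) * (2 * (poly (pderiv G) t)^2)"
    by (rule mult_right_mono[OF t3(1)[OF t]]) simp
   moreover have "tent t * (8 * L^2 * (poly G t)^2) <= 1 / 2 * (8 * L^2 * (poly G t)^2)" by (rule mult_right_mono[OF tent_bounds(3)]) simp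
   moreover have "tent t * G1 t = (tent t * (tent t)^2) * (2 * (poly (pderiv G) t)^2) + tent t * (8 * L^2 * (poly G t)^2)"
    by (simp add: G1_def algebra_simps)
   ultimately show "tent t * G1 t <= (t - 0) * (1 - t) * (poly (pderiv G) t)^2 + 4 * L^2 * (poly G t)^2" by simp
  qed
  also have "... = (LINT t|?U. (t - 0) * (1 - t) * (poly (pderiv G) t)^2) + 4 * L^2 * \<Gamma>"
  proof -
   have "integrable ?U (%t. (t - 0) * (1 - t) * (poly (pderiv G) t)^2)" "integrable ?U (%t. 4 * L^2 * (poly G t)^2)"
    by (intro unit_integral(1) continuous_intros)+
   from Bochner_Integration.integral_add[OF this] show ?thesis by (simp add: \<Gamma>_def)
  qed
  also have "(LINT t|?U. (t - 0) * (1 - t) * (poly (pderiv G) t)^2) <= real p * (real p + 1) * \<Gamma>"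
  proof -
   have "continuous_on UNIV (%t. (t - 0) * (1 - t) * (poly (pderiv G) t)^2)" "continuous_on UNIV (%t. (poly G t)^2)"
    by (intro continuous_intros)+
   then show ?thesis unfolding \<Gamma>_def using poly_weighted_deriv_bound[OF zero_le_one G(1)] by (simp only: unit_integral(2))
  qed
  also have "real p * (real p + 1) * \<Gamma> + 4 * L^2 * \<Gamma> <= (2 / \<epsilon>^2 + 16 / \<epsilon>^2) * \<Gamma>"
  proof -
   have "real p <= 1 / \<epsilon>" using \<epsilon> by (simp add: pos_le_divide_eq)
   then have "(real p)^2 <= (1 / \<epsilon>)^2" by (intro power_mono) auto
   moreover have "real p * (real p + 1) <= 2 * (real p)^2"
    using mult_left_mono[OF p, of "real p"] by (simp add: power2_eq_square algebra_simps)
   ultimately have "real p * (real p + 1) + 4 * L^2 <= 2 / \<epsilon>^2 + 16 / \<epsilon>^2" using L(1) by (simp add: power_divide)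
   from mult_right_mono[OF this \<Gamma>0] show ?thesis by (simp add: distrib_right)
  qed
  finally have "(LINT x|M. (norm (grad \<phi> x))^2) <= 2 * \<epsilon> * ?l^2 * ((2 / \<epsilon>^2 + 16 / \<epsilon>^2) * \<Gamma>)"
   using \<epsilon>(1) by (simp add: mult_left_mono)
  also have "... = 36 * ?l^2 * \<Gamma> / \<epsilon>" using \<epsilon>(1) by (simp add: field_simps power2_eq_square)
  finally show ?thesis .
 qed
 have I2: "(LINT x|M. (\<phi> x)^2) <= \<epsilon> * (?l^2 * ?l^2) * \<Gamma> / 4"
 proof -
  define G2 where "G2 t = ?l^2 * ((tent t)^2 * (poly G t)^2)" for t
  have c2: "continuous_on UNIV G2" unfolding G2_def[abs_def] by (intro continuous_intros ct)
  have "(LINT x|M. (\<phi> x)^2) <= 2 * \<epsilon> * ?l^2 * (LINT t|?U. tent t * G2 t)" unfolding M_def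
  proof (rule strip_integral_le[OF \<nu>(1,2) ab \<epsilon>(1) region_open region_bounded])
   show "continuous_on UNIV (%x. (\<phi> x)^2)" by (intro continuous_intros smooth_continuous s\<phi>)
   show "continuous_on UNIV G2" by (rule c2)
   show "0 <= G2 t" for t by (simp add: G2_def)
   show "(\<phi> x)^2 = 0" if "\<not> \<bar>\<nu> \<bullet> (x - a)\<bar> < \<epsilon> * (?l * tent (?t x))" for x using v0[OF that] by (simp add: \<phi>_def)
   show "(\<phi> x)^2 <= G2 (?t x)" if x: "\<bar>\<nu> \<bullet> (x - a)\<bar> < \<epsilon> * (?l * tent (?t x))" for x
   proof -
    have "(v x)^2 <= (?l * tent (?t x))^2" by (rule power_mono[OF vl[OF x] v(2)])
    from mult_left_mono[OF this, of "(poly G (?t x))^2"] show ?thesis by (simp add: \<phi>_def G2_def power_mult_distrib mult_ac)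
   qed
  qed simp
  also have "(LINT t|?U. tent t * G2 t) <= (LINT t|?U. ?l^2 / 8 * (poly G t)^2)"
  proof (rule integral_mono)
   show "integrable ?U (%t. tent t * G2 t)" "integrable ?U (%t. ?l^2 / 8 * (poly G t)^2)"
    by (intro unit_integral(1) continuous_intros ct c2)+
   fix t assume "t \<in> space ?U"
   then have t: "t \<in> {0..1}" by simp
   have "(tent t * (tent t)^2) * (?l^2 * (poly G t)^2) <= 1 / 8 * (?l^2 * (poly G t)^2)"
    by (rule mult_right_mono[OF t3(2)[OF t]]) simp
   then show "tent t * G2 t <= ?l^2 / 8 * (poly G t)^2" by (simp add: G2_def mult_ac)
  qed
  also have "... = ?l^2 / 8 * \<Gamma>" unfolding \<Gamma>_def by (rule integral_mult_right_zero)
  finally have "(LINT x|M. (\<phi> x)^2) <= 2 * \<epsilon> * ?l^2 * (?l^2 / 8 * \<Gamma>)" using \<epsilon>(1) by (simp add: mult_left_mono)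
  then show ?thesis by (simp add: mult_ac)
 qed
 define W N where "W = (LINT x|M. (norm (\<tau> x))^2)" and "N = (LINT x|M. (d x)^2)"
 have sM: "sqint M \<phi>" "sqint M (grad \<phi>)" unfolding M_def
  by (intro bounded_continuous_sqint region_open region_bounded smooth_continuous grad_continuous s\<phi>)+
 have Y1: "\<bar>\<integral>x. \<tau> x \<bullet> grad \<phi> x \<partial>M\<bar> <= ?l^2 * \<Gamma> / (4 * P) + 36 * P * W / \<epsilon>"
 proof -
  \<comment> \<open>Chosen so that the bound 36 l^2 \<Gamma> / \<epsilon> for the gradient turns
    into l^2 \<Gamma> / (4 P).\<close>
  define s where "s = 72 * P / \<epsilon>"
  have s: "s > 0" using P \<epsilon>(1) by (simp add: s_def)
  have "\<bar>\<integral>x. \<tau> x \<bullet> grad \<phi> x \<partial>M\<bar> <= (LINT x|M. (norm (grad \<phi> x))^2) / (2 * s) + s / 2 * W"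
   using integral_Young[OF sM(2) \<tau>(1) s] by (simp add: inner_commute W_def)
  also have "(LINT x|M. (norm (grad \<phi> x))^2) / (2 * s) <= (36 * ?l^2 * \<Gamma> / \<epsilon>) / (2 * s)" by (rule divide_right_mono[OF I1]) (use s in simp)
  also have "(36 * ?l^2 * \<Gamma> / \<epsilon>) / (2 * s) = ?l^2 * \<Gamma> / (4 * P)" using P \<epsilon>(1) by (simp add: s_def field_simps)
  finally show ?thesis by (simp add: s_def)
 qed
 have Y2: "\<bar>\<integral>x. d x * \<phi> x \<partial>M\<bar> <= ?l^2 * \<Gamma> / (4 * P) + P * \<epsilon> * ?l^2 * N / 4"
 proof -
  \<comment> \<open>Chosen to give the volume norm of \<open>\<phi>\<close> the same share l^2
    \<Gamma> / (4 P).\<close>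
  define s where "s = P * \<epsilon> * ?l^2 / 2"
  have s: "s > 0" using P \<epsilon>(1) l by (simp add: s_def)
  have "\<bar>\<integral>x. d x * \<phi> x \<partial>M\<bar> <= (LINT x|M. (\<phi> x)^2) / (2 * s) + s / 2 * N"
   using integral_Young[OF sM(1) \<tau>(2) s] by (simp add: mult.commute N_def d_def)
  also have "(LINT x|M. (\<phi> x)^2) / (2 * s) <= (\<epsilon> * (?l^2 * ?l^2) * \<Gamma> / 4) / (2 * s)" by (rule divide_right_mono[OF I2]) (use s in simp)
  also have "(\<epsilon> * (?l^2 * ?l^2) * \<Gamma> / 4) / (2 * s) = ?l^2 * \<Gamma> / (4 * P)" using P \<epsilon>(1) l by (simp add: s_def field_simps)
  finally show ?thesis by (simp add: s_def)
 qed
 have low: "?l^2 * \<Gamma> / P - ?l^2 * \<Gamma> / (4 * P) <= ?l * (LINT t|?U. g (linepath a b t) * (poly G t * v (linepath a b t)))"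
 proof -
  define E where "E = (LINT t|?U. tent t * (poly G t)^2)"
  have "\<Gamma> <= P * E" using tent_mass_bound[OF G(1,2)] by (simp add: \<Gamma>_def P_def E_def)
  then have "\<Gamma> / P <= E" using P by (simp add: pos_divide_le_eq mult.commute)
  then have "?l^2 * (\<Gamma> / P) <= ?l^2 * E" by (rule mult_left_mono) simp
  moreover have "?l * (\<delta> * \<Gamma>) = ?l^2 * \<Gamma> / (4 * P)" by (simp add: \<delta>_def power2_eq_square)
  moreover have "?l * (?l * E - \<delta> * \<Gamma>) <= ?l * (LINT t|?U. g (linepath a b t) * (poly G t * v (linepath a b t)))"
  proof (rule mult_left_mono)
   have cvl: "continuous_on UNIV (%t. v (linepath a b t))" unfolding linepath_def
    by (intro continuous_on_compose2[OF smooth_continuous[OF v(1), of UNIV]] continuous_intros) auto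
   have "?l * E - \<delta> * \<Gamma> = (LINT t|?U. ?l * (tent t * (poly G t)^2) - \<delta> * (poly G t)^2)"
   proof -
    have "integrable ?U (%t. ?l * (tent t * (poly G t)^2))" "integrable ?U (%t. \<delta> * (poly G t)^2)"
     by (intro unit_integral(1) continuous_intros ct)+
    from Bochner_Integration.integral_diff[OF this] show ?thesis by (simp add: E_def \<Gamma>_def)
   qed
   also have "... <= (LINT t|?U. (poly G t)^2 * v (linepath a b t))"
   proof (rule integral_mono)
    show "integrable ?U (%t. ?l * (tent t * (poly G t)^2) - \<delta> * (poly G t)^2)" "integrable ?U (%t. (poly G t)^2 * v (linepath a b t))"
     by (intro unit_integral(1) continuous_intros ct cvl)+
    fix t :: real
    have "?l * tent t - \<delta> <= v (linepath a b t)"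
     using v(4)[of "linepath a b t"] roof_linepath_ge[OF \<nu>(2) ab, of t \<epsilon>] by linarith
    from mult_right_mono[OF this, of "(poly G t)^2"]
    show "?l * (tent t * (poly G t)^2) - \<delta> * (poly G t)^2 <= (poly G t)^2 * v (linepath a b t)" by (simp add: algebra_simps)
   qed
   also have "... = (LINT t|?U. g (linepath a b t) * (poly G t * v (linepath a b t)))"
   proof (rule Bochner_Integration.integral_cong[OF refl])
    fix t assume "t \<in> space ?U"
    \<comment> \<open>The trace agrees with the polynomial on the open interval only; at the
      vertices the test function is zero.\<close>
    then consider "t = 0" | "t = 1" | "t \<in> {0<..<1}" by fastforce
    then show "(poly G t)^2 * v (linepath a b t) = g (linepath a b t) * (poly G t * v (linepath a b t))"
    proof cases
     case 3 then show ?thesis using G(3) by (simp add: power2_eq_square)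
    next
     case 1
     have "v (linepath a b t) = 0" by (rule v0) (simp add: edge_param_linepath[OF ab] 1 tent_def)
     then show ?thesis by simp
    next
     case 2
     have "v (linepath a b t) = 0" by (rule v0) (simp add: edge_param_linepath[OF ab] 2 tent_def)
     then show ?thesis by simp
    qed
   qed
   finally show "?l * E - \<delta> * \<Gamma> <= (LINT t|?U. g (linepath a b t) * (poly G t * v (linepath a b t)))" .
  qed simp
  moreover have "?l * (?l * E - \<delta> * \<Gamma>) = ?l^2 * E - ?l * (\<delta> * \<Gamma>)" by (simp add: right_diff_distrib power2_eq_square)
  moreover have "?l^2 * (\<Gamma> / P) = ?l^2 * \<Gamma> / P" by simp
  ultimately show ?thesis by linarith
 qed
 have "?l * (LINT t|?U. g (linepath a b t) * (poly G t * v (linepath a b t))) = (LINT x|M. \<tau> x \<bullet> grad \<phi> x) + (LINT x|M. d x * \<phi> x)"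
 proof -
  have "?l * (LINT t|?U. g (linepath a b t) * (poly G t * v (linepath a b t))) = (LINT x|lebesgue_on (region vs). \<tau> x \<bullet> grad \<phi> x)
   + (LINT x|lebesgue_on (region vs). weak_div (region vs) \<tau> x * (poly G (?t x) * v x))" by (rule T(3)[OF _ g])
  then show ?thesis by (simp only: M_def d_def \<phi>_def)
 qed
 then have "?l^2 * \<Gamma> / P - ?l^2 * \<Gamma> / (4 * P) <= ?l^2 * \<Gamma> / (4 * P) + 36 * P * W / \<epsilon> + (?l^2 * \<Gamma> / (4 * P) + P * \<epsilon> * ?l^2 * N / 4)"
  using low Y1 Y2 by linarith
 moreover have "?l^2 * \<Gamma> / P = 4 * (?l^2 * \<Gamma> / (4 * P))" by simp
 ultimately have "?l^2 * \<Gamma> / (4 * P) <= 36 * P * W / \<epsilon> + P * \<epsilon> * ?l^2 * N / 4" by linarith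
 then have "(4 * P) * (?l^2 * \<Gamma> / (4 * P)) <= (4 * P) * (36 * P * W / \<epsilon> + P * \<epsilon> * ?l^2 * N / 4)" by (rule mult_left_mono) (use P in simp)
 then have "?l^2 * \<Gamma> <= P^2 * (144 * W / \<epsilon> + \<epsilon> * ?l^2 * N)" using P by (simp add: power2_eq_square algebra_simps)
 then show ?thesis by (simp only: \<Gamma>_def P_def W_def N_def d_def)
qed

text \<open>The trace inequality for the constant 1: the gradient term vanishes, and the region lies
  in a square of side 2 h, whence 8 = 2 times 4.\<close>

lemma perimeter_bound:
 assumes K: "simple_polygon vs" "convex (region vs)" and B: "ball z r \<subseteq> region vs" "r > 0"
 shows "r * (\<Sum>(a, b)\<in>edges vs. norm (b - a)) <= 8 * (diameter (region vs))^2"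
proof -
 let ?D = "region vs" let ?h = "diameter ?D"
 have ne: "?D ~= {}" and zD: "z \<in> ?D" using B by auto
 have h: "?h > 0" by (rule diameter_region_pos[OF ne])
 have g0: "grad (%x. 1) x = 0" for x by (simp add: grad_def partial_eq[OF has_derivative_const] vec_eq_iff)
 have F: "continuous_on UNIV (%x::real^2. 1 :: real)" by simp
 define l u where "l = z - ?h *\<^sub>R (\<Sum>Basis)" and "u = z + ?h *\<^sub>R (\<Sum>Basis)"
 have sub: "?D \<subseteq> cbox l u"
 proof
  fix x assume x: "x \<in> ?D"
  have n: "norm (x - z) <= ?h" by (rule diameter_region_bound) (use x zD closure_subset in auto)
  have "\<bar>(x - z) \<bullet> i\<bar> <= ?h" if "i \<in> Basis" for i using Basis_le_norm[OF that, of "x - z"] n by linarith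
  then show "x \<in> cbox l u" by (auto simp: mem_box l_def u_def inner_diff_left inner_add_left abs_le_iff algebra_simps)
 qed
 have "ennreal (r * boundary_integral vs (%x. 1)) <= (nn_integral lborel (%x. ennreal 2 * indicator ?D x))"
  using trace_inequality[OF K B diameter_region_bound smooth_const[of 1]]
  unfolding boundary_sum_real[OF continuous_on_power[OF F] zero_le_power2 less_imp_le[OF B(2)]] by (simp add: g0)
 also have "... <= (nn_integral lborel (%x. ennreal 2 * indicator (cbox l u) x))"
  using sub by (intro nn_integral_mono) (auto simp: indicator_def)
 also have "... = ennreal 2 * emeasure lborel (cbox l u)" by (rule nn_integral_cmult_indicator) simp
 also have "emeasure lborel (cbox l u) = ennreal ((2 * ?h)^2)"
 proof -
  have 1: "u \<bullet> i = z \<bullet> i + ?h" "l \<bullet> i = z \<bullet> i - ?h" if "i \<in> Basis" for i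
   using that by (simp_all add: l_def u_def inner_diff_left inner_add_left inner_sum_left_Basis)
  have "emeasure lborel (cbox l u) = ennreal (\<Prod>i\<in>Basis. (u - l) \<bullet> i)" by (rule emeasure_lborel_cbox) (use h 1 in simp)
  also have "(\<Prod>i\<in>Basis. (u - l) \<bullet> i) = (\<Prod>i\<in>(Basis :: (real^2) set). 2 * ?h)" by (rule prod.cong) (simp_all add: 1 inner_diff_left)
  finally show ?thesis by simp
 qed
 also have "ennreal 2 * ennreal ((2 * ?h)^2) = ennreal (8 * ?h^2)" by (subst ennreal_mult[symmetric]) (auto simp: power_mult_distrib)
 finally have "r * boundary_integral vs (%x. 1) <= 8 * ?h^2" by (subst (asm) ennreal_le_iff) auto
 moreover have one: "(LINT t|lebesgue_on {0..1::real}. 1) = (1 :: real)" by (subst unit_integral(2)) simp_all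
 moreover have "boundary_integral vs (%x. 1) = (\<Sum>(a, b)\<in>edges vs. norm (b - a))"
  unfolding boundary_integral_def one by (simp add: edge_length_norm)
 ultimately show ?thesis by simp
qed

text \<open>With W and N the squared norms of \<tau> and its divergence, the width r / (h p^3)
  balances W / \<epsilon> against \<epsilon> l^2 N, because N is at most a multiple of p^6 W / r^2.
  Both become multiples of p^3 (h / r) W, with 518544 = 144 + 518400, and the factor (360 p^2)^2
  adds p^4.\<close>

lemma edge_trace_bound:
 fixes vs :: polygon
 defines "D \<equiv> region vs" and "h \<equiv> diameter (region vs)"
 assumes K: "simple_polygon vs" "convex (region vs)" and e: "(a, b) \<in> edges vs" and B: "ball z r \<subseteq> region vs" "r > 0"
  and \<tau>: "sqint (lebesgue_on D) \<tau>" "sqint (lebesgue_on D) (weak_div D \<tau>)"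
  and g: "has_normal_trace vs \<tau> g" and g': "has_normal_trace vs \<tau> g'" "poly_on_edge p (a, b) g'" and p: "1 <= p"
  and div: "r^2 * (LINT x|lebesgue_on D. (weak_div D \<tau> x)^2) <= 518400 * real p ^ 6 * (LINT x|lebesgue_on D. (norm (\<tau> x))^2)"
 shows "(norm (b - a))^2 * (LINT t|lebesgue_on {0..1}. (g (linepath a b t))^2)
  <= 129600 * 518544 * real p ^ 7 * (h / r) * (LINT x|lebesgue_on D. (norm (\<tau> x))^2)"
proof -
 let ?U = "lebesgue_on {0..1::real}" let ?l = "norm (b - a)"
 define W N where "W = (LINT x|lebesgue_on D. (norm (\<tau> x))^2)" and "N = (LINT x|lebesgue_on D. (weak_div D \<tau> x)^2)"
 have W0: "0 <= W" "0 <= N" by (simp_all add: W_def N_def)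
 have ne: "region vs ~= {}" and zD: "z \<in> region vs" using B by auto
 have h: "h > 0" unfolding h_def by (rule diameter_region_pos[OF ne])
 have p1: "1 <= real p" using p by simp
 have fr: "closed_segment a b \<subseteq> closure (region vs)" using edge_in_frontier[OF K ne e] by (auto simp: frontier_def)
 then have cl: "a \<in> closure (region vs)" "b \<in> closure (region vs)" by auto
 have lh: "?l <= h" unfolding h_def by (rule diameter_region_bound[OF cl])
 have rh: "r <= h"
 proof -
  obtain \<nu> where \<nu>: "norm \<nu> = 1" "\<nu> \<bullet> (b - a) = 0" "!!x. x \<in> region vs ==> 0 < \<nu> \<bullet> (x - a)" "r <= \<nu> \<bullet> (z - a)"
   by (rule edge_inner_normal[OF K e B]) (assumption | blast)+
  have "\<nu> \<bullet> (z - a) <= norm (z - a)" using Cauchy_Schwarz_ineq2[of \<nu> "z - a"] \<nu>(1) by simp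
  also have "... <= h" unfolding h_def by (rule diameter_region_bound[OF cl(1)]) (use zD closure_subset in auto)
  finally show ?thesis using \<nu>(4) by linarith
 qed
 obtain c where c: "!!t. t \<in> {0<..<1} ==> g' (linepath a b t) = (\<Sum>i\<le>p. c i * t ^ i)"
  using g'(2) unfolding poly_on_edge_def by auto
 define G where "G = (\<Sum>i\<le>p. monom (c i) i)"
 have G: "degree G <= p" unfolding G_def by (intro degree_sum_le) (auto intro: order_trans[OF degree_monom_le])
 have gG: "g' (linepath a b t) = poly G t" if "t \<in> {0<..<1}" for t
  using c[OF that] by (simp add: G_def poly_sum poly_monom)
 define \<epsilon> where "\<epsilon> = r / (h * real p ^ 3)"
 have p3: "1 <= real p ^ 3" "real p <= real p ^ 3" using p1 self_le_power[of "real p" 3] one_le_power[of "real p" 3] by auto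
 have pne: "p ~= 0" using p by simp
 have hp: "0 < h * real p ^ 3" using h p by simp
 have \<epsilon>0: "\<epsilon> > 0" using B(2) hp by (simp add: \<epsilon>_def)
 have \<epsilon>p: "real p ^ 3 * \<epsilon> = r / h" using h by (simp add: \<epsilon>_def pne)
 have rh1: "r / h <= 1" using rh h by simp
 have \<epsilon>2: "real p * \<epsilon> <= 1" using mult_right_mono[OF p3(2) less_imp_le[OF \<epsilon>0]] \<epsilon>p rh1 by linarith
 have \<epsilon>3: "\<epsilon> <= 1" "\<epsilon> <= r / h" using mult_right_mono[OF p3(1) less_imp_le[OF \<epsilon>0]] \<epsilon>p rh1 by linarith+
 have \<epsilon>4: "h * \<epsilon> <= r" using mult_left_mono[OF \<epsilon>3(2), of h] h by simp
 have "?l^2 * (LINT t|?U. (poly G t)^2) <= (360 * (real p)^2)^2 * (144 * W / \<epsilon> + \<epsilon> * ?l^2 * N)"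
  unfolding W_def N_def D_def
  by (rule edge_weighted_estimate[OF K e B \<tau>[unfolded D_def] g'(1) G p gG \<epsilon>0 \<epsilon>4[unfolded h_def] \<epsilon>3(1) \<epsilon>2])
 also have "... <= (360 * (real p)^2)^2 * (144 * (real p ^ 3 * (h / r) * W) + 518400 * (real p ^ 3 * (h / r) * W))"
 proof (intro mult_left_mono add_mono)
  show "144 * W / \<epsilon> <= 144 * (real p ^ 3 * (h / r) * W)" by (simp add: \<epsilon>_def mult_ac)
  have "\<epsilon> * ?l^2 * N <= \<epsilon> * h^2 * N" using \<epsilon>0 lh W0 by (intro mult_right_mono mult_left_mono power_mono) auto
  also have "... = (h / (r * real p ^ 3)) * (r^2 * N)" using h B(2) p3 by (simp add: \<epsilon>_def field_simps power2_eq_square)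
  also have "... <= (h / (r * real p ^ 3)) * (518400 * real p ^ 6 * W)"
   by (rule mult_left_mono[OF div[folded N_def W_def]]) (use h B(2) in simp)
  also have "... = 518400 * (real p ^ 3 * (h / r) * W)"
  proof -
   have "real p ^ 6 = real p ^ 3 * real p ^ 3" by (simp flip: power_add)
   moreover have "(h / (r * P)) * (518400 * (P * P) * W) = 518400 * (P * (h / r) * W)" if "P ~= 0" for P :: real
    using that B(2) by (simp add: field_simps)
   from this[of "real p ^ 3"] have "(h / (r * real p ^ 3)) * (518400 * (real p ^ 3 * real p ^ 3) * W) = 518400 * (real p ^ 3 * (h / r) * W)" using pne by simp
   ultimately show ?thesis by (simp only:)
  qed
  finally show "\<epsilon> * ?l^2 * N <= 518400 * (real p ^ 3 * (h / r) * W)" .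
 qed simp
 also have "... = 129600 * 518544 * real p ^ 7 * (h / r) * W"
 proof -
  have "real p ^ 7 = real p ^ 4 * real p ^ 3" by (simp flip: power_add)
  moreover have "(360 * (real p)^2)^2 = 129600 * real p ^ 4" by (simp add: power_mult_distrib flip: power_mult)
  ultimately show ?thesis by (simp add: algebra_simps)
 qed
 finally have main: "?l^2 * (LINT t|?U. (poly G t)^2) <= 129600 * 518544 * real p ^ 7 * (h / r) * W" .
 \<comment> \<open>The trace \<open>g\<close> in the claim is an arbitrary representative; on this
   edge it agrees almost everywhere with the polynomial one.\<close>
 have "AE t in ?U. (g (linepath a b t))^2 = (poly G t)^2"
  using normal_trace_edge_unique[OF K e B g g'(1)] AE_unit_interior by eventually_elim (simp add: gG)
 moreover have "(%t. (g (linepath a b t))^2) \<in> borel_measurable ?U"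
 proof -
  have "sqint ?U (%t. g (linepath a b t))"
   using g e unfolding has_normal_trace_def L2_boundary_def L2_on_sqint by blast
  then show ?thesis by (intro borel_measurable_power) (simp add: sqint_def)
 qed
 moreover have "(%t. (poly G t)^2) \<in> borel_measurable ?U"
  by (rule borel_measurable_integrable, rule unit_integral(1)) (intro continuous_intros)
 ultimately have "(LINT t|?U. (g (linepath a b t))^2) = (LINT t|?U. (poly G t)^2)"
  by (intro integral_cong_AE)
 then show ?thesis using main by (simp add: W_def)
qed

lemma stability_upper:
 fixes vs :: polygon
 defines "D \<equiv> region vs" and "h \<equiv> diameter (region vs)"
 assumes K: "simple_polygon vs" "convex (region vs)" and B: "ball z r \<subseteq> region vs" "r > 0"
  and \<gamma>: "\<gamma> > 0" "\<gamma> * h <= r" and \<gamma>': "\<gamma>' > 0" "!!e. e \<in> edges vs ==> h <= \<gamma>' * edge_length e"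
  and \<tau>: "sqint (lebesgue_on D) \<tau>" and d: "has_weak_div D \<tau> (weak_div D \<tau>)" and \<rho>: "has_weak_rot D \<tau> \<rho>"
  and g: "has_normal_trace vs \<tau> g" and g': "has_normal_trace vs \<tau> g'" "!!e. e \<in> edges vs ==> poly_on_edge p e g'"
  and q: "q \<in> polys (p - 1)" "has_weak_div D \<tau> q" "q' \<in> polys (p - 1)" "has_weak_rot D \<tau> q'" and p: "1 <= p"
 shows "h * boundary_integral vs (%x. (g x)^2) + h^2 * (LINT x|lebesgue_on D. (weak_div D \<tau> x)^2) + h^2 * (LINT x|lebesgue_on D. (\<rho> x)^2)
  <= (8 * \<gamma>'^2 * (129600 * 518544) + 1036800) / \<gamma>^2 * real p ^ 7 * (LINT x|lebesgue_on D. (norm (\<tau> x))^2)"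
proof -
 define W N R where "W = (LINT x|lebesgue_on D. (norm (\<tau> x))^2)" and "N = (LINT x|lebesgue_on D. (weak_div D \<tau> x)^2)"
  and "R = (LINT x|lebesgue_on D. (\<rho> x)^2)"
 have W0: "0 <= W" "0 <= N" "0 <= R" by (simp_all add: W_def N_def R_def)
 have D: "convex D" "open D" "bounded D" using K by (simp_all add: D_def region_open region_bounded)
 have "z \<in> D" using B by (auto simp: D_def)
 then have ne: "D ~= {}" by blast
 have h: "h > 0" unfolding h_def by (rule diameter_region_pos) (use ne in \<open>simp add: D_def\<close>)
 have p1: "1 <= real p" using p by simp
 have hr: "h / r <= 1 / \<gamma>" "0 <= h / r" using \<gamma> B(2) h by (simp_all add: field_simps)
 have hr2: "(h / r)^2 <= 1 / \<gamma>^2" using power_mono[OF hr, of 2] by (simp add: power_divide)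
 note DR = div_rot_bound[OF D ne B[folded D_def] p \<tau>]
 have bd: "r^2 * N <= 518400 * real p ^ 6 * W" "r^2 * R <= 518400 * real p ^ 6 * W"
  unfolding N_def R_def W_def by (rule DR(1)[OF d q(1,2)], rule DR(2)[OF \<rho> q(3,4)])
 have vol: "h^2 * X <= 518400 / \<gamma>^2 * real p ^ 7 * W" if X: "r^2 * X <= 518400 * real p ^ 6 * W" for X
 proof -
  have "h^2 * X = (h / r)^2 * (r^2 * X)" using B(2) by (simp add: power_divide)
  also have "... <= (h / r)^2 * (518400 * real p ^ 6 * W)" by (rule mult_left_mono[OF X]) simp
  also have "... <= 1 / \<gamma>^2 * (518400 * real p ^ 6 * W)" by (rule mult_right_mono[OF hr2]) (use W0 in simp)
  also have "... <= 1 / \<gamma>^2 * (518400 * real p ^ 7 * W)"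
   by (intro mult_left_mono mult_right_mono power_increasing p1 W0) auto
  finally show ?thesis by (simp add: mult_ac)
 qed
 have sd: "sqint (lebesgue_on D) (weak_div D \<tau>)" using d unfolding has_weak_div_def L2_on_sqint by blast
 define B0 where "B0 = 129600 * 518544 * real p ^ 7 * (h / r) * W"
 have B00: "0 <= B0" unfolding B0_def using W0 hr by (intro mult_nonneg_nonneg) auto
 \<comment> \<open>Both factors h are replaced by \<gamma>' times the edge length, which turns the
   edge estimate into one proportional to the length of the edge, ready to be summed.\<close>
 have edge: "h * (h * (norm (b - a) * (LINT t|lebesgue_on {0..1}. (g (linepath a b t))^2))) <= \<gamma>'^2 * B0 * norm (b - a)" if e: "(a, b) \<in> edges vs" for a b
 proof -
  let ?l = "norm (b - a)"
  define \<Gamma> where "\<Gamma> = (LINT t|lebesgue_on {0..1::real}. (g (linepath a b t))^2)"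
  have \<Gamma>0: "0 <= \<Gamma>" by (simp add: \<Gamma>_def)
  have est: "?l^2 * \<Gamma> <= B0" unfolding \<Gamma>_def B0_def W_def D_def h_def
   by (rule edge_trace_bound[OF K e B \<tau>[unfolded D_def] sd[unfolded D_def] g g'(1) g'(2)[OF e] p bd(1)[unfolded N_def W_def D_def]])
  have "h <= \<gamma>' * ?l" using \<gamma>'(2)[OF e] by (simp add: edge_length_norm)
  then have "h * h <= (\<gamma>' * ?l) * (\<gamma>' * ?l)" using h by (intro mult_mono) auto
  from mult_right_mono[OF this, of "?l * \<Gamma>"] have "h * (h * (?l * \<Gamma>)) <= \<gamma>'^2 * (?l^2 * \<Gamma>) * ?l"
   using \<Gamma>0 by (simp add: power2_eq_square mult_ac)
  also have "... <= \<gamma>'^2 * B0 * ?l" by (intro mult_right_mono mult_left_mono est) auto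
  finally show ?thesis by (simp add: \<Gamma>_def)
 qed
 have "h * (h * boundary_integral vs (%x. (g x)^2)) = (\<Sum>(a, b)\<in>edges vs. h * (h * (norm (b - a) * (LINT t|lebesgue_on {0..1}. (g (linepath a b t))^2))))"
  unfolding boundary_integral_def sum_distrib_left by (intro sum.cong) (auto simp: edge_length_norm)
 also have "... <= (\<Sum>(a, b)\<in>edges vs. \<gamma>'^2 * B0 * norm (b - a))" by (intro sum_mono) (auto intro: edge)
 also have "... = \<gamma>'^2 * B0 * (\<Sum>(a, b)\<in>edges vs. norm (b - a))" unfolding sum_distrib_left by (intro sum.cong) auto
 \<comment> \<open>The perimeter is at most 8 h^2 / r, so a second factor h / r joins the one in
   \<open>B0\<close>, and one h is left to cancel.\<close>
 also have "... <= \<gamma>'^2 * B0 * (8 * h^2 / r)"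
  using perimeter_bound[OF K B] B(2) B00 by (intro mult_left_mono) (auto simp: h_def pos_le_divide_eq mult.commute)
 also have "... = h * (8 * \<gamma>'^2 * (129600 * 518544) * real p ^ 7 * ((h / r)^2 * W))"
  unfolding B0_def power2_eq_square by simp
 finally have "h * boundary_integral vs (%x. (g x)^2) <= 8 * \<gamma>'^2 * (129600 * 518544) * real p ^ 7 * ((h / r)^2 * W)"
  by (rule mult_left_le_imp_le[OF _ h])
 also have "... <= 8 * \<gamma>'^2 * (129600 * 518544) * real p ^ 7 * (1 / \<gamma>^2 * W)"
  by (intro mult_left_mono mult_right_mono hr2 W0) auto
 finally have bnd: "h * boundary_integral vs (%x. (g x)^2) <= 8 * \<gamma>'^2 * (129600 * 518544) / \<gamma>^2 * real p ^ 7 * W" by (simp add: mult_ac)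
 have "(8 * \<gamma>'^2 * (129600 * 518544) + 1036800) / \<gamma>^2 * real p ^ 7 * W
  = 8 * \<gamma>'^2 * (129600 * 518544) / \<gamma>^2 * real p ^ 7 * W + 518400 / \<gamma>^2 * real p ^ 7 * W + 518400 / \<gamma>^2 * real p ^ 7 * W"
  by (simp add: add_divide_distrib distrib_right)
 then show ?thesis using bnd vol[OF bd(1)] vol[OF bd(2)] unfolding W_def N_def R_def by linarith
qed

theorem proposition2p7:
  fixes \<gamma> \<gamma>' k0 :: real
  assumes "0 < \<gamma>" and "0 < \<gamma>'" and "0 < k0"
  shows "\<exists>c>0. \<exists>C>0. \<forall>(T :: polygon set) (\<kappa> :: polygon \<Rightarrow> real) (k_lo :: real) (k_hi :: real) (p :: nat).
     polygonal_mesh T \<longrightarrow> mesh_G1 \<gamma> T \<longrightarrow> mesh_G2 \<gamma>' T \<longrightarrow>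
     0 < k_lo \<longrightarrow> (\<forall>K\<in>T. k_lo \<le> \<kappa> K \<and> \<kappa> K \<le> k_hi) \<longrightarrow> k_lo \<le> k0 \<longrightarrow> k0 \<le> k_hi \<longrightarrow>
     1 \<le> p \<longrightarrow>
     (\<forall>K\<in>T. convex (region K) \<longrightarrow>
        (\<exists>\<alpha>_lo \<alpha>_hi :: real.
           c * inverse k_hi \<le> \<alpha>_lo \<and> \<alpha>_hi \<le> C * (inverse k_lo * real p ^ 7) \<and>
           (\<forall>\<tau>\<in>ker_Pi0 p K (\<kappa> K).
              \<alpha>_lo * a_form K (\<kappa> K) \<tau> \<tau> \<le> S_form K (\<kappa> K) \<tau> \<tau> \<and>
              S_form K (\<kappa> K) \<tau> \<tau> \<le> \<alpha>_hi * a_form K (\<kappa> K) \<tau> \<tau>)))"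
proof -
 \<comment> \<open>The sum dominates each of the coefficients 216 / \<gamma>, 68 and 6912 of the
   lower estimate.\<close>
 define CL where "CL = 4 * (216 / \<gamma> + 6912)"
 define CU where "CU = (8 * \<gamma>'^2 * (129600 * 518544) + 1036800) / \<gamma>^2"
 have CL: "CL > 0" using assms by (simp add: CL_def add_pos_pos)
 have CU: "CU > 0" using assms by (auto simp: CU_def intro!: divide_pos_pos add_nonneg_pos)
 have core: "(1 / CL) * a_form K k \<tau> \<tau> <= S_form K k \<tau> \<tau> \<and> S_form K k \<tau> \<tau> <= CU * real p ^ 7 * a_form K k \<tau> \<tau>"
  if T: "polygonal_mesh T" "mesh_G1 \<gamma> T" "mesh_G2 \<gamma>' T" and KT: "K \<in> T" "convex (region K)" and k: "0 < k" and p: "1 <= p"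
   and \<tau>: "\<tau> \<in> Sigma_n p K" for T K k p \<tau>
 proof -
  let ?D = "region K" let ?M = "lebesgue_on (region K)"
  define h where "h = diameter ?D"
  define g where "g = normal_trace K \<tau>"
  define d where "d = weak_div ?D \<tau>"
  define \<rho> where "\<rho> = weak_rot ?D \<tau>"
  define W where "W = (LINT x|?M. (norm (\<tau> x))^2)"
  define S where "S = h * boundary_integral K (%x. (g x)^2) + h^2 * (LINT x|?M. (d x)^2) + h^2 * (LINT x|?M. (\<rho> x)^2)"
  have aW: "a_form K k \<tau> \<tau> = inverse k * W"
   unfolding a_form_def W_def power2_norm_eq_inner by (rule integral_mult_right_zero)
  have bi: "boundary_integral K (%x. inverse k * g x * g x) = inverse k * boundary_integral K (%x. (g x)^2)"
   unfolding boundary_integral_def sum_distrib_left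
   by (intro sum.cong) (auto simp: power2_eq_square mult.assoc)
  have sS: "S_form K k \<tau> \<tau> = inverse k * S"
   unfolding S_form_def Let_def g_def[symmetric] d_def[symmetric] \<rho>_def[symmetric] h_def[symmetric] bi S_def
   by (simp add: power2_eq_square mult.assoc distrib_left mult.left_commute)
  have "(1 / CL) * W <= S \<and> S <= CU * real p ^ 7 * W"
  \<comment> \<open>For an empty region the diameter and all volume integrals are zero, so both
    inequalities are trivial.\<close>
  proof (cases "?D = {}")
   case True
   then have "W = 0" "S = 0" by (simp_all add: W_def S_def h_def integral_restrict_space)
   then show ?thesis by simp
  next
   case False
   have sp: "simple_polygon K" using T(1) KT(1) by (simp add: polygonal_mesh_def)
   obtain z r where zr: "\<gamma> * h <= r" "star_shaped_wrt ?D (ball z r)" using T(2) KT(1) unfolding mesh_G1_def h_def by blast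
   have hpos: "h > 0" unfolding h_def by (rule diameter_region_pos[OF False])
   have "0 < \<gamma> * h" using assms(1) hpos by simp
   then have r: "r > 0" using zr(1) by linarith
   have B: "ball z r \<subseteq> ?D" using zr(2) by (simp add: star_shaped_wrt_def)
   have G2: "h <= \<gamma>' * edge_length e" if "e \<in> edges K" for e using T(3) KT(1) that unfolding mesh_G2_def h_def by blast
   obtain g' q q' where g': "has_normal_trace K \<tau> g'" "!!e. e \<in> edges K ==> poly_on_edge p e g'"
    and q: "q \<in> polys (p - 1)" "has_weak_div ?D \<tau> q" "q' \<in> polys (p - 1)" "has_weak_rot ?D \<tau> q'"
    and H: "\<tau> \<in> H_div ?D" using \<tau> unfolding Sigma_n_def by auto
   have s\<tau>: "sqint ?M \<tau>" using H by (simp add: H_div_def L2_on_sqint)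
   \<comment> \<open>Membership in \<open>Sigma_n\<close> provides witnesses, so the choice
     operators behind \<open>S_form\<close> return functions with the required properties.\<close>
   have hg: "has_normal_trace K \<tau> g" unfolding g_def normal_trace_def by (rule someI[of "has_normal_trace K \<tau>", OF g'(1)])
   have hd: "has_weak_div ?D \<tau> (weak_div ?D \<tau>)" unfolding weak_div_def by (rule someI[of "has_weak_div ?D \<tau>", OF q(2)])
   have hr: "has_weak_rot ?D \<tau> \<rho>" unfolding \<rho>_def weak_rot_def by (rule someI[of "has_weak_rot ?D \<tau>", OF q(4)])
   define A1 A2 A3 where "A1 = h * boundary_integral K (%x. (g x)^2)" and "A2 = h^2 * (LINT x|?M. (d x)^2)" and "A3 = h^2 * (LINT x|?M. (\<rho> x)^2)"
   have A: "0 <= A1" "0 <= A2" "0 <= A3" using hpos by (auto simp: A1_def A2_def A3_def boundary_integral_nonneg)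
   have "W <= 4 * (216 / \<gamma> * A1 + 68 * A2 + 6912 * A3)"
    unfolding W_def A1_def A2_def A3_def h_def d_def
    by (rule stability_lower[OF sp KT(2) B r assms(1) zr(1)[unfolded h_def] s\<tau> hd hr hg])
   also have "... <= 4 * ((216 / \<gamma> + 6912) * A1 + (216 / \<gamma> + 6912) * A2 + (216 / \<gamma> + 6912) * A3)"
    using A assms(1) by (intro mult_left_mono add_mono mult_right_mono) (auto simp: add_increasing)
   also have "... = CL * S" by (simp add: CL_def S_def A1_def A2_def A3_def algebra_simps)
   finally have "W <= CL * S" .
   then have "(1 / CL) * W <= S" using CL by (simp add: pos_divide_le_eq mult.commute)
   moreover have "S <= CU * real p ^ 7 * W" unfolding S_def CU_def W_def h_def d_def
    by (rule stability_upper[OF sp KT(2) B r assms(1) zr(1)[unfolded h_def] assms(2) G2[unfolded h_def] s\<tau> hd hr hg g' q p])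
   ultimately show ?thesis by blast
  qed
  note both = this
  have ik: "0 <= inverse k" using k by simp
  have "inverse k * ((1 / CL) * W) <= inverse k * S" "inverse k * S <= inverse k * (CU * real p ^ 7 * W)"
   by (rule mult_left_mono[OF conjunct1[OF both] ik], rule mult_left_mono[OF conjunct2[OF both] ik])
  then show ?thesis unfolding aW sS mult.left_commute[of "inverse k" "1 / CL" W] mult.left_commute[of "inverse k" "CU * real p ^ 7" W] ..
 qed
 \<comment> \<open>The weight 1/\<kappa> cancels between \<open>a_form\<close> and
   \<open>S_form\<close>, so the ratio is bounded independently of the coefficient. The reference
   value \<open>k0\<close> is the unit in which the displayed dependence is measured: k0 / k_hi <= 1
   <= k0 / k_lo.\<close>
 have pos: "0 < k0 / CL" "0 < CU * k0" using assms CL CU by simp_all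
 show ?thesis
 proof (rule exI[of _ "k0 / CL"], rule conjI[OF pos(1)], rule exI[of _ "CU * k0"], rule conjI[OF pos(2)], intro allI impI ballI)
  fix T :: "polygon set" and \<kappa> :: "polygon => real" and k_lo k_hi :: real and p :: nat and K
  assume T: "polygonal_mesh T" "mesh_G1 \<gamma> T" "mesh_G2 \<gamma>' T" and k: "0 < k_lo" "\<forall>K\<in>T. k_lo <= \<kappa> K \<and> \<kappa> K <= k_hi" "k_lo <= k0" "k0 <= k_hi"
   and p: "1 <= p" and KT: "K \<in> T" "convex (region K)"
  have kK: "0 < \<kappa> K" using k(1) bspec[OF k(2) KT(1)] by linarith
  have kh: "0 < k_hi" using k assms(3) by linarith
  have lo: "k0 / CL * inverse k_hi <= 1 / CL"
  proof -
   have "k0 * inverse k_hi <= k_hi * inverse k_hi" by (rule mult_right_mono[OF k(4)]) (use kh in simp)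
   then have "k0 * inverse k_hi <= 1" using kh by simp
   from divide_right_mono[OF this less_imp_le[OF CL]] show ?thesis by simp
  qed
  have hi: "CU * real p ^ 7 <= CU * k0 * (inverse k_lo * real p ^ 7)"
  proof -
   have "k_lo * inverse k_lo <= k0 * inverse k_lo" by (rule mult_right_mono[OF k(3)]) (use k(1) in simp)
   then have "1 <= k0 * inverse k_lo" using k(1) by simp
   from mult_left_mono[OF this, of "CU * real p ^ 7"] have "CU * real p ^ 7 * 1 <= CU * real p ^ 7 * (k0 * inverse k_lo)" using CU by simp
   then show ?thesis by (simp only: mult_ac mult_1_right mult_1_left)
  qed
  have bounds: "(1 / CL) * a_form K (\<kappa> K) \<tau> \<tau> <= S_form K (\<kappa> K) \<tau> \<tau> \<and> S_form K (\<kappa> K) \<tau> \<tau> <= CU * real p ^ 7 * a_form K (\<kappa> K) \<tau> \<tau>"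
   if "\<tau> \<in> ker_Pi0 p K (\<kappa> K)" for \<tau>
   by (rule core[OF T KT kK p]) (use that in \<open>simp add: ker_Pi0_def\<close>)
  have "\<exists>\<alpha>_lo \<alpha>_hi. k0 / CL * inverse k_hi <= \<alpha>_lo \<and> \<alpha>_hi <= CU * k0 * (inverse k_lo * real p ^ 7) \<and>
    (\<forall>\<tau>\<in>ker_Pi0 p K (\<kappa> K). \<alpha>_lo * a_form K (\<kappa> K) \<tau> \<tau> <= S_form K (\<kappa> K) \<tau> \<tau> \<and> S_form K (\<kappa> K) \<tau> \<tau> <= \<alpha>_hi * a_form K (\<kappa> K) \<tau> \<tau>)"
  proof (rule exI[of _ "1 / CL"], rule exI[of _ "CU * real p ^ 7"], rule conjI[OF lo], rule conjI[OF hi], rule ballI)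
   fix \<tau> assume "\<tau> \<in> ker_Pi0 p K (\<kappa> K)"
   then show "(1 / CL) * a_form K (\<kappa> K) \<tau> \<tau> <= S_form K (\<kappa> K) \<tau> \<tau> \<and> S_form K (\<kappa> K) \<tau> \<tau> <= CU * real p ^ 7 * a_form K (\<kappa> K) \<tau> \<tau>"
    by (rule bounds)
  qed
  then show "\<exists>\<alpha>_lo \<alpha>_hi. k0 / CL * inverse k_hi <= \<alpha>_lo \<and> \<alpha>_hi <= CU * k0 * (inverse k_lo * real p ^ 7) \<and>
    (\<forall>\<tau>\<in>ker_Pi0 p K (\<kappa> K). \<alpha>_lo * a_form K (\<kappa> K) \<tau> \<tau> <= S_form K (\<kappa> K) \<tau> \<tau> \<and> S_form K (\<kappa> K) \<tau> \<tau> <= \<alpha>_hi * a_form K (\<kappa> K) \<tau> \<tau>)" .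
 qed
qed

end
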